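(* Let $\mathbf{k}$ be an algebraically closed field, $\Lambda=\mathbf{k}Q/I$ a gentle algebra, and $(b,\mu)\neq(c,\lambda)$ bands with $\lambda,\mu\in\mathbf{k}^*$. Suppose that ${}^\infty c^\infty$ and ${}^\infty b^\infty$ admit decompositions $${}^\infty c^\infty={}^\infty c\,c_L\bar BmAc_R\,c^\infty\quad\text{and}\quad{}^\infty b^\infty={}^\infty b\,b_LDm\bar Cb_R\,b^\infty,$$ where $A,B,C,D\in Q_1$ are each nonempty and $c_L,c_R,m,b_L,b_R$ are (possibly trivial) strings such that if $m=1_x$ is a trivial string then $CA\in I$ and $DB\in I$. Then either (a) $m$ is a proper subword of $b$, i.e. after suitable rotation of $b$ there is a decomposition $b=mv$; or (b) $b$ is a subword of $m$, i.e. after suitable rotation there is a decomposition $b=b_2b_1$ such that $m=b^kb_2$; and either (c) $m$ is a proper subword of $c$, i.e. after suitable rotation of $c$ there is a decomposition $c=mw$; or (d) $c$ is a subword of $m$, i.e. after suitable rotation there is a decomposition $c=c_2c_1$ such that $m=c^\ell c_2$. Then there are a band $d$ and an integer $t\ge1$ such that $$d^t=\begin{cases}mvmw&\text{if (a) and (c)};\\ mvc_2c_1&\text{if (a) and (d)};\\ b_2b_1mw&\text{if (b) and (c)};\\ b_2b_1c_2c_1&\text{if (b) and (d)},\end{cases}$$ and a non-split overlap extension $$0\to B(b,\mu)\to\bigoplus_{i=1}^tB\bigl(d,\omega^i\sqrt[t]{\pm\lambda\mu^{-1}}\bigr)\to B(c,\lambda)\to0,$$ where $\omega$ is a primitive $t$-th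 root of unity. Moreover, the collection of such extensions forms a basis of $\operatorname{Ext}^1_\Lambda(B(c,\lambda),B(b,\mu))$.
   Context: Gentle algebra: $\Lambda=\mathbf{k}Q/I$ is finite-dimensional, $Q$ a finite quiver, $I$ an admissible ideal, such that (1) at each vertex at most two arrows start and at most two arrows end; (2) for each arrow $a$ there is at most one arrow $b$ with $e(a)=s(b)$ and $ba\notin I$, and at most one arrow $c$ with $e(c)=s(a)$ and $ac\notin I$; (3) for each arrow $a$ there is at most one arrow $b$ with $e(a)=s(b)$ and $ba\in I$, and at most one arrow $c$ with $e(c)=s(a)$ and $ac\in I$; (4) $I$ is generated by paths of length two. Modules are finitely generated left modules and paths are read from right to left; $s,e$ denote start and end. Bands: each arrow $a$ has a formal inverse $\bar a$ with $s(\bar a)=e(a)$, $e(\bar a)=s(a)$. A walk is a sequence $w=w_l\cdots w_1$ of letters (arrows, called direct, or inverse arrows) with $s(w_{i+1})=e(w_i)$ and no subsequence $a\bar a$ or $\bar aa$; its inverse is $\bar w=\bar w_1\cdots\bar w_l$. A string is a walk with no subwalk $u$ with $u\in I$ or $\bar u\in I$, or a trivial string $1_x$ for a vertex $x$. A band is a string $b=b_n\cdots b_1$ with $e(b_n)=s(b_1)$, $b_1\ne\bar b_n$, $b_1b_n$ a string, and $b\ne y^r$ for every substring $y$ and $r>1$; bands are taken modulo inversion and cyclic permutation (rotation). The (quasi-simple) band module $B(b,\mu)$ has basis $z_i$, $i\in\mathbb{Z}/n$, with $z_i$ at the vertex $e(b_i)$; a direct letter $b_i$ sends $z_{i-1}$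 to $z_i$, for $b_i=\bar a$ the arrow $a$ sends $z_i$ to $z_{i-1}$, except that one chosen direct letter $b_i$ acts by $z_{i-1}\mapsto\mu z_i$; all other actions are zero. The infinite words ${}^\infty b^\infty=\cdots bbb\cdots$, ${}^\infty b=\cdots bb$, $b^\infty=bb\cdots$ are obtained by repeated concatenation (in both directions, to the left, to the right). $(b,\mu)=(c,\lambda)$ means: ${}^\infty b^\infty={}^\infty c^\infty$ or ${}^\infty b^\infty={}^\infty(c^{-1})^\infty$, and $\lambda=\mu$ with both scalars placed on a direct arrow in the infinite words that are equal. An overlap extension is the extension associated with a pair of decompositions of ${}^\infty c^\infty$ and ${}^\infty b^\infty$ with common subword $m$, where $m$ is bounded by $\bar B$ and $A$ in ${}^\infty c^\infty$ and by $D$ and $\bar C$ in ${}^\infty b^\infty$: the middle term is obtained by gluing along $m$, joining the part of each word to the right of $m$ to the part of the other word to the left of $m$. "The collection of such extensions" has one extension for each pair of decompositions ${}^\infty c^\infty={}^\infty c\,c_L\bar BmAc_R\,c^\infty$ and ${}^\infty b^\infty={}^\infty b\,b_LDm\bar Cb_R\,b^\infty$ with $A,B,C,D\in Q_1$ each nonempty and $c_L,c_R,m,b_L,b_R$ (possibly trivial) strings such that if $m=1_x$ is a trivial string then $CA\in I$ and $DB\in I$, for all choices of representatives modulo inversion; decompositions of the infinite words are taken up to translation by the respective period, and data differing by simultaneous inversion are identified.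
   Formalization: The scalar ±λμ⁻¹ is read with μ on a direct letter of the inverse of the displayed b (so ±λμ if μ sits on the displayed b), since it fails otherwise; the direct sum is claimed whenever a primitive t-th root of unity exists, else only the glued module of dᵗ with that scalar. *)

theory Defs
  imports
    "HOL-Computational_Algebra.Polynomial"
    "HOL-Algebra.Module"
    "HOL-Algebra.QuotRing"
    "Graph_Theory.Digraph"
begin

hide_const (open) Polynomial.smult

section \<open>Path algebras and gentle algebras\<close>

text \<open>
  A quiver is a \<open>pre_digraph\<close>, with \<open>s = tail\<close> and \<open>e = head\<close>.  Paths and words are read from
  right to left, and every list is written exactly as on paper: the path \<open>a\<^sub>l \<dots> a\<^sub>1\<close> is the list
  \<open>[a\<^sub>l, \<dots>, a\<^sub>1]\<close>.  A path is stored together with its starting vertex, so that the trivial path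
  at \<open>x\<close> is \<open>(x, [])\<close>.
\<close>

type_synonym ('v, 'a) path = "'v \<times> 'a list"

primrec path_end :: "('v, 'a) pre_digraph \<Rightarrow> 'v \<Rightarrow> 'a list \<Rightarrow> 'v" where
  "path_end Q x [] = x"
| "path_end Q x (a # p) = head Q a"

primrec path_from :: "('v, 'a) pre_digraph \<Rightarrow> 'v \<Rightarrow> 'a list \<Rightarrow> bool" where
  "path_from Q x [] \<longleftrightarrow> x \<in> verts Q"
| "path_from Q x (a # p) \<longleftrightarrow> path_from Q x p \<and> a \<in> arcs Q \<and> tail Q a = path_end Q x p"

definition paths :: "('v, 'a) pre_digraph \<Rightarrow> ('v, 'a) path set" where
  "paths Q = {(x, p). path_from Q x p}"

text \<open>
  The elements of \<open>kQ\<close> are the finitely supported functions on the set of paths.  The coefficient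
  of a product at a path is the sum over all ways of cutting that path into two.
\<close>

definition path_algebra :: "('v, 'a) pre_digraph \<Rightarrow> (('v, 'a) path \<Rightarrow> 'k::field) ring" where
  "path_algebra Q =
    \<lparr>carrier = {f. finite {r. f r \<noteq> 0} \<and> {r. f r \<noteq> 0} \<subseteq> paths Q},
     mult = (\<lambda>f g (x, p). \<Sum>i\<le>length p. f (path_end Q x (drop i p), take i p) * g (x, drop i p)),
     one = (\<lambda>(x, p). if x \<in> verts Q \<and> p = [] then 1 else 0),
     zero = (\<lambda>_. 0),
     add = (\<lambda>f g r. f r + g r)\<rparr>"

definition path_elem :: "('v, 'a) path \<Rightarrow> ('v, 'a) path \<Rightarrow> 'k::field" where
  "path_elem r = (\<lambda>r'. if r' = r then 1 else 0)"

definition arrow_path :: "('v, 'a) pre_digraph \<Rightarrow> 'a list \<Rightarrow> ('v, 'a) path \<Rightarrow> 'k::field" where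
  "arrow_path Q p = path_elem (tail Q (last p), p)"

text \<open>
  The \<open>n\<close>-th power of the arrow ideal is spanned by the paths of length at least \<open>n\<close>.  For a finite
  quiver, an admissible ideal has a finite-dimensional quotient, so finite dimension of \<open>kQ/I\<close>
  is not listed separately in \<open>gentle\<close> below.
\<close>

definition admissible :: "('v, 'a) pre_digraph \<Rightarrow> (('v, 'a) path \<Rightarrow> 'k::field) set \<Rightarrow> bool" where
  "admissible Q I \<longleftrightarrow>
     ideal I (path_algebra Q) \<and>
     (\<exists>n\<ge>2. \<forall>r\<in>paths Q. n \<le> length (snd r) \<longrightarrow> path_elem r \<in> I) \<and>
     (\<forall>f\<in>I. \<forall>r. f r \<noteq> 0 \<longrightarrow> 2 \<le> length (snd r))"

definition gentle :: "('v, 'a) pre_digraph \<Rightarrow> (('v, 'a) path \<Rightarrow> 'k::field) set \<Rightarrow> bool" where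
  "gentle Q I \<longleftrightarrow>
     fin_digraph Q \<and> admissible Q I \<and>
     (\<forall>x\<in>verts Q. card {a \<in> arcs Q. tail Q a = x} \<le> 2 \<and> card {a \<in> arcs Q. head Q a = x} \<le> 2) \<and>
     (\<forall>a\<in>arcs Q.
        card {b \<in> arcs Q. head Q a = tail Q b \<and> arrow_path Q [b, a] \<notin> I} \<le> 1 \<and>
        card {c \<in> arcs Q. head Q c = tail Q a \<and> arrow_path Q [a, c] \<notin> I} \<le> 1 \<and>
        card {b \<in> arcs Q. head Q a = tail Q b \<and> arrow_path Q [b, a] \<in> I} \<le> 1 \<and>
        card {c \<in> arcs Q. head Q c = tail Q a \<and> arrow_path Q [a, c] \<in> I} \<le> 1) \<and>
     (\<exists>S \<subseteq> {r \<in> paths Q. length (snd r) = 2}. I = Idl\<^bsub>path_algebra Q\<^esub> (path_elem ` S))"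

definition bound_algebra ::
  "('v, 'a) pre_digraph \<Rightarrow> (('v, 'a) path \<Rightarrow> 'k::field) set \<Rightarrow> (('v, 'a) path \<Rightarrow> 'k) set ring" where
  "bound_algebra Q I = path_algebra Q Quot I"

definition scalar_elem ::
  "('v, 'a) pre_digraph \<Rightarrow> (('v, 'a) path \<Rightarrow> 'k::field) set \<Rightarrow> 'k \<Rightarrow> (('v, 'a) path \<Rightarrow> 'k) set" where
  "scalar_elem Q I \<kappa> = I +>\<^bsub>path_algebra Q\<^esub> (\<lambda>r. \<kappa> * \<one>\<^bsub>path_algebra Q\<^esub> r)"


section \<open>Left modules and the first extension space\<close>

text \<open>
  The library's locale \<open>module\<close> needs a commutative ring.  As there, the components \<open>mult\<close> and
  \<open>one\<close> of the record are not used for modules.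
\<close>

locale left_module = R?: ring R + M?: abelian_group M
  for R :: "('r, 'x) ring_scheme" (structure) and M :: "('r, 'm, 'y) module_scheme" (structure) +
  assumes smult_closed: "r \<in> carrier R \<Longrightarrow> x \<in> carrier M \<Longrightarrow> r \<odot>\<^bsub>M\<^esub> x \<in> carrier M"
    and smult_l_distr: "r \<in> carrier R \<Longrightarrow> s \<in> carrier R \<Longrightarrow> x \<in> carrier M \<Longrightarrow>
      (r \<oplus>\<^bsub>R\<^esub> s) \<odot>\<^bsub>M\<^esub> x = r \<odot>\<^bsub>M\<^esub> x \<oplus>\<^bsub>M\<^esub> s \<odot>\<^bsub>M\<^esub> x"
    and smult_r_distr: "r \<in> carrier R \<Longrightarrow> x \<in> carrier M \<Longrightarrow> y \<in> carrier M \<Longrightarrow>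
      r \<odot>\<^bsub>M\<^esub> (x \<oplus>\<^bsub>M\<^esub> y) = r \<odot>\<^bsub>M\<^esub> x \<oplus>\<^bsub>M\<^esub> r \<odot>\<^bsub>M\<^esub> y"
    and smult_assoc1: "r \<in> carrier R \<Longrightarrow> s \<in> carrier R \<Longrightarrow> x \<in> carrier M \<Longrightarrow>
      (r \<otimes>\<^bsub>R\<^esub> s) \<odot>\<^bsub>M\<^esub> x = r \<odot>\<^bsub>M\<^esub> (s \<odot>\<^bsub>M\<^esub> x)"
    and smult_one: "x \<in> carrier M \<Longrightarrow> \<one>\<^bsub>R\<^esub> \<odot>\<^bsub>M\<^esub> x = x"

definition lmod_hom :: "('r, 'x) ring_scheme \<Rightarrow> ('r, 'm) module \<Rightarrow> ('r, 'n) module \<Rightarrow> ('m \<Rightarrow> 'n) set"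
  where
  "lmod_hom R M N =
    {f \<in> carrier M \<rightarrow> carrier N.
       (\<forall>x\<in>carrier M. \<forall>y\<in>carrier M. f (x \<oplus>\<^bsub>M\<^esub> y) = f x \<oplus>\<^bsub>N\<^esub> f y) \<and>
       (\<forall>r\<in>carrier R. \<forall>x\<in>carrier M. f (r \<odot>\<^bsub>M\<^esub> x) = r \<odot>\<^bsub>N\<^esub> f x)}"

definition lmod_iso :: "('r, 'x) ring_scheme \<Rightarrow> ('r, 'm) module \<Rightarrow> ('r, 'n) module \<Rightarrow> bool" where
  "lmod_iso R M N \<longleftrightarrow> (\<exists>f\<in>lmod_hom R M N. bij_betw f (carrier M) (carrier N))"

definition lmod_dsum :: "'i set \<Rightarrow> ('i \<Rightarrow> ('r, 'm) module) \<Rightarrow> ('r, 'i \<Rightarrow> 'm) module" where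
  "lmod_dsum J M =
    \<lparr>carrier = (\<Pi>\<^sub>E i\<in>J. carrier (M i)), mult = undefined, one = undefined,
     zero = (\<lambda>i\<in>J. \<zero>\<^bsub>M i\<^esub>),
     add = (\<lambda>f g. \<lambda>i\<in>J. f i \<oplus>\<^bsub>M i\<^esub> g i),
     smult = (\<lambda>r f. \<lambda>i\<in>J. r \<odot>\<^bsub>M i\<^esub> f i)\<rparr>"

text \<open>A triple \<open>(E, i, p)\<close> stands for the sequence \<open>0 \<rightarrow> N \<rightarrow> E \<rightarrow> M \<rightarrow> 0\<close> with maps \<open>i\<close> and \<open>p\<close>.\<close>

type_synonym ('r, 'n, 'e, 'm) extn = "('r, 'e) module \<times> ('n \<Rightarrow> 'e) \<times> ('e \<Rightarrow> 'm)"

definition extensions ::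
  "('r, 'x) ring_scheme \<Rightarrow> ('r, 'm) module \<Rightarrow> ('r, 'n) module \<Rightarrow> ('r, 'n, 'e, 'm) extn set" where
  "extensions R M N =
    {(E, i, p). left_module R N \<and> left_module R E \<and> left_module R M \<and>
       i \<in> lmod_hom R N E \<and> p \<in> lmod_hom R E M \<and>
       inj_on i (carrier N) \<and> p ` carrier E = carrier M \<and>
       i ` carrier N = {x \<in> carrier E. p x = \<zero>\<^bsub>M\<^esub>}}"

fun ext_split :: "('r, 'x) ring_scheme \<Rightarrow> ('r, 'm) module \<Rightarrow> ('r, 'n, 'e, 'm) extn \<Rightarrow> bool" where
  "ext_split R M (E, i, p) \<longleftrightarrow> (\<exists>s\<in>lmod_hom R M E. \<forall>x\<in>carrier M. p (s x) = x)"

fun ext_equiv :: "('r, 'x) ring_scheme \<Rightarrow> ('r, 'n) module \<Rightarrow>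
    ('r, 'n, 'e, 'm) extn \<Rightarrow> ('r, 'n, 'f, 'm) extn \<Rightarrow> bool" where
  "ext_equiv R N (E, i, p) (E', i', p') \<longleftrightarrow>
    (\<exists>f\<in>lmod_hom R E E'. (\<forall>y\<in>carrier N. f (i y) = i' y) \<and> (\<forall>x\<in>carrier E. p' (f x) = p x))"

text \<open>
  \<open>baer_sum R N \<xi>\<^sub>1 \<xi>\<^sub>2 \<xi>\<close> says that \<open>\<xi>\<close> is (equivalent to) the Baer sum of \<open>\<xi>\<^sub>1\<close> and \<open>\<xi>\<^sub>2\<close>: the map \<open>f\<close> is
  a morphism of extensions from the pullback of \<open>\<xi>\<^sub>1 \<oplus> \<xi>\<^sub>2\<close> along the diagonal of \<open>M\<close> to \<open>\<xi>\<close> that is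
  the addition \<open>N \<oplus> N \<rightarrow> N\<close> on the left and the identity on the right; by the universal property
  of the pushout, \<open>\<xi>\<close> is then the pushout along the addition.  Likewise \<open>ext_scale R N r \<xi>\<^sub>1 \<xi>\<close> says
  that \<open>\<xi>\<close> is the pushout of \<open>\<xi>\<^sub>1\<close> along multiplication by the (central) element \<open>r\<close>.
\<close>

fun baer_sum :: "('r, 'x) ring_scheme \<Rightarrow> ('r, 'n) module \<Rightarrow>
    ('r, 'n, 'e, 'm) extn \<Rightarrow> ('r, 'n, 'e, 'm) extn \<Rightarrow> ('r, 'n, 'e, 'm) extn \<Rightarrow> bool" where
  "baer_sum R N (E1, i1, p1) (E2, i2, p2) (E, i, p) \<longleftrightarrow>
    (let P = {(x, y). x \<in> carrier E1 \<and> y \<in> carrier E2 \<and> p1 x = p2 y} in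
     \<exists>f \<in> P \<rightarrow> carrier E.
       (\<forall>(x, y)\<in>P. \<forall>(x', y')\<in>P. f (x \<oplus>\<^bsub>E1\<^esub> x', y \<oplus>\<^bsub>E2\<^esub> y') = f (x, y) \<oplus>\<^bsub>E\<^esub> f (x', y')) \<and>
       (\<forall>r\<in>carrier R. \<forall>(x, y)\<in>P. f (r \<odot>\<^bsub>E1\<^esub> x, r \<odot>\<^bsub>E2\<^esub> y) = r \<odot>\<^bsub>E\<^esub> f (x, y)) \<and>
       (\<forall>u\<in>carrier N. \<forall>v\<in>carrier N. f (i1 u, i2 v) = i (u \<oplus>\<^bsub>N\<^esub> v)) \<and>
       (\<forall>(x, y)\<in>P. p (f (x, y)) = p1 x))"

fun ext_scale :: "('r, 'x) ring_scheme \<Rightarrow> ('r, 'n) module \<Rightarrow> 'r \<Rightarrow>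
    ('r, 'n, 'e, 'm) extn \<Rightarrow> ('r, 'n, 'e, 'm) extn \<Rightarrow> bool" where
  "ext_scale R N r (E1, i1, p1) (E, i, p) \<longleftrightarrow>
    (\<exists>f\<in>lmod_hom R E1 E.
       (\<forall>u\<in>carrier N. f (i1 u) = i (r \<odot>\<^bsub>N\<^esub> u)) \<and> (\<forall>x\<in>carrier E1. p (f x) = p1 x))"

definition ext_class :: "('r, 'x) ring_scheme \<Rightarrow> ('r, 'm) module \<Rightarrow> ('r, 'n) module \<Rightarrow>
    ('r, 'n, 'e, 'm) extn \<Rightarrow> ('r, 'n, 'e, 'm) extn set" where
  "ext_class R M N \<xi> = {\<xi>' \<in> extensions R M N. ext_equiv R N \<xi> \<xi>'}"

text \<open>
  \<open>Ext1 R \<eta> M N\<close> is the \<open>k\<close>-vector space \<open>Ext\<^sup>1\<^sub>R(M, N)\<close> of Yoneda classes of extensions of \<open>M\<close> by \<open>N\<close>,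
  where \<open>\<eta>\<close> is the structure map from \<open>k\<close> to the centre of \<open>R\<close>.  The carriers of the middle terms
  are subsets of one fixed type \<open>'e\<close>.  Below \<open>'e\<close> is \<open>nat \<Rightarrow> 'k\<close>, which has room for every
  finite-dimensional module, and every extension of finite-dimensional modules is
  finite-dimensional.
\<close>

definition Ext1 :: "('r, 'x) ring_scheme \<Rightarrow> ('k::field \<Rightarrow> 'r) \<Rightarrow> ('r, 'm) module \<Rightarrow> ('r, 'n) module \<Rightarrow>
    ('k, ('r, 'n, 'e, 'm) extn set) module" where
  "Ext1 R \<eta> M N =
    \<lparr>carrier = ext_class R M N ` extensions R M N, mult = undefined, one = undefined,
     zero = {\<xi> \<in> extensions R M N. ext_split R M \<xi>},
     add = (\<lambda>X Y. {\<xi> \<in> extensions R M N. \<exists>\<xi>1\<in>X. \<exists>\<xi>2\<in>Y. baer_sum R N \<xi>1 \<xi>2 \<xi>}),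
     smult = (\<lambda>\<kappa> X. {\<xi> \<in> extensions R M N. \<exists>\<xi>1\<in>X. ext_scale R N (\<eta> \<kappa>) \<xi>1 \<xi>})\<rparr>"

definition is_basis :: "('k::field, 'w) module \<Rightarrow> 'i set \<Rightarrow> ('i \<Rightarrow> 'w) \<Rightarrow> bool" where
  "is_basis V J v \<longleftrightarrow>
     finite J \<and> v \<in> J \<rightarrow> carrier V \<and>
     (\<forall>y\<in>carrier V. \<exists>!\<kappa>. \<kappa> \<in> J \<rightarrow>\<^sub>E UNIV \<and> y = (\<Oplus>\<^bsub>V\<^esub>i\<in>J. \<kappa> i \<odot>\<^bsub>V\<^esub> v i))"


section \<open>Strings and bands\<close>

datatype 'a letter = Dir 'a | Inv 'a

primrec letter_inv :: "'a letter \<Rightarrow> 'a letter" where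
  "letter_inv (Dir a) = Inv a"
| "letter_inv (Inv a) = Dir a"

primrec arrow_of :: "'a letter \<Rightarrow> 'a" where
  "arrow_of (Dir a) = a"
| "arrow_of (Inv a) = a"

primrec lstart :: "('v, 'a) pre_digraph \<Rightarrow> 'a letter \<Rightarrow> 'v" where
  "lstart Q (Dir a) = tail Q a"
| "lstart Q (Inv a) = head Q a"

primrec lend :: "('v, 'a) pre_digraph \<Rightarrow> 'a letter \<Rightarrow> 'v" where
  "lend Q (Dir a) = head Q a"
| "lend Q (Inv a) = tail Q a"

definition word_inv :: "'a letter list \<Rightarrow> 'a letter list" where
  "word_inv w = rev (map letter_inv w)"

definition word_pow :: "'a letter list \<Rightarrow> nat \<Rightarrow> 'a letter list" where
  "word_pow w r = concat (replicate r w)"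

definition walk :: "('v, 'a) pre_digraph \<Rightarrow> 'a letter list \<Rightarrow> bool" where
  "walk Q w \<longleftrightarrow>
     arrow_of ` set w \<subseteq> arcs Q \<and>
     (\<forall>i. Suc i < length w \<longrightarrow>
        lstart Q (w ! i) = lend Q (w ! Suc i) \<and> w ! i \<noteq> letter_inv (w ! Suc i))"

text \<open>Only strings of positive length are needed as such.\<close>

definition is_string ::
  "('v, 'a) pre_digraph \<Rightarrow> (('v, 'a) path \<Rightarrow> 'k::field) set \<Rightarrow> 'a letter list \<Rightarrow> bool" where
  "is_string Q I w \<longleftrightarrow>
     w \<noteq> [] \<and> walk Q w \<and>
     (\<nexists>x u y p. w = x @ u @ y \<and> p \<noteq> [] \<and> (u = map Dir p \<or> word_inv u = map Dir p) \<and>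
        arrow_path Q p \<in> I)"

definition band ::
  "('v, 'a) pre_digraph \<Rightarrow> (('v, 'a) path \<Rightarrow> 'k::field) set \<Rightarrow> 'a letter list \<Rightarrow> bool" where
  "band Q I b \<longleftrightarrow>
     is_string Q I b \<and>
     lend Q (hd b) = lstart Q (last b) \<and>
     last b \<noteq> letter_inv (hd b) \<and>
     is_string Q I [last b, hd b] \<and>
     (\<nexists>y r. r > 1 \<and> b = word_pow y r)"

text \<open>
  \<open>inf_word w\<close> is the doubly infinite word \<open>\<dots>www\<dots>\<close>, indexed from left to right (so the index
  runs against the numbering \<open>w\<^sub>l \<dots> w\<^sub>1\<close>), with a copy of \<open>w\<close> starting at index \<open>0\<close>.
\<close>

definition inf_word :: "'a letter list \<Rightarrow> int \<Rightarrow> 'a letter" where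
  "inf_word w i = w ! nat (i mod int (length w))"

definition inf_word_eq :: "'a letter list \<Rightarrow> 'a letter list \<Rightarrow> bool" where
  "inf_word_eq b c \<longleftrightarrow> (\<exists>k. \<forall>i. inf_word b i = inf_word c (i + k))"

text \<open>
  A scalar \<open>\<lambda>\<close> on a direct letter of \<open>c\<close> sits on an inverse letter of \<open>c\<^sup>-\<^sup>1\<close>.  Moved to a direct
  letter of \<open>c\<^sup>-\<^sup>1\<close> it becomes \<open>\<lambda>\<^sup>-\<^sup>1\<close>; this is the scalar to be compared with \<open>\<mu>\<close> in the second case.
\<close>

definition band_data_eq :: "'a letter list \<Rightarrow> 'k::field \<Rightarrow> 'a letter list \<Rightarrow> 'k \<Rightarrow> bool" where
  "band_data_eq b \<mu> c lam \<longleftrightarrow>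
     (inf_word_eq b c \<and> \<mu> = lam) \<or> (inf_word_eq b (word_inv c) \<and> \<mu> = inverse lam)"


section \<open>Band modules\<close>

text \<open>
  \<open>rep_module Q n vx act\<close> is the \<open>kQ/I\<close>-module given by a representation of the quiver: it has basis
  \<open>z\<^sub>0, \<dots>, z\<^sub>n\<^sub>-\<^sub>1\<close>, with \<open>z\<^sub>i\<close> at the vertex \<open>vx i\<close>, a vector is its coordinate function, and
  the arrow \<open>a\<close> acts by \<open>act a\<close>.  A coset acts through any of its elements.
\<close>

definition path_act :: "(nat \<Rightarrow> 'v) \<Rightarrow> ('a \<Rightarrow> (nat \<Rightarrow> 'k) \<Rightarrow> (nat \<Rightarrow> 'k)) \<Rightarrow>
    ('v, 'a) path \<Rightarrow> (nat \<Rightarrow> 'k::field) \<Rightarrow> (nat \<Rightarrow> 'k)" where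
  "path_act vx act r v = foldr act (snd r) (\<lambda>i. if vx i = fst r then v i else 0)"

definition rep_module :: "nat \<Rightarrow> (nat \<Rightarrow> 'v) \<Rightarrow> ('a \<Rightarrow> (nat \<Rightarrow> 'k) \<Rightarrow> (nat \<Rightarrow> 'k)) \<Rightarrow>
    ((('v, 'a) path \<Rightarrow> 'k) set, nat \<Rightarrow> 'k::field) module" where
  "rep_module n vx act =
    \<lparr>carrier = {v. \<forall>i\<ge>n. v i = 0}, mult = undefined, one = undefined,
     zero = (\<lambda>_. 0),
     add = (\<lambda>u v i. u i + v i),
     smult = (\<lambda>X v i. let f = (SOME f. f \<in> X) in \<Sum>r | f r \<noteq> 0. f r * path_act vx act r v i)\<rparr>"

text \<open>
  For a cyclic word \<open>w\<close> the basis vector \<open>z\<^sub>i\<close> sits at the end (that is, the left end) of the letter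
  \<open>w ! i\<close>.  This letter joins \<open>z\<^sub>i\<^sub>+\<^sub>1\<close> on its right to \<open>z\<^sub>i\<close> on its left: it sends \<open>z\<^sub>i\<^sub>+\<^sub>1\<close> to \<open>z\<^sub>i\<close> if it
  is direct, and its arrow sends \<open>z\<^sub>i\<close> to \<open>z\<^sub>i\<^sub>+\<^sub>1\<close> if it is inverse.  The scalar is placed on the
  letter \<open>w ! j\<close>, which is meant to be direct.
\<close>

definition word_act :: "'a letter list \<Rightarrow> nat \<Rightarrow> 'k::field \<Rightarrow> 'a \<Rightarrow> (nat \<Rightarrow> 'k) \<Rightarrow> (nat \<Rightarrow> 'k)" where
  "word_act w j \<mu> a v = (\<lambda>i. let n = length w; i' = (i + n - 1) mod n in
     if i < n then
       (if w ! i = Dir a then (if i = j then \<mu> else 1) * v (Suc i mod n) else 0) +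
       (if w ! i' = Inv a then v i' else 0)
     else 0)"

definition word_vertex :: "('v, 'a) pre_digraph \<Rightarrow> 'a letter list \<Rightarrow> nat \<Rightarrow> 'v" where
  "word_vertex Q w i = lend Q (w ! i)"

definition band_module :: "('v, 'a) pre_digraph \<Rightarrow> 'a letter list \<Rightarrow> nat \<Rightarrow> 'k::field \<Rightarrow>
    ((('v, 'a) path \<Rightarrow> 'k) set, nat \<Rightarrow> 'k) module" where
  "band_module Q b j \<mu> = rep_module (length b) (word_vertex Q b) (word_act b j \<mu>)"

definition direct_at :: "'a letter list \<Rightarrow> nat \<Rightarrow> bool" where
  "direct_at w j \<longleftrightarrow> j < length w \<and> (\<exists>a. w ! j = Dir a)"


section \<open>Overlap extensions\<close>

text \<open>
  \<open>overlap Q I c b p q m A B C D\<close> encodes a pair of decompositions of \<open>\<dots>ccc\<dots>\<close> and \<open>\<dots>bbb\<dots>\<close>.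
  A decomposition is given by the index at which the subword \<open>m\<close> starts, taken modulo the period.
  The strings \<open>c\<^sub>L\<close>, \<open>c\<^sub>R\<close>, \<open>b\<^sub>L\<close>, \<open>b\<^sub>R\<close> are what is left between the displayed letters and the next
  copies of \<open>c\<close> and \<open>b\<close>, so they carry no information.  A trivial \<open>m\<close> is the empty list; its vertex
  is determined by \<open>A\<close>.
\<close>

definition subword_at :: "'a letter list \<Rightarrow> int \<Rightarrow> 'a letter list \<Rightarrow> bool" where
  "subword_at w s u \<longleftrightarrow> (\<forall>i<length u. inf_word w (s + int i) = u ! i)"

definition overlap :: "('v, 'a) pre_digraph \<Rightarrow> (('v, 'a) path \<Rightarrow> 'k::field) set \<Rightarrow>
    'a letter list \<Rightarrow> 'a letter list \<Rightarrow> nat \<Rightarrow> nat \<Rightarrow> 'a letter list \<Rightarrow> 'a \<Rightarrow> 'a \<Rightarrow> 'a \<Rightarrow> 'a \<Rightarrow> bool" where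
  "overlap Q I c b p q m A B C D \<longleftrightarrow>
     p < length c \<and> q < length b \<and>
     subword_at c (int p - 1) (Inv B # m @ [Dir A]) \<and>
     subword_at b (int q - 1) (Dir D # m @ [Inv C]) \<and>
     (m = [] \<longrightarrow>
        head Q A = tail Q C \<and> arrow_path Q [C, A] \<in> I \<and>
        head Q B = tail Q D \<and> arrow_path Q [D, B] \<in> I)"

text \<open>
  Bands are taken modulo inversion, so either band may be replaced by its inverse in a decomposition.
  Since simultaneous inversion of both words changes nothing, \<open>c\<close> keeps its given orientation; the
  flag \<open>r\<close> tells whether \<open>b\<close> is displayed inverted.
\<close>

definition orient :: "bool \<Rightarrow> 'a letter list \<Rightarrow> 'a letter list" where
  "orient r b = (if r then word_inv b else b)"

definition overlap_data :: "('v, 'a) pre_digraph \<Rightarrow> (('v, 'a) path \<Rightarrow> 'k::field) set \<Rightarrow>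
    'a letter list \<Rightarrow> 'a letter list \<Rightarrow> (bool \<times> nat \<times> nat \<times> 'a letter list) set" where
  "overlap_data Q I c b = {(r, p, q, m). \<exists>A B C D. overlap Q I c (orient r b) p q m A B C D}"

text \<open>
  In the overlap extension of \<open>B(c, \<lambda>)\<close> by \<open>B(b, \<mu>)\<close> the two words are cut at the left end of \<open>m\<close> and
  rejoined crosswise.  Let \<open>z\<^sup>c\<close> and \<open>z\<^sup>b\<close> be the basis vectors of \<open>B(c, \<lambda>)\<close> and \<open>B(b, \<mu>)\<close> at the left
  end of \<open>m\<close>.  On the vector space \<open>B(b, \<mu>) \<oplus> B(c, \<lambda>)\<close> the arrows act diagonally, except that \<open>D\<close> sends
  \<open>z\<^sup>c\<close> to the same vector as \<open>z\<^sup>b\<close>, so the left part of \<open>b\<close> is joined to the copy \<open>z\<^sup>c, \<dots>\<close> of \<open>m\<close>, which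
  continues with \<open>A\<close> on the right; and where \<open>B\<close> ended at \<open>z\<^sup>c\<close> it now ends at \<open>z\<^sup>c - z\<^sup>b\<close>, so the
  left part of \<open>c\<close> is joined to the copy \<open>z\<^sup>c - z\<^sup>b, \<dots>\<close> of \<open>m\<close>, which is killed by \<open>D\<close> and continues on
  the right with the inverse of \<open>C\<close>.  (Rejoining at the right end of \<open>m\<close> gives the same class up to sign.)

  The first \<open>length b\<close> coordinates are those of \<open>B(b, \<mu>)\<close>.  In \<open>glue_act\<close>, \<open>actb\<close> and \<open>actc\<close> are the
  actions on the two band modules, \<open>nb\<close> is the length of \<open>b\<close>, and \<open>z\<^sup>b = z\<^sub>y\<close>, \<open>z\<^sup>c = z\<^sub>x\<close>.
\<close>

definition glue_act :: "nat \<Rightarrow> ('a \<Rightarrow> (nat \<Rightarrow> 'k) \<Rightarrow> (nat \<Rightarrow> 'k)) \<Rightarrow>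
    ('a \<Rightarrow> (nat \<Rightarrow> 'k) \<Rightarrow> (nat \<Rightarrow> 'k)) \<Rightarrow> nat \<Rightarrow> nat \<Rightarrow> 'a \<Rightarrow> 'a \<Rightarrow>
    'a \<Rightarrow> (nat \<Rightarrow> 'k::field) \<Rightarrow> (nat \<Rightarrow> 'k)" where
  "glue_act nb actb actc x y D B a v =
    (let vb = (\<lambda>i. if i < nb then v i else 0);
         vc = (\<lambda>i. v (nb + i));
         h = (\<lambda>u i. if i = y then u x else 0)
     in (\<lambda>i. if i < nb
            then actb a vb i + (if a = D then actb a (h vc) i else 0)
                             - (if a = B then h (actc a vc) i else 0)
            else actc a vc (i - nb)))"

text \<open>
  The left end of the letter with index \<open>q\<close> of \<open>b\<^sup>-\<^sup>1\<close> is the left end of the letter of \<open>b\<close> with index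
  \<open>length b - q\<close> modulo \<open>length b\<close>.
\<close>

definition overlap_ext :: "('v, 'a) pre_digraph \<Rightarrow> 'a letter list \<Rightarrow> nat \<Rightarrow> 'k::field \<Rightarrow>
    'a letter list \<Rightarrow> nat \<Rightarrow> 'k \<Rightarrow> bool \<times> nat \<times> nat \<times> 'a letter list \<Rightarrow>
    ((('v, 'a) path \<Rightarrow> 'k) set, nat \<Rightarrow> 'k, nat \<Rightarrow> 'k, nat \<Rightarrow> 'k) extn" where
  "overlap_ext Q c jc lam b jb \<mu> = (\<lambda>(r, p, q, m).
    let nb = length b; nc = length c;
        y = (if r then (nb - q) mod nb else q);
        D = arrow_of (inf_word (orient r b) (int q - 1));
        B = arrow_of (inf_word c (int p - 1))
    in (rep_module (nb + nc)
          (\<lambda>i. if i < nb then word_vertex Q b i else word_vertex Q c (i - nb))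
          (glue_act nb (word_act b jb \<mu>) (word_act c jc lam) p y D B),
        (\<lambda>u. u),
        (\<lambda>v i. v (nb + i))))"

text \<open>
  The quotient \<open>\<lambda>\<mu>\<^sup>-\<^sup>1\<close> in the scalar of the middle term presupposes that \<open>\<lambda>\<close> is placed on a direct
  letter of the displayed word of \<open>c\<close> and \<open>\<mu>\<close> on a direct letter of the inverse of the displayed
  word of \<open>b\<close>: walking once around the glued word passes both words in the same direction, so the
  two scalars multiply when both are placed on direct letters of the displayed words.
  \<open>opposite_scalar r \<mu>\<close> is the scalar of \<open>B(b, \<mu>)\<close> in that normalisation, where \<open>orient r b\<close> is the
  displayed word and \<open>\<mu>\<close> is placed on a direct letter of \<open>b\<close>.
\<close>

definition opposite_scalar :: "bool \<Rightarrow> 'k::field \<Rightarrow> 'k" where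
  "opposite_scalar r \<mu> = (if r then \<mu> else inverse \<mu>)"

definition primitive_unity_root :: "nat \<Rightarrow> 'k::field \<Rightarrow> bool" where
  "primitive_unity_root t \<omega> \<longleftrightarrow> \<omega> ^ t = 1 \<and> (\<forall>s. 0 < s \<and> s < t \<longrightarrow> \<omega> ^ s \<noteq> 1)"

end

theory Submission
  imports Defs "Jordan_Normal_Form.Determinant"
begin

text \<open>
  Write \<open>M\<^sub>b\<close> and \<open>M\<^sub>c\<close> for the two band modules. The extensions are computed by hand, as a linear system, and the
  combinatorics of overlaps appears as the combinatorics of this system.

  In coordinates an extension of \<open>M\<^sub>c\<close> by \<open>M\<^sub>b\<close> is an action by block triangular matrices. The corner blocks form a
  cocycle, and two cocycles give equivalent extensions if they differ by the coboundary of a linear map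
  \<open>h : M\<^sub>c \<rightarrow> M\<^sub>b\<close> (\<open>every_extension\<close>, \<open>equiv_X_iff\<close>). Baer sums and scalar multiples are those of cocycles, so
  that the claim about the basis becomes a statement of linear algebra (\<open>basis_criterion\<close>).

  The basis vectors of a band module lie on a circle whose edges are the letters of the band. At a vertex of a
  gentle quiver the half-edges fall into at most two classes of mutually blocking ones, so two basis vectors
  \<open>z\<^sup>b\<close> and \<open>z\<^sup>c\<close> at the same vertex determine which direction on the first circle corresponds to the direction to the
  right on the second one; such a pair is a node. The entries of a cocycle that are not forced to vanish belong to
  nodes (\<open>cocycle_vanishes\<close>). If the letters to the right of \<open>z\<^sup>b\<close> and \<open>z\<^sup>c\<close> agree, the entry of a coboundary there
  is an equation between \<open>h\<close> at this node and \<open>h\<close> at the next one. So the nodes form chains, and a chain spells a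
  common subword of the two infinite words. At an end of a chain the two letters differ, and there is one further
  equation exactly if they differ as \<open>D\<close> and the inverse of \<open>B\<close>, or as the inverse of \<open>C\<close> and \<open>A\<close>, in an overlap.
  A finite chain of \<open>n\<close> nodes thus has \<open>n - 1\<close> equations, one more for each such end, in \<open>n\<close> unknowns. It obstructs
  the solution only if both ends are of this kind, which makes it an overlap, and then the cokernel has dimension
  one and is spanned by the gluing cocycle (\<open>chain_solvable\<close>, \<open>chain_unique\<close>, \<open>glue_basis\<close>). A chain without end
  means that the two infinite words agree; going around it multiplies \<open>h\<close> by the quotient of
  the two scalars, both placed on direct letters of this word, and it is not \<open>1\<close> since the band data differ (\<open>closed_chain\<close>).

  For the middle term, let \<open>b'\<close> and \<open>c'\<close> be the periods of the two words read from the left end of \<open>m\<close>. Starting from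
  the vector \<open>z\<^sup>c - z\<^sup>b\<close>, which \<open>D\<close> kills, one can walk through the glued module along \<open>b'c'\<close>: along \<open>m\<close> with both
  components, after \<open>m\<close> only with the component in \<open>M\<^sub>b\<close>, then through \<open>D\<close> into \<open>c'\<close>, and through the inverse
  of \<open>B\<close> back to a multiple of the first vector (\<open>wact\<close>). The minus sign in front of \<open>z\<^sup>b\<close> gives the sign \<open>\<epsilon> = -1\<close>.
  These vectors span the module, which is therefore the module of the cyclic word \<open>b'c'\<close> (\<open>middle_term_iso\<close>).
  If \<open>b'c' = d\<^sup>t\<close> with \<open>d\<close> primitive, this module is a cyclic cover: combining the copies of each basis vector of \<open>d\<close>
  by powers of the \<open>t\<close>-th roots of the scalar splits it into \<open>t\<close> band modules of \<open>d\<close>, by the invertibility of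
  Vandermonde matrices (\<open>cyclic_cover_iso\<close>). The words \<open>mvmw\<close>, \<open>mvc\<^sub>2c\<^sub>1\<close>, \<open>b\<^sub>2b\<^sub>1mw\<close> and \<open>b\<^sub>2b\<^sub>1c\<^sub>2c\<^sub>1\<close> are four
  ways of writing \<open>b'c'\<close>.
\<close>

section \<open>Representations of a quiver with quadratic monomial relations\<close>

locale bound_quiver =
  fixes Q :: "('v, 'a) pre_digraph" and I :: "(('v, 'a) path \<Rightarrow> 'k::field) set"
  assumes finite_quiver: "fin_digraph Q"
    and admissible: "admissible Q I"
    and quadratic: "\<exists>S \<subseteq> {r \<in> paths Q. length (snd r) = 2}. I = Idl\<^bsub>path_algebra Q\<^esub> (path_elem ` S)"
begin

abbreviation PA :: "(('v, 'a) path \<Rightarrow> 'k) ring" where "PA \<equiv> path_algebra Q"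
abbreviation L where "L \<equiv> bound_algebra Q I"

sublocale fin_digraph Q by (rule finite_quiver)

sublocale ideal I PA using admissible by (simp add: admissible_def)

lemma ring_L: "ring L"
  unfolding bound_algebra_def by (rule quotient_is_ring)

definition cls where "cls f = I +>\<^bsub>PA\<^esub> f"

lemma carrier_L: "carrier L = cls ` carrier PA"
  by (auto simp: bound_algebra_def FactRing_def A_RCOSETS_def' cls_def)

lemma cls_mult: "f \<in> carrier PA \<Longrightarrow> g \<in> carrier PA \<Longrightarrow> cls f \<otimes>\<^bsub>L\<^esub> cls g = cls (f \<otimes>\<^bsub>PA\<^esub> g)"
  by (simp add: bound_algebra_def FactRing_def cls_def rcoset_mult_add)

lemma cls_add: "f \<in> carrier PA \<Longrightarrow> g \<in> carrier PA \<Longrightarrow> cls f \<oplus>\<^bsub>L\<^esub> cls g = cls (f \<oplus>\<^bsub>PA\<^esub> g)"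
  by (simp add: bound_algebra_def FactRing_def cls_def a_rcos_sum)

lemma cls_one: "\<one>\<^bsub>L\<^esub> = cls \<one>\<^bsub>PA\<^esub>"
  by (simp add: bound_algebra_def FactRing_def cls_def)

lemma cls_zero: "\<zero>\<^bsub>L\<^esub> = cls \<zero>\<^bsub>PA\<^esub>"
  by (simp add: bound_algebra_def FactRing_def cls_def a_rcos_zero[OF is_ideal])

lemma carrier_PA: "f \<in> carrier PA \<longleftrightarrow> finite {r. f r \<noteq> 0} \<and> {r. f r \<noteq> 0} \<subseteq> paths Q"
  by (simp add: path_algebra_def)

lemma PA_add: "f \<oplus>\<^bsub>PA\<^esub> g = (\<lambda>r. f r + g r)"
  by (simp add: path_algebra_def)

lemma PA_zero: "\<zero>\<^bsub>PA\<^esub> = (\<lambda>_. 0)"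
  by (simp add: path_algebra_def)

lemma PA_mult: "(f \<otimes>\<^bsub>PA\<^esub> g) (x, p) =
    (\<Sum>i\<le>length p. f (path_end Q x (drop i p), take i p) * g (x, drop i p))"
  by (simp add: path_algebra_def)

lemma PA_one: "\<one>\<^bsub>PA\<^esub> (x, p) = (if x \<in> verts Q \<and> p = [] then 1 else 0)"
  by (simp add: path_algebra_def)

lemma path_elem_carrier: "r \<in> paths Q \<Longrightarrow> path_elem r \<in> carrier PA"
  by (auto simp: carrier_PA path_elem_def)


lemma path_end_vert: "path_from Q x p \<Longrightarrow> path_end Q x p \<in> verts Q"
  by (cases p) auto

lemma path_end_append: "path_end Q x (q @ p) = path_end Q (path_end Q x p) q"
  by (cases q) auto

lemma path_elem_mult:
  assumes "(y, q) \<in> paths Q" and "(x, p) \<in> paths Q" and "y = path_end Q x p"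
  shows "path_elem (y, q) \<otimes>\<^bsub>PA\<^esub> path_elem (x, p) = path_elem (x, q @ p)"
proof (rule ext, clarify)
  fix x' p'
  have "(path_elem (y, q) \<otimes>\<^bsub>PA\<^esub> path_elem (x, p)) (x', p') =
     (\<Sum>i\<le>length p'. if i = length q \<and> x' = x \<and> p' = q @ p then 1 else (0::'k))"
    unfolding PA_mult
  proof (rule sum.cong[OF refl])
    fix i assume "i \<in> {..length p'}"
    then have "length (take i p') = i" by simp
    then have "take i p' = q \<and> drop i p' = p \<longleftrightarrow> i = length q \<and> p' = q @ p"
      by (metis append_eq_conv_conj append_take_drop_id)
    then show "path_elem (y, q) (path_end Q x' (drop i p'), take i p') * path_elem (x, p) (x', drop i p')
        = (if i = length q \<and> x' = x \<and> p' = q @ p then 1 else (0::'k))"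
      using assms(3) by (auto simp: path_elem_def)
  qed
  also have "\<dots> = path_elem (x, q @ p) (x', p')"
    by (auto simp: path_elem_def)
  finally show "(path_elem (y, q) \<otimes>\<^bsub>PA\<^esub> path_elem (x, p)) (x', p') = path_elem (x, q @ p) (x', p')" .
qed

lemma scalar_mult:
  assumes "f \<in> carrier PA"
  shows "(\<lambda>r. \<kappa> * \<one>\<^bsub>PA\<^esub> r) \<otimes>\<^bsub>PA\<^esub> f = (\<lambda>r. \<kappa> * f r)"
proof (rule ext, clarify)
  fix x p
  have "((\<lambda>r. \<kappa> * \<one>\<^bsub>PA\<^esub> r) \<otimes>\<^bsub>PA\<^esub> f) (x, p) = (\<Sum>i\<le>length p. if i = 0 then \<kappa> * f (x, p) else 0)"
    unfolding PA_mult
  proof (rule sum.cong[OF refl])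
    fix i assume "i \<in> {..length p}"
    moreover have "path_from Q x p" if "f (x, p) \<noteq> 0"
      using assms that by (auto simp: carrier_PA paths_def)
    ultimately show "\<kappa> * \<one>\<^bsub>PA\<^esub> (path_end Q x (drop i p), take i p) * f (x, drop i p) =
        (if i = 0 then \<kappa> * f (x, p) else 0)"
      using path_end_vert[of x p] by (cases "f (x, p) = 0") (auto simp: PA_one)
  qed
  then show "((\<lambda>r. \<kappa> * \<one>\<^bsub>PA\<^esub> r) \<otimes>\<^bsub>PA\<^esub> f) (x, p) = \<kappa> * f (x, p)" by simp
qed

lemma scalar_carrier: "(\<lambda>r. \<kappa> * \<one>\<^bsub>PA\<^esub> r) \<in> carrier PA"
proof -
  have "finite {r. \<kappa> * \<one>\<^bsub>PA\<^esub> r \<noteq> 0}"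
    by (rule finite_subset[of _ "(\<lambda>x. (x, [])) ` verts Q"]) (auto simp: PA_one split: if_splits)
  then show ?thesis
    by (auto simp: carrier_PA PA_one paths_def split: if_splits)
qed

lemma arrow_path_single: "arrow_path Q [a] = path_elem (tail Q a, [a])"
  by (simp add: arrow_path_def)

lemma arrow_in_paths: "a \<in> arcs Q \<Longrightarrow> (tail Q a, [a]) \<in> paths Q"
  by (simp add: paths_def)

text \<open>
  A statement about all elements of \<open>kQ/I\<close> that is stable under sums and products only has to be
  checked on scalars, vertices and arrows.
\<close>

lemma generated_by_arrows:
  assumes scal: "\<And>\<kappa>. scalar_elem Q I \<kappa> \<in> T"
    and vert: "\<And>x. x \<in> verts Q \<Longrightarrow> cls (path_elem (x, [])) \<in> T"
    and arr: "\<And>a. a \<in> arcs Q \<Longrightarrow> cls (arrow_path Q [a]) \<in> T"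
    and add: "\<And>X Y. X \<in> T \<Longrightarrow> Y \<in> T \<Longrightarrow> X \<in> carrier L \<Longrightarrow> Y \<in> carrier L \<Longrightarrow> X \<oplus>\<^bsub>L\<^esub> Y \<in> T"
    and mult: "\<And>X Y. X \<in> T \<Longrightarrow> Y \<in> T \<Longrightarrow> X \<in> carrier L \<Longrightarrow> Y \<in> carrier L \<Longrightarrow> X \<otimes>\<^bsub>L\<^esub> Y \<in> T"
  shows "carrier L \<subseteq> T"
proof -
  have path: "cls (path_elem (x, p)) \<in> T" if "path_from Q x p" for x p
    using that
  proof (induction p)
    case Nil then show ?case by (simp add: vert)
  next
    case (Cons a p)
    have 1: "(x, p) \<in> paths Q" "(tail Q a, [a]) \<in> paths Q" "tail Q a = path_end Q x p"
      using Cons.prems by (auto simp: paths_def path_end_vert)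
    have "cls (arrow_path Q [a]) \<otimes>\<^bsub>L\<^esub> cls (path_elem (x, p)) = cls (path_elem (x, a # p))"
      using 1 by (simp add: cls_mult path_elem_carrier path_elem_mult arrow_path_single)
    moreover have "cls (arrow_path Q [a]) \<in> T" "cls (path_elem (x, p)) \<in> T"
      using Cons arr by auto
    ultimately show ?case
      using mult 1 by (metis arrow_path_single carrier_L imageI path_elem_carrier)
  qed
  have sc: "cls (\<lambda>r. \<kappa> * \<one>\<^bsub>PA\<^esub> r) \<in> T" for \<kappa>
    using scal[of \<kappa>] by (simp add: scalar_elem_def cls_def)
  have "cls f \<in> T" if "finite S" "f \<in> carrier PA" "{r. f r \<noteq> 0} \<subseteq> S" for f S
    using that
  proof (induction S arbitrary: f rule: finite_induct)
    case empty
    then have "f = (\<lambda>r. 0 * \<one>\<^bsub>PA\<^esub> r)" by auto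
    then show ?case using sc[of 0] by simp
  next
    case (insert r S)
    define g where "g = f(r := 0)"
    have gc: "g \<in> carrier PA"
      using insert.prems(1) by (auto simp: g_def carrier_PA elim: finite_subset[rotated])
    have "{r. g r \<noteq> 0} \<subseteq> S" using insert.prems(2) by (auto simp: g_def)
    then have gT: "cls g \<in> T" using insert.IH gc by blast
    show ?case
    proof (cases "f r = 0")
      case True
      then have "g = f" by (auto simp: g_def)
      then show ?thesis using gT by simp
    next
      case False
      then have r: "r \<in> paths Q" using insert.prems(1) by (auto simp: carrier_PA)
      define s where "s = (\<lambda>q. f r * \<one>\<^bsub>PA\<^esub> q) \<otimes>\<^bsub>PA\<^esub> path_elem r"
      have s: "s = (\<lambda>q. f r * path_elem r q)"
        using r by (simp add: s_def scalar_mult path_elem_carrier)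
      have sC: "s \<in> carrier PA" using r by (simp add: s_def scalar_carrier path_elem_carrier)
      have "cls s = cls (\<lambda>q. f r * \<one>\<^bsub>PA\<^esub> q) \<otimes>\<^bsub>L\<^esub> cls (path_elem r)"
        using r by (simp add: s_def cls_mult scalar_carrier path_elem_carrier)
      also have "\<dots> \<in> T"
        using r by (intro mult sc) (auto simp: carrier_L scalar_carrier path_elem_carrier paths_def path path_end_vert)
      finally have sT: "cls s \<in> T" .
      have "f = s \<oplus>\<^bsub>PA\<^esub> g" by (auto simp: s PA_add g_def path_elem_def)
      then have "cls f = cls s \<oplus>\<^bsub>L\<^esub> cls g" using sC gc by (simp add: cls_add)
      also have "\<dots> \<in> T" using add sT gT sC gc by (simp add: carrier_L)
      finally show ?thesis .
    qed
  qed
  then show ?thesis by (auto simp: carrier_L carrier_PA)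
qed

text \<open>
  A homomorphism only has to commute with the scalars, the vertices and the arrows, because the elements of
  the algebra with which it commutes are closed under sums and products.
\<close>

lemma hom_criterion:
  assumes "left_module L M" and "left_module L N"
    and F: "F \<in> carrier M \<rightarrow> carrier N"
    and add: "\<And>x y. x \<in> carrier M \<Longrightarrow> y \<in> carrier M \<Longrightarrow> F (x \<oplus>\<^bsub>M\<^esub> y) = F x \<oplus>\<^bsub>N\<^esub> F y"
    and scal: "\<And>\<kappa> x. x \<in> carrier M \<Longrightarrow> F (scalar_elem Q I \<kappa> \<odot>\<^bsub>M\<^esub> x) = scalar_elem Q I \<kappa> \<odot>\<^bsub>N\<^esub> F x"
    and vert: "\<And>v x. v \<in> verts Q \<Longrightarrow> x \<in> carrier M \<Longrightarrow>
        F (cls (path_elem (v, [])) \<odot>\<^bsub>M\<^esub> x) = cls (path_elem (v, [])) \<odot>\<^bsub>N\<^esub> F x"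
    and arr: "\<And>a x. a \<in> arcs Q \<Longrightarrow> x \<in> carrier M \<Longrightarrow>
        F (cls (arrow_path Q [a]) \<odot>\<^bsub>M\<^esub> x) = cls (arrow_path Q [a]) \<odot>\<^bsub>N\<^esub> F x"
  shows "F \<in> lmod_hom L M N"
proof -
  interpret M: left_module L M by fact
  interpret N: left_module L N by fact
  let ?T = "{X. \<forall>x\<in>carrier M. F (X \<odot>\<^bsub>M\<^esub> x) = X \<odot>\<^bsub>N\<^esub> F x}"
  have "carrier L \<subseteq> ?T"
  proof (rule generated_by_arrows)
    show "scalar_elem Q I \<kappa> \<in> ?T" for \<kappa> using scal by blast
    show "cls (path_elem (x, [])) \<in> ?T" if "x \<in> verts Q" for x using vert that by blast
    show "cls (arrow_path Q [a]) \<in> ?T" if "a \<in> arcs Q" for a using arr that by blast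
  next
    fix X Y assume *: "X \<in> ?T" "Y \<in> ?T" "X \<in> carrier L" "Y \<in> carrier L"
    show "X \<oplus>\<^bsub>L\<^esub> Y \<in> ?T"
      using * F by (auto simp: M.smult_l_distr N.smult_l_distr add M.smult_closed Pi_iff)
    show "X \<otimes>\<^bsub>L\<^esub> Y \<in> ?T"
      using * F by (auto simp: M.smult_assoc1 N.smult_assoc1 M.smult_closed Pi_iff)
  qed
  then show ?thesis using F add by (auto simp: lmod_hom_def)
qed

end

definition alg_act :: "(nat \<Rightarrow> 'v) \<Rightarrow> ('a \<Rightarrow> (nat \<Rightarrow> 'k) \<Rightarrow> (nat \<Rightarrow> 'k)) \<Rightarrow>
    (('v, 'a) path \<Rightarrow> 'k) \<Rightarrow> (nat \<Rightarrow> 'k::field) \<Rightarrow> (nat \<Rightarrow> 'k)" where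
  "alg_act vx act f v = (\<lambda>i. \<Sum>r | f r \<noteq> 0. f r * path_act vx act r v i)"

text \<open>
  A representation of the quiver in coordinates: \<open>act a\<close> is linear, reads only the coordinates at the start of \<open>a\<close>,
  writes only those at its end, and satisfies the relations of length two in \<open>I\<close>. As \<open>I\<close> is generated by such
  relations, this suffices for a module over \<open>kQ/I\<close>.
\<close>

locale quiver_rep = bound_quiver Q I
  for Q :: "('v, 'a) pre_digraph" and I :: "(('v, 'a) path \<Rightarrow> 'k::field) set" +
  fixes n :: nat and vx :: "nat \<Rightarrow> 'v" and act :: "'a \<Rightarrow> (nat \<Rightarrow> 'k) \<Rightarrow> (nat \<Rightarrow> 'k)"
  assumes vx_vert: "i < n \<Longrightarrow> vx i \<in> verts Q"
    and act_add: "a \<in> arcs Q \<Longrightarrow> act a (\<lambda>i. u i + v i) = (\<lambda>i. act a u i + act a v i)"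
    and act_scale: "a \<in> arcs Q \<Longrightarrow> act a (\<lambda>i. \<kappa> * v i) = (\<lambda>i. \<kappa> * act a v i)"
    and act_supp: "a \<in> arcs Q \<Longrightarrow> act a v i \<noteq> 0 \<Longrightarrow> i < n \<and> vx i = head Q a"
    and act_cong: "a \<in> arcs Q \<Longrightarrow> (\<And>i. i < n \<Longrightarrow> vx i = tail Q a \<Longrightarrow> u i = v i) \<Longrightarrow> act a u = act a v"
    and act_rel: "\<alpha> \<in> arcs Q \<Longrightarrow> \<beta> \<in> arcs Q \<Longrightarrow> head Q \<alpha> = tail Q \<beta> \<Longrightarrow> arrow_path Q [\<beta>, \<alpha>] \<in> I \<Longrightarrow>
        act \<beta> (act \<alpha> v) = (\<lambda>_. 0)"
begin

abbreviation M where "M \<equiv> rep_module n vx act :: ((('v, 'a) path \<Rightarrow> 'k) set, nat \<Rightarrow> 'k) module"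

lemma act_bound: "a \<in> arcs Q \<Longrightarrow> n \<le> i \<Longrightarrow> act a v i = 0"
  using act_supp[of a v i] by auto

lemma act_zero: "a \<in> arcs Q \<Longrightarrow> act a (\<lambda>_. 0) = (\<lambda>_. 0)"
  using act_scale[of a 0 "\<lambda>_. 0"] by simp

lemma act_sum: "a \<in> arcs Q \<Longrightarrow> act a (\<lambda>i. \<Sum>x\<in>X. g x i) = (\<lambda>i. \<Sum>x\<in>X. act a (g x) i)"
  by (induction X rule: infinite_finite_induct) (auto simp: act_zero act_add)

lemma act_diff: "a \<in> arcs Q \<Longrightarrow> act a (\<lambda>i. u i - v i) = (\<lambda>i. act a u i - act a v i)"
  using act_add[of a u "\<lambda>i. -1 * v i"] act_scale[of a "-1" v] by simp

lemma path_act_Nil: "path_act vx act (x, []) v = (\<lambda>i. if vx i = x then v i else 0)"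
  by (simp add: path_act_def)

lemma path_act_Cons: "path_act vx act (x, a # p) v = act a (path_act vx act (x, p) v)"
  by (simp add: path_act_def)

lemma path_act_add: "path_from Q x p \<Longrightarrow>
    path_act vx act (x, p) (\<lambda>i. u i + v i) = (\<lambda>i. path_act vx act (x, p) u i + path_act vx act (x, p) v i)"
  by (induction p) (auto simp: path_act_Nil path_act_Cons act_add)

lemma path_act_scale: "path_from Q x p \<Longrightarrow>
    path_act vx act (x, p) (\<lambda>i. \<kappa> * v i) = (\<lambda>i. \<kappa> * path_act vx act (x, p) v i)"
  by (induction p) (auto simp: path_act_Nil path_act_Cons act_scale)

lemma path_act_zero: "path_from Q x p \<Longrightarrow> path_act vx act (x, p) (\<lambda>_. 0) = (\<lambda>_. 0)"
  using path_act_scale[of x p 0 "\<lambda>_. 0"] by simp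

lemma path_act_sum: "path_from Q x p \<Longrightarrow>
    path_act vx act (x, p) (\<lambda>i. \<Sum>y\<in>Y. g y i) = (\<lambda>i. \<Sum>y\<in>Y. path_act vx act (x, p) (g y) i)"
  by (induction Y rule: infinite_finite_induct) (auto simp: path_act_zero path_act_add)

lemma path_act_end: "path_from Q x p \<Longrightarrow> path_act vx act (x, p) v i \<noteq> 0 \<Longrightarrow> vx i = path_end Q x p"
  by (cases p) (auto simp: path_act_Nil path_act_Cons act_supp split: if_splits)

lemma path_act_compose:
  assumes "path_from Q y q" and "path_from Q x p"
  shows "path_act vx act (y, q) (path_act vx act (x, p) v) =
    (if y = path_end Q x p then path_act vx act (x, q @ p) v else (\<lambda>_. 0))"
  using assms(1)
proof (induction q)
  case Nil
  show ?case
  proof (cases "y = path_end Q x p")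
    case True
    then have "path_act vx act (x, p) v i = 0" if "vx i \<noteq> y" for i
      using path_act_end[OF assms(2)] that by blast
    with True show ?thesis by (auto simp: path_act_Nil)
  next
    case False
    then have "path_act vx act (x, p) v i = 0" if "vx i = y" for i
      using path_act_end[OF assms(2)] that by blast
    with False show ?thesis by (auto simp: path_act_Nil)
  qed
next
  case (Cons a q)
  then show ?case by (auto simp: path_act_Cons act_zero)
qed

lemma alg_act_superset:
  assumes "finite X" and "{r. f r \<noteq> 0} \<subseteq> X"
  shows "alg_act vx act f v i = (\<Sum>r\<in>X. f r * path_act vx act r v i)"
  unfolding alg_act_def using assms by (intro sum.mono_neutral_left) auto

lemma alg_act_add:
  assumes "f \<in> carrier PA" and "g \<in> carrier PA"
  shows "alg_act vx act (f \<oplus>\<^bsub>PA\<^esub> g) v = (\<lambda>i. alg_act vx act f v i + alg_act vx act g v i)"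
proof
  fix i
  let ?X = "{r. f r \<noteq> 0} \<union> {r. g r \<noteq> 0}"
  have fin: "finite ?X" using assms by (auto simp: carrier_PA)
  have "alg_act vx act (f \<oplus>\<^bsub>PA\<^esub> g) v i = (\<Sum>r\<in>?X. (f r + g r) * path_act vx act r v i)"
    using fin by (subst alg_act_superset[of ?X]) (auto simp: PA_add)
  also have "\<dots> = alg_act vx act f v i + alg_act vx act g v i"
    using fin by (subst (1 2) alg_act_superset[of ?X]) (auto simp: distrib_right sum.distrib)
  finally show "alg_act vx act (f \<oplus>\<^bsub>PA\<^esub> g) v i = alg_act vx act f v i + alg_act vx act g v i" .
qed

lemma alg_act_mult:
  assumes f: "f \<in> carrier PA" and g: "g \<in> carrier PA"
  shows "alg_act vx act (f \<otimes>\<^bsub>PA\<^esub> g) v = alg_act vx act f (alg_act vx act g v)"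
proof
  fix i
  define F where "F = {r. f r \<noteq> 0}"
  define G where "G = {r. g r \<noteq> 0}"
  define C where "C = {(r1, r2). r1 \<in> F \<and> r2 \<in> G \<and> fst r1 = path_end Q (fst r2) (snd r2)}"
  define cat :: "('v, 'a) path \<times> ('v, 'a) path \<Rightarrow> ('v, 'a) path"
    where "cat = (\<lambda>(r1, r2). (fst r2, snd r1 @ snd r2))"
  have F: "finite F" "F \<subseteq> paths Q" and G: "finite G" "G \<subseteq> paths Q"
    using f g by (auto simp: F_def G_def carrier_PA)
  have "C \<subseteq> F \<times> G" by (auto simp: C_def)
  then have finC: "finite C" using F G finite_subset by blast
  have coeff: "(f \<otimes>\<^bsub>PA\<^esub> g) r = (\<Sum>(r1, r2) | (r1, r2) \<in> C \<and> cat (r1, r2) = r. f r1 * g r2)" for r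
  proof -
    obtain x p where r: "r = (x, p)" by fastforce
    let ?h = "\<lambda>i. ((path_end Q x (drop i p), take i p), (x, drop i p))"
    have "(f \<otimes>\<^bsub>PA\<^esub> g) r = (\<Sum>i\<in>{i. i \<le> length p \<and> ?h i \<in> C}. (\<lambda>(r1, r2). f r1 * g r2) (?h i))"
      unfolding r PA_mult case_prod_conv
      by (rule sum.mono_neutral_right) (auto simp: C_def F_def G_def)
    also have "\<dots> = (\<Sum>(r1, r2) | (r1, r2) \<in> C \<and> cat (r1, r2) = r. f r1 * g r2)"
    proof (rule sum.reindex_bij_betw[symmetric, of _ _ _ , THEN sym])
      show "bij_betw ?h {i. i \<le> length p \<and> ?h i \<in> C} {(r1, r2). (r1, r2) \<in> C \<and> cat (r1, r2) = r}"
      proof (rule bij_betw_byWitness[where f' = "\<lambda>(r1, r2). length (snd r1)"])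
        show "(\<lambda>(r1, r2). length (snd r1)) ` {(r1, r2). (r1, r2) \<in> C \<and> cat (r1, r2) = r} \<subseteq>
            {i. i \<le> length p \<and> ?h i \<in> C}"
          by (auto simp: cat_def r C_def)
      qed (auto simp: cat_def r C_def)
    qed
    finally show ?thesis .
  qed
  have supp: "{r. (f \<otimes>\<^bsub>PA\<^esub> g) r \<noteq> 0} \<subseteq> cat ` C"
  proof (clarify)
    fix x p assume nz: "(f \<otimes>\<^bsub>PA\<^esub> g) (x, p) \<noteq> 0"
    then have "{(r1, r2). (r1, r2) \<in> C \<and> cat (r1, r2) = (x, p)} \<noteq> {}"
      unfolding coeff using sum.empty by metis
    then show "(x, p) \<in> cat ` C" by force
  qed
  have "alg_act vx act (f \<otimes>\<^bsub>PA\<^esub> g) v i = (\<Sum>r\<in>cat ` C. (f \<otimes>\<^bsub>PA\<^esub> g) r * path_act vx act r v i)"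
    using finC supp by (simp add: alg_act_superset)
  also have "\<dots> = (\<Sum>r\<in>cat ` C. \<Sum>z\<in>{z \<in> C. cat z = r}. (case z of (r1, r2) \<Rightarrow> f r1 * g r2) * path_act vx act (cat z) v i)"
  proof (rule sum.cong[OF refl])
    fix r
    have "{(r1, r2). (r1, r2) \<in> C \<and> cat (r1, r2) = r} = {z \<in> C. cat z = r}" by auto
    then show "(f \<otimes>\<^bsub>PA\<^esub> g) r * path_act vx act r v i =
        (\<Sum>z\<in>{z \<in> C. cat z = r}. (case z of (r1, r2) \<Rightarrow> f r1 * g r2) * path_act vx act (cat z) v i)"
      by (simp add: coeff sum_distrib_right)
  qed
  also have "\<dots> = (\<Sum>z\<in>C. (case z of (r1, r2) \<Rightarrow> f r1 * g r2) * path_act vx act (cat z) v i)"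
    using finC by (rule sum.image_gen[symmetric])
  also have "\<dots> = (\<Sum>(r1, r2)\<in>F \<times> G. f r1 * (g r2 * path_act vx act r1 (path_act vx act r2 v) i))"
  proof (rule sum.mono_neutral_cong_left)
    show "finite (F \<times> G)" using F G by simp
    show "C \<subseteq> F \<times> G" by fact
    show "\<forall>z\<in>F \<times> G - C. (case z of (r1, r2) \<Rightarrow> f r1 * (g r2 * path_act vx act r1 (path_act vx act r2 v) i)) = 0"
      using F G by (auto simp: C_def paths_def subset_iff path_act_compose split: if_splits)
    show "(case z of (r1, r2) \<Rightarrow> f r1 * g r2) * path_act vx act (cat z) v i =
        (case z of (r1, r2) \<Rightarrow> f r1 * (g r2 * path_act vx act r1 (path_act vx act r2 v) i))" if "z \<in> C" for z
      using that F G by (auto simp: C_def paths_def subset_iff path_act_compose cat_def)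
  qed
  also have "\<dots> = (\<Sum>r1\<in>F. \<Sum>r2\<in>G. f r1 * (g r2 * path_act vx act r1 (path_act vx act r2 v) i))"
    by (simp add: sum.cartesian_product)
  also have "\<dots> = (\<Sum>r1\<in>F. f r1 * path_act vx act r1 (alg_act vx act g v) i)"
  proof (rule sum.cong[OF refl])
    fix r1 assume "r1 \<in> F"
    then obtain y q where r1: "r1 = (y, q)" "path_from Q y q" using F by (auto simp: paths_def)
    have "path_act vx act r1 (alg_act vx act g v) i =
        path_act vx act r1 (\<lambda>i. \<Sum>r2\<in>G. g r2 * path_act vx act r2 v i) i"
      by (simp add: alg_act_def[abs_def] G_def)
    also have "\<dots> = (\<Sum>r2\<in>G. g r2 * path_act vx act r1 (path_act vx act r2 v) i)"
      using r1 by (simp add: path_act_sum path_act_scale)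
    finally show "(\<Sum>r2\<in>G. f r1 * (g r2 * path_act vx act r1 (path_act vx act r2 v) i)) =
        f r1 * path_act vx act r1 (alg_act vx act g v) i"
      by (simp add: sum_distrib_left)
  qed
  finally show "alg_act vx act (f \<otimes>\<^bsub>PA\<^esub> g) v i = alg_act vx act f (alg_act vx act g v) i"
    by (simp add: alg_act_def F_def)
qed

lemma alg_act_path_elem: "alg_act vx act (path_elem r) v = path_act vx act r v"
proof
  fix i show "alg_act vx act (path_elem r) v i = path_act vx act r v i"
    by (subst alg_act_superset[of "{r}"]) (auto simp: path_elem_def)
qed

lemma alg_act_scalar: "v \<in> carrier M \<Longrightarrow> alg_act vx act (\<lambda>r. \<kappa> * \<one>\<^bsub>PA\<^esub> r) v = (\<lambda>i. \<kappa> * v i)"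
proof
  fix i assume v: "v \<in> carrier M"
  have "alg_act vx act (\<lambda>r. \<kappa> * \<one>\<^bsub>PA\<^esub> r) v i =
      (\<Sum>r\<in>(\<lambda>x. (x, [])) ` verts Q. \<kappa> * \<one>\<^bsub>PA\<^esub> r * path_act vx act r v i)"
    by (rule alg_act_superset) (auto simp: PA_one split: if_splits)
  also have "\<dots> = (\<Sum>x\<in>verts Q. \<kappa> * (if vx i = x then v i else 0))"
    by (subst sum.reindex) (auto simp: inj_on_def PA_one path_act_Nil)
  also have "\<dots> = \<kappa> * v i"
    using v vx_vert[of i] by (cases "i < n") (auto simp: rep_module_def sum_distrib_left[symmetric])
  finally show "alg_act vx act (\<lambda>r. \<kappa> * \<one>\<^bsub>PA\<^esub> r) v i = \<kappa> * v i" .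
qed

lemma alg_act_zero_elem: "alg_act vx act \<zero>\<^bsub>PA\<^esub> v = (\<lambda>_. 0)"
  by (simp add: alg_act_def PA_zero)

lemma alg_act_zero: "f \<in> carrier PA \<Longrightarrow> alg_act vx act f (\<lambda>_. 0) = (\<lambda>_. 0)"
  by (rule ext) (auto simp: alg_act_def carrier_PA paths_def path_act_zero intro!: sum.neutral)

text \<open>The ideal \<open>I\<close> acts by zero because the annihilator is an ideal that contains the generators of \<open>I\<close>.\<close>

lemma alg_act_ideal:
  assumes "f \<in> I"
  shows "alg_act vx act f v = (\<lambda>_. 0)"
proof -
  obtain S where S: "S \<subseteq> {r \<in> paths Q. length (snd r) = 2}" "I = Idl\<^bsub>PA\<^esub> (path_elem ` S)"
    using quadratic by blast
  define K where "K = {f \<in> carrier PA. \<forall>v. alg_act vx act f v = (\<lambda>_. 0)}"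
  have "ideal K PA"
  proof (rule idealI)
    show "ring PA" by (rule ring_axioms)
    show "subgroup K (add_monoid PA)"
    proof (rule group.subgroupI)
      show "Group.group (add_monoid PA)" by (rule a_group)
      show "K \<noteq> {}" using alg_act_zero_elem zero_closed unfolding K_def by blast
      fix f assume f: "f \<in> K"
      have neg: "inv\<^bsub>add_monoid PA\<^esub> f = \<ominus>\<^bsub>PA\<^esub> f" by (simp add: a_inv_def)
      have fc: "f \<in> carrier PA" "\<ominus>\<^bsub>PA\<^esub> f \<in> carrier PA" using f by (auto simp: K_def)
      have "alg_act vx act (\<ominus>\<^bsub>PA\<^esub> f) v i = 0" for v i
      proof -
        have "alg_act vx act (f \<oplus>\<^bsub>PA\<^esub> \<ominus>\<^bsub>PA\<^esub> f) v i = 0"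
          using fc(1) by (simp only: r_neg alg_act_zero_elem)
        moreover have "alg_act vx act f v i = 0" using f by (simp add: K_def)
        ultimately show ?thesis by (simp add: alg_act_add[OF fc])
      qed
      then show "inv\<^bsub>add_monoid PA\<^esub> f \<in> K" unfolding neg using fc by (auto simp: K_def)
      fix g assume "g \<in> K"
      with f show "f \<otimes>\<^bsub>add_monoid PA\<^esub> g \<in> K" by (simp add: K_def alg_act_add)
    qed (auto simp: K_def)
    fix a x assume "a \<in> K" "x \<in> carrier PA"
    then show "x \<otimes>\<^bsub>PA\<^esub> a \<in> K" "a \<otimes>\<^bsub>PA\<^esub> x \<in> K"
      by (simp_all add: K_def alg_act_mult alg_act_zero)
  qed
  moreover have "path_elem ` S \<subseteq> K"
  proof (clarify)
    fix x p assume s: "(x, p) \<in> S"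
    then have p: "path_from Q x p" "length p = 2" using S(1) by (auto simp: paths_def)
    then obtain \<beta> \<alpha> where ba: "p = [\<beta>, \<alpha>]"
      by (auto simp: length_Suc_conv numeral_2_eq_2)
    with p have arcs: "\<alpha> \<in> arcs Q" "\<beta> \<in> arcs Q" "head Q \<alpha> = tail Q \<beta>" "x = tail Q \<alpha>" by auto
    have "path_elem ` S \<subseteq> carrier PA" using S(1) path_elem_carrier by auto
    then have "path_elem (x, p) \<in> I" using S(2) s genideal_self[of "path_elem ` S"] by auto
    then have "arrow_path Q [\<beta>, \<alpha>] \<in> I" using ba arcs by (simp add: arrow_path_def)
    then have "path_act vx act (x, p) v = (\<lambda>_. 0)" for v
      using act_rel arcs ba by (simp add: path_act_Cons)
    moreover have "path_elem (x, p) \<in> carrier PA" using p by (simp add: paths_def path_elem_carrier)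
    ultimately show "path_elem (x, p) \<in> K" by (simp add: K_def alg_act_path_elem)
  qed
  ultimately have "I \<subseteq> K" unfolding S(2) by (rule genideal_minimal)
  then show ?thesis using assms by (auto simp: K_def)
qed

lemma carrier_M: "v \<in> carrier M \<longleftrightarrow> (\<forall>i\<ge>n. v i = 0)"
  by (simp add: rep_module_def)

lemma M_simps: "\<zero>\<^bsub>M\<^esub> = (\<lambda>_. 0)" "u \<oplus>\<^bsub>M\<^esub> v = (\<lambda>i. u i + v i)"
  by (auto simp: rep_module_def)

lemma rep_smult:
  assumes "f \<in> carrier PA"
  shows "cls f \<odot>\<^bsub>M\<^esub> v = alg_act vx act f v"
proof -
  let ?g = "SOME g. g \<in> cls f"
  have "f \<in> cls f" using assms a_rcos_self by (simp add: cls_def)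
  then have "?g \<in> cls f" by (rule someI[where P = "\<lambda>g. g \<in> cls f"])
  then obtain h where h: "h \<in> I" "?g = h \<oplus>\<^bsub>PA\<^esub> f"
    by (auto simp: cls_def a_r_coset_def r_coset_def)
  have "cls f \<odot>\<^bsub>M\<^esub> v = alg_act vx act ?g v"
    by (simp add: rep_module_def alg_act_def Let_def)
  also have "\<dots> = alg_act vx act f v"
    using h assms a_subset by (simp add: alg_act_add alg_act_ideal subset_iff)
  finally show ?thesis .
qed

lemma rep_scalar: "v \<in> carrier M \<Longrightarrow> scalar_elem Q I \<kappa> \<odot>\<^bsub>M\<^esub> v = (\<lambda>i. \<kappa> * v i)"
  using rep_smult[OF scalar_carrier, of \<kappa> v] alg_act_scalar[of v \<kappa>]
  by (simp add: scalar_elem_def cls_def)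

lemma rep_vert: "x \<in> verts Q \<Longrightarrow> cls (path_elem (x, [])) \<odot>\<^bsub>M\<^esub> v = (\<lambda>i. if vx i = x then v i else 0)"
  by (simp add: rep_smult path_elem_carrier paths_def alg_act_path_elem path_act_Nil)

lemma rep_arrow: "a \<in> arcs Q \<Longrightarrow> cls (arrow_path Q [a]) \<odot>\<^bsub>M\<^esub> v = act a v"
  using act_cong[of a "\<lambda>i. if vx i = tail Q a then v i else 0" v]
  by (simp add: arrow_path_single rep_smult path_elem_carrier arrow_in_paths alg_act_path_elem path_act_Cons path_act_Nil)

lemma path_act_closed: "path_from Q x p \<Longrightarrow> v \<in> carrier M \<Longrightarrow> path_act vx act (x, p) v \<in> carrier M"
  using act_bound by (cases p) (auto simp: path_act_Nil path_act_Cons carrier_M)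

lemma alg_act_closed: "f \<in> carrier PA \<Longrightarrow> v \<in> carrier M \<Longrightarrow> alg_act vx act f v \<in> carrier M"
proof -
  assume f: "f \<in> carrier PA" and v: "v \<in> carrier M"
  have "path_act vx act r v i = 0" if "f r \<noteq> 0" "n \<le> i" for r i
    using path_act_closed[of "fst r" "snd r" v] v f that by (auto simp: carrier_PA paths_def carrier_M)
  then show ?thesis by (auto simp: alg_act_def carrier_M intro!: sum.neutral)
qed

lemma abelian_group_M: "abelian_group M"
proof (rule abelian_groupI)
  fix v assume v: "v \<in> carrier M"
  then show "\<exists>y\<in>carrier M. y \<oplus>\<^bsub>M\<^esub> v = \<zero>\<^bsub>M\<^esub>"
    by (intro bexI[of _ "\<lambda>i. - v i"]) (auto simp: M_simps carrier_M)
qed (auto simp: M_simps carrier_M ac_simps)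

lemma left_module_M: "left_module L M"
proof (rule left_module.intro)
  show "ring L" by (rule ring_L)
  show "abelian_group M" by (rule abelian_group_M)
  show "left_module_axioms L M"
  proof
    fix X v assume *: "X \<in> carrier L" "v \<in> carrier M"
    then show "X \<odot>\<^bsub>M\<^esub> v \<in> carrier M" by (auto simp: carrier_L rep_smult alg_act_closed)
    fix Y assume Y: "Y \<in> carrier L"
    with * show "(X \<oplus>\<^bsub>L\<^esub> Y) \<odot>\<^bsub>M\<^esub> v = X \<odot>\<^bsub>M\<^esub> v \<oplus>\<^bsub>M\<^esub> Y \<odot>\<^bsub>M\<^esub> v"
      by (auto simp: carrier_L rep_smult cls_add alg_act_add M_simps)
    show "(X \<otimes>\<^bsub>L\<^esub> Y) \<odot>\<^bsub>M\<^esub> v = X \<odot>\<^bsub>M\<^esub> (Y \<odot>\<^bsub>M\<^esub> v)"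
      using * Y by (auto simp: carrier_L rep_smult cls_mult alg_act_mult)
  next
    fix X u v assume "X \<in> carrier L" "u \<in> carrier M" "v \<in> carrier M"
    then show "X \<odot>\<^bsub>M\<^esub> (u \<oplus>\<^bsub>M\<^esub> v) = X \<odot>\<^bsub>M\<^esub> u \<oplus>\<^bsub>M\<^esub> X \<odot>\<^bsub>M\<^esub> v"
      by (auto simp: carrier_L rep_smult M_simps alg_act_def carrier_PA paths_def path_act_add
          subset_iff distrib_left sum.distrib[symmetric] intro!: ext sum.cong)
  next
    fix v assume v: "v \<in> carrier M"
    have "(\<lambda>r. 1 * \<one>\<^bsub>PA\<^esub> r) = \<one>\<^bsub>PA\<^esub>" by simp
    then show "\<one>\<^bsub>L\<^esub> \<odot>\<^bsub>M\<^esub> v = v"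
      using alg_act_scalar[OF v, of 1] by (simp add: cls_one rep_smult)
  qed
qed

end

text \<open>
  The criterion above for modules given by representations: there the vertices act by truncation and the arrows
  by \<open>act\<close>.
\<close>

lemma rep_hom:
  assumes "quiver_rep Q I n vx act" and "quiver_rep Q I n' vx' act'"
    and "\<And>v. v \<in> carrier (rep_module n vx act) \<Longrightarrow> F v \<in> carrier (rep_module n' vx' act')"
    and "\<And>u v. F (\<lambda>i. u i + v i) = (\<lambda>i. F u i + F v i)"
    and "\<And>\<kappa> v. F (\<lambda>i. \<kappa> * v i) = (\<lambda>i. \<kappa> * F v i)"
    and "\<And>x v. x \<in> verts Q \<Longrightarrow> v \<in> carrier (rep_module n vx act) \<Longrightarrow>
      F (\<lambda>i. if vx i = x then v i else 0) = (\<lambda>i. if vx' i = x then F v i else 0)"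
    and "\<And>a v. a \<in> arcs Q \<Longrightarrow> v \<in> carrier (rep_module n vx act) \<Longrightarrow> F (act a v) = act' a (F v)"
  shows "F \<in> lmod_hom (bound_algebra Q I) (rep_module n vx act) (rep_module n' vx' act')"
proof -
  interpret A: quiver_rep Q I n vx act by fact
  interpret B: quiver_rep Q I n' vx' act' by fact
  show ?thesis
  proof (rule A.hom_criterion[OF A.left_module_M B.left_module_M])
    show F: "F \<in> carrier A.M \<rightarrow> carrier B.M" using assms(3) by blast
    show "F (x \<oplus>\<^bsub>A.M\<^esub> y) = F x \<oplus>\<^bsub>B.M\<^esub> F y" for x y
      unfolding A.M_simps B.M_simps by (rule assms(4))
    show "F (scalar_elem Q I \<kappa> \<odot>\<^bsub>A.M\<^esub> x) = scalar_elem Q I \<kappa> \<odot>\<^bsub>B.M\<^esub> F x" if "x \<in> carrier A.M" for \<kappa> x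
      unfolding A.rep_scalar[OF that] B.rep_scalar[OF assms(3)[OF that]] by (rule assms(5))
    show "F (A.cls (path_elem (v, [])) \<odot>\<^bsub>A.M\<^esub> x) = A.cls (path_elem (v, [])) \<odot>\<^bsub>B.M\<^esub> F x"
      if "v \<in> verts Q" "x \<in> carrier A.M" for v x
      unfolding A.rep_vert[OF that(1)] B.rep_vert[OF that(1)] by (rule assms(6)[OF that])
    show "F (A.cls (arrow_path Q [a]) \<odot>\<^bsub>A.M\<^esub> x) = A.cls (arrow_path Q [a]) \<odot>\<^bsub>B.M\<^esub> F x"
      if "a \<in> arcs Q" "x \<in> carrier A.M" for a x
      unfolding A.rep_arrow[OF that(1)] B.rep_arrow[OF that(1)] by (rule assms(7)[OF that])
  qed
qed

section \<open>Morphisms of modules and of extensions\<close>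

lemma lmod_homD:
  assumes "f \<in> lmod_hom R M N"
  shows "x \<in> carrier M \<Longrightarrow> f x \<in> carrier N"
    and "x \<in> carrier M \<Longrightarrow> y \<in> carrier M \<Longrightarrow> f (x \<oplus>\<^bsub>M\<^esub> y) = f x \<oplus>\<^bsub>N\<^esub> f y"
    and "r \<in> carrier R \<Longrightarrow> x \<in> carrier M \<Longrightarrow> f (r \<odot>\<^bsub>M\<^esub> x) = r \<odot>\<^bsub>N\<^esub> f x"
  using assms by (auto simp: lmod_hom_def)

lemma lmod_hom_minus:
  assumes "left_module R M" and "left_module R N" and "f \<in> lmod_hom R M N"
  shows "f \<zero>\<^bsub>M\<^esub> = \<zero>\<^bsub>N\<^esub>"
    and "x \<in> carrier M \<Longrightarrow> f (\<ominus>\<^bsub>M\<^esub> x) = \<ominus>\<^bsub>N\<^esub> f x"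
proof -
  interpret M: left_module R M by fact
  interpret N: left_module R N by fact
  note h = lmod_homD[OF assms(3)]
  show z: "f \<zero>\<^bsub>M\<^esub> = \<zero>\<^bsub>N\<^esub>"
    using h(2)[of "\<zero>\<^bsub>M\<^esub>" "\<zero>\<^bsub>M\<^esub>"] h(1)[of "\<zero>\<^bsub>M\<^esub>"] by (simp add: N.M.add.l_cancel_one')
  assume x: "x \<in> carrier M"
  have "f (\<ominus>\<^bsub>M\<^esub> x) \<oplus>\<^bsub>N\<^esub> f x = \<zero>\<^bsub>N\<^esub>"
    using h(2)[of "\<ominus>\<^bsub>M\<^esub> x" x] x z by (simp add: M.M.l_neg)
  then show "f (\<ominus>\<^bsub>M\<^esub> x) = \<ominus>\<^bsub>N\<^esub> f x"
    using x h(1) by (simp add: N.M.minus_equality)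
qed

lemma lmod_hom_comp:
  "f \<in> lmod_hom R M N \<Longrightarrow> g \<in> lmod_hom R N K \<Longrightarrow> (\<lambda>x. g (f x)) \<in> lmod_hom R M K"
  by (auto simp: lmod_hom_def Pi_iff)

lemma lmod_hom_inverse:
  assumes "left_module R M" and f: "f \<in> lmod_hom R M N" and bij: "bij_betw f (carrier M) (carrier N)"
  shows "inv_into (carrier M) f \<in> lmod_hom R N M"
proof -
  interpret M: left_module R M by fact
  let ?g = "inv_into (carrier M) f"
  note h = lmod_homD[OF f]
  have g: "?g y \<in> carrier M" "f (?g y) = y" if "y \<in> carrier N" for y
    using that bij by (auto simp: bij_betw_def inv_into_into f_inv_into_f)
  have eq: "?g y = x" if "x \<in> carrier M" "f x = y" for x y
    using that bij by (auto simp: bij_betw_def)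
  show ?thesis unfolding lmod_hom_def
    using g h by (auto intro!: eq simp: M.smult_closed)
qed

lemma lmod_iso_sym: "left_module R M \<Longrightarrow> lmod_iso R M N \<Longrightarrow> lmod_iso R N M"
  unfolding lmod_iso_def using lmod_hom_inverse bij_betw_inv_into by blast

lemma lmod_iso_trans: "lmod_iso R M N \<Longrightarrow> lmod_iso R N K \<Longrightarrow> lmod_iso R M K"
  unfolding lmod_iso_def by (meson bij_betw_trans[unfolded comp_def] lmod_hom_comp)

lemma extensionsD:
  assumes "(E, i, p) \<in> extensions R M N"
  shows "left_module R N" "left_module R E" "left_module R M" "i \<in> lmod_hom R N E" "p \<in> lmod_hom R E M"
    "inj_on i (carrier N)" "p ` carrier E = carrier M" "i ` carrier N = {x \<in> carrier E. p x = \<zero>\<^bsub>M\<^esub>}"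
  using assms by (auto simp: extensions_def)

lemma ext_equiv_refl: "ext_equiv R N (E, i, p) (E, i, p)"
  by (auto simp: lmod_hom_def intro!: bexI[of _ "\<lambda>x. x"])

lemma ext_equiv_trans:
  assumes "\<xi> \<in> extensions R M N" and "ext_equiv R N \<xi> \<xi>'" and "ext_equiv R N \<xi>' \<xi>''"
  shows "ext_equiv R N \<xi> \<xi>''"
proof -
  obtain E i p E' i' p' E'' i'' p'' where X: "\<xi> = (E, i, p)" "\<xi>' = (E', i', p')" "\<xi>'' = (E'', i'', p'')"
    by (metis prod_cases3)
  obtain f where f: "f \<in> lmod_hom R E E'" "\<forall>y\<in>carrier N. f (i y) = i' y" "\<forall>x\<in>carrier E. p' (f x) = p x"
    using assms X by auto
  obtain g where g: "g \<in> lmod_hom R E' E''" "\<forall>y\<in>carrier N. g (i' y) = i'' y" "\<forall>x\<in>carrier E'. p'' (g x) = p' x"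
    using assms X by auto
  show ?thesis unfolding X ext_equiv.simps
    using f g lmod_homD(1)[OF f(1)] by (intro bexI[OF _ lmod_hom_comp[OF f(1) g(1)]]) auto
qed

text \<open>The five lemma for a morphism of extensions with identities at both ends.\<close>

lemma ext_equiv_bij:
  assumes X: "(E, i, p) \<in> extensions R M N" and X': "(E', i', p') \<in> extensions R M N"
    and f: "f \<in> lmod_hom R E E'" "\<forall>y\<in>carrier N. f (i y) = i' y" "\<forall>x\<in>carrier E. p' (f x) = p x"
  shows "bij_betw f (carrier E) (carrier E')"
proof -
  note x = extensionsD[OF X] and x' = extensionsD[OF X']
  interpret E: left_module R E by (rule x)
  interpret E': left_module R E' by (rule x')
  interpret M: left_module R M by (rule x)
  interpret N: left_module R N by (rule x)
  note h = lmod_homD[OF f(1)] and hp' = lmod_homD[OF x'(5)] and hi = lmod_homD[OF x(4)]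
  have ker: "z = \<zero>\<^bsub>E\<^esub>" if z: "z \<in> carrier E" "f z = \<zero>\<^bsub>E'\<^esub>" for z
  proof -
    have "p z = \<zero>\<^bsub>M\<^esub>" using f(3) z lmod_hom_minus(1)[OF x'(2,3,5)] by metis
    then obtain y where y: "y \<in> carrier N" "z = i y" using x(8) z by blast
    then have "i' y = i' \<zero>\<^bsub>N\<^esub>" using f(2) z lmod_hom_minus(1)[OF x'(1,2,4)] by metis
    then have "y = \<zero>\<^bsub>N\<^esub>" using x'(6) y by (auto simp: inj_on_def)
    then show ?thesis using y lmod_hom_minus(1)[OF x(1,2,4)] by simp
  qed
  have "inj_on f (carrier E)"
  proof
    fix u v assume uv: "u \<in> carrier E" "v \<in> carrier E" "f u = f v"
    have "f (u \<oplus>\<^bsub>E\<^esub> \<ominus>\<^bsub>E\<^esub> v) = \<zero>\<^bsub>E'\<^esub>"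
      using uv h lmod_hom_minus(2)[OF x(2) x'(2) f(1)] by (simp add: E'.M.r_neg)
    then have "u \<oplus>\<^bsub>E\<^esub> \<ominus>\<^bsub>E\<^esub> v = \<zero>\<^bsub>E\<^esub>" using ker uv by simp
    then show "u = v" using uv by (metis E.M.a_inv_closed E.M.minus_equality E.M.minus_minus)
  qed
  moreover have "carrier E' \<subseteq> f ` carrier E"
  proof
    fix e assume e: "e \<in> carrier E'"
    then have "p' e \<in> p ` carrier E" using hp'(1) x(7) by blast
    then obtain z where z: "z \<in> carrier E" "p z = p' e" by auto
    let ?d = "e \<oplus>\<^bsub>E'\<^esub> \<ominus>\<^bsub>E'\<^esub> f z"
    have "p' ?d = \<zero>\<^bsub>M\<^esub>"
      using e z h hp' f(3) lmod_hom_minus(2)[OF x'(2,3,5)] by (simp add: M.M.r_neg)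
    then have "?d \<in> i' ` carrier N" using x'(8) e z h by simp
    then obtain y where y: "y \<in> carrier N" "?d = i' y" by auto
    have "f (i y \<oplus>\<^bsub>E\<^esub> z) = ?d \<oplus>\<^bsub>E'\<^esub> f z" using y z h hi f(2) by simp
    also have "\<dots> = e" using e z h by (simp add: E'.M.a_assoc E'.M.l_neg)
    finally show "e \<in> f ` carrier E" using y z hi by (metis E.M.add.m_closed imageI)
  qed
  ultimately show ?thesis using h by (auto simp: bij_betw_def)
qed

lemma ext_equiv_sym:
  assumes "\<xi> \<in> extensions R M N" and "\<xi>' \<in> extensions R M N" and "ext_equiv R N \<xi> \<xi>'"
  shows "ext_equiv R N \<xi>' \<xi>"
proof -
  obtain E i p E' i' p' where X: "\<xi> = (E, i, p)" "\<xi>' = (E', i', p')" by (metis prod_cases3)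
  obtain f where f: "f \<in> lmod_hom R E E'" "\<forall>y\<in>carrier N. f (i y) = i' y" "\<forall>x\<in>carrier E. p' (f x) = p x"
    using assms X by auto
  note x = extensionsD[OF assms(1)[unfolded X]]
  have bij: "bij_betw f (carrier E) (carrier E')"
    using ext_equiv_bij f assms X by metis
  let ?g = "inv_into (carrier E) f"
  have g: "?g y \<in> carrier E" "f (?g y) = y" if "y \<in> carrier E'" for y
    using that bij by (auto simp: bij_betw_def inv_into_into f_inv_into_f)
  have "?g (i' y) = i y" if "y \<in> carrier N" for y
    using that bij f(2) lmod_homD(1)[OF x(4)] by (metis bij_betw_inv_into_left)
  moreover have "p (?g y) = p' y" if "y \<in> carrier E'" for y
    using that g f(3) by metis
  ultimately show ?thesis unfolding X ext_equiv.simps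
    using lmod_hom_inverse[OF x(2) f(1) bij] by blast
qed

lemma ext_class_eq_iff:
  assumes "\<xi> \<in> extensions R M N" and "\<xi>' \<in> extensions R M N"
  shows "ext_class R M N \<xi> = ext_class R M N \<xi>' \<longleftrightarrow> ext_equiv R N \<xi> \<xi>'"
proof
  assume "ext_class R M N \<xi> = ext_class R M N \<xi>'"
  moreover have "\<xi>' \<in> ext_class R M N \<xi>'"
    using assms ext_equiv_refl by (cases \<xi>') (auto simp: ext_class_def simp del: ext_equiv.simps)
  ultimately show "ext_equiv R N \<xi> \<xi>'" by (auto simp: ext_class_def)
next
  assume e: "ext_equiv R N \<xi> \<xi>'"
  then have e': "ext_equiv R N \<xi>' \<xi>" using ext_equiv_sym assms by blast
  show "ext_class R M N \<xi> = ext_class R M N \<xi>'"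
    unfolding ext_class_def using ext_equiv_trans[OF assms(1) e] ext_equiv_trans[OF assms(2) e'] by blast
qed

text \<open>
  The middle term of an extension may be replaced by an isomorphic module, by transporting both maps.
\<close>

lemma extension_along_iso:
  assumes X: "(E, i, p) \<in> extensions R M N" and F: "left_module R F" "g \<in> lmod_hom R E F"
    "bij_betw g (carrier E) (carrier F)"
  defines "g' \<equiv> inv_into (carrier E) g"
  shows "(F, \<lambda>y. g (i y), \<lambda>x. p (g' x)) \<in> extensions R M N"
    and "ext_equiv R N (E, i, p) (F, \<lambda>y. g (i y), \<lambda>x. p (g' x))"
    and "\<not> ext_split R M (E, i, p) \<Longrightarrow> \<not> ext_split R M (F, \<lambda>y. g (i y), \<lambda>x. p (g' x))"
proof -
  note x = extensionsD[OF X]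
  note g' = lmod_hom_inverse[OF x(2) F(2,3), folded g'_def]
  have gg: "g' (g z) = z" if "z \<in> carrier E" for z using F(3) that by (simp add: g'_def bij_betw_inv_into_left)
  have gg': "g' z \<in> carrier E" "g (g' z) = z" if "z \<in> carrier F" for z
    using F(3) that by (auto simp: g'_def bij_betw_def inv_into_into f_inv_into_f)
  note gc = lmod_homD(1)[OF F(2)] and ic = lmod_homD(1)[OF x(4)]
  have "inj_on (\<lambda>y. g (i y)) (carrier N)"
    using x(6) gg ic by (auto simp: inj_on_def) (metis gg ic)
  moreover have "(\<lambda>x. p (g' x)) ` carrier F = carrier M"
    using x(7) gg gc gg' by (auto simp: image_iff) (metis gg gc image_iff, metis gg gc image_iff)
  moreover have "(\<lambda>y. g (i y)) ` carrier N = {x \<in> carrier F. p (g' x) = \<zero>\<^bsub>M\<^esub>}"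
  proof -
    have "(\<lambda>y. g (i y)) ` carrier N = g ` {x \<in> carrier E. p x = \<zero>\<^bsub>M\<^esub>}"
      unfolding x(8)[symmetric] by auto
    also have "\<dots> = {x \<in> carrier F. p (g' x) = \<zero>\<^bsub>M\<^esub>}"
    proof safe
      fix z assume "z \<in> carrier F" "p (g' z) = \<zero>\<^bsub>M\<^esub>"
      then show "z \<in> g ` {x \<in> carrier E. p x = \<zero>\<^bsub>M\<^esub>}" using gg'[of z] by (intro image_eqI[of _ _ "g' z"]) auto
    qed (auto simp: gc gg)
    finally show ?thesis .
  qed
  ultimately show "(F, \<lambda>y. g (i y), \<lambda>x. p (g' x)) \<in> extensions R M N"
    using x F lmod_hom_comp[OF x(4) F(2)] lmod_hom_comp[OF g' x(5)] by (simp add: extensions_def)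
  show "ext_equiv R N (E, i, p) (F, \<lambda>y. g (i y), \<lambda>x. p (g' x))"
    using F(2) gg by auto
  show "\<not> ext_split R M (F, \<lambda>y. g (i y), \<lambda>x. p (g' x))" if "\<not> ext_split R M (E, i, p)"
  proof
    assume "ext_split R M (F, \<lambda>y. g (i y), \<lambda>x. p (g' x))"
    then obtain s where "s \<in> lmod_hom R M F" "\<forall>x\<in>carrier M. p (g' (s x)) = x" by auto
    then show False using that lmod_hom_comp[OF _ g', of s] by auto
  qed
qed

section \<open>Extensions of quiver representations as cocycles\<close>

context bound_quiver
begin

lemma mult_scalar:
  assumes "f \<in> carrier PA"
  shows "f \<otimes>\<^bsub>PA\<^esub> (\<lambda>r. \<kappa> * \<one>\<^bsub>PA\<^esub> r) = (\<lambda>r. \<kappa> * f r)"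
proof (rule ext, clarify)
  fix x p
  have "(f \<otimes>\<^bsub>PA\<^esub> (\<lambda>r. \<kappa> * \<one>\<^bsub>PA\<^esub> r)) (x, p) = (\<Sum>i\<le>length p. if i = length p then \<kappa> * f (x, p) else 0)"
    unfolding PA_mult
  proof (rule sum.cong[OF refl])
    fix i assume "i \<in> {..length p}"
    moreover have "x \<in> verts Q" if "path_from Q x p"
      using that by (induction p) auto
    then have "x \<in> verts Q" if "f (x, p) \<noteq> 0"
      using assms that by (auto simp: carrier_PA paths_def)
    ultimately show "f (path_end Q x (drop i p), take i p) * (\<kappa> * \<one>\<^bsub>PA\<^esub> (x, drop i p)) =
        (if i = length p then \<kappa> * f (x, p) else 0)"
      by (cases "f (x, p) = 0") (auto simp: PA_one)
  qed
  then show "(f \<otimes>\<^bsub>PA\<^esub> (\<lambda>r. \<kappa> * \<one>\<^bsub>PA\<^esub> r)) (x, p) = \<kappa> * f (x, p)" by simp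
qed

abbreviation sc where "sc \<equiv> scalar_elem Q I"

lemma sc_cls: "sc \<kappa> = cls (\<lambda>r. \<kappa> * \<one>\<^bsub>PA\<^esub> r)"
  by (simp add: scalar_elem_def cls_def)

lemma sc_carrier: "sc \<kappa> \<in> carrier L"
  by (simp add: sc_cls carrier_L scalar_carrier)

lemma sc_add: "sc \<kappa> \<oplus>\<^bsub>L\<^esub> sc \<nu> = sc (\<kappa> + \<nu>)"
  by (simp add: sc_cls cls_add scalar_carrier PA_add distrib_right)

lemma sc_mult: "sc \<kappa> \<otimes>\<^bsub>L\<^esub> sc \<nu> = sc (\<kappa> * \<nu>)"
  by (simp add: sc_cls cls_mult scalar_carrier scalar_mult mult.assoc)

lemma sc_central: "X \<in> carrier L \<Longrightarrow> sc \<kappa> \<otimes>\<^bsub>L\<^esub> X = X \<otimes>\<^bsub>L\<^esub> sc \<kappa>"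
  by (auto simp: sc_cls carrier_L cls_mult scalar_carrier scalar_mult mult_scalar)

abbreviation vt where "vt x \<equiv> cls (path_elem (x, []))"
abbreviation ar where "ar a \<equiv> cls (arrow_path Q [a])"

lemma vt_carrier: "x \<in> verts Q \<Longrightarrow> vt x \<in> carrier L"
  by (auto simp: carrier_L paths_def intro!: imageI path_elem_carrier)

lemma ar_carrier: "a \<in> arcs Q \<Longrightarrow> ar a \<in> carrier L"
  by (auto simp: carrier_L arrow_path_single intro!: imageI path_elem_carrier arrow_in_paths)

lemma vt_ar: "a \<in> arcs Q \<Longrightarrow> vt (head Q a) \<otimes>\<^bsub>L\<^esub> ar a = ar a"
  by (simp add: cls_mult path_elem_carrier paths_def arrow_path_single path_elem_mult)

lemma ar_vt: "a \<in> arcs Q \<Longrightarrow> ar a \<otimes>\<^bsub>L\<^esub> vt (tail Q a) = ar a"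
  by (simp add: cls_mult path_elem_carrier paths_def arrow_path_single path_elem_mult)

lemma vt_vt: "x \<in> verts Q \<Longrightarrow> y \<in> verts Q \<Longrightarrow> vt x \<otimes>\<^bsub>L\<^esub> vt y = (if x = y then vt x else \<zero>\<^bsub>L\<^esub>)"
proof -
  assume xy: "x \<in> verts Q" "y \<in> verts Q"
  have "(path_elem (x, []) \<otimes>\<^bsub>PA\<^esub> path_elem (y, [])) = (\<zero>\<^bsub>PA\<^esub> :: _ \<Rightarrow> 'k)" if "x \<noteq> y"
  proof (rule ext, clarify)
    fix z p
    show "(path_elem (x, []) \<otimes>\<^bsub>PA\<^esub> path_elem (y, [])) (z, p) = (\<zero>\<^bsub>PA\<^esub> (z, p) :: 'k)"
      unfolding PA_mult PA_zero using that by (intro sum.neutral) (auto simp: path_elem_def)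
  qed
  then show ?thesis
    using xy by (auto simp: cls_mult path_elem_carrier paths_def path_elem_mult cls_zero)
qed

lemma ar_ar_zero:
  assumes "\<alpha> \<in> arcs Q" "\<beta> \<in> arcs Q" "head Q \<alpha> = tail Q \<beta>" "arrow_path Q [\<beta>, \<alpha>] \<in> I"
  shows "ar \<beta> \<otimes>\<^bsub>L\<^esub> ar \<alpha> = \<zero>\<^bsub>L\<^esub>"
proof -
  have "ar \<beta> \<otimes>\<^bsub>L\<^esub> ar \<alpha> = cls (arrow_path Q [\<beta>, \<alpha>])"
    using assms by (simp add: cls_mult path_elem_carrier paths_def arrow_path_single path_elem_mult arrow_path_def)
  then show ?thesis using assms
    by (simp add: cls_zero cls_def a_rcos_zero[OF is_ideal] additive_subgroup.zero_closed[OF is_additive_subgroup])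
qed

end

lemma (in left_module) smult_zero: "r \<in> carrier R \<Longrightarrow> r \<odot>\<^bsub>M\<^esub> \<zero>\<^bsub>M\<^esub> = \<zero>\<^bsub>M\<^esub>"
  using smult_r_distr[of r "\<zero>\<^bsub>M\<^esub>" "\<zero>\<^bsub>M\<^esub>"] smult_closed[of r "\<zero>\<^bsub>M\<^esub>"] by (simp add: M.add.l_cancel_one')

lemma (in left_module) zero_smult: "x \<in> carrier M \<Longrightarrow> \<zero>\<^bsub>R\<^esub> \<odot>\<^bsub>M\<^esub> x = \<zero>\<^bsub>M\<^esub>"
  using smult_l_distr[of "\<zero>\<^bsub>R\<^esub>" "\<zero>\<^bsub>R\<^esub>" x] smult_closed[of "\<zero>\<^bsub>R\<^esub>" x] by (simp add: M.add.l_cancel_one')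

lemma (in left_module) smult_finsum:
  "r \<in> carrier R \<Longrightarrow> f \<in> J \<rightarrow> carrier M \<Longrightarrow>
    r \<odot>\<^bsub>M\<^esub> (\<Oplus>\<^bsub>M\<^esub>j\<in>J. f j) = (\<Oplus>\<^bsub>M\<^esub>j\<in>J. r \<odot>\<^bsub>M\<^esub> f j)"
proof (induction J rule: infinite_finite_induct)
  case (insert j J)
  then have "f j \<in> carrier M" "f \<in> J \<rightarrow> carrier M" "(\<lambda>j. r \<odot>\<^bsub>M\<^esub> f j) \<in> J \<rightarrow> carrier M"
    by (auto simp: smult_closed Pi_iff)
  then show ?case using insert by (simp add: smult_r_distr smult_closed)
qed (auto simp: smult_zero)

lemma lmod_hom_finsum:
  assumes "left_module R M" and "left_module R N" and f: "f \<in> lmod_hom R M N"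
  shows "g \<in> J \<rightarrow> carrier M \<Longrightarrow> f (\<Oplus>\<^bsub>M\<^esub>j\<in>J. g j) = (\<Oplus>\<^bsub>N\<^esub>j\<in>J. f (g j))"
proof -
  interpret M: left_module R M by fact
  interpret N: left_module R N by fact
  show "g \<in> J \<rightarrow> carrier M \<Longrightarrow> f (\<Oplus>\<^bsub>M\<^esub>j\<in>J. g j) = (\<Oplus>\<^bsub>N\<^esub>j\<in>J. f (g j))"
  proof (induction J rule: infinite_finite_induct)
    case (insert j J)
    then have "g j \<in> carrier M" "g \<in> J \<rightarrow> carrier M" "(\<lambda>j. f (g j)) \<in> J \<rightarrow> carrier N" "f (g j) \<in> carrier N"
      using lmod_homD(1)[OF f] by auto
    then show ?case using insert lmod_homD[OF f] by simp
  qed (auto simp: lmod_hom_minus(1)[OF assms])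
qed

context bound_quiver
begin
lemma sc_zero: "sc 0 = \<zero>\<^bsub>L\<^esub>"
  by (simp add: sc_cls cls_zero PA_zero)
end

lemma (in quiver_rep) finsum_M:
  "finite J \<Longrightarrow> g \<in> J \<rightarrow> carrier M \<Longrightarrow> (\<Oplus>\<^bsub>M\<^esub>j\<in>J. g j) = (\<lambda>i. \<Sum>j\<in>J. g j i)"
proof (induction J rule: finite_induct)
  interpret M: abelian_group M by (rule abelian_group_M)
  case empty then show ?case by (simp add: M_simps)
next
  interpret M: abelian_group M by (rule abelian_group_M)
  case (insert x F)
  then have "g x \<in> carrier M" "g \<in> F \<rightarrow> carrier M" by auto
  with insert show ?case by (simp add: M_simps)
qed

text \<open>
  Two representations \<open>M\<^sub>b\<close> and \<open>M\<^sub>c\<close>. An extension of \<open>M\<^sub>c\<close> by \<open>M\<^sub>b\<close> on the space of pairs is an upper triangular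
  action; \<open>T a\<close> below is the matrix of the corner of the arrow \<open>a\<close>, from \<open>M\<^sub>c\<close> to \<open>M\<^sub>b\<close>.
\<close>

locale rep_pair = bound_quiver Q I + N: quiver_rep Q I nb vb actb + M: quiver_rep Q I nc vc actc
  for Q :: "('v, 'a) pre_digraph" and I :: "(('v, 'a) path \<Rightarrow> 'k::field) set"
    and nb vb actb nc vc actc
begin

abbreviation "Mb \<equiv> rep_module nb vb actb :: ((('v, 'a) path \<Rightarrow> 'k) set, nat \<Rightarrow> 'k) module"
abbreviation "Mc \<equiv> rep_module nc vc actc :: ((('v, 'a) path \<Rightarrow> 'k) set, nat \<Rightarrow> 'k) module"

definition lo :: "(nat \<Rightarrow> 'k) \<Rightarrow> nat \<Rightarrow> 'k" where "lo v = (\<lambda>i. if i < nb then v i else 0)"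
definition hi :: "(nat \<Rightarrow> 'k) \<Rightarrow> nat \<Rightarrow> 'k" where "hi v = (\<lambda>i. v (nb + i))"
definition join :: "(nat \<Rightarrow> 'k) \<Rightarrow> (nat \<Rightarrow> 'k) \<Rightarrow> nat \<Rightarrow> 'k" where
  "join u v = (\<lambda>i. if i < nb then u i else v (i - nb))"

definition mat :: "('a \<Rightarrow> nat \<Rightarrow> nat \<Rightarrow> 'k) \<Rightarrow> 'a \<Rightarrow> (nat \<Rightarrow> 'k) \<Rightarrow> nat \<Rightarrow> 'k" where
  "mat T a v = (\<lambda>i. if i < nb then \<Sum>j<nc. T a i j * v j else 0)"

text \<open>
  The second condition says that the triangular action satisfies the relations. Only relations of length two occur,
  so it is linear in \<open>T\<close>.
\<close>

definition cocycle :: "('a \<Rightarrow> nat \<Rightarrow> nat \<Rightarrow> 'k) \<Rightarrow> bool" where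
  "cocycle T \<longleftrightarrow>
    (\<forall>a i j. T a i j \<noteq> 0 \<longrightarrow> a \<in> arcs Q \<and> i < nb \<and> j < nc \<and> vb i = head Q a \<and> vc j = tail Q a) \<and>
    (\<forall>\<alpha>\<in>arcs Q. \<forall>\<beta>\<in>arcs Q. head Q \<alpha> = tail Q \<beta> \<longrightarrow> arrow_path Q [\<beta>, \<alpha>] \<in> I \<longrightarrow>
      (\<forall>v i. actb \<beta> (mat T \<alpha> v) i + mat T \<beta> (actc \<alpha> v) i = 0))"

definition ext_act :: "('a \<Rightarrow> nat \<Rightarrow> nat \<Rightarrow> 'k) \<Rightarrow> 'a \<Rightarrow> (nat \<Rightarrow> 'k) \<Rightarrow> nat \<Rightarrow> 'k" where
  "ext_act T a v = (\<lambda>i. if i < nb then actb a (lo v) i + mat T a (hi v) i else actc a (hi v) (i - nb))"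

definition evx :: "nat \<Rightarrow> 'v" where "evx i = (if i < nb then vb i else vc (i - nb))"

abbreviation "E T \<equiv> rep_module (nb + nc) evx (ext_act T) :: ((('v, 'a) path \<Rightarrow> 'k) set, nat \<Rightarrow> 'k) module"

definition X :: "('a \<Rightarrow> nat \<Rightarrow> nat \<Rightarrow> 'k) \<Rightarrow> ((('v, 'a) path \<Rightarrow> 'k) set, nat \<Rightarrow> 'k, nat \<Rightarrow> 'k, nat \<Rightarrow> 'k) extn"
  where "X T = (E T, (\<lambda>u. u), (\<lambda>v i. v (nb + i)))"

text \<open>The matrix \<open>h\<close> is a linear map \<open>M\<^sub>c \<rightarrow> M\<^sub>b\<close> that respects vertices, and \<open>T\<close> is its coboundary.\<close>

definition coboundary :: "(nat \<Rightarrow> nat \<Rightarrow> 'k) \<Rightarrow> ('a \<Rightarrow> nat \<Rightarrow> nat \<Rightarrow> 'k) \<Rightarrow> bool" where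
  "coboundary h T \<longleftrightarrow>
    (\<forall>i j. h i j \<noteq> 0 \<longrightarrow> i < nb \<and> j < nc \<and> vb i = vc j) \<and>
    (\<forall>a\<in>arcs Q. \<forall>v i. mat T a v i = actb a (mat (\<lambda>_. h) a v) i - mat (\<lambda>_. h) a (actc a v) i)"

lemma mat_add: "mat T a (\<lambda>i. u i + v i) = (\<lambda>i. mat T a u i + mat T a v i)"
  by (auto simp: mat_def distrib_left sum.distrib)

lemma mat_scale: "mat T a (\<lambda>i. \<kappa> * v i) = (\<lambda>i. \<kappa> * mat T a v i)"
  by (auto simp: mat_def sum_distrib_left ac_simps intro!: ext sum.cong)

lemma mat_zero: "mat T a (\<lambda>_. 0) = (\<lambda>_. 0)"
  by (auto simp: mat_def)

lemma mat_bound: "nb \<le> i \<Longrightarrow> mat T a v i = 0"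
  by (simp add: mat_def)

lemma mat_cong: "(\<And>j. j < nc \<Longrightarrow> u j = v j) \<Longrightarrow> mat T a u = mat T a v"
  by (auto simp: mat_def)

lemma mat_T_add: "mat (\<lambda>a i j. T a i j + T' a i j) a v = (\<lambda>i. mat T a v i + mat T' a v i)"
  by (auto simp: mat_def distrib_right sum.distrib)

lemma mat_T_diff: "mat (\<lambda>a i j. T a i j - T' a i j) a v = (\<lambda>i. mat T a v i - mat T' a v i)"
  by (auto simp: mat_def left_diff_distrib sum_subtractf)

lemma mat_T_scale: "mat (\<lambda>a i j. \<kappa> * T a i j) a v = (\<lambda>i. \<kappa> * mat T a v i)"
  by (auto simp: mat_def sum_distrib_left ac_simps intro!: ext sum.cong)

lemma cocycle_supp: "cocycle T \<Longrightarrow> T a i j \<noteq> 0 \<Longrightarrow> a \<in> arcs Q \<and> i < nb \<and> j < nc \<and> vb i = head Q a \<and> vc j = tail Q a"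
  by (simp add: cocycle_def)

lemma cocycle_rel: "cocycle T \<Longrightarrow> \<alpha> \<in> arcs Q \<Longrightarrow> \<beta> \<in> arcs Q \<Longrightarrow> head Q \<alpha> = tail Q \<beta> \<Longrightarrow> arrow_path Q [\<beta>, \<alpha>] \<in> I \<Longrightarrow>
      actb \<beta> (mat T \<alpha> v) i + mat T \<beta> (actc \<alpha> v) i = 0"
  unfolding cocycle_def by blast

lemma mat_supp: "cocycle T \<Longrightarrow> mat T a v i \<noteq> 0 \<Longrightarrow> i < nb \<and> vb i = head Q a"
proof -
  assume c: "cocycle T" and nz: "mat T a v i \<noteq> 0"
  then have i: "i < nb" "(\<Sum>j<nc. T a i j * v j) \<noteq> 0" by (auto simp: mat_def split: if_splits)
  then obtain j where "T a i j * v j \<noteq> 0" by (metis (no_types, lifting) sum.neutral)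
  then show ?thesis using cocycle_supp[OF c, of a i j] by auto
qed

lemma mat_cong_supp: "cocycle T \<Longrightarrow> (\<And>j. j < nc \<Longrightarrow> vc j = tail Q a \<Longrightarrow> u j = v j) \<Longrightarrow> mat T a u = mat T a v"
proof -
  assume c: "cocycle T" and uv: "\<And>j. j < nc \<Longrightarrow> vc j = tail Q a \<Longrightarrow> u j = v j"
  have *: "T a i j * u j = T a i j * v j" for i j
    using cocycle_supp[OF c, of a i j] uv by (cases "T a i j = 0") auto
  show ?thesis by (simp only: mat_def *)
qed

lemma lo_add: "lo (\<lambda>i. u i + v i) = (\<lambda>i. lo u i + lo v i)" by (auto simp: lo_def)
lemma lo_scale: "lo (\<lambda>i. \<kappa> * u i) = (\<lambda>i. \<kappa> * lo u i)" by (auto simp: lo_def)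
lemma hi_add: "hi (\<lambda>i. u i + v i) = (\<lambda>i. hi u i + hi v i)" by (auto simp: hi_def)
lemma hi_scale: "hi (\<lambda>i. \<kappa> * u i) = (\<lambda>i. \<kappa> * hi u i)" by (auto simp: hi_def)

lemma lo_ext_act: "a \<in> arcs Q \<Longrightarrow> lo (ext_act T a v) = (\<lambda>i. actb a (lo v) i + mat T a (hi v) i)"
  by (auto simp: lo_def ext_act_def mat_bound N.act_bound)

lemma hi_ext_act: "hi (ext_act T a v) = actc a (hi v)"
  by (auto simp: hi_def ext_act_def)

lemma carrier_E: "v \<in> carrier (E T) \<longleftrightarrow> (\<forall>i\<ge>nb + nc. v i = 0)"
  by (simp add: rep_module_def)

lemma vec_eqI: "lo u = lo v \<Longrightarrow> hi u = hi v \<Longrightarrow> u = v"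
proof
  fix i assume *: "lo u = lo v" "hi u = hi v"
  show "u i = v i"
    using fun_cong[OF *(1), of i] fun_cong[OF *(2), of "i - nb"] by (cases "i < nb") (auto simp: lo_def hi_def)
qed

lemma join_simps: "lo (join u v) = lo u" "hi (join u v) = v"
  by (auto simp: lo_def hi_def join_def)

lemma ext_rep:
  assumes T: "cocycle T"
  shows "quiver_rep Q I (nb + nc) evx (ext_act T)"
proof
  show "evx i \<in> verts Q" if "i < nb + nc" for i
    using that N.vx_vert M.vx_vert by (auto simp: evx_def)
next
  fix a u v assume a: "a \<in> arcs Q"
  show "ext_act T a (\<lambda>i. u i + v i) = (\<lambda>i. ext_act T a u i + ext_act T a v i)"
    using a by (auto simp: ext_act_def lo_add hi_add mat_add N.act_add M.act_add)
  show "ext_act T a (\<lambda>i. \<kappa> * v i) = (\<lambda>i. \<kappa> * ext_act T a v i)" for \<kappa>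
    using a by (auto simp: ext_act_def lo_scale hi_scale mat_scale N.act_scale M.act_scale distrib_left)
  show "i < nb + nc \<and> evx i = head Q a" if "ext_act T a v i \<noteq> 0" for i
  proof (cases "i < nb")
    case True
    then have "actb a (lo v) i \<noteq> 0 \<or> mat T a (hi v) i \<noteq> 0" using that by (auto simp: ext_act_def)
    then show ?thesis using True N.act_supp[OF a] mat_supp[OF T] by (auto simp: evx_def)
  next
    case False
    then show ?thesis using that M.act_supp[OF a, of "hi v" "i - nb"] by (auto simp: ext_act_def evx_def)
  qed
  assume uv: "\<And>i. i < nb + nc \<Longrightarrow> evx i = tail Q a \<Longrightarrow> u i = v i"
  have "u (nb + j) = v (nb + j)" if "j < nc" "vc j = tail Q a" for j
    using uv[of "nb + j"] that by (simp add: evx_def)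
  then have huv: "hi u j = hi v j" if "j < nc" "vc j = tail Q a" for j
    using that by (simp add: hi_def)
  have "mat T a (hi u) = mat T a (hi v)" by (rule mat_cong_supp[OF T]) (rule huv)
  moreover have "actc a (hi u) = actc a (hi v)" by (rule M.act_cong[OF a]) (rule huv)
  moreover have "actb a (lo u) = actb a (lo v)"
    using uv by (intro N.act_cong[OF a]) (auto simp: lo_def evx_def)
  ultimately show "ext_act T a u = ext_act T a v" unfolding ext_act_def by metis
next
  fix \<alpha> \<beta> v assume *: "\<alpha> \<in> arcs Q" "\<beta> \<in> arcs Q" "head Q \<alpha> = tail Q \<beta>" "arrow_path Q [\<beta>, \<alpha>] \<in> I"
  show "ext_act T \<beta> (ext_act T \<alpha> v) = (\<lambda>_. 0)"
  proof (rule vec_eqI)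
    have "lo (ext_act T \<beta> (ext_act T \<alpha> v)) = (\<lambda>i. actb \<beta> (mat T \<alpha> (hi v)) i + mat T \<beta> (actc \<alpha> (hi v)) i)"
      using * by (simp add: lo_ext_act hi_ext_act N.act_add N.act_rel)
    also have "\<dots> = lo (\<lambda>_. 0)" using cocycle_rel[OF T *] by (simp add: lo_def)
    finally show "lo (ext_act T \<beta> (ext_act T \<alpha> v)) = lo (\<lambda>_. 0)" .
    show "hi (ext_act T \<beta> (ext_act T \<alpha> v)) = hi (\<lambda>_. 0)"
      using * by (simp add: hi_ext_act M.act_rel) (simp add: hi_def)
  qed
qed

lemma lo_trunc: "lo (\<lambda>i. if evx i = x then v i else 0) = (\<lambda>i. if vb i = x then lo v i else 0)"
  by (auto simp: lo_def evx_def)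

lemma hi_trunc: "hi (\<lambda>i. if evx i = x then v i else 0) = (\<lambda>i. if vc i = x then hi v i else 0)"
  by (auto simp: hi_def evx_def)

lemma lo_carrier: "lo v \<in> carrier Mb"
  by (simp add: N.carrier_M lo_def)

lemma hi_carrier: "v \<in> carrier (E T) \<Longrightarrow> hi v \<in> carrier Mc"
  by (simp add: M.carrier_M hi_def carrier_E)

lemma lo_Mb: "u \<in> carrier Mb \<Longrightarrow> lo u = u"
  by (auto simp: N.carrier_M lo_def)

lemma hi_Mb: "u \<in> carrier Mb \<Longrightarrow> hi u = (\<lambda>_. 0)"
  by (auto simp: N.carrier_M hi_def)

lemma Mb_E: "u \<in> carrier Mb \<Longrightarrow> u \<in> carrier (E T)"
  by (auto simp: N.carrier_M carrier_E)

lemma join_E: "v \<in> carrier Mc \<Longrightarrow> join u v \<in> carrier (E T)"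
  by (auto simp: M.carrier_M carrier_E join_def)

lemma X_extension:
  assumes T: "cocycle T"
  shows "X T \<in> extensions L Mc Mb"
proof -
  interpret E: quiver_rep Q I "nb + nc" evx "ext_act T" by (rule ext_rep[OF T])
  have 1: "(\<lambda>u. u) \<in> lmod_hom L Mb (E T)"
  proof (rule rep_hom[OF N.quiver_rep_axioms E.quiver_rep_axioms])
    show "(\<lambda>i. if vb i = x then v i else 0) = (\<lambda>i. if evx i = x then v i else 0)" if "v \<in> carrier Mb" for x v
      using that by (auto simp: N.carrier_M evx_def)
    show "actb a v = ext_act T a v" if "a \<in> arcs Q" "v \<in> carrier Mb" for a v
    proof (rule vec_eqI)
      have c: "actb a v \<in> carrier Mb" using N.act_bound[OF that(1)] by (simp add: N.carrier_M)
      show "lo (actb a v) = lo (ext_act T a v)"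
        by (simp add: lo_ext_act[OF that(1)] lo_Mb[OF that(2)] lo_Mb[OF c] hi_Mb[OF that(2)] mat_zero)
      show "hi (actb a v) = hi (ext_act T a v)"
        by (simp add: hi_ext_act hi_Mb[OF that(2)] hi_Mb[OF c] M.act_zero[OF that(1)])
    qed
  qed (auto intro: Mb_E)
  have 2: "(\<lambda>v i. v (nb + i)) \<in> lmod_hom L (E T) Mc"
  proof (rule rep_hom[OF E.quiver_rep_axioms M.quiver_rep_axioms])
    show "(\<lambda>i. ext_act T a v (nb + i)) = actc a (\<lambda>i. v (nb + i))" for a v
      by (simp add: ext_act_def hi_def)
  qed (simp_all add: carrier_E M.carrier_M evx_def)
  have 3: "(\<lambda>v i. v (nb + i)) ` carrier (E T) = carrier Mc"
  proof (intro equalityI subsetI)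
    fix v assume "v \<in> carrier Mc"
    then show "v \<in> (\<lambda>v i. v (nb + i)) ` carrier (E T)"
      using join_E join_simps(2) by (intro image_eqI[of _ _ "join (\<lambda>_. 0) v"]) (auto simp: hi_def)
  qed (auto simp: carrier_E M.carrier_M)
  have 4: "(\<lambda>u. u) ` carrier Mb = {x \<in> carrier (E T). (\<lambda>i. x (nb + i)) = \<zero>\<^bsub>Mc\<^esub>}"
  proof (intro equalityI subsetI)
    fix x assume "x \<in> {x \<in> carrier (E T). (\<lambda>i. x (nb + i)) = \<zero>\<^bsub>Mc\<^esub>}"
    then have "x (nb + i) = 0" for i by (auto simp: M.M_simps dest: fun_cong)
    then have "x i = 0" if "nb \<le> i" for i using that le_Suc_ex by blast
    then show "x \<in> (\<lambda>u. u) ` carrier Mb" by (simp add: N.carrier_M)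
  qed (auto simp: carrier_E N.carrier_M M.M_simps)
  show ?thesis
    using 1 2 3 4 N.left_module_M M.left_module_M E.left_module_M
    by (auto simp: X_def extensions_def inj_on_def)
qed

lemma X_equivI:
  assumes T: "cocycle T" and \<xi>: "(F, i, p) \<in> extensions L Mc Mb"
    and s: "\<And>v. v \<in> carrier Mc \<Longrightarrow> s v \<in> carrier F"
    and s_add: "\<And>u v. u \<in> carrier Mc \<Longrightarrow> v \<in> carrier Mc \<Longrightarrow> s (\<lambda>i. u i + v i) = s u \<oplus>\<^bsub>F\<^esub> s v"
    and s_scale: "\<And>\<kappa> v. v \<in> carrier Mc \<Longrightarrow> s (\<lambda>i. \<kappa> * v i) = sc \<kappa> \<odot>\<^bsub>F\<^esub> s v"
    and s_vert: "\<And>x v. x \<in> verts Q \<Longrightarrow> v \<in> carrier Mc \<Longrightarrow> s (\<lambda>i. if vc i = x then v i else 0) = vt x \<odot>\<^bsub>F\<^esub> s v"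
    and s_arrow: "\<And>a v. a \<in> arcs Q \<Longrightarrow> v \<in> carrier Mc \<Longrightarrow> ar a \<odot>\<^bsub>F\<^esub> s v = s (actc a v) \<oplus>\<^bsub>F\<^esub> i (mat T a v)"
    and s_sect: "\<And>v. v \<in> carrier Mc \<Longrightarrow> p (s v) = v"
  shows "ext_equiv L Mb (X T) (F, i, p)"
proof -
  note x = extensionsD[OF \<xi>]
  interpret E: quiver_rep Q I "nb + nc" evx "ext_act T" by (rule ext_rep[OF T])
  interpret F: left_module L F by (rule x)
  note ih = lmod_homD[OF x(4)] and ph = lmod_homD[OF x(5)]
  define f where "f v = i (lo v) \<oplus>\<^bsub>F\<^esub> s (hi v)" for v
  have lo: "lo v \<in> carrier Mb" for v by (rule lo_carrier)
  have hom: "f \<in> lmod_hom L (E T) F"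
  proof (rule hom_criterion[OF E.left_module_M x(2)])
    show "f \<in> carrier (E T) \<rightarrow> carrier F"
      using ih(1) s hi_carrier lo by (auto simp: f_def)
    fix u v assume u: "u \<in> carrier (E T)" and v: "v \<in> carrier (E T)"
    note c = hi_carrier[OF u] hi_carrier[OF v] ih(1)[OF lo[of u]] ih(1)[OF lo[of v]]
    have "f (u \<oplus>\<^bsub>E T\<^esub> v) = i (lo u \<oplus>\<^bsub>Mb\<^esub> lo v) \<oplus>\<^bsub>F\<^esub> s (\<lambda>i. hi u i + hi v i)"
      by (simp add: f_def E.M_simps N.M_simps lo_add hi_add)
    also have "\<dots> = (i (lo u) \<oplus>\<^bsub>F\<^esub> i (lo v)) \<oplus>\<^bsub>F\<^esub> (s (hi u) \<oplus>\<^bsub>F\<^esub> s (hi v))"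
      using c by (simp add: ih lo s_add)
    also have "\<dots> = f u \<oplus>\<^bsub>F\<^esub> f v"
      using c s by (simp add: f_def F.M.a_ac)
    finally show "f (u \<oplus>\<^bsub>E T\<^esub> v) = f u \<oplus>\<^bsub>F\<^esub> f v" .
  next
    fix \<kappa> v assume v: "v \<in> carrier (E T)"
    note c = hi_carrier[OF v] ih(1)[OF lo[of v]]
    have "f (sc \<kappa> \<odot>\<^bsub>E T\<^esub> v) = i (sc \<kappa> \<odot>\<^bsub>Mb\<^esub> lo v) \<oplus>\<^bsub>F\<^esub> s (\<lambda>i. \<kappa> * hi v i)"
      using v lo by (simp add: f_def E.rep_scalar N.rep_scalar lo_scale hi_scale)
    then show "f (sc \<kappa> \<odot>\<^bsub>E T\<^esub> v) = sc \<kappa> \<odot>\<^bsub>F\<^esub> f v"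
      using c s by (simp add: f_def ih lo s_scale F.smult_r_distr sc_carrier)
  next
    fix x v assume v: "v \<in> carrier (E T)" and x: "x \<in> verts Q"
    note c = hi_carrier[OF v] ih(1)[OF lo[of v]]
    have "f (vt x \<odot>\<^bsub>E T\<^esub> v) = i (vt x \<odot>\<^bsub>Mb\<^esub> lo v) \<oplus>\<^bsub>F\<^esub> s (\<lambda>i. if vc i = x then hi v i else 0)"
      using x by (simp add: f_def E.rep_vert N.rep_vert lo_trunc hi_trunc)
    then show "f (vt x \<odot>\<^bsub>E T\<^esub> v) = vt x \<odot>\<^bsub>F\<^esub> f v"
      using c s x by (simp add: f_def ih lo s_vert F.smult_r_distr vt_carrier)
  next
    fix a v assume v: "v \<in> carrier (E T)" and a: "a \<in> arcs Q"
    have mc: "mat T a (hi v) \<in> carrier Mb" by (simp add: N.carrier_M mat_bound)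
    have ac: "ar a \<odot>\<^bsub>Mb\<^esub> lo v \<in> carrier Mb" "actc a (hi v) \<in> carrier Mc"
      using N.left_module_M ar_carrier[OF a] lo by (auto simp: left_module.smult_closed M.carrier_M M.act_bound[OF a])
    note c = hi_carrier[OF v] ih(1)[OF lo[of v]] ih(1)[OF mc] ih(1)[OF ac(1)] s[OF ac(2)]
    have "f (ar a \<odot>\<^bsub>E T\<^esub> v) = i (ar a \<odot>\<^bsub>Mb\<^esub> lo v \<oplus>\<^bsub>Mb\<^esub> mat T a (hi v)) \<oplus>\<^bsub>F\<^esub> s (actc a (hi v))"
      using a by (simp add: f_def E.rep_arrow N.rep_arrow N.M_simps lo_ext_act hi_ext_act)
    also have "\<dots> = i (ar a \<odot>\<^bsub>Mb\<^esub> lo v) \<oplus>\<^bsub>F\<^esub> (s (actc a (hi v)) \<oplus>\<^bsub>F\<^esub> i (mat T a (hi v)))"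
      using c by (simp add: ih(2) ac mc F.M.a_ac)
    also have "\<dots> = ar a \<odot>\<^bsub>F\<^esub> i (lo v) \<oplus>\<^bsub>F\<^esub> ar a \<odot>\<^bsub>F\<^esub> s (hi v)"
      using c a lo by (simp add: ih(3) s_arrow ar_carrier)
    also have "\<dots> = ar a \<odot>\<^bsub>F\<^esub> f v"
      using c a s by (simp add: f_def F.smult_r_distr ar_carrier)
    finally show "f (ar a \<odot>\<^bsub>E T\<^esub> v) = ar a \<odot>\<^bsub>F\<^esub> f v" .
  qed
  have s0: "s (\<lambda>_. 0) = \<zero>\<^bsub>F\<^esub>"
  proof -
    have z: "(\<lambda>_. 0) \<in> carrier Mc" by (simp add: M.carrier_M)
    have "s (\<lambda>_. 0) = s (\<lambda>_. 0) \<oplus>\<^bsub>F\<^esub> s (\<lambda>_. 0)" using s_add[OF z z] by simp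
    then show ?thesis using s[OF z] by (metis F.M.add.l_cancel_one)
  qed
  have "f u = i u" if "u \<in> carrier Mb" for u
    using that ih(1)[OF that] by (simp add: f_def lo_Mb hi_Mb s0)
  moreover have "p (f v) = (\<lambda>i. v (nb + i))" if v: "v \<in> carrier (E T)" for v
  proof -
    have c: "hi v \<in> carrier Mc" using v by (rule hi_carrier)
    have "p (i (lo v)) = \<zero>\<^bsub>Mc\<^esub>" using x(8) lo by blast
    then show ?thesis
      using c s ih(1)[OF lo] by (simp add: f_def ph s_sect) (simp add: M.M_simps hi_def)
  qed
  ultimately show ?thesis unfolding X_def ext_equiv.simps using hom by (intro bexI[of _ f]) auto
qed

end

context rep_pair
begin

text \<open>
  Every extension has a section that is linear and respects vertices, since the vertices act as orthogonal
  idempotents. In the coordinates that it gives on the middle term, the failure of the section to commute with the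
  arrow \<open>a\<close> is the corner \<open>T a\<close>.
\<close>

lemma every_extension:
  assumes \<xi>: "(F, i, p) \<in> extensions L Mc Mb"
  shows "\<exists>T. cocycle T \<and> ext_equiv L Mb (X T) (F, i, p)"
proof -
  note x = extensionsD[OF \<xi>]
  interpret F: left_module L F by (rule x)
  interpret Mc: left_module L Mc by (rule x)
  note ih = lmod_homD[OF x(4)] and ph = lmod_homD[OF x(5)]
  note i0 = lmod_hom_minus(1)[OF x(1,2,4)] and p0 = lmod_hom_minus(1)[OF x(2,3,5)]
  define unit :: "nat \<Rightarrow> nat \<Rightarrow> 'k" where "unit j = (\<lambda>i. if i = j then 1 else 0)" for j
  have unit_c: "unit j \<in> carrier Mc" if "j < nc" for j using that by (simp add: unit_def M.carrier_M)
  have "\<exists>x. x \<in> carrier F \<and> p x = unit j" if "j < nc" for j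
    using unit_c[OF that] x(7) by (metis imageE)
  then obtain y where y: "\<And>j. j < nc \<Longrightarrow> y j \<in> carrier F" "\<And>j. j < nc \<Longrightarrow> p (y j) = unit j" by metis
  (* multiplying by the idempotent of the vertex moves the lift of a basis vector to its vertex *)
  define z where "z j = vt (vc j) \<odot>\<^bsub>F\<^esub> y j" for j
  have zc: "z j \<in> carrier F" if "j < nc" for j
    using y that by (auto simp: z_def F.smult_closed vt_carrier M.vx_vert)
  have pz: "p (z j) = unit j" if "j < nc" for j
    using y that by (auto simp: z_def ph vt_carrier M.vx_vert M.rep_vert unit_def)
  have vz: "vt x \<odot>\<^bsub>F\<^esub> z j = (if vc j = x then z j else \<zero>\<^bsub>F\<^esub>)" if "j < nc" "x \<in> verts Q" for x j
    using that y M.vx_vert[OF that(1)]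
    by (auto simp: z_def F.smult_assoc1[symmetric] vt_carrier vt_vt F.zero_smult)
  have sc_smult: "sc \<kappa> \<odot>\<^bsub>F\<^esub> (X \<odot>\<^bsub>F\<^esub> w) = X \<odot>\<^bsub>F\<^esub> (sc \<kappa> \<odot>\<^bsub>F\<^esub> w)" if "X \<in> carrier L" "w \<in> carrier F" for \<kappa> X w
    using that by (simp add: F.smult_assoc1[symmetric] sc_carrier sc_central)
  define s where "s v = (\<Oplus>\<^bsub>F\<^esub>j\<in>{..<nc}. sc (v j) \<odot>\<^bsub>F\<^esub> z j)" for v
  have termc: "(\<lambda>j. sc (v j) \<odot>\<^bsub>F\<^esub> z j) \<in> {..<nc} \<rightarrow> carrier F" for v
    using zc by (auto simp: F.smult_closed sc_carrier)
  have s_c: "s v \<in> carrier F" for v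
    unfolding s_def using termc by (rule F.M.finsum_closed)
  have s_add: "s (\<lambda>i. u i + v i) = s u \<oplus>\<^bsub>F\<^esub> s v" for u v
    unfolding s_def F.M.finsum_addf[OF termc termc, symmetric]
    by (rule F.M.finsum_cong') (use zc in \<open>auto simp: sc_add[symmetric] F.smult_l_distr sc_carrier F.smult_closed\<close>)
  have s_scale: "s (\<lambda>i. \<kappa> * v i) = sc \<kappa> \<odot>\<^bsub>F\<^esub> s v" for \<kappa> v
    unfolding s_def F.smult_finsum[OF sc_carrier termc]
    by (rule F.M.finsum_cong') (use zc in \<open>auto simp: sc_mult[symmetric] F.smult_assoc1 sc_carrier F.smult_closed\<close>)
  have s_zero: "s (\<lambda>_. 0) = \<zero>\<^bsub>F\<^esub>"
    using s_add[of "\<lambda>_. 0" "\<lambda>_. 0"] s_c[of "\<lambda>_. 0"] by (simp add: F.M.add.l_cancel_one')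
  have s_sum: "s (\<lambda>i. \<Sum>j\<in>J. g j i) = (\<Oplus>\<^bsub>F\<^esub>j\<in>J. s (g j))" if "finite J" for g :: "nat \<Rightarrow> nat \<Rightarrow> 'k" and J
    using that by (induction J rule: finite_induct) (auto simp: s_zero s_add s_c)
  have s_vert: "s (\<lambda>i. if vc i = x then v i else 0) = vt x \<odot>\<^bsub>F\<^esub> s v" if "x \<in> verts Q" for x v
    unfolding s_def F.smult_finsum[OF vt_carrier[OF that] termc]
  proof (rule F.M.finsum_cong')
    fix j assume "j \<in> {..<nc}"
    then have j: "j < nc" by simp
    have "vt x \<odot>\<^bsub>F\<^esub> (sc (v j) \<odot>\<^bsub>F\<^esub> z j) = sc (v j) \<odot>\<^bsub>F\<^esub> (vt x \<odot>\<^bsub>F\<^esub> z j)"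
      using sc_smult[OF vt_carrier[OF that] zc[OF j]] by simp
    also have "\<dots> = sc (if vc j = x then v j else 0) \<odot>\<^bsub>F\<^esub> z j"
      using zc[OF j] by (simp add: vz[OF j that] F.smult_zero sc_carrier sc_zero F.zero_smult)
    finally show "sc (if vc j = x then v j else 0) \<odot>\<^bsub>F\<^esub> z j = vt x \<odot>\<^bsub>F\<^esub> (sc (v j) \<odot>\<^bsub>F\<^esub> z j)" by simp
  qed (use zc that in \<open>auto simp: F.smult_closed sc_carrier vt_carrier\<close>)
  have p_s: "p (s v) = v" if v: "v \<in> carrier Mc" for v
  proof -
    have "p (s v) = (\<Oplus>\<^bsub>Mc\<^esub>j\<in>{..<nc}. p (sc (v j) \<odot>\<^bsub>F\<^esub> z j))"
      unfolding s_def by (rule lmod_hom_finsum[OF x(2,3,5) termc])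
    also have "\<dots> = (\<Oplus>\<^bsub>Mc\<^esub>j\<in>{..<nc}. (\<lambda>i. v j * unit j i))"
      by (rule Mc.M.finsum_cong') (auto simp: ph zc sc_carrier pz M.rep_scalar unit_c, auto simp: M.carrier_M unit_def)
    also have "\<dots> = (\<lambda>i. \<Sum>j<nc. v j * unit j i)"
      by (rule M.finsum_M) (auto simp: M.carrier_M unit_def)
    also have "\<dots> = v"
      using v by (auto simp: unit_def M.carrier_M if_distrib[of "\<lambda>t. _ * t"] cong: if_cong)
    finally show ?thesis .
  qed
  have ker: "\<exists>t\<in>carrier Mb. u = w \<oplus>\<^bsub>F\<^esub> i t" if uw: "u \<in> carrier F" "w \<in> carrier F" "p u = p w" for u w
  proof -
    have "p (u \<ominus>\<^bsub>F\<^esub> w) = \<zero>\<^bsub>Mc\<^esub>"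
      using uw ph lmod_hom_minus(2)[OF x(2,3,5)] by (simp add: F.M.minus_eq Mc.M.r_neg)
    then have "u \<ominus>\<^bsub>F\<^esub> w \<in> i ` carrier Mb"
      unfolding x(8) using F.M.minus_closed[OF uw(1,2)] by simp
    then obtain t where "t \<in> carrier Mb" "u \<ominus>\<^bsub>F\<^esub> w = i t" by (elim imageE) auto
    moreover have "w \<oplus>\<^bsub>F\<^esub> (u \<ominus>\<^bsub>F\<^esub> w) = u"
      using uw by (simp add: F.M.minus_eq F.M.a_ac F.M.r_neg2 F.M.r_neg)
    ultimately show ?thesis by (intro bexI[of _ t]) simp_all
  qed
  have act_c: "actc a v \<in> carrier Mc" if "a \<in> arcs Q" for a v
    using that by (simp add: M.carrier_M M.act_bound)
  have ac: "ar a \<odot>\<^bsub>F\<^esub> w \<in> carrier F" if "a \<in> arcs Q" "w \<in> carrier F" for a w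
    using that by (simp add: F.smult_closed ar_carrier)
  have "\<exists>t\<in>carrier Mb. ar a \<odot>\<^bsub>F\<^esub> z j = s (actc a (unit j)) \<oplus>\<^bsub>F\<^esub> i t" if "a \<in> arcs Q" "j < nc" for a j
    using that by (intro ker) (auto simp: ac zc s_c ph ar_carrier pz p_s act_c M.rep_arrow)
  then obtain t where tc: "\<And>a j. a \<in> arcs Q \<Longrightarrow> j < nc \<Longrightarrow> t a j \<in> carrier Mb"
    and t: "\<And>a j. a \<in> arcs Q \<Longrightarrow> j < nc \<Longrightarrow> ar a \<odot>\<^bsub>F\<^esub> z j = s (actc a (unit j)) \<oplus>\<^bsub>F\<^esub> i (t a j)"
    by metis
  define T where "T a i j = (if a \<in> arcs Q \<and> j < nc then t a j i else 0)" for a i j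
  have ic: "i u \<in> carrier F" if "u \<in> carrier Mb" for u using ih(1) that .
  have mat_T: "mat T a v = (\<lambda>i. \<Sum>j<nc. v j * t a j i)" if "a \<in> arcs Q" for a v
    using tc that by (auto simp: mat_def T_def N.carrier_M mult.commute intro!: ext)
  have mat_c: "mat T a v \<in> carrier Mb" for a v by (simp add: N.carrier_M mat_bound)
  have s_arrow: "ar a \<odot>\<^bsub>F\<^esub> s v = s (actc a v) \<oplus>\<^bsub>F\<^esub> i (mat T a v)" if a: "a \<in> arcs Q" for a v
  proof -
    have c1: "(\<lambda>i. v j * t a j i) \<in> carrier Mb" if "j < nc" for j
      using tc[OF a that] by (simp add: N.carrier_M)
    have "ar a \<odot>\<^bsub>F\<^esub> s v = (\<Oplus>\<^bsub>F\<^esub>j\<in>{..<nc}. ar a \<odot>\<^bsub>F\<^esub> (sc (v j) \<odot>\<^bsub>F\<^esub> z j))"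
      unfolding s_def by (rule F.smult_finsum[OF ar_carrier[OF a] termc])
    also have "\<dots> = (\<Oplus>\<^bsub>F\<^esub>j\<in>{..<nc}. s (\<lambda>i. v j * actc a (unit j) i) \<oplus>\<^bsub>F\<^esub> i (\<lambda>i. v j * t a j i))"
    proof (rule F.M.finsum_cong')
      fix j assume "j \<in> {..<nc}"
      then have j: "j < nc" by simp
      have "ar a \<odot>\<^bsub>F\<^esub> (sc (v j) \<odot>\<^bsub>F\<^esub> z j) = sc (v j) \<odot>\<^bsub>F\<^esub> (s (actc a (unit j)) \<oplus>\<^bsub>F\<^esub> i (t a j))"
        using sc_smult[OF ar_carrier[OF a] zc[OF j]] t[OF a j] by simp
      also have "\<dots> = s (\<lambda>i. v j * actc a (unit j) i) \<oplus>\<^bsub>F\<^esub> i (sc (v j) \<odot>\<^bsub>Mb\<^esub> t a j)"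
        by (simp add: F.smult_r_distr sc_carrier s_c ic tc[OF a j] s_scale ih(3))
      finally show "ar a \<odot>\<^bsub>F\<^esub> (sc (v j) \<odot>\<^bsub>F\<^esub> z j) = s (\<lambda>i. v j * actc a (unit j) i) \<oplus>\<^bsub>F\<^esub> i (\<lambda>i. v j * t a j i)"
        by (simp add: N.rep_scalar tc[OF a j])
    qed (use c1 in \<open>auto simp: s_c ic\<close>)
    also have "\<dots> = (\<Oplus>\<^bsub>F\<^esub>j\<in>{..<nc}. s (\<lambda>i. v j * actc a (unit j) i)) \<oplus>\<^bsub>F\<^esub> (\<Oplus>\<^bsub>F\<^esub>j\<in>{..<nc}. i (\<lambda>i. v j * t a j i))"
      by (rule F.M.finsum_addf) (use c1 in \<open>auto simp: s_c ic\<close>)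
    also have "(\<Oplus>\<^bsub>F\<^esub>j\<in>{..<nc}. s (\<lambda>i. v j * actc a (unit j) i)) = s (actc a v)"
    proof -
      have "actc a v = actc a (\<lambda>i. \<Sum>j<nc. v j * unit j i)"
        by (rule M.act_cong[OF a]) (auto simp: unit_def if_distrib[of "\<lambda>t. _ * t"] cong: if_cong)
      also have "\<dots> = (\<lambda>i. \<Sum>j<nc. v j * actc a (unit j) i)"
        by (simp add: M.act_sum[OF a] M.act_scale[OF a])
      finally show ?thesis by (simp add: s_sum)
    qed
    also have "(\<Oplus>\<^bsub>F\<^esub>j\<in>{..<nc}. i (\<lambda>i. v j * t a j i)) = i (mat T a v)"
    proof -
      have "(\<lambda>j i. v j * t a j i) \<in> {..<nc} \<rightarrow> carrier Mb" using c1 by auto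
      then have "i (\<Oplus>\<^bsub>Mb\<^esub>j\<in>{..<nc}. (\<lambda>i. v j * t a j i)) = (\<Oplus>\<^bsub>F\<^esub>j\<in>{..<nc}. i (\<lambda>i. v j * t a j i))"
        using lmod_hom_finsum[OF x(1,2,4), of "\<lambda>j i. v j * t a j i"] by simp
      then show ?thesis using c1 by (simp add: N.finsum_M mat_T[OF a])
    qed
    finally show ?thesis .
  qed
  have cancel: "u = w" if "u \<in> carrier Mb" "w \<in> carrier Mb" "y \<in> carrier F" "y \<oplus>\<^bsub>F\<^esub> i u = y \<oplus>\<^bsub>F\<^esub> i w" for u w y
    using that x(6) ic by (auto simp: inj_on_def)
  have act0: "actc a (\<lambda>_. 0) = (\<lambda>_. 0)" if "a \<in> arcs Q" for a using M.act_zero that .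
  have "cocycle T"
    unfolding cocycle_def
  proof (intro conjI allI ballI impI)
    fix a k j assume nz: "T a k j \<noteq> 0"
    then show a: "a \<in> arcs Q" and j: "j < nc" by (auto simp: T_def split: if_splits)
    show "k < nb" using nz tc[OF a j] by (simp add: T_def a j N.carrier_M) (meson not_le)
    show "vb k = head Q a"
    proof (rule ccontr)
      assume v: "vb k \<noteq> head Q a"
      have h: "head Q a \<in> verts Q" using a by simp
      let ?t = "\<lambda>i. if vb i = head Q a then t a j i else 0"
      have "ar a \<odot>\<^bsub>F\<^esub> z j = vt (head Q a) \<odot>\<^bsub>F\<^esub> (ar a \<odot>\<^bsub>F\<^esub> z j)"
        using zc[OF j] by (simp add: F.smult_assoc1[symmetric] vt_carrier[OF h] ar_carrier[OF a] vt_ar[OF a])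
      also have "\<dots> = s (\<lambda>i. if vc i = head Q a then actc a (unit j) i else 0) \<oplus>\<^bsub>F\<^esub> i ?t"
        using tc[OF a j] by (simp add: t[OF a j] F.smult_r_distr vt_carrier[OF h] s_c ic s_vert[OF h]
            ih(3)[symmetric] N.rep_vert[OF h])
      also have "(\<lambda>i. if vc i = head Q a then actc a (unit j) i else 0) = actc a (unit j)"
        using M.act_supp[OF a, of "unit j"] by (intro ext) fastforce
      finally have "i (t a j) = i ?t"
        using tc[OF a j] by (simp add: t[OF a j] s_c ic N.carrier_M)
      moreover have "?t \<in> carrier Mb" using tc[OF a j] by (simp add: N.carrier_M)
      ultimately have "t a j = ?t" using x(6) tc[OF a j] by (simp add: inj_on_def)
      then have "t a j k = 0" using v by (metis (mono_tags))
      then show False using nz by (simp add: T_def a j)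
    qed
    show "vc j = tail Q a"
    proof (rule ccontr)
      assume v: "vc j \<noteq> tail Q a"
      have h: "tail Q a \<in> verts Q" using a by simp
      have "ar a \<odot>\<^bsub>F\<^esub> z j = ar a \<odot>\<^bsub>F\<^esub> (vt (tail Q a) \<odot>\<^bsub>F\<^esub> z j)"
        using zc[OF j] by (simp add: F.smult_assoc1[symmetric] vt_carrier[OF h] ar_carrier[OF a] ar_vt[OF a])
      also have "\<dots> = \<zero>\<^bsub>F\<^esub>" using v by (simp add: vz[OF j h] F.smult_zero ar_carrier[OF a])
      finally have "s (actc a (unit j)) \<oplus>\<^bsub>F\<^esub> i (t a j) = \<zero>\<^bsub>F\<^esub>" using t[OF a j] by simp
      moreover have "actc a (unit j) = actc a (\<lambda>_. 0)"
        using v by (intro M.act_cong[OF a]) (auto simp: unit_def)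
      ultimately have "i (t a j) = i \<zero>\<^bsub>Mb\<^esub>" using tc[OF a j] by (simp add: act0[OF a] s_zero ic i0)
      moreover have "\<zero>\<^bsub>Mb\<^esub> \<in> carrier Mb" by (simp add: N.carrier_M N.M_simps)
      ultimately have "t a j = \<zero>\<^bsub>Mb\<^esub>" using x(6) tc[OF a j] by (simp add: inj_on_def)
      then show False using nz by (simp add: T_def a j N.M_simps)
    qed
  next
    fix \<alpha> \<beta> v k assume *: "\<alpha> \<in> arcs Q" "\<beta> \<in> arcs Q" "head Q \<alpha> = tail Q \<beta>" "arrow_path Q [\<beta>, \<alpha>] \<in> I"
    let ?u = "actb \<beta> (mat T \<alpha> v)" and ?w = "mat T \<beta> (actc \<alpha> v)"
    have uc: "?u \<in> carrier Mb" using * by (simp add: N.carrier_M N.act_bound)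
    have iu: "ar \<beta> \<odot>\<^bsub>F\<^esub> i (mat T \<alpha> v) = i ?u"
      by (simp add: ih(3)[symmetric] ar_carrier[OF *(2)] mat_c N.rep_arrow[OF *(2)])
    have "\<zero>\<^bsub>F\<^esub> = ar \<beta> \<odot>\<^bsub>F\<^esub> (ar \<alpha> \<odot>\<^bsub>F\<^esub> s v)"
      using * by (simp add: F.smult_assoc1[symmetric] ar_carrier s_c ar_ar_zero F.zero_smult)
    also have "\<dots> = ar \<beta> \<odot>\<^bsub>F\<^esub> s (actc \<alpha> v) \<oplus>\<^bsub>F\<^esub> ar \<beta> \<odot>\<^bsub>F\<^esub> i (mat T \<alpha> v)"
      by (simp add: s_arrow[OF *(1)] F.smult_r_distr ar_carrier[OF *(2)] s_c ic mat_c)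
    also have "\<dots> = i ?w \<oplus>\<^bsub>F\<^esub> i ?u"
      by (simp add: s_arrow[OF *(2)] iu M.act_rel[OF *] s_zero ic mat_c)
    also have "\<dots> = i (?w \<oplus>\<^bsub>Mb\<^esub> ?u)" by (simp add: ih(2) mat_c uc)
    finally have "i (?w \<oplus>\<^bsub>Mb\<^esub> ?u) = i \<zero>\<^bsub>Mb\<^esub>" by (simp add: i0)
    moreover have "?w \<oplus>\<^bsub>Mb\<^esub> ?u \<in> carrier Mb" "\<zero>\<^bsub>Mb\<^esub> \<in> carrier Mb"
      using uc mat_c[of \<beta> "actc \<alpha> v"] by (simp_all add: N.carrier_M N.M_simps)
    ultimately have "?w \<oplus>\<^bsub>Mb\<^esub> ?u = \<zero>\<^bsub>Mb\<^esub>" using x(6) by (simp add: inj_on_def)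
    then have "?w k + ?u k = 0" by (simp add: N.M_simps) (metis)
    then show "?u k + ?w k = 0" by (simp add: add.commute)
  qed
  moreover from this have "ext_equiv L Mb (X T) (F, i, p)"
    by (rule X_equivI[OF _ \<xi>, where s = s]) (auto simp: s_c s_add s_scale s_vert s_arrow p_s)
  ultimately show ?thesis by blast
qed

end

context rep_pair
begin

text \<open>
  A linear section \<open>s\<close> of an extension that respects vertices; the cocycle \<open>T\<close> measures how far it is
  from a morphism.
\<close>

definition is_section ::
  "('a \<Rightarrow> nat \<Rightarrow> nat \<Rightarrow> 'k) \<Rightarrow> ((('v, 'a) path \<Rightarrow> 'k) set, nat \<Rightarrow> 'k, 'e, nat \<Rightarrow> 'k) extn \<Rightarrow> ((nat \<Rightarrow> 'k) \<Rightarrow> 'e) \<Rightarrow> bool"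
  where
  "is_section T \<xi> s \<longleftrightarrow> (case \<xi> of (F, i, p) \<Rightarrow>
    (\<forall>v\<in>carrier Mc. s v \<in> carrier F \<and> p (s v) = v \<and>
      (\<forall>u\<in>carrier Mc. s (\<lambda>i. u i + v i) = s u \<oplus>\<^bsub>F\<^esub> s v) \<and>
      (\<forall>\<kappa>. s (\<lambda>i. \<kappa> * v i) = sc \<kappa> \<odot>\<^bsub>F\<^esub> s v) \<and>
      (\<forall>x\<in>verts Q. s (\<lambda>i. if vc i = x then v i else 0) = vt x \<odot>\<^bsub>F\<^esub> s v) \<and>
      (\<forall>a\<in>arcs Q. ar a \<odot>\<^bsub>F\<^esub> s v = s (actc a v) \<oplus>\<^bsub>F\<^esub> i (mat T a v))))"

lemma sectionD:
  assumes "is_section T (F, i, p) s" and "v \<in> carrier Mc"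
  shows "s v \<in> carrier F" "p (s v) = v"
    "u \<in> carrier Mc \<Longrightarrow> s (\<lambda>i. u i + v i) = s u \<oplus>\<^bsub>F\<^esub> s v"
    "s (\<lambda>i. \<kappa> * v i) = sc \<kappa> \<odot>\<^bsub>F\<^esub> s v"
    "x \<in> verts Q \<Longrightarrow> s (\<lambda>i. if vc i = x then v i else 0) = vt x \<odot>\<^bsub>F\<^esub> s v"
    "a \<in> arcs Q \<Longrightarrow> ar a \<odot>\<^bsub>F\<^esub> s v = s (actc a v) \<oplus>\<^bsub>F\<^esub> i (mat T a v)"
  using assms by (simp_all add: is_section_def)

text \<open>
  An equivalence from the triangular extension is determined by the images of the second summand, and these
  form a section whose defect is the given cocycle.
\<close>

lemma equiv_iff_section:
  assumes T: "cocycle T" and \<xi>: "(F, i, p) \<in> extensions L Mc Mb"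
  shows "ext_equiv L Mb (X T) (F, i, p) \<longleftrightarrow> (\<exists>s. is_section T (F, i, p) s)"
proof
  assume "\<exists>s. is_section T (F, i, p) s"
  then obtain s where s: "is_section T (F, i, p) s" ..
  show "ext_equiv L Mb (X T) (F, i, p)"
    by (rule X_equivI[OF T \<xi>, where s = s]) (simp_all add: sectionD[OF s])
next
  assume "ext_equiv L Mb (X T) (F, i, p)"
  then obtain f where f: "f \<in> lmod_hom L (E T) F" "\<And>u. u \<in> carrier Mb \<Longrightarrow> f u = i u"
    "\<And>v. v \<in> carrier (E T) \<Longrightarrow> p (f v) = hi v"
    by (auto simp: X_def hi_def)
  note fh = lmod_homD[OF f(1)] and x = extensionsD[OF \<xi>]
  interpret E: quiver_rep Q I "nb + nc" evx "ext_act T" by (rule ext_rep[OF T])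
  interpret F: left_module L F by (rule x)
  define j where "j v = join (\<lambda>_. 0) v" for v
  have jl: "lo (j v) = (\<lambda>_. 0)" and jh: "hi (j v) = v" for v
    by (simp_all add: j_def join_simps) (simp add: lo_def)
  have jc: "v \<in> carrier Mc \<Longrightarrow> j v \<in> carrier (E T)" for v
    unfolding j_def by (rule join_E)
  have "is_section T (F, i, p) (\<lambda>v. f (j v))"
    unfolding is_section_def prod.case
  proof (intro ballI conjI allI)
    fix v assume v: "v \<in> carrier Mc"
    show "f (j v) \<in> carrier F" using fh(1) jc[OF v] .
    show "p (f (j v)) = v" using f(3)[OF jc[OF v]] jh by simp
    show "f (j (\<lambda>i. u i + v i)) = f (j u) \<oplus>\<^bsub>F\<^esub> f (j v)" if u: "u \<in> carrier Mc" for u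
    proof -
      have "j (\<lambda>i. u i + v i) = j u \<oplus>\<^bsub>E T\<^esub> j v"
        by (auto simp: j_def join_def E.M_simps)
      then show ?thesis using fh(2) jc u v by simp
    qed
    show "f (j (\<lambda>i. \<kappa> * v i)) = sc \<kappa> \<odot>\<^bsub>F\<^esub> f (j v)" for \<kappa>
    proof -
      have "j (\<lambda>i. \<kappa> * v i) = sc \<kappa> \<odot>\<^bsub>E T\<^esub> j v"
        unfolding E.rep_scalar[OF jc[OF v]] by (auto simp: j_def join_def)
      then show ?thesis using fh(3) jc v sc_carrier by simp
    qed
    show "f (j (\<lambda>i. if vc i = x then v i else 0)) = vt x \<odot>\<^bsub>F\<^esub> f (j v)" if x: "x \<in> verts Q" for x
    proof -
      have "j (\<lambda>i. if vc i = x then v i else 0) = vt x \<odot>\<^bsub>E T\<^esub> j v"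
        unfolding E.rep_vert[OF x] by (auto simp: j_def join_def evx_def)
      then show ?thesis using fh(3) jc v vt_carrier[OF x] by simp
    qed
    show "ar a \<odot>\<^bsub>F\<^esub> f (j v) = f (j (actc a v)) \<oplus>\<^bsub>F\<^esub> i (mat T a v)" if a: "a \<in> arcs Q" for a
    proof -
      have mc: "mat T a v \<in> carrier Mb" by (simp add: N.carrier_M mat_bound)
      have ac: "actc a v \<in> carrier Mc" by (simp add: M.carrier_M M.act_bound[OF a])
      have "ar a \<odot>\<^bsub>E T\<^esub> j v = j (actc a v) \<oplus>\<^bsub>E T\<^esub> mat T a v"
        unfolding E.rep_arrow[OF a] E.M_simps
        by (rule vec_eqI) (simp_all add: lo_ext_act[OF a] hi_ext_act lo_add hi_add jl jh lo_Mb[OF mc] hi_Mb[OF mc] N.act_zero[OF a])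
      moreover have "f (ar a \<odot>\<^bsub>E T\<^esub> j v) = ar a \<odot>\<^bsub>F\<^esub> f (j v)"
        using fh(3) ar_carrier[OF a] jc[OF v] .
      moreover have "f (j (actc a v) \<oplus>\<^bsub>E T\<^esub> mat T a v) = f (j (actc a v)) \<oplus>\<^bsub>F\<^esub> f (mat T a v)"
        using fh(2) jc[OF ac] Mb_E[OF mc] .
      ultimately show ?thesis using f(2)[OF mc] by simp
    qed
  qed
  then show "\<exists>s. is_section T (F, i, p) s" by blast
qed

text \<open>
  An equivalence between two triangular extensions is unipotent; its corner is the map \<open>h\<close> whose coboundary is
  the difference of the cocycles.
\<close>

lemma equiv_X_iff:
  assumes T: "cocycle T" and T': "cocycle T'"
  shows "ext_equiv L Mb (X T) (X T') \<longleftrightarrow> (\<exists>h. coboundary h (\<lambda>a i j. T a i j - T' a i j))"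
proof -
  interpret E': quiver_rep Q I "nb + nc" evx "ext_act T'" by (rule ext_rep[OF T'])
  have X': "X T' = (E T', \<lambda>u. u, \<lambda>v i. v (nb + i))" by (simp add: X_def)
  note eq = equiv_iff_section[OF T X_extension[OF T', unfolded X']]
  show ?thesis unfolding X' eq
  proof
    assume "\<exists>s. is_section T (E T', \<lambda>u. u, \<lambda>v i. v (nb + i)) s"
    then obtain s where "is_section T (E T', \<lambda>u. u, \<lambda>v i. v (nb + i)) s" ..
    note s = sectionD[OF this]
    define unit :: "nat \<Rightarrow> nat \<Rightarrow> 'k" where "unit j = (\<lambda>i. if i = j then 1 else 0)" for j
    have unit_c: "unit j \<in> carrier Mc" if "j < nc" for j using that by (simp add: unit_def M.carrier_M)
    define h where "h i j = (if i < nb \<and> j < nc then s (unit j) i else 0)" for i j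
    have hi_s: "hi (s v) = v" if "v \<in> carrier Mc" for v using s(2)[OF that] by (simp add: hi_def)
    have z: "(\<lambda>_. 0) \<in> carrier Mc" by (simp add: M.carrier_M)
    have s_add: "s (\<lambda>i. u i + v i) = (\<lambda>i. s u i + s v i)" if "u \<in> carrier Mc" "v \<in> carrier Mc" for u v
      using s(3)[OF that(2,1)] by (simp add: E'.M_simps)
    have s_scale: "s (\<lambda>i. \<kappa> * v i) = (\<lambda>i. \<kappa> * s v i)" if "v \<in> carrier Mc" for \<kappa> v
      using s(4)[OF that, of \<kappa>] E'.rep_scalar[OF s(1)[OF that]] by simp
    have s_zero: "s (\<lambda>_. 0) = (\<lambda>_. 0)" using s_scale[OF z, of 0] by simp
    have s_sum: "s (\<lambda>i. \<Sum>j\<in>J. g j i) = (\<lambda>i. \<Sum>j\<in>J. s (g j) i) \<and> (\<lambda>i. \<Sum>j\<in>J. g j i) \<in> carrier Mc"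
      if "finite J" "\<And>j. j \<in> J \<Longrightarrow> g j \<in> carrier Mc" for g :: "nat \<Rightarrow> nat \<Rightarrow> 'k" and J
      using that by (induction J rule: finite_induct) (auto simp: s_zero z s_add, auto simp: M.carrier_M)
    have lo_s: "lo (s v) = mat (\<lambda>_. h) a v" if v: "v \<in> carrier Mc" for v a
    proof -
      have "v = (\<lambda>i. \<Sum>j<nc. v j * unit j i)"
        using v by (auto simp: unit_def M.carrier_M if_distrib[of "\<lambda>t. _ * t"] cong: if_cong)
      then have "s v = s (\<lambda>i. \<Sum>j<nc. v j * unit j i)" by simp
      also have "\<dots> = (\<lambda>i. \<Sum>j<nc. s (\<lambda>i. v j * unit j i) i)"
        by (rule conjunct1[OF s_sum]) (auto simp: unit_def M.carrier_M)
      also have "\<dots> = (\<lambda>i. \<Sum>j<nc. v j * s (unit j) i)"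
        by (simp add: s_scale unit_c)
      finally show ?thesis
        by (auto simp: lo_def mat_def h_def mult.commute intro!: ext sum.cong)
    qed
    have "coboundary h (\<lambda>a i j. T a i j - T' a i j)"
      unfolding coboundary_def
    proof (intro conjI allI ballI impI)
      fix i j assume nz: "h i j \<noteq> 0"
      then show i: "i < nb" and j: "j < nc" by (auto simp: h_def split: if_splits)
      have "(\<lambda>i. if vc i = vc j then unit j i else 0) = unit j" by (auto simp: unit_def)
      then have "s (unit j) = (\<lambda>i. if evx i = vc j then s (unit j) i else 0)"
        using s(5)[OF unit_c[OF j] M.vx_vert[OF j]] E'.rep_vert[OF M.vx_vert[OF j]] by simp
      then have "s (unit j) i = (if evx i = vc j then s (unit j) i else 0)" by (rule fun_cong)
      then show "vb i = vc j" using nz i j by (auto simp: h_def evx_def split: if_splits)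
    next
      fix a and v :: "nat \<Rightarrow> 'k" and i assume a: "a \<in> arcs Q"
      define w where "w = (\<lambda>i. if i < nc then v i else 0)"
      have w: "w \<in> carrier Mc" by (simp add: w_def M.carrier_M)
      have ac: "actc a w \<in> carrier Mc" by (simp add: M.carrier_M M.act_bound[OF a])
      have mc: "mat T a w \<in> carrier Mb" by (simp add: N.carrier_M mat_bound)
      have "ext_act T' a (s w) = (\<lambda>i. s (actc a w) i + mat T a w i)"
        using s(6)[OF w a] by (simp add: E'.rep_arrow[OF a] E'.M_simps)
      then have "lo (ext_act T' a (s w)) = lo (\<lambda>i. s (actc a w) i + mat T a w i)" by simp
      then have "(\<lambda>i. actb a (lo (s w)) i + mat T' a w i) = (\<lambda>i. lo (s (actc a w)) i + mat T a w i)"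
        by (simp add: lo_ext_act[OF a] lo_add hi_s[OF w] lo_Mb[OF mc])
      then have "actb a (mat (\<lambda>_. h) a w) i + mat T' a w i = mat (\<lambda>_. h) a (actc a w) i + mat T a w i"
        unfolding lo_s[OF w, of a] lo_s[OF ac, of a] by (rule fun_cong)
      moreover have "mat S a w = mat S a v" for S by (rule mat_cong) (simp add: w_def)
      moreover have "actc a w = actc a v" by (rule M.act_cong[OF a]) (simp add: w_def)
      ultimately show "mat (\<lambda>a i j. T a i j - T' a i j) a v i =
          actb a (mat (\<lambda>_. h) a v) i - mat (\<lambda>_. h) a (actc a v) i"
        by (simp add: mat_T_diff algebra_simps)
    qed
    then show "\<exists>h. coboundary h (\<lambda>a i j. T a i j - T' a i j)" by blast
  next
    assume "\<exists>h. coboundary h (\<lambda>a i j. T a i j - T' a i j)"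
    then obtain h where cb: "coboundary h (\<lambda>a i j. T a i j - T' a i j)" ..
    have h: "i < nb \<and> j < nc \<and> vb i = vc j" if "h i j \<noteq> 0" for i j
      using cb that unfolding coboundary_def by blast
    have cob: "mat (\<lambda>a i j. T a i j - T' a i j) a v i =
        actb a (mat (\<lambda>_. h) a v) i - mat (\<lambda>_. h) a (actc a v) i" if "a \<in> arcs Q" for a v i
      using cb that unfolding coboundary_def by blast
    define H where "H = mat (\<lambda>_. h) undefined"
    have H: "mat (\<lambda>_. h) a v = H v" for a v by (simp add: H_def mat_def)
    have Hc: "H v \<in> carrier Mb" for v by (simp add: H_def N.carrier_M mat_bound)
    have Hadd: "H (\<lambda>i. u i + v i) = (\<lambda>i. H u i + H v i)" for u v by (simp add: H_def mat_add)
    have Hscale: "H (\<lambda>i. \<kappa> * v i) = (\<lambda>i. \<kappa> * H v i)" for \<kappa> v by (simp add: H_def mat_scale)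
    have Hvert: "H (\<lambda>i. if vc i = x then v i else 0) = (\<lambda>i. if vb i = x then H v i else 0)" for x v
    proof
      fix i
      have "h i j * (if vc j = x then v j else 0) = (if vb i = x then h i j * v j else 0)" for j
        using h[of i j] by (cases "h i j = 0") auto
      then show "H (\<lambda>i. if vc i = x then v i else 0) i = (if vb i = x then H v i else 0)"
        by (auto simp: H_def mat_def)
    qed
    have jl: "lo (join (H v) v) = H v" and jh: "hi (join (H v) v) = v" for v
      using lo_Mb[OF Hc] by (simp_all add: join_simps)
    have jc: "v \<in> carrier Mc \<Longrightarrow> join (H v) v \<in> carrier (E T')" for v by (rule join_E)
    have "is_section T (E T', \<lambda>u. u, \<lambda>v i. v (nb + i)) (\<lambda>v. join (H v) v)"
      unfolding is_section_def prod.case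
    proof (intro ballI conjI allI)
      fix v assume v: "v \<in> carrier Mc"
      show "join (H v) v \<in> carrier (E T')" using jc[OF v] .
      show "(\<lambda>i. join (H v) v (nb + i)) = v" by (simp add: join_def)
      show "join (H (\<lambda>i. u i + v i)) (\<lambda>i. u i + v i) = join (H u) u \<oplus>\<^bsub>E T'\<^esub> join (H v) v" for u
        by (auto simp: join_def E'.M_simps Hadd)
      show "join (H (\<lambda>i. \<kappa> * v i)) (\<lambda>i. \<kappa> * v i) = sc \<kappa> \<odot>\<^bsub>E T'\<^esub> join (H v) v" for \<kappa>
        unfolding E'.rep_scalar[OF jc[OF v]] by (auto simp: join_def Hscale)
      show "join (H (\<lambda>i. if vc i = x then v i else 0)) (\<lambda>i. if vc i = x then v i else 0) =
          vt x \<odot>\<^bsub>E T'\<^esub> join (H v) v" if x: "x \<in> verts Q" for x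
        unfolding E'.rep_vert[OF x] by (auto simp: join_def evx_def Hvert)
      show "ar a \<odot>\<^bsub>E T'\<^esub> join (H v) v = join (H (actc a v)) (actc a v) \<oplus>\<^bsub>E T'\<^esub> mat T a v" if a: "a \<in> arcs Q" for a
      proof -
        have mc: "mat T a v \<in> carrier Mb" by (simp add: N.carrier_M mat_bound)
        have "actb a (H v) i + mat T' a v i = H (actc a v) i + mat T a v i" for i
          using cob[OF a, of v i] by (simp add: mat_T_diff H algebra_simps)
        then show ?thesis
          unfolding E'.rep_arrow[OF a] E'.M_simps
          by - (rule vec_eqI, simp_all add: lo_ext_act[OF a] hi_ext_act lo_add hi_add jl jh lo_Mb[OF mc] hi_Mb[OF mc])
      qed
    qed
    then show "\<exists>s. is_section T (E T', \<lambda>u. u, \<lambda>v i. v (nb + i)) s" by blast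
  qed
qed


lemma cocycle_zero: "cocycle (\<lambda>_ _ _. 0)"
proof -
  have "mat (\<lambda>_ _ _. 0) a v = (\<lambda>_. 0)" for a v by (auto simp: mat_def)
  then show ?thesis by (simp add: cocycle_def N.act_zero)
qed

lemma cocycle_add: "cocycle T \<Longrightarrow> cocycle T' \<Longrightarrow> cocycle (\<lambda>a i j. T a i j + T' a i j)"
proof -
  assume T: "cocycle T" and T': "cocycle T'"
  show ?thesis unfolding cocycle_def
  proof (intro conjI allI ballI impI)
    fix a i j assume "T a i j + T' a i j \<noteq> 0"
    then have "T a i j \<noteq> 0 \<or> T' a i j \<noteq> 0" by auto
    then have "a \<in> arcs Q \<and> i < nb \<and> j < nc \<and> vb i = head Q a \<and> vc j = tail Q a"
      using cocycle_supp T T' by blast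
    then show "a \<in> arcs Q" "i < nb" "j < nc" "vb i = head Q a" "vc j = tail Q a" by auto
  next
    fix \<alpha> \<beta> v i assume *: "\<alpha> \<in> arcs Q" "\<beta> \<in> arcs Q" "head Q \<alpha> = tail Q \<beta>" "arrow_path Q [\<beta>, \<alpha>] \<in> I"
    show "actb \<beta> (mat (\<lambda>a i j. T a i j + T' a i j) \<alpha> v) i + mat (\<lambda>a i j. T a i j + T' a i j) \<beta> (actc \<alpha> v) i = 0"
      using cocycle_rel[OF T *, of v i] cocycle_rel[OF T' *, of v i] *(2)
      by (simp add: mat_T_add N.act_add algebra_simps)
  qed
qed

lemma cocycle_scale: "cocycle T \<Longrightarrow> cocycle (\<lambda>a i j. \<kappa> * T a i j)"
proof -
  assume T: "cocycle T"
  show ?thesis unfolding cocycle_def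
  proof (intro conjI allI ballI impI)
    fix a i j assume "\<kappa> * T a i j \<noteq> 0"
    then have "a \<in> arcs Q \<and> i < nb \<and> j < nc \<and> vb i = head Q a \<and> vc j = tail Q a"
      using cocycle_supp T by auto
    then show "a \<in> arcs Q" "i < nb" "j < nc" "vb i = head Q a" "vc j = tail Q a" by auto
  next
    fix \<alpha> \<beta> v i assume *: "\<alpha> \<in> arcs Q" "\<beta> \<in> arcs Q" "head Q \<alpha> = tail Q \<beta>" "arrow_path Q [\<beta>, \<alpha>] \<in> I"
    show "actb \<beta> (mat (\<lambda>a i j. \<kappa> * T a i j) \<alpha> v) i + mat (\<lambda>a i j. \<kappa> * T a i j) \<beta> (actc \<alpha> v) i = 0"
      using cocycle_rel[OF T *, of v i] *(2)
      by (simp add: mat_T_scale N.act_scale distrib_left[symmetric])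
  qed
qed

lemma cocycle_sum:
  "finite J \<Longrightarrow> (\<And>x. x \<in> J \<Longrightarrow> cocycle (Tf x)) \<Longrightarrow> cocycle (\<lambda>a i j. \<Sum>x\<in>J. \<kappa> x * Tf x a i j)"
proof (induction J rule: finite_induct)
  case empty then show ?case by (simp add: cocycle_zero)
next
  case (insert x J)
  then show ?case
    using cocycle_add[OF cocycle_scale[of "Tf x" "\<kappa> x"], of "\<lambda>a i j. \<Sum>x\<in>J. \<kappa> x * Tf x a i j"] by simp
qed

text \<open>
  Applying the addition morphism of the Baer sum to a pair of sections gives a section of the sum.
\<close>

lemma section_baer_sum:
  assumes \<xi>: "\<xi>\<^sub>1 = (F1, i1, p1)" "\<xi>\<^sub>2 = (F2, i2, p2)" "\<xi> = (F, i, p)"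
    and ext: "\<xi>\<^sub>1 \<in> extensions L Mc Mb" "\<xi>\<^sub>2 \<in> extensions L Mc Mb" "\<xi> \<in> extensions L Mc Mb"
    and s1: "is_section T1 \<xi>\<^sub>1 s1" and s2: "is_section T2 \<xi>\<^sub>2 s2" and sum: "baer_sum L Mb \<xi>\<^sub>1 \<xi>\<^sub>2 \<xi>"
  shows "\<exists>s. is_section (\<lambda>a i j. T1 a i j + T2 a i j) \<xi> s"
proof -
  define P where "P = {(x, y). x \<in> carrier F1 \<and> y \<in> carrier F2 \<and> p1 x = p2 y}"
  obtain g where g: "g \<in> P \<rightarrow> carrier F"
    and g_add': "\<forall>(x, y)\<in>P. \<forall>(x', y')\<in>P. g (x \<oplus>\<^bsub>F1\<^esub> x', y \<oplus>\<^bsub>F2\<^esub> y') = g (x, y) \<oplus>\<^bsub>F\<^esub> g (x', y')"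
    and g_sm': "\<forall>r\<in>carrier L. \<forall>(x, y)\<in>P. g (r \<odot>\<^bsub>F1\<^esub> x, r \<odot>\<^bsub>F2\<^esub> y) = r \<odot>\<^bsub>F\<^esub> g (x, y)"
    and g_i: "\<forall>u\<in>carrier Mb. \<forall>v\<in>carrier Mb. g (i1 u, i2 v) = i (u \<oplus>\<^bsub>Mb\<^esub> v)"
    and g_p': "\<forall>(x, y)\<in>P. p (g (x, y)) = p1 x"
    using sum unfolding \<xi> baer_sum.simps Let_def P_def[symmetric] by blast
  have g_add: "g (x \<oplus>\<^bsub>F1\<^esub> x', y \<oplus>\<^bsub>F2\<^esub> y') = g (x, y) \<oplus>\<^bsub>F\<^esub> g (x', y')" if "(x, y) \<in> P" "(x', y') \<in> P" for x y x' y'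
    using g_add' that by fast
  have g_sm: "g (r \<odot>\<^bsub>F1\<^esub> x, r \<odot>\<^bsub>F2\<^esub> y) = r \<odot>\<^bsub>F\<^esub> g (x, y)" if "r \<in> carrier L" "(x, y) \<in> P" for r x y
    using g_sm' that by fast
  have g_p: "p (g (x, y)) = p1 x" if "(x, y) \<in> P" for x y using g_p' that by fast
  note x1 = extensionsD[OF ext(1)[unfolded \<xi>]] and x2 = extensionsD[OF ext(2)[unfolded \<xi>]]
  note s1 = sectionD[OF s1[unfolded \<xi>]] and s2 = sectionD[OF s2[unfolded \<xi>]]
  have sP: "(s1 v, s2 v) \<in> P" if "v \<in> carrier Mc" for v
    using s1(1,2)[OF that] s2(1,2)[OF that] by (simp add: P_def)
  have iP: "(i1 u, i2 w) \<in> P" if u: "u \<in> carrier Mb" and w: "w \<in> carrier Mb" for u w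
  proof -
    have "i1 u \<in> {x \<in> carrier F1. p1 x = \<zero>\<^bsub>Mc\<^esub>}" unfolding x1(8)[symmetric] using u by blast
    moreover have "i2 w \<in> {x \<in> carrier F2. p2 x = \<zero>\<^bsub>Mc\<^esub>}" unfolding x2(8)[symmetric] using w by blast
    ultimately show ?thesis by (simp add: P_def)
  qed
  have "is_section (\<lambda>a i j. T1 a i j + T2 a i j) (F, i, p) (\<lambda>v. g (s1 v, s2 v))"
    unfolding is_section_def prod.case
  proof (intro ballI conjI allI)
    fix v assume v: "v \<in> carrier Mc"
    show "g (s1 v, s2 v) \<in> carrier F" using g sP[OF v] by blast
    show "p (g (s1 v, s2 v)) = v" using g_p[OF sP[OF v]] s1(2)[OF v] by simp
    show "g (s1 (\<lambda>i. u i + v i), s2 (\<lambda>i. u i + v i)) = g (s1 u, s2 u) \<oplus>\<^bsub>F\<^esub> g (s1 v, s2 v)"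
      if u: "u \<in> carrier Mc" for u
      unfolding s1(3)[OF v u] s2(3)[OF v u] by (rule g_add[OF sP[OF u] sP[OF v]])
    show "g (s1 (\<lambda>i. \<kappa> * v i), s2 (\<lambda>i. \<kappa> * v i)) = sc \<kappa> \<odot>\<^bsub>F\<^esub> g (s1 v, s2 v)" for \<kappa>
      unfolding s1(4)[OF v] s2(4)[OF v] by (rule g_sm[OF sc_carrier sP[OF v]])
    show "g (s1 (\<lambda>i. if vc i = x then v i else 0), s2 (\<lambda>i. if vc i = x then v i else 0)) =
        vt x \<odot>\<^bsub>F\<^esub> g (s1 v, s2 v)" if x: "x \<in> verts Q" for x
      unfolding s1(5)[OF v x] s2(5)[OF v x] by (rule g_sm[OF vt_carrier[OF x] sP[OF v]])
    show "ar a \<odot>\<^bsub>F\<^esub> g (s1 v, s2 v) =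
        g (s1 (actc a v), s2 (actc a v)) \<oplus>\<^bsub>F\<^esub> i (mat (\<lambda>a i j. T1 a i j + T2 a i j) a v)"
      if a: "a \<in> arcs Q" for a
    proof -
      have ac: "actc a v \<in> carrier Mc" by (simp add: M.carrier_M M.act_bound[OF a])
      have mc: "mat T1 a v \<in> carrier Mb" "mat T2 a v \<in> carrier Mb" by (simp_all add: N.carrier_M mat_bound)
      have "ar a \<odot>\<^bsub>F\<^esub> g (s1 v, s2 v) = g (ar a \<odot>\<^bsub>F1\<^esub> s1 v, ar a \<odot>\<^bsub>F2\<^esub> s2 v)"
        by (rule g_sm[OF ar_carrier[OF a] sP[OF v], symmetric])
      also have "\<dots> = g (s1 (actc a v), s2 (actc a v)) \<oplus>\<^bsub>F\<^esub> g (i1 (mat T1 a v), i2 (mat T2 a v))"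
        unfolding s1(6)[OF v a] s2(6)[OF v a] by (rule g_add[OF sP[OF ac] iP[OF mc]])
      also have "g (i1 (mat T1 a v), i2 (mat T2 a v)) = i (mat (\<lambda>a i j. T1 a i j + T2 a i j) a v)"
        using g_i mc by (simp add: mat_T_add N.M_simps)
      finally show ?thesis .
    qed
  qed
  then show ?thesis unfolding \<xi> by blast
qed

text \<open>
  The Baer sum adds sections, hence cocycles. With this lemma and the next one the space of Yoneda classes
  becomes the space of cocycles modulo coboundaries.
\<close>

lemma baer_sum_X:
  assumes T1: "cocycle T1" and T2: "cocycle T2" and \<xi>: "(F, i, p) \<in> extensions L Mc Mb"
    and eq: "ext_equiv L Mb (X (\<lambda>a i j. T1 a i j + T2 a i j)) (F, i, p)"
  shows "baer_sum L Mb (X T1) (X T2) (F, i, p)"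
proof -
  let ?T = "\<lambda>a i j. T1 a i j + T2 a i j"
  interpret E1: quiver_rep Q I "nb + nc" evx "ext_act T1" by (rule ext_rep[OF T1])
  interpret E2: quiver_rep Q I "nb + nc" evx "ext_act T2" by (rule ext_rep[OF T2])
  interpret E3: quiver_rep Q I "nb + nc" evx "ext_act ?T" by (rule ext_rep[OF cocycle_add[OF T1 T2]])
  interpret L1: left_module L "E T1" by (rule E1.left_module_M)
  interpret L2: left_module L "E T2" by (rule E2.left_module_M)
  interpret L3: left_module L "E ?T" by (rule E3.left_module_M)
  obtain f where f: "f \<in> lmod_hom L (E ?T) F" "\<And>u. u \<in> carrier Mb \<Longrightarrow> f u = i u"
    "\<And>v. v \<in> carrier (E ?T) \<Longrightarrow> p (f v) = hi v"
    using eq by (auto simp: X_def hi_def)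
  note fh = lmod_homD[OF f(1)]
  define P where "P = {(x, y). x \<in> carrier (E T1) \<and> y \<in> carrier (E T2) \<and> hi x = hi y}"
  (* the addition morphism of the Baer sum in coordinates *)
  define K where "K = (\<lambda>(x, y). join (\<lambda>i. lo x i + lo y i) (hi x))"
  have Kl: "lo (K (x, y)) = (\<lambda>i. lo x i + lo y i)" and Kh: "hi (K (x, y)) = hi x" for x y
    by (simp_all add: K_def join_simps) (auto simp: lo_def)
  have Kc: "K z \<in> carrier (E ?T)" if "z \<in> P" for z
    using that by (auto simp: K_def P_def intro!: join_E hi_carrier)
  have K_add: "K (x \<oplus>\<^bsub>E T1\<^esub> x', y \<oplus>\<^bsub>E T2\<^esub> y') = K (x, y) \<oplus>\<^bsub>E ?T\<^esub> K (x', y')" for x x' y y'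
    by (rule vec_eqI) (auto simp: E1.M_simps E2.M_simps E3.M_simps lo_add hi_add Kl Kh)
  have P_add: "(x \<oplus>\<^bsub>E T1\<^esub> x', y \<oplus>\<^bsub>E T2\<^esub> y') \<in> P" if "(x, y) \<in> P" "(x', y') \<in> P" for x x' y y'
    using that L1.M.add.m_closed L2.M.add.m_closed by (auto simp: P_def E1.M_simps E2.M_simps hi_add)
  have Kr: "carrier L \<subseteq> {r. \<forall>z\<in>P. (r \<odot>\<^bsub>E T1\<^esub> fst z, r \<odot>\<^bsub>E T2\<^esub> snd z) \<in> P \<and>
      K (r \<odot>\<^bsub>E T1\<^esub> fst z, r \<odot>\<^bsub>E T2\<^esub> snd z) = r \<odot>\<^bsub>E ?T\<^esub> K z}" (is "_ \<subseteq> ?R")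
  proof (rule generated_by_arrows)
    show "sc \<kappa> \<in> ?R" for \<kappa>
    proof (clarsimp, rule conjI)
      fix x y assume P: "(x, y) \<in> P"
      then have c: "x \<in> carrier (E T1)" "y \<in> carrier (E T2)" "hi x = hi y" by (auto simp: P_def)
      show "(sc \<kappa> \<odot>\<^bsub>E T1\<^esub> x, sc \<kappa> \<odot>\<^bsub>E T2\<^esub> y) \<in> P"
        using c L1.smult_closed[OF sc_carrier c(1)] L2.smult_closed[OF sc_carrier c(2)]
        by (simp add: P_def E1.rep_scalar E2.rep_scalar hi_scale)
      show "K (sc \<kappa> \<odot>\<^bsub>E T1\<^esub> x, sc \<kappa> \<odot>\<^bsub>E T2\<^esub> y) = sc \<kappa> \<odot>\<^bsub>E ?T\<^esub> K (x, y)"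
        by (rule vec_eqI) (simp_all add: E1.rep_scalar[OF c(1)] E2.rep_scalar[OF c(2)] E3.rep_scalar[OF Kc[OF P]]
          lo_scale hi_scale Kl Kh distrib_left)
    qed
  next
    fix w assume w: "w \<in> verts Q"
    show "vt w \<in> ?R"
    proof (clarsimp, rule conjI)
      fix x y assume P: "(x, y) \<in> P"
      then have c: "x \<in> carrier (E T1)" "y \<in> carrier (E T2)" "hi x = hi y" by (auto simp: P_def)
      show "(vt w \<odot>\<^bsub>E T1\<^esub> x, vt w \<odot>\<^bsub>E T2\<^esub> y) \<in> P"
        using c L1.smult_closed[OF vt_carrier[OF w] c(1)] L2.smult_closed[OF vt_carrier[OF w] c(2)]
        by (simp add: P_def E1.rep_vert[OF w] E2.rep_vert[OF w] hi_trunc) (subst c(3), rule refl)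
      show "K (vt w \<odot>\<^bsub>E T1\<^esub> x, vt w \<odot>\<^bsub>E T2\<^esub> y) = vt w \<odot>\<^bsub>E ?T\<^esub> K (x, y)"
        by (rule vec_eqI) (auto simp: E1.rep_vert[OF w] E2.rep_vert[OF w] E3.rep_vert[OF w]
          lo_trunc hi_trunc Kl Kh)
    qed
  next
    fix a assume a: "a \<in> arcs Q"
    show "ar a \<in> ?R"
    proof (clarsimp, rule conjI)
      fix x y assume P: "(x, y) \<in> P"
      then have c: "x \<in> carrier (E T1)" "y \<in> carrier (E T2)" "hi x = hi y" by (auto simp: P_def)
      show "(ar a \<odot>\<^bsub>E T1\<^esub> x, ar a \<odot>\<^bsub>E T2\<^esub> y) \<in> P"
        using c L1.smult_closed[OF ar_carrier[OF a] c(1)] L2.smult_closed[OF ar_carrier[OF a] c(2)]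
        by (simp add: P_def E1.rep_arrow[OF a] E2.rep_arrow[OF a] hi_ext_act)
      show "K (ar a \<odot>\<^bsub>E T1\<^esub> x, ar a \<odot>\<^bsub>E T2\<^esub> y) = ar a \<odot>\<^bsub>E ?T\<^esub> K (x, y)"
        by (rule vec_eqI) (simp_all add: E1.rep_arrow[OF a] E2.rep_arrow[OF a] E3.rep_arrow[OF a]
          lo_ext_act[OF a] hi_ext_act Kl Kh c(3) N.act_add[OF a] mat_T_add algebra_simps)
    qed
  next
    fix r r' assume r: "r \<in> ?R" "r' \<in> ?R" "r \<in> carrier L" "r' \<in> carrier L"
    show "r \<oplus>\<^bsub>L\<^esub> r' \<in> ?R"
    proof (clarsimp, rule conjI)
      fix x y assume P: "(x, y) \<in> P"
      then have c: "x \<in> carrier (E T1)" "y \<in> carrier (E T2)" by (auto simp: P_def)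
      show "((r \<oplus>\<^bsub>L\<^esub> r') \<odot>\<^bsub>E T1\<^esub> x, (r \<oplus>\<^bsub>L\<^esub> r') \<odot>\<^bsub>E T2\<^esub> y) \<in> P"
        "K ((r \<oplus>\<^bsub>L\<^esub> r') \<odot>\<^bsub>E T1\<^esub> x, (r \<oplus>\<^bsub>L\<^esub> r') \<odot>\<^bsub>E T2\<^esub> y) = (r \<oplus>\<^bsub>L\<^esub> r') \<odot>\<^bsub>E ?T\<^esub> K (x, y)"
        using bspec[OF r(1)[unfolded mem_Collect_eq] P] bspec[OF r(2)[unfolded mem_Collect_eq] P]
        unfolding L1.smult_l_distr[OF r(3,4) c(1)] L2.smult_l_distr[OF r(3,4) c(2)]
          L3.smult_l_distr[OF r(3,4) Kc[OF P]]
        by (simp_all add: K_add P_add)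
    qed
    show "r \<otimes>\<^bsub>L\<^esub> r' \<in> ?R"
    proof (clarsimp, rule conjI)
      fix x y assume P: "(x, y) \<in> P"
      then have c: "x \<in> carrier (E T1)" "y \<in> carrier (E T2)" by (auto simp: P_def)
      have r': "(r' \<odot>\<^bsub>E T1\<^esub> x, r' \<odot>\<^bsub>E T2\<^esub> y) \<in> P" "K (r' \<odot>\<^bsub>E T1\<^esub> x, r' \<odot>\<^bsub>E T2\<^esub> y) = r' \<odot>\<^bsub>E ?T\<^esub> K (x, y)"
        using bspec[OF r(2)[unfolded mem_Collect_eq] P] by simp_all
      then show "((r \<otimes>\<^bsub>L\<^esub> r') \<odot>\<^bsub>E T1\<^esub> x, (r \<otimes>\<^bsub>L\<^esub> r') \<odot>\<^bsub>E T2\<^esub> y) \<in> P"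
        "K ((r \<otimes>\<^bsub>L\<^esub> r') \<odot>\<^bsub>E T1\<^esub> x, (r \<otimes>\<^bsub>L\<^esub> r') \<odot>\<^bsub>E T2\<^esub> y) = (r \<otimes>\<^bsub>L\<^esub> r') \<odot>\<^bsub>E ?T\<^esub> K (x, y)"
        using bspec[OF r(1)[unfolded mem_Collect_eq] r'(1)] unfolding L1.smult_assoc1[OF r(3,4) c(1)] L2.smult_assoc1[OF r(3,4) c(2)]
          L3.smult_assoc1[OF r(3,4) Kc[OF P]]
        by simp_all
    qed
  qed
  have P': "P = {(x, y). x \<in> carrier (E T1) \<and> y \<in> carrier (E T2) \<and> (\<lambda>i. x (nb + i)) = (\<lambda>i. y (nb + i))}"
    by (simp add: P_def hi_def)
  show ?thesis
    unfolding X_def baer_sum.simps Let_def P'[symmetric]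
  proof (intro bexI[of _ "\<lambda>z. f (K z)"] conjI ballI)
    show "(\<lambda>z. f (K z)) \<in> P \<rightarrow> carrier F" using fh(1) Kc by blast
    fix z assume z: "z \<in> P"
    obtain x y where xy: "z = (x, y)" by fastforce
    show "case z of (x, y) \<Rightarrow> \<forall>(x', y')\<in>P. f (K (x \<oplus>\<^bsub>E T1\<^esub> x', y \<oplus>\<^bsub>E T2\<^esub> y')) = f (K (x, y)) \<oplus>\<^bsub>F\<^esub> f (K (x', y'))"
      unfolding xy using z[unfolded xy] by (auto simp: K_add fh(2) Kc)
    show "case z of (x, y) \<Rightarrow> p (f (K (x, y))) = (\<lambda>i. x (nb + i))"
      unfolding xy using f(3)[OF Kc[OF z[unfolded xy]]] by (simp add: Kh) (simp add: hi_def)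
  next
    fix r z assume r: "r \<in> carrier L" and z: "z \<in> P"
    obtain x y where xy: "z = (x, y)" by fastforce
    have "K (r \<odot>\<^bsub>E T1\<^esub> x, r \<odot>\<^bsub>E T2\<^esub> y) = r \<odot>\<^bsub>E ?T\<^esub> K (x, y)"
      using bspec[OF subsetD[OF Kr r, unfolded mem_Collect_eq] z] xy by simp
    then show "case z of (x, y) \<Rightarrow> f (K (r \<odot>\<^bsub>E T1\<^esub> x, r \<odot>\<^bsub>E T2\<^esub> y)) = r \<odot>\<^bsub>F\<^esub> f (K (x, y))"
      unfolding xy prod.case using fh(3)[OF r Kc[OF z[unfolded xy]]] by simp
  next
    fix u v assume u: "u \<in> carrier Mb" and v: "v \<in> carrier Mb"
    have "K (u, v) = u \<oplus>\<^bsub>Mb\<^esub> v"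
      by (rule vec_eqI) (simp_all add: Kl Kh N.M_simps lo_add hi_add hi_Mb[OF u] hi_Mb[OF v])
    moreover have "u \<oplus>\<^bsub>Mb\<^esub> v \<in> carrier Mb" using u v by (simp add: N.M_simps N.carrier_M)
    ultimately show "f (K (u, v)) = i (u \<oplus>\<^bsub>Mb\<^esub> v)" using f(2) by simp
  qed
qed

end

context rep_pair
begin

lemma section_ext_scale:
  assumes \<xi>: "\<xi>\<^sub>1 = (F1, i1, p1)" "\<xi> = (F, i, p)"
    and ext: "\<xi>\<^sub>1 \<in> extensions L Mc Mb" "\<xi> \<in> extensions L Mc Mb"
    and s1: "is_section T \<xi>\<^sub>1 s1" and scale: "ext_scale L Mb (sc \<kappa>) \<xi>\<^sub>1 \<xi>"
  shows "\<exists>s. is_section (\<lambda>a i j. \<kappa> * T a i j) \<xi> s"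
proof -
  obtain f where f: "f \<in> lmod_hom L F1 F" "\<forall>u\<in>carrier Mb. f (i1 u) = i (sc \<kappa> \<odot>\<^bsub>Mb\<^esub> u)"
    "\<forall>x\<in>carrier F1. p (f x) = p1 x"
    using scale unfolding \<xi> by auto
  note x1 = extensionsD[OF ext(1)[unfolded \<xi>]] and fh = lmod_homD[OF f(1)]
  note s1 = sectionD[OF s1[unfolded \<xi>]]
  have "is_section (\<lambda>a i j. \<kappa> * T a i j) (F, i, p) (\<lambda>v. f (s1 v))"
    unfolding is_section_def prod.case
  proof (intro ballI conjI allI)
    fix v assume v: "v \<in> carrier Mc"
    show "f (s1 v) \<in> carrier F" using fh(1) s1(1)[OF v] .
    show "p (f (s1 v)) = v" using f(3) s1(1,2)[OF v] by simp
    show "f (s1 (\<lambda>i. u i + v i)) = f (s1 u) \<oplus>\<^bsub>F\<^esub> f (s1 v)" if u: "u \<in> carrier Mc" for u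
      unfolding s1(3)[OF v u] by (rule fh(2)[OF s1(1)[OF u] s1(1)[OF v]])
    show "f (s1 (\<lambda>i. \<nu> * v i)) = sc \<nu> \<odot>\<^bsub>F\<^esub> f (s1 v)" for \<nu>
      unfolding s1(4)[OF v] by (rule fh(3)[OF sc_carrier s1(1)[OF v]])
    show "f (s1 (\<lambda>i. if vc i = x then v i else 0)) = vt x \<odot>\<^bsub>F\<^esub> f (s1 v)" if x: "x \<in> verts Q" for x
      unfolding s1(5)[OF v x] by (rule fh(3)[OF vt_carrier[OF x] s1(1)[OF v]])
    show "ar a \<odot>\<^bsub>F\<^esub> f (s1 v) = f (s1 (actc a v)) \<oplus>\<^bsub>F\<^esub> i (mat (\<lambda>a i j. \<kappa> * T a i j) a v)" if a: "a \<in> arcs Q" for a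
    proof -
      have ac: "actc a v \<in> carrier Mc" by (simp add: M.carrier_M M.act_bound[OF a])
      have mc: "mat T a v \<in> carrier Mb" by (simp add: N.carrier_M mat_bound)
      have "ar a \<odot>\<^bsub>F\<^esub> f (s1 v) = f (ar a \<odot>\<^bsub>F1\<^esub> s1 v)"
        by (rule fh(3)[OF ar_carrier[OF a] s1(1)[OF v], symmetric])
      also have "\<dots> = f (s1 (actc a v)) \<oplus>\<^bsub>F\<^esub> f (i1 (mat T a v))"
        unfolding s1(6)[OF v a] by (rule fh(2)[OF s1(1)[OF ac] lmod_homD(1)[OF x1(4) mc]])
      also have "f (i1 (mat T a v)) = i (mat (\<lambda>a i j. \<kappa> * T a i j) a v)"
        using f(2) mc by (simp add: mat_T_scale N.rep_scalar)
      finally show ?thesis .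
    qed
  qed
  then show ?thesis unfolding \<xi> by blast
qed

lemma ext_scale_X:
  assumes T: "cocycle T" and eq: "ext_equiv L Mb (X (\<lambda>a i j. \<kappa> * T a i j)) (F, i, p)"
  shows "ext_scale L Mb (sc \<kappa>) (X T) (F, i, p)"
proof -
  let ?T = "\<lambda>a i j. \<kappa> * T a i j"
  interpret E1: quiver_rep Q I "nb + nc" evx "ext_act T" by (rule ext_rep[OF T])
  interpret E2: quiver_rep Q I "nb + nc" evx "ext_act ?T" by (rule ext_rep[OF cocycle_scale[OF T]])
  obtain f where f: "f \<in> lmod_hom L (E ?T) F" "\<And>u. u \<in> carrier Mb \<Longrightarrow> f u = i u"
    "\<And>v. v \<in> carrier (E ?T) \<Longrightarrow> p (f v) = hi v"
    using eq by (auto simp: X_def hi_def)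
  define g where "g v = join (\<lambda>i. \<kappa> * lo v i) (hi v)" for v
  have gl: "lo (g v) = (\<lambda>i. \<kappa> * lo v i)" and gh: "hi (g v) = hi v" for v
    by (simp_all add: g_def join_simps) (auto simp: lo_def)
  have g: "g \<in> lmod_hom L (E T) (E ?T)"
  proof (rule rep_hom[OF E1.quiver_rep_axioms E2.quiver_rep_axioms])
    show "g v \<in> carrier (E ?T)" if "v \<in> carrier (E T)" for v
      unfolding g_def using that by (intro join_E hi_carrier)
    show "g (\<lambda>i. u i + v i) = (\<lambda>i. g u i + g v i)" for u v
      by (rule vec_eqI) (simp_all add: gl gh lo_add hi_add distrib_left)
    show "g (\<lambda>i. \<nu> * v i) = (\<lambda>i. \<nu> * g v i)" for \<nu> v
      by (rule vec_eqI) (simp_all add: gl gh lo_scale hi_scale algebra_simps)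
    show "g (\<lambda>i. if evx i = x then v i else 0) = (\<lambda>i. if evx i = x then g v i else 0)" for x v
      by (rule vec_eqI) (auto simp: gl gh lo_trunc hi_trunc)
    show "g (ext_act T a v) = ext_act ?T a (g v)" if a: "a \<in> arcs Q" for a v
      by (rule vec_eqI) (simp_all add: gl gh lo_ext_act[OF a] hi_ext_act N.act_scale[OF a] mat_T_scale distrib_left)
  qed
  show ?thesis unfolding X_def ext_scale.simps
  proof (intro bexI[OF _ lmod_hom_comp[OF g f(1)]] conjI ballI)
    fix u assume u: "u \<in> carrier Mb"
    then have c: "(\<lambda>i. \<kappa> * u i) \<in> carrier Mb" by (simp add: N.carrier_M)
    have "g u = (\<lambda>i. \<kappa> * u i)"
      by (rule vec_eqI) (simp_all add: gl gh lo_Mb[OF u] hi_Mb[OF u] lo_Mb[OF c] hi_Mb[OF c])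
    then show "f (g u) = i (sc \<kappa> \<odot>\<^bsub>Mb\<^esub> u)"
      using f(2)[OF c] by (simp add: N.rep_scalar[OF u])
  next
    fix v assume v: "v \<in> carrier (E T)"
    then show "p (f (g v)) = (\<lambda>i. v (nb + i))"
      using f(3)[OF lmod_homD(1)[OF g v]] by (simp add: gh) (simp add: hi_def)
  qed
qed

lemma split_iff:
  assumes \<xi>: "(F, i, p) \<in> extensions L Mc Mb"
  shows "ext_split L Mc (F, i, p) \<longleftrightarrow> ext_equiv L Mb (X (\<lambda>_ _ _. 0)) (F, i, p)"
proof -
  note x = extensionsD[OF \<xi>]
  interpret F: left_module L F by (rule x)
  have m0: "mat (\<lambda>_ _ _. 0) a v = \<zero>\<^bsub>Mb\<^esub>" for a v by (auto simp: mat_def N.M_simps)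
  have i0: "i \<zero>\<^bsub>Mb\<^esub> = \<zero>\<^bsub>F\<^esub>" by (rule lmod_hom_minus(1)[OF x(1,2,4)])
  show ?thesis unfolding equiv_iff_section[OF cocycle_zero \<xi>]
  proof
    assume "ext_split L Mc (F, i, p)"
    then obtain s where s: "s \<in> lmod_hom L Mc F" "\<forall>v\<in>carrier Mc. p (s v) = v" by auto
    note sh = lmod_homD[OF s(1)]
    have "is_section (\<lambda>_ _ _. 0) (F, i, p) s"
      unfolding is_section_def prod.case
    proof (intro ballI conjI allI)
      fix v assume v: "v \<in> carrier Mc"
      show "s v \<in> carrier F" using sh(1)[OF v] .
      show "p (s v) = v" using s(2) v by blast
      show "s (\<lambda>i. u i + v i) = s u \<oplus>\<^bsub>F\<^esub> s v" if "u \<in> carrier Mc" for u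
        using sh(2)[OF that v] by (simp add: M.M_simps)
      show "s (\<lambda>i. \<kappa> * v i) = sc \<kappa> \<odot>\<^bsub>F\<^esub> s v" for \<kappa>
        using sh(3)[OF sc_carrier v] by (simp add: M.rep_scalar[OF v])
      show "s (\<lambda>i. if vc i = x then v i else 0) = vt x \<odot>\<^bsub>F\<^esub> s v" if "x \<in> verts Q" for x
        using sh(3)[OF vt_carrier[OF that] v] by (simp add: M.rep_vert[OF that])
      show "ar a \<odot>\<^bsub>F\<^esub> s v = s (actc a v) \<oplus>\<^bsub>F\<^esub> i (mat (\<lambda>_ _ _. 0) a v)" if a: "a \<in> arcs Q" for a
      proof -
        have ac: "actc a v \<in> carrier Mc" by (simp add: M.carrier_M M.act_bound[OF a])
        show ?thesis
          unfolding sh(3)[OF ar_carrier[OF a] v, symmetric] M.rep_arrow[OF a] m0 i0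
          using sh(1)[OF ac] by simp
      qed
    qed
    then show "\<exists>s. is_section (\<lambda>_ _ _. 0) (F, i, p) s" by blast
  next
    assume "\<exists>s. is_section (\<lambda>_ _ _. 0) (F, i, p) s"
    then obtain s where "is_section (\<lambda>_ _ _. 0) (F, i, p) s" ..
    note s = sectionD[OF this]
    have "s \<in> lmod_hom L Mc F"
    proof (rule hom_criterion[OF x(3,2)])
      show "s \<in> carrier Mc \<rightarrow> carrier F" using s(1) by blast
      show "s (u \<oplus>\<^bsub>Mc\<^esub> v) = s u \<oplus>\<^bsub>F\<^esub> s v" if "u \<in> carrier Mc" "v \<in> carrier Mc" for u v
        using s(3)[OF that(2,1)] by (simp add: M.M_simps)
      show "s (sc \<kappa> \<odot>\<^bsub>Mc\<^esub> v) = sc \<kappa> \<odot>\<^bsub>F\<^esub> s v" if "v \<in> carrier Mc" for \<kappa> v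
        using s(4)[OF that] by (simp add: M.rep_scalar[OF that])
      show "s (vt x \<odot>\<^bsub>Mc\<^esub> v) = vt x \<odot>\<^bsub>F\<^esub> s v" if "x \<in> verts Q" "v \<in> carrier Mc" for x v
        using s(5)[OF that(2,1)] by (simp add: M.rep_vert[OF that(1)])
      show "s (ar a \<odot>\<^bsub>Mc\<^esub> v) = ar a \<odot>\<^bsub>F\<^esub> s v" if a: "a \<in> arcs Q" and v: "v \<in> carrier Mc" for a v
      proof -
        have ac: "actc a v \<in> carrier Mc" by (simp add: M.carrier_M M.act_bound[OF a])
        show ?thesis
          using s(6)[OF v a] s(1)[OF ac] by (simp add: M.rep_arrow[OF a] m0 i0)
      qed
    qed
    then show "ext_split L Mc (F, i, p)" using s(2) by auto
  qed
qed

definition cl :: "('a \<Rightarrow> nat \<Rightarrow> nat \<Rightarrow> 'k) \<Rightarrow> ((('v, 'a) path \<Rightarrow> 'k) set, nat \<Rightarrow> 'k, nat \<Rightarrow> 'k, nat \<Rightarrow> 'k) extn set"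
  where "cl T = ext_class L Mc Mb (X T)"

abbreviation "ExtV \<equiv> Ext1 L sc Mc Mb ::
  ('k, ((('v, 'a) path \<Rightarrow> 'k) set, nat \<Rightarrow> 'k, nat \<Rightarrow> 'k, nat \<Rightarrow> 'k) extn set) module"

lemma cl_iff: "\<xi> \<in> cl T \<longleftrightarrow> \<xi> \<in> extensions L Mc Mb \<and> ext_equiv L Mb (X T) \<xi>"
  by (simp add: cl_def ext_class_def)

lemma cl_eq_iff: "cocycle T \<Longrightarrow> cocycle T' \<Longrightarrow>
    cl T = cl T' \<longleftrightarrow> (\<exists>h. coboundary h (\<lambda>a i j. T a i j - T' a i j))"
  unfolding cl_def by (simp add: ext_class_eq_iff X_extension equiv_X_iff)

lemma X_in_cl: "cocycle T \<Longrightarrow> X T \<in> cl T"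
  unfolding cl_iff using X_extension[of T] by (auto simp: X_def intro: ext_equiv_refl simp del: ext_equiv.simps)

lemma carrier_Ext: "carrier ExtV = cl ` Collect cocycle"
proof -
  have "ext_class L Mc Mb \<xi> \<in> cl ` Collect cocycle" if \<xi>: "\<xi> \<in> extensions L Mc Mb" for \<xi>
  proof -
    obtain F i p where e: "\<xi> = (F, i, p)" by (metis prod_cases3)
    obtain T where T: "cocycle T" "ext_equiv L Mb (X T) \<xi>"
      using every_extension[of F i p] \<xi> e by auto
    then have "cl T = ext_class L Mc Mb \<xi>"
      unfolding cl_def using \<xi> by (simp add: ext_class_eq_iff X_extension)
    then show ?thesis using T by blast
  qed
  moreover have "cl T \<in> ext_class L Mc Mb ` extensions L Mc Mb" if "cocycle T" for T
    using X_extension[OF that] by (simp add: cl_def)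
  ultimately show ?thesis by (auto simp: Ext1_def)
qed

lemma cl_zero: "\<zero>\<^bsub>ExtV\<^esub> = cl (\<lambda>_ _ _. 0)"
proof -
  have "\<xi> \<in> \<zero>\<^bsub>ExtV\<^esub> \<longleftrightarrow> \<xi> \<in> cl (\<lambda>_ _ _. 0)" for \<xi>
  proof -
    obtain F i p where e: "\<xi> = (F, i, p)" by (metis prod_cases3)
    show ?thesis unfolding cl_iff e using split_iff[of F i p] by (auto simp: Ext1_def simp del: ext_equiv.simps ext_split.simps)
  qed
  then show ?thesis by blast
qed

lemma cl_add:
  assumes T1: "cocycle T1" and T2: "cocycle T2"
  shows "cl T1 \<oplus>\<^bsub>ExtV\<^esub> cl T2 = cl (\<lambda>a i j. T1 a i j + T2 a i j)"
proof -
  have "\<xi> \<in> cl T1 \<oplus>\<^bsub>ExtV\<^esub> cl T2 \<longleftrightarrow> \<xi> \<in> cl (\<lambda>a i j. T1 a i j + T2 a i j)" for \<xi>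
  proof -
    obtain F i p where e: "\<xi> = (F, i, p)" by (metis prod_cases3)
    show ?thesis
    proof
      assume "\<xi> \<in> cl T1 \<oplus>\<^bsub>ExtV\<^esub> cl T2"
      then obtain \<xi>\<^sub>1 \<xi>\<^sub>2 where \<xi>: "\<xi> \<in> extensions L Mc Mb" "\<xi>\<^sub>1 \<in> cl T1" "\<xi>\<^sub>2 \<in> cl T2" "baer_sum L Mb \<xi>\<^sub>1 \<xi>\<^sub>2 \<xi>"
        by (auto simp: Ext1_def)
      obtain F1 i1 p1 F2 i2 p2 where e12: "\<xi>\<^sub>1 = (F1, i1, p1)" "\<xi>\<^sub>2 = (F2, i2, p2)" by (metis prod_cases3)
      obtain s1 s2 where "is_section T1 \<xi>\<^sub>1 s1" "is_section T2 \<xi>\<^sub>2 s2"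
        using \<xi>(2,3) equiv_iff_section[OF T1] equiv_iff_section[OF T2] unfolding cl_iff e12 by blast
      then have "\<exists>s. is_section (\<lambda>a i j. T1 a i j + T2 a i j) \<xi> s"
        using section_baer_sum[OF e12 e] \<xi> cl_iff by blast
      then show "\<xi> \<in> cl (\<lambda>a i j. T1 a i j + T2 a i j)"
        using equiv_iff_section[OF cocycle_add[OF T1 T2]] \<xi>(1) unfolding cl_iff e by blast
    next
      assume \<xi>: "\<xi> \<in> cl (\<lambda>a i j. T1 a i j + T2 a i j)"
      then have "baer_sum L Mb (X T1) (X T2) \<xi>"
        using baer_sum_X[OF T1 T2] unfolding cl_iff e by blast
      then show "\<xi> \<in> cl T1 \<oplus>\<^bsub>ExtV\<^esub> cl T2"
        using \<xi>[unfolded cl_iff] X_in_cl[OF T1] X_in_cl[OF T2] by (auto simp: Ext1_def)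
    qed
  qed
  then show ?thesis by blast
qed

lemma cl_smult:
  assumes T: "cocycle T"
  shows "\<kappa> \<odot>\<^bsub>ExtV\<^esub> cl T = cl (\<lambda>a i j. \<kappa> * T a i j)"
proof -
  have "\<xi> \<in> \<kappa> \<odot>\<^bsub>ExtV\<^esub> cl T \<longleftrightarrow> \<xi> \<in> cl (\<lambda>a i j. \<kappa> * T a i j)" for \<xi>
  proof -
    obtain F i p where e: "\<xi> = (F, i, p)" by (metis prod_cases3)
    show ?thesis
    proof
      assume "\<xi> \<in> \<kappa> \<odot>\<^bsub>ExtV\<^esub> cl T"
      then obtain \<xi>\<^sub>1 where \<xi>: "\<xi> \<in> extensions L Mc Mb" "\<xi>\<^sub>1 \<in> cl T" "ext_scale L Mb (sc \<kappa>) \<xi>\<^sub>1 \<xi>"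
        by (auto simp: Ext1_def)
      obtain F1 i1 p1 where e1: "\<xi>\<^sub>1 = (F1, i1, p1)" by (metis prod_cases3)
      obtain s1 where "is_section T \<xi>\<^sub>1 s1"
        using \<xi>(2) equiv_iff_section[OF T] unfolding cl_iff e1 by blast
      then have "\<exists>s. is_section (\<lambda>a i j. \<kappa> * T a i j) \<xi> s"
        using section_ext_scale[OF e1 e] \<xi> cl_iff by blast
      then show "\<xi> \<in> cl (\<lambda>a i j. \<kappa> * T a i j)"
        using equiv_iff_section[OF cocycle_scale[OF T]] \<xi>(1) unfolding cl_iff e by blast
    next
      assume \<xi>: "\<xi> \<in> cl (\<lambda>a i j. \<kappa> * T a i j)"
      then have "ext_scale L Mb (sc \<kappa>) (X T) \<xi>"
        using ext_scale_X[OF T] unfolding cl_iff e by blast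
      then show "\<xi> \<in> \<kappa> \<odot>\<^bsub>ExtV\<^esub> cl T"
        using \<xi>[unfolded cl_iff] X_in_cl[OF T] by (auto simp: Ext1_def)
    qed
  qed
  then show ?thesis by blast
qed

lemma abelian_monoid_Ext: "abelian_monoid ExtV"
proof (rule abelian_monoidI)
  fix x y z assume "x \<in> carrier ExtV" "y \<in> carrier ExtV" "z \<in> carrier ExtV"
  then obtain T1 T2 T3 where T: "x = cl T1" "y = cl T2" "z = cl T3" "cocycle T1" "cocycle T2" "cocycle T3"
    unfolding carrier_Ext by auto
  show "x \<oplus>\<^bsub>ExtV\<^esub> y \<oplus>\<^bsub>ExtV\<^esub> z = x \<oplus>\<^bsub>ExtV\<^esub> (y \<oplus>\<^bsub>ExtV\<^esub> z)"
    using T by (simp add: cl_add cocycle_add add.assoc)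
next
  fix x y assume "x \<in> carrier ExtV" "y \<in> carrier ExtV"
  then obtain T1 T2 where T: "x = cl T1" "y = cl T2" "cocycle T1" "cocycle T2"
    unfolding carrier_Ext by auto
  show "x \<oplus>\<^bsub>ExtV\<^esub> y \<in> carrier ExtV" using T by (simp add: cl_add cocycle_add carrier_Ext)
  show "x \<oplus>\<^bsub>ExtV\<^esub> y = y \<oplus>\<^bsub>ExtV\<^esub> x" using T by (simp add: cl_add add.commute)
next
  show "\<zero>\<^bsub>ExtV\<^esub> \<in> carrier ExtV" by (simp add: cl_zero carrier_Ext cocycle_zero)
  fix x assume "x \<in> carrier ExtV"
  then obtain T1 where T: "x = cl T1" "cocycle T1" unfolding carrier_Ext by auto
  show "\<zero>\<^bsub>ExtV\<^esub> \<oplus>\<^bsub>ExtV\<^esub> x = x" using T by (simp add: cl_zero cl_add cocycle_zero)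
qed

lemma cl_sum:
  assumes "finite J" and "\<And>x. x \<in> J \<Longrightarrow> cocycle (Tf x)"
  shows "(\<Oplus>\<^bsub>ExtV\<^esub>x\<in>J. \<kappa> x \<odot>\<^bsub>ExtV\<^esub> cl (Tf x)) = cl (\<lambda>a i j. \<Sum>x\<in>J. \<kappa> x * Tf x a i j)"
proof -
  interpret ExtV: abelian_monoid ExtV by (rule abelian_monoid_Ext)
  show ?thesis using assms
  proof (induction J rule: finite_induct)
    case empty then show ?case by (simp add: cl_zero)
  next
    case (insert x J)
    have "\<kappa> y \<odot>\<^bsub>ExtV\<^esub> cl (Tf y) \<in> carrier ExtV" if "y \<in> insert x J" for y
      using insert.prems[OF that] by (simp add: cl_smult carrier_Ext cocycle_scale)
    then have "(\<Oplus>\<^bsub>ExtV\<^esub>x\<in>insert x J. \<kappa> x \<odot>\<^bsub>ExtV\<^esub> cl (Tf x)) =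
        \<kappa> x \<odot>\<^bsub>ExtV\<^esub> cl (Tf x) \<oplus>\<^bsub>ExtV\<^esub> (\<Oplus>\<^bsub>ExtV\<^esub>x\<in>J. \<kappa> x \<odot>\<^bsub>ExtV\<^esub> cl (Tf x))"
      using insert.hyps by (intro ExtV.finsum_insert) auto
    also have "\<dots> = cl (\<lambda>a i j. \<kappa> x * Tf x a i j) \<oplus>\<^bsub>ExtV\<^esub> cl (\<lambda>a i j. \<Sum>x\<in>J. \<kappa> x * Tf x a i j)"
      using insert.IH insert.prems by (simp add: cl_smult)
    also have "\<dots> = cl (\<lambda>a i j. \<Sum>x\<in>insert x J. \<kappa> x * Tf x a i j)"
      using insert by (simp add: cl_add cocycle_scale cocycle_sum)
    finally show ?case .
  qed
qed

text \<open>
  Reduces the claim about a basis to linear algebra: by the lemmas on Baer sums and scalar multiples, the class of a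
  combination of cocycles is the combination of the classes.
\<close>

lemma basis_criterion:
  assumes J: "finite J" and Tf: "\<And>x. x \<in> J \<Longrightarrow> cocycle (Tf x)"
    and solve: "\<And>T. cocycle T \<Longrightarrow>
      \<exists>\<kappa> h. coboundary h (\<lambda>a i j. T a i j - (\<Sum>x\<in>J. \<kappa> x * Tf x a i j))"
    and indep: "\<And>\<kappa> h x. coboundary h (\<lambda>a i j. \<Sum>x\<in>J. \<kappa> x * Tf x a i j) \<Longrightarrow> x \<in> J \<Longrightarrow> \<kappa> x = 0"
  shows "is_basis ExtV J (\<lambda>x. cl (Tf x))"
  unfolding is_basis_def
proof (intro conjI ballI)
  show "finite J" by fact
  show "(\<lambda>x. cl (Tf x)) \<in> J \<rightarrow> carrier ExtV" using Tf by (auto simp: carrier_Ext)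
  fix y assume "y \<in> carrier ExtV"
  then obtain T where T: "cocycle T" "y = cl T" unfolding carrier_Ext by auto
  obtain \<kappa> h where h: "coboundary h (\<lambda>a i j. T a i j - (\<Sum>x\<in>J. \<kappa> x * Tf x a i j))"
    using solve[OF T(1)] by blast
  define S where "S \<kappa> = (\<lambda>a i j. \<Sum>x\<in>J. \<kappa> x * Tf x a i j)" for \<kappa>
  have S: "cocycle (S \<kappa>)" "(\<Oplus>\<^bsub>ExtV\<^esub>x\<in>J. \<kappa> x \<odot>\<^bsub>ExtV\<^esub> cl (Tf x)) = cl (S \<kappa>)" for \<kappa>
    unfolding S_def by (rule cocycle_sum[OF J], erule Tf, rule cl_sum[OF J], erule Tf)
  have eq: "cl T = cl (S \<kappa>)"
    unfolding cl_eq_iff[OF T(1) S(1)] using h by (auto simp: S_def)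
  let ?r = "restrict \<kappa> J"
  have r: "S ?r = S \<kappa>"
    unfolding S_def by (intro ext sum.cong) auto
  show "\<exists>!\<kappa>. \<kappa> \<in> J \<rightarrow>\<^sub>E UNIV \<and> y = (\<Oplus>\<^bsub>ExtV\<^esub>x\<in>J. \<kappa> x \<odot>\<^bsub>ExtV\<^esub> cl (Tf x))"
    unfolding S(2) T(2)
  proof (rule ex1I[of _ ?r])
    show "?r \<in> J \<rightarrow>\<^sub>E UNIV \<and> cl T = cl (S ?r)"
      unfolding r using eq by auto
  next
    fix \<nu> assume \<nu>: "\<nu> \<in> J \<rightarrow>\<^sub>E UNIV \<and> cl T = cl (S \<nu>)"
    then have "cl (S \<kappa>) = cl (S \<nu>)" using eq by simp
    then obtain h' where "coboundary h' (\<lambda>a i j. (\<Sum>x\<in>J. \<kappa> x * Tf x a i j) - (\<Sum>x\<in>J. \<nu> x * Tf x a i j))"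
      unfolding cl_eq_iff[OF S(1) S(1)] unfolding S_def by blast
    then have "coboundary h' (\<lambda>a i j. \<Sum>x\<in>J. (\<kappa> x - \<nu> x) * Tf x a i j)"
      by (simp add: sum_subtractf left_diff_distrib)
    then have "\<kappa> x = \<nu> x" if "x \<in> J" for x using indep[OF _ that] by force
    then show "\<nu> = ?r" using \<nu> by (auto simp: PiE_def extensional_def restrict_def)
  qed
qed

end

section \<open>Two-term linear systems along chains\<close>

text \<open>
  The value at \<open>\<nu>\<close> that the equations \<open>h \<nu> = \<tau> \<nu> + \<rho> \<nu> * h (nx \<nu>)\<close> force when the value \<open>k\<close> steps further is \<open>x\<close>.
\<close>

primrec run_value :: "('n \<Rightarrow> 'n) \<Rightarrow> ('n \<Rightarrow> 'k::field) \<Rightarrow> ('n \<Rightarrow> 'k) \<Rightarrow> nat \<Rightarrow> 'n \<Rightarrow> 'k \<Rightarrow> 'k" where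
  "run_value nx \<rho> \<tau> 0 \<nu> x = x"
| "run_value nx \<rho> \<tau> (Suc k) \<nu> x = \<tau> \<nu> + \<rho> \<nu> * run_value nx \<rho> \<tau> k (nx \<nu>) x"

lemma run_value_affine:
  "run_value nx \<rho> \<tau> k \<nu> x = run_value nx \<rho> \<tau> k \<nu> 0 + (\<Prod>i<k. \<rho> ((nx ^^ i) \<nu>)) * x"
proof (induction k arbitrary: \<nu>)
  case (Suc k)
  have "(\<Prod>i<Suc k. \<rho> ((nx ^^ i) \<nu>)) = \<rho> \<nu> * (\<Prod>i<k. \<rho> ((nx ^^ i) (nx \<nu>)))"
    by (subst prod.lessThan_Suc_shift) (simp add: funpow_swap1)
  then show ?case using Suc.IH[of "nx \<nu>"] by (simp add: algebra_simps)
qed simp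

lemma run_value_snoc:
  "run_value nx \<rho> \<tau> (Suc k) \<nu> x =
    run_value nx \<rho> \<tau> k \<nu> (\<tau> ((nx ^^ k) \<nu>) + \<rho> ((nx ^^ k) \<nu>) * x)"
  by (induction k arbitrary: \<nu>) (auto simp: funpow_swap1)

text \<open>
  Following \<open>nx\<close> as long as \<open>c\<close> holds, one stops after finitely many steps, at a place where \<open>G\<close> holds.
\<close>

definition run_ends :: "('n \<Rightarrow> 'n) \<Rightarrow> ('n \<Rightarrow> bool) \<Rightarrow> ('n \<Rightarrow> bool) \<Rightarrow> 'n \<Rightarrow> bool" where
  "run_ends nx c G \<nu> \<longleftrightarrow> (\<exists>k. (\<forall>i<k. c ((nx ^^ i) \<nu>)) \<and> \<not> c ((nx ^^ k) \<nu>) \<and> G ((nx ^^ k) \<nu>))"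

lemma run_ends_step: "c \<nu> \<Longrightarrow> run_ends nx c G (nx \<nu>) \<longleftrightarrow> run_ends nx c G \<nu>"
proof
  assume c: "c \<nu>" and "run_ends nx c G (nx \<nu>)"
  then obtain k where k: "\<forall>i<k. c ((nx ^^ i) (nx \<nu>))" "\<not> c ((nx ^^ k) (nx \<nu>))" "G ((nx ^^ k) (nx \<nu>))"
    by (auto simp: run_ends_def)
  have "c ((nx ^^ i) \<nu>)" if "i < Suc k" for i
    using that k(1) c by (cases i) (auto simp: funpow_swap1)
  then show "run_ends nx c G \<nu>"
    using k(2,3) unfolding run_ends_def by (intro exI[of _ "Suc k"]) (auto simp: funpow_swap1)
next
  assume c: "c \<nu>" and "run_ends nx c G \<nu>"
  then obtain k where k: "\<forall>i<k. c ((nx ^^ i) \<nu>)" "\<not> c ((nx ^^ k) \<nu>)" "G ((nx ^^ k) \<nu>)"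
    by (auto simp: run_ends_def)
  then obtain l where l: "k = Suc l" using c by (cases k) auto
  then show "run_ends nx c G (nx \<nu>)"
    using k unfolding run_ends_def by (intro exI[of _ l]) (auto simp: funpow_swap1)
qed

definition run_length :: "('n \<Rightarrow> 'n) \<Rightarrow> ('n \<Rightarrow> bool) \<Rightarrow> 'n \<Rightarrow> nat" where
  "run_length nx c \<nu> = (LEAST k. \<not> c ((nx ^^ k) \<nu>))"

lemma run_length_step:
  assumes "run_ends nx c G \<nu>" and "c \<nu>"
  shows "run_length nx c \<nu> = Suc (run_length nx c (nx \<nu>))"
proof -
  obtain k where k: "\<not> c ((nx ^^ k) \<nu>)" using assms by (auto simp: run_ends_def)
  have "(LEAST k. \<not> c ((nx ^^ k) \<nu>)) = Suc (LEAST k. \<not> c ((nx ^^ Suc k) \<nu>))"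
    by (rule Least_Suc[where P = "\<lambda>k. \<not> c ((nx ^^ k) \<nu>)", OF k]) (simp add: assms)
  then show ?thesis by (simp add: run_length_def funpow_swap1)
qed

lemma run_length_0: "\<not> c \<nu> \<Longrightarrow> run_length nx c \<nu> = 0"
  unfolding run_length_def by (rule Least_eq_0) simp

text \<open>
  The nodes form chains. Along a chain each edge is one equation between neighbouring unknowns, so that one
  value determines all others. A boundary condition at the right end (\<open>GR\<close>) or at the left end (\<open>GL\<close>) can be met by
  starting there; only on a chain with a condition at both ends the second one has to be given up, and there
  the left one is dropped. On a closed chain going around once is an affine map \<open>x \<mapsto> \<tau> + \<rho> * x\<close>
  with \<open>\<rho> \<noteq> 1\<close>, which has a fixed point.
\<close>

lemma chain_solvable:
  fixes \<rho> \<tau> vR vL :: "'n \<Rightarrow> 'k::field"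
  assumes nx: "\<And>\<nu>. \<nu> \<in> N \<Longrightarrow> cR \<nu> \<Longrightarrow> nx \<nu> \<in> N \<and> cL (nx \<nu>) \<and> pv (nx \<nu>) = \<nu>"
    and GR: "\<And>\<nu>. \<nu> \<in> N \<Longrightarrow> GR \<nu> \<Longrightarrow> \<not> cR \<nu>"
    and GL: "\<And>\<nu>. \<nu> \<in> N \<Longrightarrow> GL \<nu> \<Longrightarrow> \<not> cL \<nu>"
    and \<rho>: "\<And>\<nu>. \<nu> \<in> N \<Longrightarrow> \<rho> \<nu> \<noteq> 0"
    and cyclic: "\<And>\<nu>. \<nu> \<in> N \<Longrightarrow> (\<And>k. cR ((nx ^^ k) \<nu>)) \<Longrightarrow>
      (nx ^^ n) \<nu> = \<nu> \<and> (\<Prod>k<n. \<rho> ((nx ^^ k) \<nu>)) \<noteq> 1"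
  shows "\<exists>h. (\<forall>\<nu>\<in>N. cR \<nu> \<longrightarrow> h \<nu> = \<tau> \<nu> + \<rho> \<nu> * h (nx \<nu>)) \<and>
    (\<forall>\<nu>\<in>N. GR \<nu> \<longrightarrow> h \<nu> = vR \<nu>) \<and>
    (\<forall>\<nu>\<in>N. GL \<nu> \<and> \<not> run_ends nx cR GR \<nu> \<longrightarrow> h \<nu> = vL \<nu>)"
proof -
  define R where "R \<nu> = run_ends nx cR (\<lambda>_. True) \<nu>" for \<nu>
  define A where "A \<nu> = run_ends nx cR GR \<nu>" for \<nu>
  define B where "B \<nu> = run_ends pv cL GL \<nu>" for \<nu>
  define eR where "eR \<nu> = (let \<nu>' = (nx ^^ run_length nx cR \<nu>) \<nu> in if GR \<nu>' then vR \<nu>' else 0)" for \<nu>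
  define hR where "hR \<nu> = run_value nx \<rho> \<tau> (run_length nx cR \<nu>) \<nu> (eR \<nu>)" for \<nu>
  define hL where "hL \<nu> = run_value pv (\<lambda>\<nu>. 1 / \<rho> (pv \<nu>)) (\<lambda>\<nu>. - \<tau> (pv \<nu>) / \<rho> (pv \<nu>)) (run_length pv cL \<nu>) \<nu>
      (vL ((pv ^^ run_length pv cL \<nu>) \<nu>))" for \<nu>
  (* the fixed point of the affine map obtained by going once around a closed chain *)
  define hC where "hC \<nu> = run_value nx \<rho> \<tau> n \<nu> 0 / (1 - (\<Prod>k<n. \<rho> ((nx ^^ k) \<nu>)))" for \<nu>
  define h where "h \<nu> = (if A \<nu> then hR \<nu> else if B \<nu> then hL \<nu> else if R \<nu> then hR \<nu> else hC \<nu>)" for \<nu>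
  have AR: "A \<nu> \<Longrightarrow> R \<nu>" for \<nu> by (auto simp: A_def R_def run_ends_def)
  have hR: "hR \<nu> = \<tau> \<nu> + \<rho> \<nu> * hR (nx \<nu>)" if "R \<nu>" "cR \<nu>" for \<nu>
    using run_length_step[OF that[unfolded R_def]] by (simp add: hR_def eR_def funpow_swap1)
  have step: "h \<nu> = \<tau> \<nu> + \<rho> \<nu> * h (nx \<nu>)" if \<nu>: "\<nu> \<in> N" "cR \<nu>" for \<nu>
  proof -
    note n = nx[OF \<nu>]
    have RA: "R (nx \<nu>) = R \<nu>" "A (nx \<nu>) = A \<nu>"
      unfolding R_def A_def using \<nu>(2) by (simp_all add: run_ends_step)
    have BB: "B (nx \<nu>) = B \<nu>"
      unfolding B_def using n run_ends_step[of cL "nx \<nu>" pv GL] by simp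
    consider (a) "A \<nu>" | (b) "\<not> A \<nu>" "B \<nu>" | (c) "\<not> A \<nu>" "\<not> B \<nu>" "R \<nu>" | (d) "\<not> A \<nu>" "\<not> B \<nu>" "\<not> R \<nu>"
      by blast
    then show ?thesis
    proof cases
      case a then show ?thesis using hR[OF AR[OF a] \<nu>(2)] by (simp add: h_def RA)
    next
      case b
      have "run_length pv cL (nx \<nu>) = Suc (run_length pv cL \<nu>)"
        using run_length_step[of pv cL GL "nx \<nu>"] n b BB by (simp add: B_def)
      then have "hL (nx \<nu>) = - \<tau> \<nu> / \<rho> \<nu> + 1 / \<rho> \<nu> * hL \<nu>"
        using n by (simp add: hL_def funpow_swap1)
      then have "hL \<nu> = \<tau> \<nu> + \<rho> \<nu> * hL (nx \<nu>)" using \<rho>[OF \<nu>(1)] by (simp add: field_simps)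
      then show ?thesis using b by (simp add: h_def RA BB)
    next
      case c then show ?thesis using hR[OF c(3) \<nu>(2)] by (simp add: h_def RA BB)
    next
      case d
      have never: "cR ((nx ^^ k) \<nu>')" if "\<not> R \<nu>'" for k \<nu>'
        using that unfolding R_def run_ends_def by (induction k rule: less_induct) auto
      have c1: "(nx ^^ n) \<nu> = \<nu>" "(\<Prod>k<n. \<rho> ((nx ^^ k) \<nu>)) \<noteq> 1" using cyclic[OF \<nu>(1)] never[OF d(3)] by auto
      have c2: "(\<Prod>k<n. \<rho> ((nx ^^ k) (nx \<nu>))) \<noteq> 1" using cyclic[of "nx \<nu>"] never[of "nx \<nu>"] RA d(3) n by auto
      define x where "x = hC (nx \<nu>)"
      have x: "run_value nx \<rho> \<tau> n (nx \<nu>) x = x"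
        using c2 by (subst run_value_affine) (simp add: x_def hC_def field_simps)
      define z where "z = \<tau> \<nu> + \<rho> \<nu> * x"
      have "run_value nx \<rho> \<tau> n \<nu> z = run_value nx \<rho> \<tau> (Suc n) \<nu> x"
        unfolding run_value_snoc c1 z_def ..
      also have "\<dots> = z" by (simp add: x z_def)
      finally have "run_value nx \<rho> \<tau> n \<nu> 0 + (\<Prod>i<n. \<rho> ((nx ^^ i) \<nu>)) * z = z"
        by (subst (asm) run_value_affine)
      then have "run_value nx \<rho> \<tau> n \<nu> 0 = z * (1 - (\<Prod>i<n. \<rho> ((nx ^^ i) \<nu>)))" by (simp add: algebra_simps)
      then have "z = hC \<nu>"
        using c1(2) unfolding hC_def by (simp add: field_simps)
      then show ?thesis using d by (simp add: h_def RA BB x_def z_def)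
    qed
  qed
  have right: "h \<nu> = vR \<nu>" if \<nu>: "\<nu> \<in> N" "GR \<nu>" for \<nu>
  proof -
    have c: "\<not> cR \<nu>" using GR \<nu> by blast
    then have "A \<nu>" unfolding A_def run_ends_def using \<nu> by (intro exI[of _ 0]) auto
    then show ?thesis using \<nu> c by (simp add: h_def hR_def eR_def run_length_0)
  qed
  have left: "h \<nu> = vL \<nu>" if \<nu>: "\<nu> \<in> N" "GL \<nu>" "\<not> run_ends nx cR GR \<nu>" for \<nu>
  proof -
    have c: "\<not> cL \<nu>" using GL \<nu> by blast
    then have "B \<nu>" unfolding B_def run_ends_def using \<nu> by (intro exI[of _ 0]) auto
    then show ?thesis using \<nu> c by (simp add: h_def hL_def A_def run_length_0)
  qed
  show ?thesis using step right left by blast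
qed

text \<open>
  A homogeneous chain with a condition at its right end has only the zero solution; so the condition at its left
  end is the obstruction that the previous lemma leaves open.
\<close>

lemma chain_unique:
  fixes \<rho> h :: "'n \<Rightarrow> 'k::field"
  assumes nx: "\<And>\<nu>. \<nu> \<in> N \<Longrightarrow> cR \<nu> \<Longrightarrow> nx \<nu> \<in> N"
    and step: "\<And>\<nu>. \<nu> \<in> N \<Longrightarrow> cR \<nu> \<Longrightarrow> h \<nu> = \<rho> \<nu> * h (nx \<nu>)"
    and right: "\<And>\<nu>. \<nu> \<in> N \<Longrightarrow> GR \<nu> \<Longrightarrow> h \<nu> = 0"
    and \<nu>: "\<nu> \<in> N" "run_ends nx cR GR \<nu>"
  shows "h \<nu> = 0"
proof -
  obtain k where "\<forall>i<k. cR ((nx ^^ i) \<nu>)" "GR ((nx ^^ k) \<nu>)" using \<nu>(2) by (auto simp: run_ends_def)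
  then show ?thesis using \<nu>(1)
  proof (induction k arbitrary: \<nu>)
    case 0 then show ?case using right by auto
  next
    case (Suc k)
    have c: "cR \<nu>" using Suc.prems(1)[rule_format, of 0] by simp
    have "cR ((nx ^^ i) (nx \<nu>))" if "i < k" for i
      using Suc.prems(1)[rule_format, of "Suc i"] that by (simp add: funpow_swap1)
    then have "h (nx \<nu>) = 0"
      using Suc.IH[of "nx \<nu>"] Suc.prems(2,3) nx c by (auto simp: funpow_swap1)
    then show ?case using step[OF Suc.prems(3) c] by simp
  qed
qed

section \<open>Half-edges at the vertices of a gentle quiver\<close>

lemma letter_inv_inv [simp]: "letter_inv (letter_inv x) = x"
  by (cases x) auto

lemma arrow_of_inv [simp]: "arrow_of (letter_inv x) = arrow_of x"
  by (cases x) auto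

lemma lstart_inv [simp]: "lstart Q (letter_inv x) = lend Q x" "lend Q (letter_inv x) = lstart Q x"
  by (cases x; simp)+

context bound_quiver
begin

text \<open>
  The elements supported on paths that contain a relation of length two form an ideal, and the generators of
  \<open>I\<close> lie in it.
\<close>

lemma ideal_support:
  assumes "f \<in> I" and "f (x, p) \<noteq> 0"
  shows "\<exists>u \<beta> \<alpha> v. p = u @ \<beta> # \<alpha> # v \<and> arrow_path Q [\<beta>, \<alpha>] \<in> I"
proof -
  obtain S where S: "S \<subseteq> {r \<in> paths Q. length (snd r) = 2}" "I = Idl\<^bsub>PA\<^esub> (path_elem ` S)"
    using quadratic by blast
  define bad where "bad p \<longleftrightarrow> (\<exists>u \<beta> \<alpha> v. p = u @ \<beta> # \<alpha> # v \<and> arrow_path Q [\<beta>, \<alpha>] \<in> I)" for p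
  have bad_app: "bad (q @ p)" if "bad q \<or> bad p" for q p
    using that unfolding bad_def by (metis append.assoc append_Cons)
  define J where "J = {f \<in> carrier PA. \<forall>x p. f (x, p) \<noteq> 0 \<longrightarrow> bad p}"
  have mult_J: "\<exists>i. f (path_end Q x (drop i p), take i p) \<noteq> 0 \<and> g (x, drop i p) \<noteq> 0"
    if "(f \<otimes>\<^bsub>PA\<^esub> g) (x, p) \<noteq> 0" for f g x p
  proof (rule ccontr)
    assume "\<nexists>i. f (path_end Q x (drop i p), take i p) \<noteq> 0 \<and> g (x, drop i p) \<noteq> 0"
    then have "(f \<otimes>\<^bsub>PA\<^esub> g) (x, p) = 0" unfolding PA_mult by (intro sum.neutral) auto
    then show False using that by simp
  qed
  have "ideal J PA"
  proof (rule idealI)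
    show "ring PA" by (rule ring_axioms)
    show "subgroup J (add_monoid PA)"
    proof (rule group.subgroupI)
      show "Group.group (add_monoid PA)" by (rule a_group)
      show "J \<noteq> {}" using zero_closed by (auto simp: J_def PA_zero)
      fix f assume f: "f \<in> J"
      have fc: "f \<in> carrier PA" "\<ominus>\<^bsub>PA\<^esub> f \<in> carrier PA" using f by (auto simp: J_def)
      have "f \<oplus>\<^bsub>PA\<^esub> \<ominus>\<^bsub>PA\<^esub> f = \<zero>\<^bsub>PA\<^esub>" using fc(1) by (rule r_neg)
      then have "f r + (\<ominus>\<^bsub>PA\<^esub> f) r = 0" for r unfolding PA_add PA_zero by (rule fun_cong)
      then have "(\<ominus>\<^bsub>PA\<^esub> f) r \<noteq> 0 \<Longrightarrow> f r \<noteq> 0" for r by (metis add_0)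
      then show "inv\<^bsub>add_monoid PA\<^esub> f \<in> J"
        using f fc(2) by (simp add: J_def a_inv_def) blast
      fix g assume g: "g \<in> J"
      have "f r + g r \<noteq> 0 \<Longrightarrow> f r \<noteq> 0 \<or> g r \<noteq> 0" for r by auto
      then show "f \<otimes>\<^bsub>add_monoid PA\<^esub> g \<in> J"
        using f g a_closed[of f g] by (simp add: J_def PA_add) blast
    qed (auto simp: J_def)
    fix a x assume a: "a \<in> J" and x: "x \<in> carrier PA"
    then have c: "x \<otimes>\<^bsub>PA\<^esub> a \<in> carrier PA" "a \<otimes>\<^bsub>PA\<^esub> x \<in> carrier PA" by (auto simp: J_def)
    have "bad p" if nz: "(x \<otimes>\<^bsub>PA\<^esub> a) (v, p) \<noteq> 0" for v p
    proof -
      obtain i where "a (v, drop i p) \<noteq> 0" using mult_J[OF nz] by blast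
      then have "bad (drop i p)" using a by (simp add: J_def)
      then show ?thesis using bad_app[of "take i p" "drop i p"] by simp
    qed
    then show "x \<otimes>\<^bsub>PA\<^esub> a \<in> J" using c by (simp add: J_def)
    have "bad p" if nz: "(a \<otimes>\<^bsub>PA\<^esub> x) (v, p) \<noteq> 0" for v p
    proof -
      obtain i where "a (path_end Q v (drop i p), take i p) \<noteq> 0" using mult_J[OF nz] by blast
      then have "bad (take i p)" using a by (simp add: J_def)
      then show ?thesis using bad_app[of "take i p" "drop i p"] by simp
    qed
    then show "a \<otimes>\<^bsub>PA\<^esub> x \<in> J" using c by (simp add: J_def)
  qed
  moreover have "path_elem ` S \<subseteq> J"
  proof (clarify)
    fix x p assume s: "(x, p) \<in> S"
    then have p: "path_from Q x p" "length p = 2" using S(1) by (auto simp: paths_def)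
    then obtain \<beta> \<alpha> where ba: "p = [\<beta>, \<alpha>]" by (auto simp: length_Suc_conv numeral_2_eq_2)
    with p have x: "x = tail Q \<alpha>" by auto
    have "path_elem ` S \<subseteq> carrier PA" using S(1) path_elem_carrier by auto
    then have "path_elem (x, p) \<in> I" using S(2) s genideal_self[of "path_elem ` S"] by auto
    then have "arrow_path Q [\<beta>, \<alpha>] \<in> I" using ba x by (simp add: arrow_path_def)
    then have "bad p" unfolding bad_def ba by (metis append_Nil)
    then show "path_elem (x, p) \<in> J"
      using p path_elem_carrier[of "(x, p)"] by (simp add: J_def paths_def path_elem_def)
  qed
  ultimately have "I \<subseteq> J" unfolding S(2) by (rule genideal_minimal)
  then show ?thesis using assms by (auto simp: J_def bad_def)
qed

lemma arrow_path_ideal: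
  assumes "arrow_path Q p \<in> I"
  shows "\<exists>u \<beta> \<alpha> v. p = u @ \<beta> # \<alpha> # v \<and> arrow_path Q [\<beta>, \<alpha>] \<in> I"
  using ideal_support[OF assms, of "tail Q (last p)" p] by (simp add: arrow_path_def path_elem_def)

lemma relation_arcs:
  assumes "arrow_path Q [\<beta>, \<alpha>] \<in> I"
  shows "\<alpha> \<in> arcs Q" "\<beta> \<in> arcs Q" "head Q \<alpha> = tail Q \<beta>"
proof -
  have "arrow_path Q [\<beta>, \<alpha>] \<in> carrier PA" using assms Icarr by blast
  then have "(tail Q \<alpha>, [\<beta>, \<alpha>]) \<in> paths Q"
    unfolding carrier_PA arrow_path_def by (auto simp: path_elem_def)
  then show "\<alpha> \<in> arcs Q" "\<beta> \<in> arcs Q" "head Q \<alpha> = tail Q \<beta>" by (auto simp: paths_def)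
qed

text \<open>
  A letter \<open>x\<close> is also a half-edge at the vertex \<open>lstart Q x\<close>, the one along which the letter leaves
  this vertex.  Two half-edges at a vertex block each other if no string may pass the vertex through both.
\<close>

definition blk :: "'a letter \<Rightarrow> 'a letter \<Rightarrow> bool" where
  "blk x y \<longleftrightarrow> x = y \<or> (\<exists>\<beta> \<alpha>. arrow_path Q [\<beta>, \<alpha>] \<in> I \<and> (x = Dir \<beta> \<and> y = Inv \<alpha> \<or> x = Inv \<alpha> \<and> y = Dir \<beta>))"

lemma blk_simps [simp]:
  "blk (Dir \<beta>) (Inv \<alpha>) \<longleftrightarrow> arrow_path Q [\<beta>, \<alpha>] \<in> I" "blk (Inv \<alpha>) (Dir \<beta>) \<longleftrightarrow> arrow_path Q [\<beta>, \<alpha>] \<in> I"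
  "blk (Dir \<beta>) (Dir \<beta>') \<longleftrightarrow> \<beta> = \<beta>'" "blk (Inv \<alpha>) (Inv \<alpha>') \<longleftrightarrow> \<alpha> = \<alpha>'"
  by (auto simp: blk_def)

lemma blk_refl [simp]: "blk x x" by (simp add: blk_def)
lemma blk_sym: "blk x y \<Longrightarrow> blk y x" by (auto simp: blk_def)
lemma blk_lstart: "blk x y \<Longrightarrow> lstart Q x = lstart Q y"
  by (auto simp: blk_def dest: relation_arcs)

text \<open>
  The letters meet at a vertex, and the two half-edges through which the string passes it, \<open>l\<close> and the inverse
  of \<open>l'\<close>, do not block each other.
\<close>

definition str_ok :: "'a letter \<Rightarrow> 'a letter \<Rightarrow> bool" where
  "str_ok l l' \<longleftrightarrow> lstart Q l = lend Q l' \<and> \<not> blk l (letter_inv l')"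

text \<open>
  Being a string is a condition on adjacent letters, because a path lies in \<open>I\<close> only if one of its subpaths of
  length two does.
\<close>

lemma is_string_iff:
  "is_string Q I w \<longleftrightarrow> w \<noteq> [] \<and> arrow_of ` set w \<subseteq> arcs Q \<and>
    (\<forall>i. Suc i < length w \<longrightarrow> str_ok (w ! i) (w ! Suc i))"
proof
  assume s: "is_string Q I w"
  then have no: "\<nexists>x u y p. w = x @ u @ y \<and> p \<noteq> [] \<and> (u = map Dir p \<or> word_inv u = map Dir p) \<and> arrow_path Q p \<in> I"
    by (simp add: is_string_def)
  have no': "arrow_path Q p \<notin> I" if "w = x @ u @ y" "p \<noteq> []" "u = map Dir p \<or> word_inv u = map Dir p" for x u y p
  proof
    assume "arrow_path Q p \<in> I"
    then have "\<exists>x u y p. w = x @ u @ y \<and> p \<noteq> [] \<and> (u = map Dir p \<or> word_inv u = map Dir p) \<and> arrow_path Q p \<in> I"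
      by (intro exI conjI) (rule that)+
    then show False using no by (rule notE[rotated])
  qed
  have "\<not> blk (w ! i) (letter_inv (w ! Suc i))" if i: "Suc i < length w" for i
  proof
    have w: "w = take i w @ [w ! i, w ! Suc i] @ drop (Suc (Suc i)) w"
      using i by (metis Cons_nth_drop_Suc Suc_lessD append_Cons append_Nil append_take_drop_id)
    assume "blk (w ! i) (letter_inv (w ! Suc i))"
    then consider "w ! i = letter_inv (w ! Suc i)"
      | \<beta> \<alpha> where "arrow_path Q [\<beta>, \<alpha>] \<in> I" "w ! i = Dir \<beta>" "letter_inv (w ! Suc i) = Inv \<alpha>"
      | \<beta> \<alpha> where "arrow_path Q [\<beta>, \<alpha>] \<in> I" "w ! i = Inv \<alpha>" "letter_inv (w ! Suc i) = Dir \<beta>"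
      by (auto simp: blk_def)
    then show False
    proof cases
      case 1 then show ?thesis using s i by (simp add: is_string_def walk_def)
    next
      case (2 \<beta> \<alpha>)
      then have "w ! Suc i = Dir \<alpha>" by (metis letter_inv_inv letter_inv.simps(2))
      then have "[w ! i, w ! Suc i] = map Dir [\<beta>, \<alpha>]" using 2 by simp
      then show ?thesis using no'[OF w, of "[\<beta>, \<alpha>]"] 2(1) by simp
    next
      case (3 \<beta> \<alpha>)
      then have "w ! Suc i = Inv \<beta>" by (metis letter_inv_inv letter_inv.simps(1))
      then have "word_inv [w ! i, w ! Suc i] = map Dir [\<beta>, \<alpha>]" using 3 by (simp add: word_inv_def)
      then show ?thesis using no'[OF w, of "[\<beta>, \<alpha>]"] 3(1) by simp
    qed
  qed
  then show "w \<noteq> [] \<and> arrow_of ` set w \<subseteq> arcs Q \<and> (\<forall>i. Suc i < length w \<longrightarrow> str_ok (w ! i) (w ! Suc i))"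
    using s by (auto simp: is_string_def walk_def str_ok_def)
next
  assume R: "w \<noteq> [] \<and> arrow_of ` set w \<subseteq> arcs Q \<and> (\<forall>i. Suc i < length w \<longrightarrow> str_ok (w ! i) (w ! Suc i))"
  have adj: "str_ok l l'" if "w = x @ l # l' # y" for x l l' y
  proof -
    have "w ! length x = l" "w ! Suc (length x) = l'" "Suc (length x) < length w"
      using that by (simp_all add: nth_append)
    then show ?thesis using R by metis
  qed
  have "\<nexists>x u y p. w = x @ u @ y \<and> p \<noteq> [] \<and> (u = map Dir p \<or> word_inv u = map Dir p) \<and> arrow_path Q p \<in> I"
  proof (intro notI, elim exE conjE)
    fix x u y p assume w: "w = x @ u @ y" and u: "u = map Dir p \<or> word_inv u = map Dir p" and p: "arrow_path Q p \<in> I"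
    obtain q \<beta> \<alpha> r where q: "p = q @ \<beta> # \<alpha> # r" "arrow_path Q [\<beta>, \<alpha>] \<in> I" using arrow_path_ideal[OF p] by blast
    from u show False
    proof
      assume "u = map Dir p"
      then have "w = (x @ map Dir q) @ Dir \<beta> # Dir \<alpha> # (map Dir r @ y)" using w q by simp
      then show False using adj q(2) by (fastforce simp: str_ok_def)
    next
      assume "word_inv u = map Dir p"
      then have "u = word_inv (map Dir p)" by (metis word_inv_def letter_inv_inv rev_map rev_rev_ident map_map comp_apply map_idI)
      then have "u = map Inv (rev r) @ Inv \<alpha> # Inv \<beta> # map Inv (rev q)"
        by (simp add: q word_inv_def rev_map comp_def)
      then have "w = (x @ map Inv (rev r)) @ Inv \<alpha> # Inv \<beta> # (map Inv (rev q) @ y)" using w by simp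
      then show False using adj q(2) by (fastforce simp: str_ok_def)
    qed
  qed
  then show "is_string Q I w"
    using R by (auto simp: is_string_def walk_def str_ok_def blk_def)
qed

end

locale gentle_quiver =
  fixes Q :: "('v, 'a) pre_digraph" and I :: "(('v, 'a) path \<Rightarrow> 'k::field) set"
  assumes gentle: "gentle Q I"
begin

sublocale bound_quiver Q I
  using gentle by unfold_locales (auto simp: gentle_def fin_digraph_def fin_digraph_axioms_def wf_digraph_def)

text \<open>
  The counting conditions of a gentle algebra in the form of uniqueness statements.
\<close>

lemma gentle_unique:
  shows "arrow_path Q [\<beta>, \<alpha>] \<in> I \<Longrightarrow> arrow_path Q [\<beta>', \<alpha>] \<in> I \<Longrightarrow> \<beta> = \<beta>'"
    and "arrow_path Q [\<beta>, \<alpha>] \<in> I \<Longrightarrow> arrow_path Q [\<beta>, \<alpha>'] \<in> I \<Longrightarrow> \<alpha> = \<alpha>'"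
    and "{\<alpha>, \<beta>, \<beta>'} \<subseteq> arcs Q \<Longrightarrow> head Q \<alpha> = tail Q \<beta> \<Longrightarrow> head Q \<alpha> = tail Q \<beta>' \<Longrightarrow>
      arrow_path Q [\<beta>, \<alpha>] \<notin> I \<Longrightarrow> arrow_path Q [\<beta>', \<alpha>] \<notin> I \<Longrightarrow> \<beta> = \<beta>'"
    and "{\<alpha>, \<alpha>', \<beta>} \<subseteq> arcs Q \<Longrightarrow> head Q \<alpha> = tail Q \<beta> \<Longrightarrow> head Q \<alpha>' = tail Q \<beta> \<Longrightarrow>
      arrow_path Q [\<beta>, \<alpha>] \<notin> I \<Longrightarrow> arrow_path Q [\<beta>, \<alpha>'] \<notin> I \<Longrightarrow> \<alpha> = \<alpha>'"
proof -
  have c: "card {b \<in> arcs Q. head Q a = tail Q b \<and> arrow_path Q [b, a] \<notin> I} \<le> 1 \<and>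
        card {c \<in> arcs Q. head Q c = tail Q a \<and> arrow_path Q [a, c] \<notin> I} \<le> 1 \<and>
        card {b \<in> arcs Q. head Q a = tail Q b \<and> arrow_path Q [b, a] \<in> I} \<le> 1 \<and>
        card {c \<in> arcs Q. head Q c = tail Q a \<and> arrow_path Q [a, c] \<in> I} \<le> 1" if "a \<in> arcs Q" for a
    using gentle that unfolding gentle_def by blast
  have u: "x = y" if "card {b \<in> arcs Q. P b} \<le> 1" "P x" "P y" "x \<in> arcs Q" "y \<in> arcs Q" for P x y
    using that finite_arcs card_le_Suc0_iff_eq[of "{b \<in> arcs Q. P b}"] by auto
  show "arrow_path Q [\<beta>, \<alpha>] \<in> I \<Longrightarrow> arrow_path Q [\<beta>', \<alpha>] \<in> I \<Longrightarrow> \<beta> = \<beta>'"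
    using c[of \<alpha>] relation_arcs[of \<beta> \<alpha>] relation_arcs[of \<beta>' \<alpha>] u[of "\<lambda>b. head Q \<alpha> = tail Q b \<and> arrow_path Q [b, \<alpha>] \<in> I" \<beta> \<beta>'] by blast
  show "arrow_path Q [\<beta>, \<alpha>] \<in> I \<Longrightarrow> arrow_path Q [\<beta>, \<alpha>'] \<in> I \<Longrightarrow> \<alpha> = \<alpha>'"
    using c[of \<beta>] relation_arcs[of \<beta> \<alpha>] relation_arcs[of \<beta> \<alpha>'] u[of "\<lambda>b. head Q b = tail Q \<beta> \<and> arrow_path Q [\<beta>, b] \<in> I" \<alpha> \<alpha>'] by blast
  show "{\<alpha>, \<beta>, \<beta>'} \<subseteq> arcs Q \<Longrightarrow> head Q \<alpha> = tail Q \<beta> \<Longrightarrow> head Q \<alpha> = tail Q \<beta>' \<Longrightarrow>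
      arrow_path Q [\<beta>, \<alpha>] \<notin> I \<Longrightarrow> arrow_path Q [\<beta>', \<alpha>] \<notin> I \<Longrightarrow> \<beta> = \<beta>'"
    using c[of \<alpha>] u[of "\<lambda>b. head Q \<alpha> = tail Q b \<and> arrow_path Q [b, \<alpha>] \<notin> I" \<beta> \<beta>'] by blast
  show "{\<alpha>, \<alpha>', \<beta>} \<subseteq> arcs Q \<Longrightarrow> head Q \<alpha> = tail Q \<beta> \<Longrightarrow> head Q \<alpha>' = tail Q \<beta> \<Longrightarrow>
      arrow_path Q [\<beta>, \<alpha>] \<notin> I \<Longrightarrow> arrow_path Q [\<beta>, \<alpha>'] \<notin> I \<Longrightarrow> \<alpha> = \<alpha>'"
    using c[of \<beta>] u[of "\<lambda>b. head Q b = tail Q \<beta> \<and> arrow_path Q [\<beta>, b] \<notin> I" \<alpha> \<alpha>'] by blast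
qed

lemma two_arrows:
  assumes "{a, b, c} \<subseteq> arcs Q" and "a \<noteq> b"
  shows "tail Q a = tail Q b \<Longrightarrow> tail Q b = tail Q c \<Longrightarrow> c = a \<or> c = b"
    and "head Q a = head Q b \<Longrightarrow> head Q b = head Q c \<Longrightarrow> c = a \<or> c = b"
proof -
  have c2: "card {x \<in> arcs Q. tail Q x = tail Q b} \<le> 2" "card {x \<in> arcs Q. head Q x = head Q b} \<le> 2"
    using gentle assms by (auto simp: gentle_def)
  have c3: "c = a \<or> c = b" if "{a, b, c} \<subseteq> S" "card S \<le> 2" "finite S" for S
  proof (rule ccontr)
    assume "\<not> (c = a \<or> c = b)"
    then have "card {a, b, c} = 3" using assms(2) by (auto simp: card_insert_if)
    then show False using card_mono[OF that(3,1)] that(2) by simp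
  qed
  show "c = a \<or> c = b" if "tail Q a = tail Q b" "tail Q b = tail Q c"
    by (rule c3[OF _ c2(1)]) (use assms that finite_arcs in auto)
  show "c = a \<or> c = b" if "head Q a = head Q b" "head Q b = head Q c"
    by (rule c3[OF _ c2(2)]) (use assms that finite_arcs in auto)
qed

lemma blk_trans: "blk x y \<Longrightarrow> blk y z \<Longrightarrow> blk x z"
  by (cases x; cases y; cases z) (auto dest: gentle_unique)

text \<open>At every vertex the half-edges fall into at most two classes of mutually blocking ones.\<close>

lemma blk_dichotomy:
  assumes "\<not> blk x y" and "lstart Q x = lstart Q y" "lstart Q z = lstart Q y"
    and "arrow_of x \<in> arcs Q" "arrow_of y \<in> arcs Q" "arrow_of z \<in> arcs Q"
  shows "blk z x \<or> blk z y"
proof -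
  have t1: "c = a \<or> c = b" if "a \<in> arcs Q" "b \<in> arcs Q" "c \<in> arcs Q" "a \<noteq> b" "tail Q a = tail Q b" "tail Q c = tail Q b" for a b c
    by (rule two_arrows(1)) (use that in auto)
  have t2: "c = a \<or> c = b" if "a \<in> arcs Q" "b \<in> arcs Q" "c \<in> arcs Q" "a \<noteq> b" "head Q a = head Q b" "head Q c = head Q b" for a b c
    by (rule two_arrows(2)) (use that in auto)
  have g3: "\<beta> = \<beta>'" if "\<alpha> \<in> arcs Q" "\<beta> \<in> arcs Q" "\<beta>' \<in> arcs Q" "head Q \<alpha> = tail Q \<beta>" "head Q \<alpha> = tail Q \<beta>'"
      "arrow_path Q [\<beta>, \<alpha>] \<notin> I" "arrow_path Q [\<beta>', \<alpha>] \<notin> I" for \<alpha> \<beta> \<beta>'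
    by (rule gentle_unique(3)) (use that in auto)
  have g4: "\<alpha> = \<alpha>'" if "\<alpha> \<in> arcs Q" "\<alpha>' \<in> arcs Q" "\<beta> \<in> arcs Q" "head Q \<alpha> = tail Q \<beta>" "head Q \<alpha>' = tail Q \<beta>"
      "arrow_path Q [\<beta>, \<alpha>] \<notin> I" "arrow_path Q [\<beta>, \<alpha>'] \<notin> I" for \<alpha> \<alpha>' \<beta>
    by (rule gentle_unique(4)) (use that in auto)
  show ?thesis
    using assms by (cases x; cases y; cases z; simp; metis t1 t2 g3 g4)
qed

end

section \<open>Extensions between two cyclic string-like modules\<close>

definition unit :: "nat \<Rightarrow> nat \<Rightarrow> 'k::field" where "unit j = (\<lambda>i. if i = j then 1 else 0)"

text \<open>
  A module whose basis vectors sit on a circle: from the basis vector \<open>i\<close> one leaves on the side \<open>s\<close> along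
  the half-edge \<open>he s i\<close> and reaches the basis vector \<open>nbr s i\<close>.  The two sides play the same role, so
  that reading the circle backwards is just a negation of \<open>s\<close>.
\<close>

locale cyc_rep = gentle_quiver Q I
  for Q :: "('v, 'a) pre_digraph" and I :: "(('v, 'a) path \<Rightarrow> 'k::field) set" +
  fixes n :: nat and vx :: "nat \<Rightarrow> 'v" and he :: "bool \<Rightarrow> nat \<Rightarrow> 'a letter"
    and nbr :: "bool \<Rightarrow> nat \<Rightarrow> nat" and ew :: "bool \<Rightarrow> nat \<Rightarrow> 'k"
    and act :: "'a \<Rightarrow> (nat \<Rightarrow> 'k) \<Rightarrow> nat \<Rightarrow> 'k"
  assumes nbr_less: "i < n \<Longrightarrow> nbr s i < n"
    and nbr_nbr: "i < n \<Longrightarrow> nbr (\<not> s) (nbr s i) = i"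
    and he_nbr: "i < n \<Longrightarrow> he (\<not> s) (nbr s i) = letter_inv (he s i)"
    and ew_nbr: "i < n \<Longrightarrow> ew (\<not> s) (nbr s i) = ew s i"
    and ew_nz: "i < n \<Longrightarrow> ew s i \<noteq> 0"
    and he_start: "i < n \<Longrightarrow> lstart Q (he s i) = vx i"
    and he_arc: "i < n \<Longrightarrow> arrow_of (he s i) \<in> arcs Q"
    and he_blk: "i < n \<Longrightarrow> \<not> blk (he s i) (he (\<not> s) i)"
    and act_eq: "act a v i = (if i < n then
      (if he True i = Inv a then ew True i * v (nbr True i) else 0) +
      (if he False i = Inv a then ew False i * v (nbr False i) else 0) else 0)"
begin

lemma he_blk_eq: "i < n \<Longrightarrow> blk (he s i) (he s' i) \<Longrightarrow> s = s'"
  using he_blk[of i s] by (cases s; cases s') auto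

lemma side_exists:
  assumes "i < n" and "lstart Q z = vx i" and "arrow_of z \<in> arcs Q"
  shows "\<exists>s. blk z (he s i)"
  using blk_dichotomy[of "he True i" "he False i" z] he_blk[OF assms(1), of True] assms he_start he_arc by auto

lemma act_in: "i < n \<Longrightarrow> he s i = Inv a \<Longrightarrow> act a v i = ew s i * v (nbr s i)"
  using he_blk_eq[of i s "\<not> s"] by (cases s) (auto simp: act_eq)

lemma act_in_none: "(\<And>s. he s i \<noteq> Inv a) \<Longrightarrow> act a v i = 0"
  by (simp add: act_eq)

lemma act_out: "i < n \<Longrightarrow> he s i = Dir a \<Longrightarrow> act a v (nbr s i) = ew s i * v i"
  using act_in[of "nbr s i" "\<not> s" a v] by (simp add: nbr_less he_nbr nbr_nbr[of i s] ew_nbr)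

lemma act_unit_none: "j < n \<Longrightarrow> (\<And>s. he s j \<noteq> Dir a) \<Longrightarrow> act a (unit j) = (\<lambda>_. 0)"
proof
  fix i assume j: "j < n" and no: "\<And>s. he s j \<noteq> Dir a"
  have "nbr s i \<noteq> j" if "i < n" "he s i = Inv a" for s
    using he_nbr[OF that(1), of s] no[of "\<not> s"] that(2) by auto
  then show "act a (unit j) i = 0" by (auto simp: act_eq unit_def)
qed

lemma act_unit: "j < n \<Longrightarrow> he s j = Dir a \<Longrightarrow> act a (unit j) = (\<lambda>i. if i = nbr s j then ew s j else 0)"
proof
  fix i assume j: "j < n" and h: "he s j = Dir a"
  show "act a (unit j) i = (if i = nbr s j then ew s j else 0)"
  proof (cases "i = nbr s j")
    case True then show ?thesis using act_out[OF j h, of "unit j"] by (simp add: unit_def)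
  next
    case False
    have "nbr s' i \<noteq> j" if i: "i < n" "he s' i = Inv a" for s'
    proof
      assume e: "nbr s' i = j"
      then have "he (\<not> s') j = Dir a" using he_nbr[OF i(1), of s'] i(2) by simp
      then have "blk (he (\<not> s') j) (he s j)" using h by simp
      then have "(\<not> s') = s" by (rule he_blk_eq[OF j])
      then show False using False nbr_nbr[OF i(1), of s'] e by (cases s; cases s'; simp)
    qed
    then show ?thesis using False by (auto simp: act_eq unit_def)
  qed
qed

sublocale quiver_rep Q I n vx act
proof
  show "vx i \<in> verts Q" if "i < n" for i
    using he_start[OF that, of True] he_arc[OF that, of True] tail_in_verts head_in_verts
    by (cases "he True i") (auto simp del: head_in_verts tail_in_verts, metis+)
next
  fix a u v assume a: "a \<in> arcs Q"
  show "act a (\<lambda>i. u i + v i) = (\<lambda>i. act a u i + act a v i)"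
    by (auto simp: act_eq algebra_simps)
  show "act a (\<lambda>i. \<kappa> * v i) = (\<lambda>i. \<kappa> * act a v i)" for \<kappa>
    by (auto simp: act_eq algebra_simps)
  show "i < n \<and> vx i = head Q a" if nz: "act a v i \<noteq> 0" for i
  proof -
    have i: "i < n" using nz by (auto simp: act_eq split: if_splits)
    obtain s where "he s i = Inv a" using nz act_in_none[of i a v] by blast
    then show ?thesis using he_start[OF i, of s] i by simp
  qed
  assume uv: "\<And>i. i < n \<Longrightarrow> vx i = tail Q a \<Longrightarrow> u i = v i"
  have "u (nbr s i) = v (nbr s i)" if "i < n" "he s i = Inv a" for s i
  proof (rule uv)
    show "nbr s i < n" using that nbr_less by simp
    show "vx (nbr s i) = tail Q a"
      using he_start[OF nbr_less[OF that(1)], of "\<not> s" s] he_nbr[OF that(1), of s] that(2) by simp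
  qed
  then show "act a u = act a v" by (intro ext) (simp add: act_eq)
next
  fix \<alpha> \<beta> v assume *: "\<alpha> \<in> arcs Q" "\<beta> \<in> arcs Q" "arrow_path Q [\<beta>, \<alpha>] \<in> I"
  show "act \<beta> (act \<alpha> v) = (\<lambda>_. 0)"
  proof
    fix i
    have "act \<alpha> v (nbr s i) = 0" if i: "i < n" "he s i = Inv \<beta>" for s
    proof (rule act_in_none)
      fix s' show "he s' (nbr s i) \<noteq> Inv \<alpha>"
      proof
        assume h: "he s' (nbr s i) = Inv \<alpha>"
        have d: "he (\<not> s) (nbr s i) = Dir \<beta>" using he_nbr[OF i(1), of s] i(2) by simp
        then have "blk (he (\<not> s) (nbr s i)) (he s' (nbr s i))" using h * by simp
        then have "(\<not> s) = s'" by (rule he_blk_eq[OF nbr_less[OF i(1)]])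
        then show False using d h by auto
      qed
    qed
    then show "act \<beta> (act \<alpha> v) i = 0" by (simp add: act_eq[of \<beta>])
  qed
qed

end

locale cyc_pair = gentle_quiver Q I + B: cyc_rep Q I nb vb hb nbb wb actb + C: cyc_rep Q I nc vc hc nbc wc actc
  for Q :: "('v, 'a) pre_digraph" and I :: "(('v, 'a) path \<Rightarrow> 'k::field) set"
    and nb vb hb nbb wb actb nc vc hc nbc wc actc
begin

sublocale rep_pair Q I nb vb actb nc vc actc
  by (intro rep_pair.intro) (rule bound_quiver_axioms B.quiver_rep_axioms C.quiver_rep_axioms)+

text \<open>
  A pair of basis vectors at the same vertex, together with the unique orientation \<open>r\<close> of the first
  circle for which the blocking classes on the two sides agree.
\<close>

fun node :: "bool \<times> nat \<times> nat \<Rightarrow> bool" where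
  "node (r, i, j) \<longleftrightarrow> i < nb \<and> j < nc \<and> blk (hb r i) (hc False j)"

text \<open>
  Both circles are traversed simultaneously, to the side \<open>s\<close> on the second one and to the side that \<open>r\<close> makes
  correspond to it on the first one. \<open>con\<close> says that the two letters met there agree, and \<open>good\<close> that they
  differ as at an end of an overlap.
\<close>

fun step :: "bool \<Rightarrow> bool \<times> nat \<times> nat \<Rightarrow> bool \<times> nat \<times> nat" where
  "step s (r, i, j) = (r, nbb (s \<noteq> r) i, nbc s j)"

fun con :: "bool \<Rightarrow> bool \<times> nat \<times> nat \<Rightarrow> bool" where
  "con s (r, i, j) \<longleftrightarrow> hb (s \<noteq> r) i = hc s j"

fun good :: "bool \<Rightarrow> bool \<times> nat \<times> nat \<Rightarrow> bool" where
  "good s (r, i, j) \<longleftrightarrow> (\<exists>D. hb (s \<noteq> r) i = Dir D) \<and> (\<exists>B. hc s j = Inv B)"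

text \<open>
  The entry of a cocycle that belongs to the node and the side \<open>s\<close>. At a connected side it lies on the edge to the next
  node. At a good side there are two entries, which the relation formed by the two arrows makes proportional; one of
  them is chosen.
\<close>

fun ent :: "('a \<Rightarrow> nat \<Rightarrow> nat \<Rightarrow> 'k) \<Rightarrow> bool \<Rightarrow> bool \<times> nat \<times> nat \<Rightarrow> 'k" where
  "ent S s (r, i, j) = (case hb (s \<noteq> r) i of Dir a \<Rightarrow> S a (nbb (s \<noteq> r) i) j
    | Inv _ \<Rightarrow> (case hc s j of Inv a \<Rightarrow> S a i (nbc s j) | Dir _ \<Rightarrow> 0))"

lemma nodeI:
  assumes "i < nb" "j < nc" and b: "blk (hb (s \<noteq> r) i) (hc s j)"
  shows "node (r, i, j)"
proof (cases s)
  case False then show ?thesis using assms by simp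
next
  case True
  have "lstart Q (hb r i) = lstart Q (hc s j)"
    using blk_lstart[OF b] B.he_start[OF assms(1), of r] B.he_start[OF assms(1), of "s \<noteq> r"] by simp
  then have "blk (hb r i) (hc True j) \<or> blk (hb r i) (hc False j)"
    using C.he_blk[OF assms(2), of True] True assms
    by (intro blk_dichotomy) (auto simp: C.he_start C.he_arc B.he_arc)
  moreover have "\<not> blk (hb r i) (hc True j)"
  proof
    assume "blk (hb r i) (hc True j)"
    then have "blk (hb r i) (hc s j)" using True by simp
    then have "blk (hb r i) (hb (s \<noteq> r) i)" by (rule blk_trans[OF _ blk_sym[OF b]])
    then show False using B.he_blk_eq[OF assms(1), of r "s \<noteq> r"] True by simp
  qed
  ultimately show ?thesis using assms by simp
qed

lemma node_side:
  assumes "node (r, i, j)"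
  shows "blk (hb (s \<noteq> r) i) (hc s j)"
proof -
  have ij: "i < nb" "j < nc" "blk (hb r i) (hc False j)" using assms by auto
  have "lstart Q (hb (\<not> r) i) = lstart Q (hc False j)"
    using blk_lstart[OF ij(3)] B.he_start[OF ij(1)] by simp
  then have "blk (hb (\<not> r) i) (hc True j) \<or> blk (hb (\<not> r) i) (hc False j)"
    using C.he_blk[OF ij(2), of True] ij by (intro blk_dichotomy) (auto simp: C.he_start C.he_arc B.he_arc)
  moreover have "\<not> blk (hb (\<not> r) i) (hc False j)"
    using blk_trans[of "hb (\<not> r) i" "hc False j" "hb r i"] blk_sym[OF ij(3)] B.he_blk_eq[OF ij(1), of "\<not> r" r] by auto
  ultimately show ?thesis using ij by (cases s) auto
qed

lemma node_unique:
  assumes "node (r, i, j)" and "node (r', i, j)"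
  shows "r = r'"
  using assms blk_trans[of "hb r i" "hc False j" "hb r' i"] blk_sym B.he_blk_eq[of i r r'] by auto

lemma step_con:
  assumes \<nu>: "node \<nu>" "con s \<nu>"
  shows "node (step s \<nu>)" "con (\<not> s) (step s \<nu>)" "step (\<not> s) (step s \<nu>) = \<nu>"
proof -
  obtain r i j where n: "\<nu> = (r, i, j)" by (cases \<nu>) auto
  have ij: "i < nb" "j < nc" and c: "hb (s \<noteq> r) i = hc s j" using \<nu> n by auto
  have e: "((\<not> s) \<noteq> r) = (\<not> (s \<noteq> r))" by auto
  have h: "hb ((\<not> s) \<noteq> r) (nbb (s \<noteq> r) i) = hc (\<not> s) (nbc s j)"
    unfolding e B.he_nbr[OF ij(1)] C.he_nbr[OF ij(2)] c ..
  then show "con (\<not> s) (step s \<nu>)" by (simp add: n)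
  have "blk (hb ((\<not> s) \<noteq> r) (nbb (s \<noteq> r) i)) (hc (\<not> s) (nbc s j))" unfolding h by simp
  then show "node (step s \<nu>)"
    unfolding n step.simps by (rule nodeI[OF B.nbr_less[OF ij(1)] C.nbr_less[OF ij(2)]])
  show "step (\<not> s) (step s \<nu>) = \<nu>"
    unfolding n step.simps e B.nbr_nbr[OF ij(1)] C.nbr_nbr[OF ij(2)] ..
qed

lemma good_not_con: "good s \<nu> \<Longrightarrow> \<not> con s \<nu>"
  by (cases \<nu>) auto

lemma ent_step:
  assumes \<nu>: "node \<nu>" "con s \<nu>"
  shows "ent S (\<not> s) (step s \<nu>) = ent S s \<nu>"
proof -
  obtain r i j where n: "\<nu> = (r, i, j)" by (cases \<nu>) auto
  have ij: "i < nb" "j < nc" and c: "hb (s \<noteq> r) i = hc s j" using \<nu> n by auto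
  have e: "((\<not> s) \<noteq> r) = (\<not> (s \<noteq> r))" by auto
  show ?thesis
    unfolding n step.simps ent.simps e B.he_nbr[OF ij(1)] C.he_nbr[OF ij(2)]
      B.nbr_nbr[OF ij(1)] C.nbr_nbr[OF ij(2)] c
    by (cases "hc s j") auto
qed

lemma mat_unit: "i < nb \<Longrightarrow> j < nc \<Longrightarrow> mat S a (unit j) i = S a i j"
  by (simp add: mat_def unit_def if_distrib[of "\<lambda>t. _ * t"] cong: if_cong)

text \<open>
  The entries of a cocycle along the connections between nodes and at the ends of the chains of nodes
  determine it: all other entries are killed by, or tied by, the relations in \<open>I\<close>.
\<close>

lemma cocycle_vanishes:
  assumes S: "cocycle S"
    and edge: "\<And>\<nu>. node \<nu> \<Longrightarrow> con True \<nu> \<Longrightarrow> ent S True \<nu> = 0"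
    and fin: "\<And>s \<nu>. node \<nu> \<Longrightarrow> good s \<nu> \<Longrightarrow> ent S s \<nu> = 0"
  shows "S a i j = 0"
proof (rule ccontr)
  assume nz: "S a i j \<noteq> 0"
  note supp = cocycle_supp[OF S nz]
  have a: "a \<in> arcs Q" and i: "i < nb" and j: "j < nc" and v: "vb i = head Q a" "vc j = tail Q a"
    using supp by auto
  have edge': "ent S s \<nu> = 0" if \<nu>: "node \<nu>" "con s \<nu>" for s \<nu>
  proof (cases s)
    case True then show ?thesis using edge \<nu> by simp
  next
    case False
    note st = step_con[OF \<nu>]
    have "ent S True (step False \<nu>) = 0" using edge st False by simp
    then show ?thesis using ent_step[OF \<nu>, of S] False by simp
  qed
  (* both ends of the arrow lie on one side of their basis vectors, up to blocking; this locates the entry at a node *)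
  obtain sb where sb: "blk (Inv a) (hb sb i)"
    using B.side_exists[OF i, of "Inv a"] a v by auto
  obtain sc where sc: "blk (Dir a) (hc sc j)"
    using C.side_exists[OF j, of "Dir a"] a v by auto
  show False
  proof (cases "hb sb i")
    case (Inv a')
    then have hb: "hb sb i = Inv a" using sb by simp
    define i0 where "i0 = nbb sb i"
    define r where "r = (sc \<noteq> (\<not> sb))"
    have r: "(sc \<noteq> r) = (\<not> sb)" by (auto simp: r_def)
    have i0: "i0 < nb" "hb (\<not> sb) i0 = Dir a" "nbb (\<not> sb) i0 = i"
      using B.nbr_less[OF i] B.he_nbr[OF i, of sb] B.nbr_nbr[OF i] hb by (simp_all add: i0_def)
    have nd: "node (r, i0, j)" by (rule nodeI[OF i0(1) j, of sc]) (simp add: r i0 sc del: not_iff)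
    have en: "ent S sc (r, i0, j) = S a i j" by (simp only: ent.simps r i0 letter.case)
    show False
    proof (cases "hc sc j")
      case (Dir a'')
      then have "con sc (r, i0, j)" using sc by (simp only: con.simps r i0) simp
      then show False using edge' nd en nz by metis
    next
      case (Inv a'')
      then have "good sc (r, i0, j)" by (simp only: good.simps r i0) simp
      then show False using fin nd en nz by metis
    qed
  next
    case (Dir \<beta>)
    then have rel: "arrow_path Q [\<beta>, a] \<in> I" using sb by simp
    note ra = relation_arcs[OF rel]
    define i' where "i' = nbb sb i"
    have i': "i' < nb" using B.nbr_less[OF i] by (simp add: i'_def)
    have R: "wb sb i * S a i j + mat S \<beta> (actc a (unit j)) i' = 0"
      using cocycle_rel[OF S ra(1,2,3) rel, of "unit j" i'] B.act_out[OF i Dir, of "mat S a (unit j)"]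
      by (simp add: mat_unit[OF i j] i'_def)
    show False
    proof (cases "hc sc j")
      case Da: (Dir a')
      then have hc: "hc sc j = Dir a" using sc by simp
      define j1 where "j1 = nbc sc j"
      have j1: "j1 < nc" "hc (\<not> sc) j1 = Inv a"
        using C.nbr_less[OF j] C.he_nbr[OF j, of sc] hc by (simp_all add: j1_def)
      define r where "r = ((\<not> sc) \<noteq> sb)"
      have r: "((\<not> sc) \<noteq> r) = sb" by (auto simp: r_def)
      have nd: "node (r, i, j1)" by (rule nodeI[OF i j1(1), of "\<not> sc"]) (simp only: r j1 Dir blk_simps rel)
      have g: "good (\<not> sc) (r, i, j1)" by (simp only: good.simps r j1 Dir) simp
      have "S \<beta> i' j1 = 0" using fin[OF nd g] by (simp only: ent.simps r Dir letter.case i'_def)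
      moreover have "actc a (unit j) = (\<lambda>k. wc sc j * unit j1 k)"
        unfolding C.act_unit[OF j hc] by (auto simp: unit_def j1_def)
      ultimately have "mat S \<beta> (actc a (unit j)) i' = 0"
        by (simp add: mat_scale mat_unit[OF i' j1(1)])
      then show False using R nz B.ew_nz[OF i, of sb] by simp
    next
      case (Inv \<alpha>)
      have "hc s j \<noteq> Dir a" for s
      proof
        assume h: "hc s j = Dir a"
        then have "blk (hc s j) (hc sc j)" using sc by simp
        then have "s = sc" by (rule C.he_blk_eq[OF j])
        then show False using h Inv by simp
      qed
      then have "actc a (unit j) = (\<lambda>_. 0)" by (rule C.act_unit_none[OF j])
      then show False using R nz B.ew_nz[OF i, of sb] by (simp add: mat_zero)
    qed
  qed
qed


lemma mat_supp_sum: "i < nb \<Longrightarrow> mat S a v i = (\<Sum>j<nc. S a i j * v j)"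
  by (simp add: mat_def)

definition cob :: "(nat \<Rightarrow> nat \<Rightarrow> 'k) \<Rightarrow> 'a \<Rightarrow> nat \<Rightarrow> nat \<Rightarrow> 'k" where
  "cob h a i j = (if a \<in> arcs Q \<and> i < nb \<and> j < nc then
    actb a (\<lambda>k. h k j) i - (\<Sum>k<nc. h i k * actc a (unit j) k) else 0)"

definition vertexwise :: "(nat \<Rightarrow> nat \<Rightarrow> 'k) \<Rightarrow> bool" where
  "vertexwise h \<longleftrightarrow> (\<forall>i j. h i j \<noteq> 0 \<longrightarrow> i < nb \<and> j < nc \<and> vb i = vc j)"

lemma mat_cob:
  assumes h: "vertexwise h" and a: "a \<in> arcs Q"
  shows "mat (cob h) a v i = actb a (mat (\<lambda>_. h) a v) i - mat (\<lambda>_. h) a (actc a v) i"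
proof (cases "i < nb")
  case False
  then show ?thesis by (simp add: mat_bound B.act_bound[OF a])
next
  case i: True
  have eq1: "mat (\<lambda>_. h) a v = (\<lambda>k. \<Sum>j<nc. v j * h k j)"
  proof
    fix k
    have "h k j = 0" if "\<not> k < nb" for j using h that by (auto simp: vertexwise_def)
    then show "mat (\<lambda>_. h) a v k = (\<Sum>j<nc. v j * h k j)"
      by (cases "k < nb") (auto simp: mat_def mult.commute)
  qed
  have "actc a v = actc a (\<lambda>k. \<Sum>j<nc. v j * unit j k)"
    by (rule C.act_cong[OF a]) (auto simp: unit_def if_distrib[of "\<lambda>t. _ * t"] cong: if_cong)
  then have eq2: "actc a v = (\<lambda>k. \<Sum>j<nc. v j * actc a (unit j) k)"
    by (simp add: C.act_sum[OF a] C.act_scale[OF a])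
  have "mat (cob h) a v i = (\<Sum>j<nc. v j * actb a (\<lambda>k. h k j) i) - (\<Sum>j<nc. \<Sum>k<nc. v j * (h i k * actc a (unit j) k))"
    using i a by (simp add: mat_def cob_def sum_subtractf[symmetric] left_diff_distrib sum_distrib_left[symmetric] mult.commute[of _ "v _"] right_diff_distrib[symmetric])
  also have "(\<Sum>j<nc. v j * actb a (\<lambda>k. h k j) i) = actb a (mat (\<lambda>_. h) a v) i"
    unfolding eq1 by (simp add: B.act_sum[OF a] B.act_scale[OF a])
  also have "(\<Sum>j<nc. \<Sum>k<nc. v j * (h i k * actc a (unit j) k)) = mat (\<lambda>_. h) a (actc a v) i"
    using i by (subst sum.swap) (simp add: mat_def eq2 sum_distrib_left ac_simps)
  finally show ?thesis .
qed

lemma coboundary_iff: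
  assumes "\<And>a i j. S a i j \<noteq> 0 \<Longrightarrow> a \<in> arcs Q \<and> i < nb \<and> j < nc"
  shows "coboundary h S \<longleftrightarrow> vertexwise h \<and> S = cob h"
proof
  assume c: "coboundary h S"
  then have h: "vertexwise h" by (simp add: coboundary_def vertexwise_def)
  have "S a i j = cob h a i j" for a i j
  proof (cases "a \<in> arcs Q \<and> i < nb \<and> j < nc")
    case True
    then have "mat S a (unit j) i = mat (cob h) a (unit j) i"
      using c mat_cob[OF h] by (simp add: coboundary_def)
    then show ?thesis using True by (simp add: mat_unit)
  next
    case False then show ?thesis using assms[of a i j] by (auto simp: cob_def)
  qed
  then have "S = cob h" by (intro ext)
  then show "vertexwise h \<and> S = cob h" using h by (intro conjI)
next
  assume "vertexwise h \<and> S = cob h"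
  then show "coboundary h S" using mat_cob[of h] by (auto simp: coboundary_def vertexwise_def)
qed

lemma cocycle_cob:
  assumes h: "vertexwise h"
  shows "cocycle (cob h)"
  unfolding cocycle_def
proof (intro conjI allI ballI impI)
  fix a i j assume nz: "cob h a i j \<noteq> 0"
  then show a: "a \<in> arcs Q" and i: "i < nb" and j: "j < nc" by (auto simp: cob_def split: if_splits)
  have "actb a (\<lambda>k. h k j) i \<noteq> 0 \<or> (\<exists>k<nc. h i k * actc a (unit j) k \<noteq> 0)"
  proof (rule ccontr)
    assume "\<not> ?thesis"
    then have "actb a (\<lambda>k. h k j) i = 0" "(\<Sum>k<nc. h i k * actc a (unit j) k) = 0"
      by (auto intro!: sum.neutral)
    then have "cob h a i j = 0" by (simp add: cob_def)
    then show False using nz by simp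
  qed
  then show "vb i = head Q a"
    using B.act_supp[OF a, of "\<lambda>k. h k j" i] C.act_supp[OF a, of "unit j"] h by (fastforce simp: vertexwise_def)
  show "vc j = tail Q a"
  proof (rule ccontr)
    assume v: "vc j \<noteq> tail Q a"
    have "actb a (\<lambda>k. h k j) = actb a (\<lambda>_. 0)"
      by (rule B.act_cong[OF a]) (use h v in \<open>unfold vertexwise_def, metis\<close>)
    moreover have "actc a (unit j) = actc a (\<lambda>_. 0)"
      by (rule C.act_cong[OF a]) (use v in \<open>auto simp: unit_def\<close>)
    ultimately show False using nz by (simp add: cob_def B.act_zero[OF a] C.act_zero[OF a] split: if_splits)
  qed
next
  fix \<alpha> \<beta> v i assume *: "\<alpha> \<in> arcs Q" "\<beta> \<in> arcs Q" "head Q \<alpha> = tail Q \<beta>" "arrow_path Q [\<beta>, \<alpha>] \<in> I"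
  define H where "H = mat (\<lambda>_. h) undefined"
  have H: "mat (\<lambda>_. h) a v = H v" for a v by (simp add: H_def mat_def)
  have H0: "H (\<lambda>_. 0) = (\<lambda>_. 0)" by (simp add: H_def mat_zero)
  have "mat (cob h) \<alpha> v = (\<lambda>k. actb \<alpha> (H v) k - H (actc \<alpha> v) k)"
    by (rule ext) (simp add: mat_cob[OF h *(1)] H)
  then have "actb \<beta> (mat (cob h) \<alpha> v) = (\<lambda>i. actb \<beta> (actb \<alpha> (H v)) i - actb \<beta> (H (actc \<alpha> v)) i)"
    by (simp only: B.act_diff[OF *(2)])
  then have "actb \<beta> (mat (cob h) \<alpha> v) i = - actb \<beta> (H (actc \<alpha> v)) i"
    unfolding B.act_rel[OF *] by simp
  moreover have "mat (cob h) \<beta> (actc \<alpha> v) i = actb \<beta> (H (actc \<alpha> v)) i"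
    by (simp add: mat_cob[OF h *(2)] H C.act_rel[OF *] H0)
  ultimately show "actb \<beta> (mat (cob h) \<alpha> v) i + mat (cob h) \<beta> (actc \<alpha> v) i = 0" by simp
qed

text \<open>
  A connection between two nodes couples two unknowns, a good end involves only one.
\<close>

lemma ent_cob:
  assumes n: "node (r, i, j)"
  shows "hb (s \<noteq> r) i = Dir a \<Longrightarrow> hc s j = Dir a \<Longrightarrow>
      ent (cob h) s (r, i, j) = wb (s \<noteq> r) i * h i j - wc s j * h (nbb (s \<noteq> r) i) (nbc s j)"
    and "hb (s \<noteq> r) i = Inv a \<Longrightarrow> hc s j = Inv a \<Longrightarrow>
      ent (cob h) s (r, i, j) = wb (s \<noteq> r) i * h (nbb (s \<noteq> r) i) (nbc s j) - wc s j * h i j"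
    and "good s (r, i, j) \<Longrightarrow> ent (cob h) s (r, i, j) = wb (s \<noteq> r) i * h i j"
proof -
  have ij: "i < nb" "j < nc" using n by auto
  note lt = B.nbr_less[OF ij(1)] C.nbr_less[OF ij(2)]
  have arcs: "a \<in> arcs Q" if "hb (s \<noteq> r) i = Dir a \<or> hc s j = Inv a" for a
    using that B.he_arc[OF ij(1), of "s \<noteq> r"] C.he_arc[OF ij(2), of s] by auto
  have s1: "(\<Sum>k<nc. f k * (if k = k0 then w else 0)) = w * f k0" if "k0 < nc" for f k0 and w :: 'k
    using that by (simp add: if_distrib[of "\<lambda>t. _ * t"] cong: if_cong)
  {
    assume h: "hb (s \<noteq> r) i = Dir a" "hc s j = Dir a"
    show "ent (cob h) s (r, i, j) = wb (s \<noteq> r) i * h i j - wc s j * h (nbb (s \<noteq> r) i) (nbc s j)"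
      using lt ij arcs[of a] h
      by (simp only: ent.simps letter.case cob_def C.act_unit[OF ij(2) h(2)] B.act_out[OF ij(1) h(1)] s1) simp
  next
    assume h: "hb (s \<noteq> r) i = Inv a" "hc s j = Inv a"
    have h': "hc (\<not> s) (nbc s j) = Dir a" using C.he_nbr[OF ij(2), of s] h by simp
    show "ent (cob h) s (r, i, j) = wb (s \<noteq> r) i * h (nbb (s \<noteq> r) i) (nbc s j) - wc s j * h i j"
      using lt ij arcs[of a] h
      by (simp only: ent.simps letter.case cob_def C.act_unit[OF lt(2) h'] B.act_in[OF ij(1) h(1)]
          C.nbr_nbr[OF ij(2)] C.ew_nbr[OF ij(2)] s1) simp
  next
    assume "good s (r, i, j)"
    then obtain D B where h: "hb (s \<noteq> r) i = Dir D" "hc s j = Inv B" by auto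
    have "hc s' j \<noteq> Dir D" for s'
    proof
      assume d: "hc s' j = Dir D"
      then have "blk (hc s' j) (hc s j)" using node_side[OF n, of s] h by simp
      then have "s' = s" by (rule C.he_blk_eq[OF ij(2)])
      then show False using d h by simp
    qed
    then have "actc D (unit j) = (\<lambda>_. 0)" by (rule C.act_unit_none[OF ij(2)])
    then show "ent (cob h) s (r, i, j) = wb (s \<noteq> r) i * h i j"
      using lt ij arcs[of D] h
      by (simp only: ent.simps letter.case cob_def B.act_out[OF ij(1) h(1)]) simp
  }
qed

text \<open>
  The cocycle of the crosswise gluing at a node whose left end is good: half of the coboundary of the
  map \<open>z\<^sup>c \<mapsto> z\<^sup>b\<close>, namely its components on the left-hand side.
\<close>

fun glue_cocycle :: "bool \<times> nat \<times> nat \<Rightarrow> 'a \<Rightarrow> nat \<Rightarrow> nat \<Rightarrow> 'k" where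
  "glue_cocycle (r, y, p) a i j =
    (if hb r y = Dir a \<and> i = nbb r y \<and> j = p then wb r y else 0) -
    (if hc False p = Inv a \<and> i = y \<and> j = nbc False p then wc False p else 0)"

lemma mat_glue_cocycle:
  assumes "y < nb" "p < nc"
  shows "mat (glue_cocycle (r, y, p)) a v i =
    (if hb r y = Dir a \<and> i = nbb r y then wb r y * v p else 0) -
    (if hc False p = Inv a \<and> i = y then wc False p * v (nbc False p) else 0)"
proof (cases "i < nb")
  case False
  then show ?thesis using assms B.nbr_less[of y r] by (auto simp: mat_bound)
next
  case True
  have s1: "(\<Sum>j<nc. (if P \<and> i = k \<and> j = q then w else 0) * v j) = (if P \<and> i = k then w * v q else 0)" if "q < nc"
    for P k q and w :: 'k
    using that by (auto simp: if_distrib[of "\<lambda>t. t * _"] cong: if_cong)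
  show ?thesis
    using True assms C.nbr_less[OF assms(2)]
    by (simp only: mat_supp_sum glue_cocycle.simps left_diff_distrib sum_subtractf s1)
qed

text \<open>
  The only relation that could fail is the one formed by \<open>D\<close> and \<open>B\<close>. There the two summands of the glued action
  contribute opposite terms, which is the reason for the sign.
\<close>

lemma cocycle_glue:
  assumes n: "node (r, y, p)" and g: "good False (r, y, p)"
  shows "cocycle (glue_cocycle (r, y, p))"
proof -
  have yp: "y < nb" "p < nc" using n by auto
  obtain D B where h: "hb r y = Dir D" "hc False p = Inv B" using g by auto
  have DB: "arrow_path Q [D, B] \<in> I" using n h by simp
  note ra = relation_arcs[OF DB]
  have y': "nbb r y < nb" "hb (\<not> r) (nbb r y) = Inv D" using B.nbr_less[OF yp(1)] B.he_nbr[OF yp(1), of r] h by auto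
  have p': "nbc False p < nc" "hc True (nbc False p) = Dir B" using C.nbr_less[OF yp(2)] C.he_nbr[OF yp(2), of False] h by auto
  show ?thesis unfolding cocycle_def
  proof (intro conjI allI ballI impI)
    fix a i j assume "glue_cocycle (r, y, p) a i j \<noteq> 0"
    then have "(a = D \<and> i = nbb r y \<and> j = p) \<or> (a = B \<and> i = y \<and> j = nbc False p)"
      using h by (auto split: if_splits)
    moreover have "vb (nbb r y) = head Q D" using B.he_start[OF y'(1), of "\<not> r"] y' by simp
    moreover have "vc p = head Q B" using C.he_start[OF yp(2), of False] h by simp
    moreover have "vb y = tail Q D" using B.he_start[OF yp(1), of r] h by simp
    moreover have "vc (nbc False p) = tail Q B" using C.he_start[OF p'(1), of True] p' by simp
    ultimately have "a \<in> arcs Q \<and> i < nb \<and> j < nc \<and> vb i = head Q a \<and> vc j = tail Q a"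
      using ra y' p' yp by auto
    then show "a \<in> arcs Q" "i < nb" "j < nc" "vb i = head Q a" "vc j = tail Q a" by auto
  next
    fix \<alpha> \<beta> v i assume *: "\<alpha> \<in> arcs Q" "\<beta> \<in> arcs Q" "head Q \<alpha> = tail Q \<beta>" "arrow_path Q [\<beta>, \<alpha>] \<in> I"
    have e: "mat (glue_cocycle (r, y, p)) a v = (\<lambda>i. (if a = D then wb r y * v p else 0) * unit (nbb r y) i
        + (if a = B then - (wc False p * v (nbc False p)) else 0) * unit y i)" for a v
      by (rule ext) (auto simp: mat_glue_cocycle[OF yp] h unit_def)
    have b1: "actb \<beta> (unit (nbb r y)) = (\<lambda>_. 0)" if "\<alpha> = D"
    proof (rule B.act_unit_none[OF y'(1)])
      fix s show "hb s (nbb r y) \<noteq> Dir \<beta>"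
      proof
        assume d: "hb s (nbb r y) = Dir \<beta>"
        then have "blk (hb s (nbb r y)) (hb (\<not> r) (nbb r y))" using y' * that by simp
        then have "s = (\<not> r)" by (rule B.he_blk_eq[OF y'(1)])
        then show False using d y' by simp
      qed
    qed
    have b2: "actb \<beta> (unit y) i = (if \<beta> = D then wb r y * unit (nbb r y) i else 0)" if "\<alpha> = B"
    proof (cases "\<beta> = D")
      case True
      then show ?thesis using B.act_unit[OF yp(1), of r \<beta>] h by (simp add: unit_def)
    next
      case False
      have "actb \<beta> (unit y) = (\<lambda>_. 0)"
        using gentle_unique(1)[of \<beta> B D] * DB that False by blast
      then show ?thesis using False by simp
    qed
    have b3: "actc \<alpha> v (nbc False p) = 0" if "\<beta> = B"
    proof (rule C.act_in_none)
      fix s show "hc s (nbc False p) \<noteq> Inv \<alpha>"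
      proof
        assume d: "hc s (nbc False p) = Inv \<alpha>"
        then have "blk (hc s (nbc False p)) (hc True (nbc False p))" using p' * that by simp
        then have "s = True" by (rule C.he_blk_eq[OF p'(1)])
        then show False using d p' by simp
      qed
    qed
    have b4: "actc \<alpha> v p = wc False p * v (nbc False p) \<and> \<alpha> = B" if "\<beta> = D"
    proof -
      have "\<alpha> = B" using gentle_unique(2)[of D \<alpha> B] * DB that by blast
      then show ?thesis using C.act_in[OF yp(2), of False \<alpha>] h by simp
    qed
    show "actb \<beta> (mat (glue_cocycle (r, y, p)) \<alpha> v) i + mat (glue_cocycle (r, y, p)) \<beta> (actc \<alpha> v) i = 0"
    proof -
      have ab: "\<beta> = D" if "\<alpha> = B" using gentle_unique(1)[of \<beta> B D] *(4) DB that by simp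
      have t1: "(if \<alpha> = D then wb r y * v p else 0) * actb \<beta> (unit (nbb r y)) i = 0"
        using b1 by (cases "\<alpha> = D") simp_all
      have t2: "(if \<alpha> = B then - (wc False p * v (nbc False p)) else 0) * actb \<beta> (unit y) i =
          (if \<beta> = D then - (wc False p * v (nbc False p) * wb r y * unit (nbb r y) i) else 0)"
        using b2 ab b4 by (cases "\<alpha> = B") auto
      have t3: "(if \<beta> = D then wb r y * actc \<alpha> v p else 0) * unit (nbb r y) i =
          (if \<beta> = D then wc False p * v (nbc False p) * wb r y * unit (nbb r y) i else 0)"
      proof (cases "\<beta> = D")
        case True
        then have "actc \<alpha> v p = wc False p * v (nbc False p)" using b4 by blast
        then show ?thesis by simp
      qed simp
      have t4: "(if \<beta> = B then - (wc False p * actc \<alpha> v (nbc False p)) else 0) * unit y i = 0"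
        using b3 by (cases "\<beta> = B") simp_all
      show ?thesis
        unfolding e B.act_add[OF *(2)] B.act_scale[OF *(2)] t1 t2 t3 t4 by simp
    qed
  qed
qed

text \<open>
  Gluing at a node changes exactly one of the coordinates of a cocycle, the one at the good left end.
\<close>

lemma ent_glue:
  assumes x: "node (r, y, p)" "good False (r, y, p)" and \<nu>: "node \<nu>"
  shows "ent (glue_cocycle (r, y, p)) s \<nu> = (if \<not> s \<and> \<nu> = (r, y, p) then wb r y else 0)"
proof -
  obtain r' i j where \<nu>': "\<nu> = (r', i, j)" by (cases \<nu>) auto
  have yp: "y < nb" "p < nc" and ij: "i < nb" "j < nc" using x \<nu> \<nu>' by auto
  obtain D B where h: "hb r y = Dir D" "hc False p = Inv B" using x by auto
  have DB: "arrow_path Q [D, B] \<in> I" using x h by simp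
  have y': "nbb r y < nb" "hb (\<not> r) (nbb r y) = Inv D" using B.nbr_less[OF yp(1)] B.he_nbr[OF yp(1), of r] h by auto
  have p': "nbc False p < nc" "hc True (nbc False p) = Dir B" using C.nbr_less[OF yp(2)] C.he_nbr[OF yp(2), of False] h by auto
  have nB: "hb t y \<noteq> Inv B" for t
  proof
    assume d: "hb t y = Inv B"
    then have "blk (hb t y) (hb r y)" using h DB by simp
    then have "t = r" by (rule B.he_blk_eq[OF yp(1)])
    then show False using d h by simp
  qed
  have nD: "hc t p \<noteq> Dir D" for t
  proof
    assume d: "hc t p = Dir D"
    then have "blk (hc t p) (hc False p)" using h DB by simp
    then have "t = False" by (rule C.he_blk_eq[OF yp(2)])
    then show False using d h by simp
  qed
  define q where "q = (s \<noteq> r')"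
  have same: "\<nu> = (r, y, p) \<and> \<not> s" if "q = r" "i = y" "j = p"
  proof -
    have "r' = r" using node_unique[of r' y p r] x(1) \<nu> \<nu>' that by simp
    then show ?thesis using that \<nu>' by (auto simp: q_def)
  qed
  have conv: "q = r \<and> i = y \<and> j = p" if "\<nu> = (r, y, p)" "\<not> s" using that \<nu>' by (auto simp: q_def)
  show ?thesis
  proof (cases "hb q i")
    case (Dir a)
    have 1: "hb r y = Dir a \<and> nbb q i = nbb r y \<and> j = p \<longleftrightarrow> \<nu> = (r, y, p) \<and> \<not> s"
    proof
      assume *: "hb r y = Dir a \<and> nbb q i = nbb r y \<and> j = p"
      then have "hb (\<not> q) (nbb r y) = Inv D" using B.he_nbr[OF ij(1), of q] Dir h by simp
      then have "blk (hb (\<not> q) (nbb r y)) (hb (\<not> r) (nbb r y))" using y' by simp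
      then have "(\<not> q) = (\<not> r)" by (rule B.he_blk_eq[OF y'(1)])
      then have q: "q = r" by simp
      have nq: "nbb q i = nbb r y" and jp: "j = p" using * by blast+
      have "nbb (\<not> q) (nbb q i) = nbb (\<not> r) (nbb r y)" unfolding nq unfolding q ..
      then have iy: "i = y" unfolding B.nbr_nbr[OF ij(1)] B.nbr_nbr[OF yp(1)] .
      show "\<nu> = (r, y, p) \<and> \<not> s" by (rule same[OF q iy jp])
    next
      assume "\<nu> = (r, y, p) \<and> \<not> s"
      then have "q = r" "i = y" "j = p" using conv by auto
      then show "hb r y = Dir a \<and> nbb q i = nbb r y \<and> j = p" using Dir by simp
    qed
    have 2: "\<not> (hc False p = Inv a \<and> nbb q i = y)"
      using B.he_nbr[OF ij(1), of q] Dir h nB[of "\<not> q"] by auto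
    have e1: "(if hb r y = Dir a \<and> nbb q i = nbb r y \<and> j = p then wb r y else 0) =
        (if \<not> s \<and> \<nu> = (r, y, p) then wb r y else 0)"
      using 1 by (simp only: conj_commute)
    have e2: "(if hc False p = Inv a \<and> nbb q i = y \<and> j = nbc False p then wc False p else 0) = 0"
      using 2 by auto
    have "ent (glue_cocycle (r, y, p)) s \<nu> = glue_cocycle (r, y, p) a (nbb q i) j"
      unfolding \<nu>' ent.simps q_def[symmetric] Dir letter.case ..
    then show ?thesis unfolding glue_cocycle.simps e1 e2 by simp
  next
    case lb: (Inv a')
    have no: "\<not> (\<nu> = (r, y, p) \<and> \<not> s)"
    proof
      assume "\<nu> = (r, y, p) \<and> \<not> s"
      then have "q = r" "i = y" using conv by auto
      then show False using lb h by simp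
    qed
    show ?thesis
    proof (cases "hc s j")
      case (Dir a)
      then have "ent (glue_cocycle (r, y, p)) s \<nu> = 0"
        unfolding \<nu>' ent.simps q_def[symmetric] lb letter.case by simp
      then show ?thesis using no by auto
    next
      case (Inv a)
      have 1: "\<not> (hb r y = Dir a \<and> nbc s j = p)"
        using C.he_nbr[OF ij(2), of s] Inv h nD[of "\<not> s"] by auto
      have 2: "\<not> (hc False p = Inv a \<and> i = y \<and> nbc s j = nbc False p)"
      proof
        assume *: "hc False p = Inv a \<and> i = y \<and> nbc s j = nbc False p"
        have "blk (hb q i) (hc s j)" unfolding q_def by (rule node_side[OF \<nu>[unfolded \<nu>']])
        then show False using lb Inv * h nB[of q] by auto
      qed
      have e1: "(if hb r y = Dir a \<and> i = nbb r y \<and> nbc s j = p then wb r y else 0) = 0"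
        using 1 by auto
      have e2: "(if hc False p = Inv a \<and> i = y \<and> nbc s j = nbc False p then wc False p else 0) = 0"
        using 2 by auto
      have "ent (glue_cocycle (r, y, p)) s \<nu> = glue_cocycle (r, y, p) a i (nbc s j)"
        unfolding \<nu>' ent.simps q_def[symmetric] lb Inv letter.case ..
      then show ?thesis unfolding glue_cocycle.simps e1 e2 using no by auto
    qed
  qed
qed

end

context cyc_pair
begin

text \<open>
  \<open>ratio\<close> and \<open>shift\<close> are the coefficients of the equation on the edge to the right of a node, solved for the
  unknown at that node.
\<close>

fun ratio :: "bool \<times> nat \<times> nat \<Rightarrow> 'k" where
  "ratio (r, i, j) = (case hc True j of Dir _ \<Rightarrow> wc True j / wb (\<not> r) i | Inv _ \<Rightarrow> wb (\<not> r) i / wc True j)"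

fun shift :: "'k \<Rightarrow> bool \<times> nat \<times> nat \<Rightarrow> 'k" where
  "shift x (r, i, j) = (case hc True j of Dir _ \<Rightarrow> x / wb (\<not> r) i | Inv _ \<Rightarrow> - x / wc True j)"

lemma edge_equation:
  assumes n: "node (r, i, j)" and c: "con True (r, i, j)"
  shows "ent (cob h) True (r, i, j) = x \<longleftrightarrow>
    h i j = shift x (r, i, j) + ratio (r, i, j) * h (nbb (\<not> r) i) (nbc True j)"
proof -
  have ij: "i < nb" "j < nc" using n by auto
  have nz: "wb (\<not> r) i \<noteq> 0" "wc True j \<noteq> 0" using B.ew_nz[OF ij(1)] C.ew_nz[OF ij(2)] by auto
  have t: "(True \<noteq> r) = (\<not> r)" by simp
  have hh: "hb (\<not> r) i = hc True j" using c by simp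
  show ?thesis
  proof (cases "hc True j")
    case (Dir a)
    have e1: "ent (cob h) True (r, i, j) = wb (\<not> r) i * h i j - wc True j * h (nbb (\<not> r) i) (nbc True j)"
      using ent_cob(1)[OF n, of True a] hh Dir unfolding t by simp
    show ?thesis unfolding e1 using nz Dir by (auto simp: field_simps)
  next
    case (Inv a)
    have e1: "ent (cob h) True (r, i, j) = wb (\<not> r) i * h (nbb (\<not> r) i) (nbc True j) - wc True j * h i j"
      using ent_cob(2)[OF n, of True a] hh Inv unfolding t by simp
    show ?thesis unfolding e1 using nz Inv by (auto simp: field_simps)
  qed
qed

lemma ent_diff: "ent (\<lambda>a i j. S a i j - S' a i j) s \<nu> = ent S s \<nu> - ent S' s \<nu>"
  by (cases \<nu>) (auto split: letter.split)

lemma ent_sum: "ent (\<lambda>a i j. \<Sum>x\<in>J. \<kappa> x * S x a i j) s \<nu> = (\<Sum>x\<in>J. \<kappa> x * ent (S x) s \<nu>)"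
  by (cases \<nu>) (auto split: letter.split)

lemma cocycle_diff: "cocycle T \<Longrightarrow> cocycle T' \<Longrightarrow> cocycle (\<lambda>a i j. T a i j - T' a i j)"
  using cocycle_add[of T "\<lambda>a i j. - 1 * T' a i j"] cocycle_scale[of T' "- 1"] by simp

text \<open>
  The left end of a chain both of whose ends are good.
\<close>

definition overlap_node :: "bool \<times> nat \<times> nat \<Rightarrow> bool" where
  "overlap_node x \<longleftrightarrow> node x \<and> good False x \<and> run_ends (step True) (con True) (good True) x"

lemma ent_glue_sum:
  assumes J: "finite J" and g: "\<And>x. x \<in> J \<Longrightarrow> overlap_node (g x)" and n: "node \<nu>"
  shows "ent (\<lambda>a i j. \<Sum>x\<in>J. \<kappa> x * glue_cocycle (g x) a i j) s \<nu> =
      (if s then 0 else \<Sum>x | x \<in> J \<and> \<nu> = g x. \<kappa> x * wb (fst \<nu>) (fst (snd \<nu>)))"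
proof -
  have gO: "node (g x)" "good False (g x)" "run_ends (step True) (con True) (good True) (g x)" if "x \<in> J" for x
    using g that by (auto simp: overlap_node_def)
  have ent_g: "ent (glue_cocycle (g x)) s \<nu> = (if \<not> s \<and> \<nu> = g x then wb (fst \<nu>) (fst (snd \<nu>)) else 0)"
    if "x \<in> J" "node \<nu>" for x s \<nu>
    using gO[OF that(1)] ent_glue[OF _ _ that(2)] by (cases "g x") auto
    have "ent (\<lambda>a i j. \<Sum>x\<in>J. \<kappa> x * glue_cocycle (g x) a i j) s \<nu> =
        (\<Sum>x\<in>J. if \<nu> = g x then (if s then 0 else \<kappa> x * wb (fst \<nu>) (fst (snd \<nu>))) else 0)"
      unfolding ent_sum by (rule sum.cong) (auto simp: ent_g n)
    also have "\<dots> = (\<Sum>x | x \<in> J \<and> \<nu> = g x. (if s then 0 else \<kappa> x * wb (fst \<nu>) (fst (snd \<nu>))))"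
      using J by (simp add: sum.inter_filter)
    finally show ?thesis by simp
  qed

text \<open>
  If a combination of gluings is a coboundary of \<open>h\<close>, then \<open>h\<close> vanishes along each chain in question because its
  right end is good, and the equation at the left end says that the coefficient is zero.
\<close>

lemma glue_independent:
  assumes J: "finite J" and g: "\<And>x. x \<in> J \<Longrightarrow> overlap_node (g x)" and inj: "inj_on g J"
    and cb: "coboundary h (\<lambda>a i j. \<Sum>x\<in>J. \<kappa> x * glue_cocycle (g x) a i j)" and x: "x \<in> J"
  shows "\<kappa> x = 0"
proof -
  have gO: "node (g x)" "good False (g x)" "run_ends (step True) (con True) (good True) (g x)" if "x \<in> J" for x
    using g that by (auto simp: overlap_node_def)
  have gT: "cocycle (glue_cocycle (g x))" if "x \<in> J" for x
    using gO[OF that] cocycle_glue by (cases "g x") auto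
  have ent_gsum: "ent (\<lambda>a i j. \<Sum>x\<in>J. \<kappa> x * glue_cocycle (g x) a i j) s \<nu> =
      (if s then 0 else \<Sum>x | x \<in> J \<and> \<nu> = g x. \<kappa> x * wb (fst \<nu>) (fst (snd \<nu>)))" if "node \<nu>" for \<kappa> s \<nu>
    by (rule ent_glue_sum[OF J _ that]) (rule g)
  have single: "{x. x \<in> J \<and> g x0 = g x} = {x0}" if "x0 \<in> J" for x0
    using inj that by (auto simp: inj_on_def)
  have bwt: "wb r i \<noteq> 0" if "node (r', i, j)" for r r' i j
    using that B.ew_nz by simp
  have supp: "a \<in> arcs Q \<and> i < nb \<and> j < nc" if "cocycle S" "S a i j \<noteq> 0" for S a i j
    using cocycle_supp[OF that] by blast
  let ?G = "\<lambda>a i j. \<Sum>x\<in>J. \<kappa> x * glue_cocycle (g x) a i j"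
  have cG: "cocycle ?G" by (rule cocycle_sum[OF J gT])
  have h: "vertexwise h" "?G = cob h" using coboundary_iff[of ?G h] supp[OF cG] cb by blast+
  have entG: "ent (cob h) s \<nu> = (if s then 0 else \<Sum>x | x \<in> J \<and> \<nu> = g x. \<kappa> x * wb (fst \<nu>) (fst (snd \<nu>)))"
    if "node \<nu>" for s \<nu>
    using ent_gsum[OF that, of \<kappa> s] unfolding h(2) .
  define hN where "hN \<nu> = h (fst (snd \<nu>)) (snd (snd \<nu>))" for \<nu> :: "bool \<times> nat \<times> nat"
  have "hN (g x) = 0"
  proof (rule chain_unique[where N = "Collect node" and cR = "con True" and nx = "step True" and \<rho> = ratio and GR = "good True"])
    show "step True \<nu> \<in> Collect node" if "\<nu> \<in> Collect node" "con True \<nu>" for \<nu>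
      using step_con(1)[of \<nu> True] that by simp
    show "hN \<nu> = ratio \<nu> * hN (step True \<nu>)" if \<nu>: "\<nu> \<in> Collect node" "con True \<nu>" for \<nu>
    proof -
      obtain r i j where e: "\<nu> = (r, i, j)" by (cases \<nu>) auto
      have n: "node (r, i, j)" "con True (r, i, j)" using \<nu> e by auto
      have t: "(True \<noteq> r) = (\<not> r)" by simp
      have "ent (cob h) True (r, i, j) = 0" using entG[OF n(1), of True] by simp
      then have "h i j = shift 0 (r, i, j) + ratio (r, i, j) * h (nbb (\<not> r) i) (nbc True j)"
        unfolding edge_equation[OF n] .
      moreover have "shift 0 (r, i, j) = 0" by (simp split: letter.split)
      ultimately show ?thesis unfolding e hN_def step.simps t by simp
    qed
    show "hN \<nu> = 0" if \<nu>: "\<nu> \<in> Collect node" "good True \<nu>" for \<nu>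
    proof -
      obtain r i j where e: "\<nu> = (r, i, j)" by (cases \<nu>) auto
      have n: "node (r, i, j)" "good True (r, i, j)" using \<nu> e by auto
      have "wb (True \<noteq> r) i * h i j = 0" using ent_cob(3)[OF n, of h] entG[OF n(1), of True] by simp
      then show ?thesis using bwt[OF n(1)] unfolding e hN_def by simp
    qed
  qed (use gO x in auto)
  moreover obtain r i j where e: "g x = (r, i, j)" by (cases "g x") auto
  ultimately have h0: "h i j = 0" by (simp add: hN_def)
  note n = gO(1,2)[OF x, unfolded e]
  have "ent (cob h) False (r, i, j) = (\<Sum>x' | x' \<in> J \<and> (r, i, j) = g x'. \<kappa> x' * wb r i)"
    using entG[OF n(1), of False] by (simp only: fst_conv snd_conv if_False)
  also have "\<dots> = \<kappa> x * wb r i" unfolding single[OF x, unfolded e] by simp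
  finally have "\<kappa> x * wb r i = 0" using ent_cob(3)[OF n, of h] h0 by simp
  then show "\<kappa> x = 0" using bwt[OF n(1)] by simp
qed

text \<open>
  Every chain of nodes with good ends on both sides contributes one dimension to the first extension
  space; along all other chains the unknown map \<open>h\<close> can be solved for. A closed chain is solvable
  because its monodromy is not \<open>1\<close>.
\<close>

lemma glue_basis:
  assumes J: "finite J"
    and g: "bij_betw g J (Collect overlap_node)"
    and cyclic: "\<And>\<nu>. node \<nu> \<Longrightarrow> (\<And>k. con True ((step True ^^ k) \<nu>)) \<Longrightarrow>
      (step True ^^ n) \<nu> = \<nu> \<and> (\<Prod>k<n. ratio ((step True ^^ k) \<nu>)) \<noteq> 1"
  shows "is_basis ExtV J (\<lambda>x. cl (glue_cocycle (g x)))"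
proof -
  have gO: "node (g x)" "good False (g x)" "run_ends (step True) (con True) (good True) (g x)" if "x \<in> J" for x
    using g that by (auto simp: bij_betw_def overlap_node_def)
  have gT: "cocycle (glue_cocycle (g x))" if "x \<in> J" for x
    using gO[OF that] cocycle_glue by (cases "g x") auto
  have gO': "overlap_node (g x)" if "x \<in> J" for x using g that by (auto simp: bij_betw_def)
  have inj: "inj_on g J" using g by (simp add: bij_betw_def)
  have ent_gsum: "ent (\<lambda>a i j. \<Sum>x\<in>J. \<kappa> x * glue_cocycle (g x) a i j) s \<nu> =
      (if s then 0 else \<Sum>x | x \<in> J \<and> \<nu> = g x. \<kappa> x * wb (fst \<nu>) (fst (snd \<nu>)))" if "node \<nu>" for \<kappa> s \<nu>
    by (rule ent_glue_sum[OF J _ that]) (rule gO')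
  have single: "{x. x \<in> J \<and> g x0 = g x} = {x0}" if "x0 \<in> J" for x0
    using g that by (auto simp: bij_betw_def inj_on_def)
  have none: "{x. x \<in> J \<and> \<nu> = g x} = {}" if "\<not> run_ends (step True) (con True) (good True) \<nu>" for \<nu>
    using gO(3) that by auto
  have bwt: "wb r i \<noteq> 0" if "node (r', i, j)" for r r' i j
    using that B.ew_nz by simp
  have supp: "a \<in> arcs Q \<and> i < nb \<and> j < nc" if "cocycle S" "S a i j \<noteq> 0" for S a i j
    using cocycle_supp[OF that] by blast
  show ?thesis
  proof (rule basis_criterion[OF J gT])
    fix T assume T: "cocycle T"
      (* the left condition is dropped exactly on the chains of the overlaps, whose coefficients absorb it *)
      have "\<exists>h. (\<forall>\<nu>\<in>Collect node. con True \<nu> \<longrightarrow> h \<nu> = shift (ent T True \<nu>) \<nu> + ratio \<nu> * h (step True \<nu>)) \<and>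
        (\<forall>\<nu>\<in>Collect node. good True \<nu> \<longrightarrow> h \<nu> = ent T True \<nu> / wb (\<not> fst \<nu>) (fst (snd \<nu>))) \<and>
        (\<forall>\<nu>\<in>Collect node. good False \<nu> \<and> \<not> run_ends (step True) (con True) (good True) \<nu> \<longrightarrow>
          h \<nu> = ent T False \<nu> / wb (fst \<nu>) (fst (snd \<nu>)))"
      proof (rule chain_solvable[where cL = "con False" and pv = "step False"])
        fix \<nu> assume \<nu>: "\<nu> \<in> Collect node"
        then show "ratio \<nu> \<noteq> 0"
          by (cases \<nu>) (auto simp: B.ew_nz C.ew_nz split: letter.split)
        show "con True \<nu> \<Longrightarrow> step True \<nu> \<in> Collect node \<and> con False (step True \<nu>) \<and> step False (step True \<nu>) = \<nu>"
          using step_con[of \<nu> True] \<nu> by simp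
        show "(\<And>k. con True ((step True ^^ k) \<nu>)) \<Longrightarrow>
          (step True ^^ n) \<nu> = \<nu> \<and> (\<Prod>k<n. ratio ((step True ^^ k) \<nu>)) \<noteq> 1"
          using cyclic \<nu> by simp
      qed (use good_not_con in auto)
    then obtain h where h3: "(\<forall>\<nu>\<in>Collect node. con True \<nu> \<longrightarrow> h \<nu> = shift (ent T True \<nu>) \<nu> + ratio \<nu> * h (step True \<nu>)) \<and>
        (\<forall>\<nu>\<in>Collect node. good True \<nu> \<longrightarrow> h \<nu> = ent T True \<nu> / wb (\<not> fst \<nu>) (fst (snd \<nu>))) \<and>
        (\<forall>\<nu>\<in>Collect node. good False \<nu> \<and> \<not> run_ends (step True) (con True) (good True) \<nu> \<longrightarrow>
          h \<nu> = ent T False \<nu> / wb (fst \<nu>) (fst (snd \<nu>)))" ..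
    have h_edge: "h \<nu> = shift (ent T True \<nu>) \<nu> + ratio \<nu> * h (step True \<nu>)" if "node \<nu>" "con True \<nu>" for \<nu>
      using h3 that by blast
    have h_R: "h \<nu> = ent T True \<nu> / wb (\<not> fst \<nu>) (fst (snd \<nu>))" if "node \<nu>" "good True \<nu>" for \<nu>
      using h3 that by blast
    have h_L: "h \<nu> = ent T False \<nu> / wb (fst \<nu>) (fst (snd \<nu>))"
      if "node \<nu>" "good False \<nu>" "\<not> run_ends (step True) (con True) (good True) \<nu>" for \<nu>
      using h3 that by blast
    (* at most one of the two orientations makes the pair a node, so this is well defined *)
    define hm where "hm i j = (if node (True, i, j) then h (True, i, j) else if node (False, i, j) then h (False, i, j) else 0)" for i j
    have hm: "hm i j = h (r, i, j)" if "node (r, i, j)" for r i j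
      using that node_unique[of True i j False] by (cases r) (auto simp: hm_def simp del: node.simps)
    have vw: "vertexwise hm"
      unfolding vertexwise_def
    proof (intro allI impI)
      fix i j assume "hm i j \<noteq> 0"
      then obtain r where "node (r, i, j)" by (auto simp: hm_def simp del: node.simps split: if_splits)
      then show "i < nb \<and> j < nc \<and> vb i = vc j"
        using blk_lstart[of "hb r i" "hc False j"] by (auto simp: B.he_start C.he_start)
    qed
    define \<kappa> where "\<kappa> x = (ent T False (g x) - wb (fst (g x)) (fst (snd (g x))) * h (g x)) / wb (fst (g x)) (fst (snd (g x)))" for x
    let ?G = "\<lambda>a i j. \<Sum>x\<in>J. \<kappa> x * glue_cocycle (g x) a i j"
    let ?S = "\<lambda>a i j. (T a i j - ?G a i j) - cob hm a i j"
    have cG: "cocycle ?G" by (rule cocycle_sum[OF J gT])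
    have cS: "cocycle ?S" by (rule cocycle_diff[OF cocycle_diff[OF T cG] cocycle_cob[OF vw]])
    have "?S a i j = 0" for a i j
    proof (rule cocycle_vanishes[OF cS])
      fix \<nu> assume \<nu>: "node \<nu>" "con True \<nu>"
      obtain r i j where e: "\<nu> = (r, i, j)" by (cases \<nu>) auto
      have t: "(True \<noteq> r) = (\<not> r)" by simp
      have "ent (cob hm) True (r, i, j) = ent T True (r, i, j)"
        unfolding edge_equation[OF \<nu>[unfolded e]]
        using h_edge[OF \<nu>] hm[OF \<nu>(1)[unfolded e]] hm[OF step_con(1)[OF \<nu>, unfolded e step.simps]]
        unfolding e step.simps t by simp
      then have "ent (cob hm) True \<nu> = ent T True \<nu>" unfolding e .
      then show "ent ?S True \<nu> = 0" unfolding ent_diff ent_gsum[OF \<nu>(1)] by simp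
    next
      fix s \<nu> assume \<nu>: "node \<nu>" "good s \<nu>"
      obtain r i j where e: "\<nu> = (r, i, j)" by (cases \<nu>) auto
      have c: "ent (cob hm) s \<nu> = wb (s \<noteq> r) i * h \<nu>"
        using ent_cob(3)[OF \<nu>[unfolded e]] hm[OF \<nu>(1)[unfolded e]] e by simp
      have nz: "wb q i \<noteq> 0" for q using bwt \<nu>(1) e by blast
      show "ent ?S s \<nu> = 0"
      proof (cases s)
        case True
        have t: "(True \<noteq> r) = (\<not> r)" by simp
        have st: "s = True" using True by simp
        have "ent (cob hm) s \<nu> = ent T s \<nu>"
          using h_R[OF \<nu>(1) \<nu>(2)[unfolded st]] nz[of "\<not> r"] unfolding c unfolding st t by (simp add: e del: node.simps good.simps ent.simps)
        then show ?thesis unfolding ent_diff ent_gsum[OF \<nu>(1)] using True by simp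
      next
        case False
        have t: "(False \<noteq> r) = r" by simp
        have sf: "s = False" using False by simp
        have c': "ent (cob hm) False \<nu> = wb r i * h \<nu>" using c unfolding sf t .
        show ?thesis
        proof (cases "run_ends (step True) (con True) (good True) \<nu>")
          case True
          then have "\<nu> \<in> g ` J" using g \<nu> False by (auto simp: bij_betw_def overlap_node_def)
          then obtain x0 where x0: "x0 \<in> J" "\<nu> = g x0" by auto
          have "(\<Sum>x | x \<in> J \<and> \<nu> = g x. \<kappa> x * wb (fst \<nu>) (fst (snd \<nu>))) = \<kappa> x0 * wb (fst \<nu>) (fst (snd \<nu>))"
            unfolding x0(2) single[OF x0(1)] by simp
          also have "\<dots> = ent T False \<nu> - wb r i * h \<nu>"
            using nz[of r] unfolding \<kappa>_def x0(2)[symmetric] e by (simp del: ent.simps)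
          finally show ?thesis
            unfolding ent_diff ent_gsum[OF \<nu>(1)] sf c' by simp
        next
          case nr: False
          have "ent T False \<nu> = wb r i * h \<nu>"
            using h_L[OF \<nu>(1) _ nr] \<nu>(2) False nz[of r] e by (simp del: ent.simps good.simps)
          then show ?thesis
            unfolding ent_diff ent_gsum[OF \<nu>(1)] sf c' none[OF nr] by simp
        qed
      qed
    qed
    then have "(\<lambda>a i j. T a i j - ?G a i j) = cob hm" by (intro ext) (simp add: algebra_simps)
    then have "coboundary hm (\<lambda>a i j. T a i j - ?G a i j)"
      using coboundary_iff[of "\<lambda>a i j. T a i j - ?G a i j" hm] supp[OF cocycle_diff[OF T cG]] vw by blast
    then show "\<exists>\<kappa> h. coboundary h (\<lambda>a i j. T a i j - (\<Sum>x\<in>J. \<kappa> x * glue_cocycle (g x) a i j))" by blast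
  next
    fix \<kappa> h x assume "coboundary h (\<lambda>a i j. \<Sum>x\<in>J. \<kappa> x * glue_cocycle (g x) a i j)" and "x \<in> J"
    then show "\<kappa> x = 0" by (intro glue_independent[OF J _ inj, of h \<kappa> x]) (rule gO')
  qed
qed

end

section \<open>Cyclic words and their modules\<close>

lemma inf_word_mod: "i mod int (length w) = j mod int (length w) \<Longrightarrow> inf_word w i = inf_word w j"
  by (simp add: inf_word_def)

lemma inf_word_add: "inf_word w (i + int (length w)) = inf_word w i"
  by (rule inf_word_mod) simp

lemma inf_word_nth: "i < length w \<Longrightarrow> inf_word w (int i) = w ! i"
  by (simp add: inf_word_def nat_mod_distrib)

lemma inf_word_inv:
  assumes "w \<noteq> []"
  shows "inf_word (word_inv w) k = letter_inv (inf_word w (- 1 - k))"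
proof -
  let ?n = "int (length w)"
  define i where "i = nat (k mod ?n)"
  have n: "0 < ?n" using assms by simp
  have i: "int i = k mod ?n" using n by (simp add: i_def)
  then have il: "i < length w" using n by (metis of_nat_less_iff pos_mod_bound)
  have "inf_word (word_inv w) k = word_inv w ! i" by (simp add: inf_word_def word_inv_def i_def)
  also have "\<dots> = letter_inv (w ! (length w - Suc i))"
    using il by (simp add: word_inv_def rev_nth)
  also have "w ! (length w - Suc i) = inf_word w (int (length w - Suc i))"
    using il by (intro inf_word_nth[symmetric]) auto
  also have "\<dots> = inf_word w (- 1 - k)"
  proof (rule inf_word_mod)
    have "int (length w - Suc i) = ?n - 1 - k mod ?n" using il i by (simp add: of_nat_diff)
    also have "\<dots> = (- 1 - k mod ?n) + ?n" by simp
    also have "\<dots> mod ?n = (- 1 - k mod ?n) mod ?n" by (rule mod_add_self2)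
    also have "\<dots> = (- 1 - k) mod ?n" by (rule mod_diff_right_eq)
    finally show "int (length w - Suc i) mod ?n = (- 1 - k) mod ?n" .
  qed
  finally show ?thesis .
qed

text \<open>
  \<open>whe\<close>, \<open>wnbr\<close> and \<open>wew\<close> present the module of a cyclic word as a circle of basis vectors: \<open>True\<close> is the side to
  the right.
\<close>

definition whe :: "'a letter list \<Rightarrow> bool \<Rightarrow> nat \<Rightarrow> 'a letter" where
  "whe w s i = (if s then letter_inv (inf_word w (int i)) else inf_word w (int i - 1))"

definition wnbr :: "nat \<Rightarrow> bool \<Rightarrow> nat \<Rightarrow> nat" where
  "wnbr n s i = (if s then Suc i mod n else (i + n - 1) mod n)"

definition wew :: "nat \<Rightarrow> nat \<Rightarrow> 'k::field \<Rightarrow> bool \<Rightarrow> nat \<Rightarrow> 'k" where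
  "wew n j \<mu> s i = (if (if s then i else (i + n - 1) mod n) = j then \<mu> else 1)"

lemma wnbr_int: "0 < n \<Longrightarrow> int (wnbr n s i) = (if s then int i + 1 else int i - 1) mod int n"
proof -
  assume n: "0 < n"
  have "int ((i + n - 1) mod n) = (int i + int n - 1) mod int n"
    using n by (simp add: of_nat_mod of_nat_diff)
  also have "\<dots> = (int n + (int i - 1)) mod int n" by (simp add: algebra_simps)
  also have "\<dots> = (int i - 1) mod int n" by (rule mod_add_self1)
  finally show ?thesis by (simp add: wnbr_def of_nat_mod add.commute)
qed

lemma wnbr_wnbr: "i < n \<Longrightarrow> wnbr n (\<not> s) (wnbr n s i) = i"
proof -
  assume i: "i < n"
  have "int (wnbr n (\<not> s) (wnbr n s i)) = int i"
    using i by (cases s) (auto simp: wnbr_int mod_add_left_eq mod_diff_left_eq)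
  then show ?thesis by simp
qed

lemma whe_mod: "w \<noteq> [] \<Longrightarrow> int i mod int (length w) = k mod int (length w) \<Longrightarrow>
    whe w s i = (if s then letter_inv (inf_word w k) else inf_word w (k - 1))"
  unfolding whe_def by (auto intro!: inf_word_mod arg_cong[of _ _ letter_inv] mod_diff_cong)

context bound_quiver
begin

text \<open>
  Bands without the condition of primitivity, so that powers of bands are included.
\<close>

definition cyc_word :: "'a letter list \<Rightarrow> bool" where
  "cyc_word w \<longleftrightarrow> w \<noteq> [] \<and> arrow_of ` set w \<subseteq> arcs Q \<and>
    (\<forall>i. str_ok (inf_word w i) (inf_word w (i + 1)))"

lemma cyc_wordI:
  assumes "w \<noteq> []" and "arrow_of ` set w \<subseteq> arcs Q"
    and "\<And>i. Suc i < length w \<Longrightarrow> str_ok (w ! i) (w ! Suc i)" and "str_ok (last w) (hd w)"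
  shows "cyc_word w"
  unfolding cyc_word_def
proof (intro conjI allI assms(1,2))
  fix i
  let ?n = "int (length w)"
  define k where "k = nat (i mod ?n)"
  have n: "0 < ?n" using assms by simp
  have k: "int k = i mod ?n" using n by (simp add: k_def)
  have kl: "k < length w" using k n by (metis of_nat_less_iff pos_mod_bound)
  have 1: "inf_word w i = w ! k" by (simp add: inf_word_def k_def)
  have 2: "inf_word w (i + 1) = inf_word w (int k + 1)" by (rule inf_word_mod) (simp add: k mod_add_left_eq)
  show "str_ok (inf_word w i) (inf_word w (i + 1))"
  proof (cases "Suc k < length w")
    case True
    then have "inf_word w (int k + 1) = w ! Suc k" using inf_word_nth[of "Suc k" w] by (simp add: add.commute)
    then show ?thesis using 1 2 assms(3) True by simp
  next
    case False
    then have e: "Suc k = length w" using kl by simp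
    then have "int k + 1 = int (length w)" by simp
    then have "inf_word w (int k + 1) = inf_word w (int 0)" by (intro inf_word_mod) simp
    then have "inf_word w (int k + 1) = w ! 0" using inf_word_nth[of 0 w] n by simp
    moreover have "w ! k = last w" "w ! 0 = hd w" using assms(1) e by (simp_all add: last_conv_nth hd_conv_nth e[symmetric])
    ultimately show ?thesis using 1 2 assms(4) by simp
  qed
qed

lemma band_cyc_word: "band Q I b \<Longrightarrow> cyc_word b"
  unfolding band_def is_string_iff by (intro cyc_wordI) auto

lemma cyc_word_arc: "cyc_word w \<Longrightarrow> arrow_of (inf_word w i) \<in> arcs Q"
proof -
  assume w: "cyc_word w"
  then have "w \<noteq> []" by (simp add: cyc_word_def)
  then have "nat (i mod int (length w)) < length w"
    by (metis length_greater_0_conv nat_less_iff of_nat_0_less_iff pos_mod_bound pos_mod_sign)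
  then show ?thesis using w by (auto simp: cyc_word_def inf_word_def)
qed

text \<open>
  The condition depends only on the infinite word, not on its period.
\<close>

lemma cyc_word_cong:
  assumes "w \<noteq> []" "\<And>i. inf_word w i = inf_word w' (i + k)" and "cyc_word w'"
  shows "cyc_word w"
proof -
  have "arrow_of (w ! i) \<in> arcs Q" if "i < length w" for i
    using inf_word_nth[OF that] assms(2)[of "int i"] cyc_word_arc[OF assms(3), of "int i + k"] by simp
  then have "arrow_of ` set w \<subseteq> arcs Q" by (auto simp: in_set_conv_nth)
  moreover have "str_ok (inf_word w i) (inf_word w (i + 1))" for i
  proof -
    have "str_ok (inf_word w' (i + k)) (inf_word w' (i + k + 1))" using assms(3) by (simp add: cyc_word_def)
    then show ?thesis unfolding assms(2) by (simp add: ac_simps)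
  qed
  ultimately show ?thesis using assms(1) by (simp add: cyc_word_def)
qed

end

context gentle_quiver
begin

lemma str_ok_inv: "str_ok l l' \<Longrightarrow> str_ok (letter_inv l') (letter_inv l)"
  by (auto simp: str_ok_def dest: blk_sym)

lemma cyc_word_inv: "cyc_word w \<Longrightarrow> cyc_word (word_inv w)"
proof -
  assume w: "cyc_word w"
  then have ne: "w \<noteq> []" by (simp add: cyc_word_def)
  have "str_ok (inf_word (word_inv w) i) (inf_word (word_inv w) (i + 1))" for i
  proof -
    have "str_ok (inf_word w (- 1 - (i + 1))) (inf_word w (- 1 - (i + 1) + 1))" using w by (simp only: cyc_word_def)
    then show ?thesis unfolding inf_word_inv[OF ne] by (intro str_ok_inv) (simp add: algebra_simps)
  qed
  then show ?thesis using w ne by (auto simp: cyc_word_def word_inv_def)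
qed

lemma cyc_rep_word:
  assumes w: "cyc_word w" and \<mu>: "\<mu> \<noteq> 0" and dj: "direct_at w j"
  shows "cyc_rep Q I (length w) (word_vertex Q w) (whe w) (wnbr (length w)) (wew (length w) j \<mu>) (word_act w j \<mu>)"
proof
  have ne: "w \<noteq> []" using w by (simp add: cyc_word_def)
  let ?n = "length w"
  have n: "0 < ?n" using ne by simp
  have ok: "str_ok (inf_word w k) (inf_word w (k + 1))" for k using w by (simp add: cyc_word_def)
  have ok': "str_ok (inf_word w (int i - 1)) (inf_word w (int i))" for i using ok[of "int i - 1"] by simp
  fix i s a v assume i: "i < ?n"
  show nl: "wnbr ?n s i < ?n" using n by (simp add: wnbr_def)
  show "wnbr ?n (\<not> s) (wnbr ?n s i) = i" using i by (rule wnbr_wnbr)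
  show "whe w (\<not> s) (wnbr ?n s i) = letter_inv (whe w s i)"
  proof -
    have "int (wnbr ?n s i) mod int ?n = (if s then int i + 1 else int i - 1) mod int ?n"
      using n by (simp add: wnbr_int)
    from whe_mod[OF ne this, of "\<not> s"] show ?thesis by (simp add: whe_def)
  qed
  show "wew ?n j \<mu> (\<not> s) (wnbr ?n s i) = wew ?n j \<mu> s i"
  proof (cases s)
    case True
    have "(wnbr ?n True i + ?n - 1) mod ?n = i" using wnbr_wnbr[OF i, of True] by (simp add: wnbr_def)
    then show ?thesis using True by (simp add: wew_def)
  next
    case False
    then show ?thesis by (simp add: wew_def wnbr_def)
  qed
  show "wew ?n j \<mu> s i \<noteq> 0" using \<mu> by (simp add: wew_def)
  show "lstart Q (whe w s i) = word_vertex Q w i"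
    using ok'[of i] by (simp add: whe_def word_vertex_def inf_word_nth[OF i, symmetric] str_ok_def)
  show "arrow_of (whe w s i) \<in> arcs Q" by (simp add: whe_def cyc_word_arc[OF w])
  show "\<not> blk (whe w s i) (whe w (\<not> s) i)"
    using ok'[of i] blk_sym by (auto simp: whe_def str_ok_def)
next
  fix a v i
  let ?n = "length w"
  have ne: "w \<noteq> []" using w by (simp add: cyc_word_def)
  then have n: "0 < ?n" by simp
  show "word_act w j \<mu> a v i = (if i < length w
      then (if whe w True i = Inv a then wew ?n j \<mu> True i * v (wnbr ?n True i) else 0) +
        (if whe w False i = Inv a then wew ?n j \<mu> False i * v (wnbr ?n False i) else 0) else 0)"
  proof (cases "i < ?n")
    case True
    let ?i' = "(i + ?n - 1) mod ?n"
    have i': "?i' < ?n" using n by simp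
    have 1: "whe w True i = Inv a \<longleftrightarrow> w ! i = Dir a"
      unfolding whe_def inf_word_nth[OF True] by (cases "w ! i") auto
    have "inf_word w (int i - 1) = inf_word w (int ?i')"
      using wnbr_int[OF n, of False i] by (intro inf_word_mod) (simp add: wnbr_def)
    then have 2: "whe w False i = w ! ?i'" by (simp only: whe_def if_False inf_word_nth[OF i'])
    have 3: "?i' \<noteq> j" if "w ! ?i' = Inv a" using dj that by (auto simp: direct_at_def)
    show ?thesis unfolding 1 2 using True 3 by (auto simp: word_act_def Let_def wew_def wnbr_def)
  next
    case False then show ?thesis by (auto simp: word_act_def Let_def)
  qed
qed

end

lemma wnbr_pow:
  assumes "i < n"
  shows "int ((wnbr n s ^^ k) i) = (if s then int i + int k else int i - int k) mod int n"
proof (induction k)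
  case 0 then show ?case using assms by simp
next
  case (Suc k)
  have "int ((wnbr n s ^^ Suc k) i) = (if s then int ((wnbr n s ^^ k) i) + 1 else int ((wnbr n s ^^ k) i) - 1) mod int n"
    using assms by (simp add: wnbr_int)
  also have "\<dots> = (if s then int i + int (Suc k) else int i - int (Suc k)) mod int n"
    unfolding Suc by (cases s) (simp_all add: mod_add_left_eq mod_add_right_eq mod_diff_left_eq algebra_simps)
  finally show ?case .
qed

lemma wnbr_pow_less: "i < n \<Longrightarrow> (wnbr n s ^^ k) i < n"
  by (induction k) (auto simp: wnbr_def)

lemma wnbr_pow_period: "i < n \<Longrightarrow> (wnbr n s ^^ n) i = i"
proof -
  assume i: "i < n"
  have "int ((wnbr n s ^^ n) i) = int i" using wnbr_pow[OF i, of n s] i by (cases s) auto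
  then show ?thesis by simp
qed

lemma wnbr_pow_bij: "i < n \<Longrightarrow> bij_betw (\<lambda>k. (wnbr n s ^^ k) i) {..<n} {..<n}"
proof -
  assume i: "i < n"
  have inj: "inj_on (\<lambda>k. (wnbr n s ^^ k) i) {..<n}"
  proof
    fix k l assume *: "k \<in> {..<n}" "l \<in> {..<n}" "(wnbr n s ^^ k) i = (wnbr n s ^^ l) i"
    have "(if s then int i + int k else int i - int k) mod int n = (if s then int i + int l else int i - int l) mod int n"
      using wnbr_pow[OF i, of k s] wnbr_pow[OF i, of l s] * by simp
    then have "int n dvd int k - int l \<or> int n dvd int l - int k"
      by (cases s) (simp_all add: mod_eq_dvd_iff)
    then have "int n dvd int k - int l" by (metis dvd_minus_iff minus_diff_eq)
    moreover have "\<bar>int k - int l\<bar> < int n" using * by auto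
    ultimately have "int k - int l = 0" by (metis dvd_imp_le_int leD abs_of_nat)
    then show "k = l" by simp
  qed
  have "(\<lambda>k. (wnbr n s ^^ k) i) ` {..<n} \<subseteq> {..<n}" using wnbr_pow_less[OF i] by auto
  then have "(\<lambda>k. (wnbr n s ^^ k) i) ` {..<n} = {..<n}"
    using inj by (intro endo_inj_surj) auto
  then show ?thesis using inj by (simp add: bij_betw_def)
qed

lemma prod_single_orbit:
  fixes x :: "'k::field"
  assumes "i < n" and "a < n"
  shows "(\<Prod>k<n. if (wnbr n s ^^ k) i = a then x else 1) = x"
proof -
  have "(\<Prod>k<n. if (wnbr n s ^^ k) i = a then x else 1) = (\<Prod>k<n. if k = a then x else 1)"
    using prod.reindex_bij_betw[OF wnbr_pow_bij[OF assms(1), of s], of "\<lambda>k. if k = a then x else 1"] .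
  then show ?thesis using assms(2) by simp
qed

section \<open>Periodic words\<close>

lemma word_pow_simps: "word_pow z 0 = []" "word_pow z (Suc k) = z @ word_pow z k"
  by (simp_all add: word_pow_def)

lemma word_pow_add: "word_pow z (k + l) = word_pow z k @ word_pow z l"
  by (induction k) (auto simp: word_pow_simps)

lemma rotate1_word_pow: "rotate1 (word_pow z k) = word_pow (rotate1 z) k"
proof (cases z)
  case Nil
  have "word_pow [] k = ([] :: 'a letter list)" by (induction k) (auto simp: word_pow_simps)
  then show ?thesis using Nil by simp
next
  case (Cons x xs)
  have *: "word_pow (x # xs) k @ [x] = x # word_pow (xs @ [x]) k" for k
    by (induction k) (auto simp: word_pow_simps)
  show ?thesis
  proof (cases k)
    case 0 then show ?thesis by (simp add: word_pow_simps)
  next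
    case (Suc k') then show ?thesis using Cons *[of k'] by (simp add: word_pow_simps)
  qed
qed

lemma rotate_word_pow: "rotate q (word_pow z k) = word_pow (rotate q z) k"
  by (induction q) (auto simp: rotate1_word_pow)

lemma word_inv_append: "word_inv (x @ y) = word_inv y @ word_inv x"
  by (simp add: word_inv_def)

lemma word_inv_word_pow: "word_inv (word_pow z k) = word_pow (word_inv z) k"
proof (induction k)
  case (Suc k)
  have "word_inv (word_pow z (Suc k)) = word_pow (word_inv z) (k + 1)"
    using Suc by (simp add: word_pow_simps word_inv_append word_pow_add del: One_nat_def) (simp add: word_pow_simps)
  then show ?case by simp
qed (simp add: word_pow_simps word_inv_def)

lemma word_inv_inv: "word_inv (word_inv w) = w"
  by (simp add: word_inv_def rev_map comp_def)

definition primitive :: "'a letter list \<Rightarrow> bool" where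
  "primitive w \<longleftrightarrow> w \<noteq> [] \<and> (\<forall>z k. w = word_pow z k \<longrightarrow> k = 1)"

lemma band_primitive: "band Q I b \<Longrightarrow> primitive b"
  unfolding primitive_def
proof (intro conjI allI impI)
  assume b: "band Q I b"
  then show "b \<noteq> []" by (auto simp: band_def is_string_def)
  fix z k assume "b = word_pow z k"
  moreover have "\<not> k > 1" using b \<open>b = word_pow z k\<close> unfolding band_def by blast
  moreover have "b \<noteq> []" using b by (simp add: band_def is_string_def)
  then have "k \<noteq> 0" using \<open>b = word_pow z k\<close> by (metis word_pow_simps(1))
  ultimately show "k = 1" by simp
qed

lemma primitive_rotate: "primitive w \<Longrightarrow> primitive (rotate q w)"
  unfolding primitive_def
proof (intro conjI allI impI)
  assume w: "w \<noteq> [] \<and> (\<forall>z k. w = word_pow z k \<longrightarrow> k = 1)"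
  then show "rotate q w \<noteq> []" by simp
  fix z k assume e: "rotate q w = word_pow z k"
  let ?l = "length w - q mod length w"
  have "w = rotate (?l + q) w"
  proof -
    have "(?l + q) mod length w = 0"
      using w by (metis (no_types, lifting) add.commute le_add_diff_inverse length_greater_0_conv mod_add_left_eq
          mod_less_divisor mod_self less_imp_le_nat)
    then show ?thesis using rotate_conv_mod[of "?l + q" w] by simp
  qed
  then have "w = rotate ?l (rotate q w)" by (simp add: rotate_rotate)
  then have "w = word_pow (rotate ?l z) k" by (simp add: e rotate_word_pow)
  then show "k = 1" using w by blast
qed

lemma primitive_inv: "primitive w \<Longrightarrow> primitive (word_inv w)"
  unfolding primitive_def
proof (intro conjI allI impI)
  assume w: "w \<noteq> [] \<and> (\<forall>z k. w = word_pow z k \<longrightarrow> k = 1)"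
  then show "word_inv w \<noteq> []" by (simp add: word_inv_def)
  fix z k assume "word_inv w = word_pow z k"
  then have "w = word_pow (word_inv z) k" by (metis word_inv_inv word_inv_word_pow)
  then show "k = 1" using w by blast
qed

lemma primitive_commute:
  assumes "primitive x" and "primitive y" and "x @ y = y @ x"
  shows "x = y"
proof -
  obtain m n z where "concat (replicate m z) = x" "concat (replicate n z) = y"
    using comm_append_are_replicate[OF assms(3)] by blast
  then have xy: "x = word_pow z m" "y = word_pow z n" by (simp_all add: word_pow_def)
  then have "m = 1" "n = 1" using assms by (auto simp: primitive_def)
  then show ?thesis using xy by simp
qed

lemma rotate_nth_inf: "k < length w \<Longrightarrow> rotate q w ! k = inf_word w (int q + int k)"
proof -
  assume "k < length w"
  moreover have "(int q + int k) mod int (length w) = int ((k + q) mod length w)"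
    by (simp add: of_nat_mod add.commute)
  ultimately show ?thesis by (simp add: nth_rotate inf_word_def add.commute)
qed

text \<open>
  If the two infinite words agree on their first \<open>m\<close> letters, then writing one period of each of them one
  after the other continues to spell the first infinite word up to and including the index \<open>m\<close>.
\<close>

lemma append_rotations_nth:
  assumes "x \<noteq> []" and "\<And>l. l < m \<Longrightarrow> inf_word x (int i + int l) = inf_word y (int j + int l)"
    and "k \<le> m" and "k < length x + length y"
  shows "(rotate i x @ rotate j y) ! k = inf_word x (int i + int k)"
proof (cases "k < length x")
  case True then show ?thesis by (simp add: nth_append rotate_nth_inf)
next
  case False
  then have "(rotate i x @ rotate j y) ! k = inf_word y (int j + int (k - length x))"
    using assms by (simp add: nth_append rotate_nth_inf)
  also have "\<dots> = inf_word x (int i + int (k - length x))"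
    using assms False by (intro assms(2)[symmetric]) (cases x; auto)
  also have "\<dots> = inf_word x (int i + int (k - length x) + int (length x))" by (rule inf_word_add[symmetric])
  also have "int i + int (k - length x) + int (length x) = int i + int k" using False by simp
  finally show ?thesis .
qed

lemma equal_forever_commute:
  assumes "x \<noteq> []" "y \<noteq> []" and "\<And>l::nat. inf_word x (int i + int l) = inf_word y (int j + int l)"
  shows "rotate i x @ rotate j y = rotate j y @ rotate i x"
proof (rule nth_equalityI)
  fix k assume k: "k < length (rotate i x @ rotate j y)"
  have "(rotate i x @ rotate j y) ! k = inf_word x (int i + int k)"
    by (rule append_rotations_nth[of x k]) (use assms k in auto)
  moreover have "(rotate j y @ rotate i x) ! k = inf_word y (int j + int k)"
    by (rule append_rotations_nth[of y k]) (use assms k in auto)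
  ultimately show "(rotate i x @ rotate j y) ! k = (rotate j y @ rotate i x) ! k" using assms(3) by simp
qed simp

section \<open>Overlaps as chains of nodes\<close>

lemma subword_at_iff:
  "subword_at w s (x # m @ [y]) \<longleftrightarrow> inf_word w s = x \<and>
    (\<forall>i<length m. inf_word w (s + 1 + int i) = m ! i) \<and> inf_word w (s + 1 + int (length m)) = y"
proof -
  have "(\<forall>i<Suc (Suc n). P i) \<longleftrightarrow> P 0 \<and> (\<forall>i<n. P (Suc i)) \<and> P (Suc n)" for P n
    unfolding All_less_Suc2[of "Suc n" P] All_less_Suc[of n "\<lambda>i. P (Suc i)"] by blast
  from this[of "length m" "\<lambda>i. inf_word w (s + int i) = (x # m @ [y]) ! i"]
  show ?thesis by (simp add: subword_at_def nth_append add.assoc)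
qed

locale band_pair = gentle_quiver Q I
  for Q :: "('v, 'a) pre_digraph" and I :: "(('v, 'a) path \<Rightarrow> 'k::field) set" +
  fixes b c :: "'a letter list" and jb jc :: nat and \<mu> lam :: 'k
  assumes band_b: "band Q I b" and band_c: "band Q I c"
    and \<mu>_nz: "\<mu> \<noteq> 0" and lam_nz: "lam \<noteq> 0"
    and direct_b: "direct_at b jb" and direct_c: "direct_at c jc"
begin

abbreviation "nb \<equiv> length b"
abbreviation "nc \<equiv> length c"

lemma b_ne: "b \<noteq> []" and c_ne: "c \<noteq> []"
  using band_b band_c by (auto simp: band_def is_string_def)

sublocale cyc_pair Q I nb "word_vertex Q b" "whe b" "wnbr nb" "wew nb jb \<mu>" "word_act b jb \<mu>"
    nc "word_vertex Q c" "whe c" "wnbr nc" "wew nc jc lam" "word_act c jc lam"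
  by (intro cyc_pair.intro gentle_quiver_axioms cyc_rep_word band_cyc_word band_b band_c \<mu>_nz lam_nz direct_b direct_c)

text \<open>
  The index of the basis vector at the left end of the letter with index \<open>q\<close> of the displayed word.
\<close>

definition pos :: "bool \<Rightarrow> nat \<Rightarrow> nat" where "pos r q = (if r then (nb - q) mod nb else q)"

lemma orient_ne: "orient r b \<noteq> []"
  using b_ne by (simp add: orient_def word_inv_def)

lemma length_orient [simp]: "length (orient r b) = nb"
  by (simp add: orient_def word_inv_def)

lemma pos_less: "q < nb \<Longrightarrow> pos r q < nb"
  using b_ne by (simp add: pos_def)

lemma pos_pos: "q < nb \<Longrightarrow> pos r (pos r q) = q"
  by (cases "q = 0") (auto simp: pos_def)

lemma pos_int: "q < nb \<Longrightarrow> int (pos r q) mod int nb = (if r then - int q else int q) mod int nb"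
proof -
  assume q: "q < nb"
  have "int ((nb - q) mod nb) mod int nb = (int nb + - int q) mod int nb"
    using q by (simp add: of_nat_mod of_nat_diff)
  also have "\<dots> = (- int q) mod int nb" by (rule mod_add_self1)
  finally show ?thesis by (simp add: pos_def)
qed

lemma right_half_edge:
  assumes q: "q < nb"
  shows "whe b (\<not> r) ((wnbr nb (\<not> r) ^^ k) (pos r q)) = letter_inv (inf_word (orient r b) (int q + int k))"
proof (cases r)
  case False
  have "int ((wnbr nb True ^^ k) q) mod int nb = (int q + int k) mod int nb"
    using wnbr_pow[OF q, of k True] by simp
  from whe_mod[OF b_ne this, of True] False show ?thesis by (simp add: orient_def pos_def)
next
  case True
  have "int ((wnbr nb False ^^ k) (pos True q)) mod int nb = (int (pos True q) - int k) mod int nb"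
    using wnbr_pow[OF pos_less[OF q, of True], of k False] by simp
  also have "\<dots> = (int (pos True q) mod int nb - int k) mod int nb" by (simp add: mod_diff_left_eq)
  also have "\<dots> = (- int q - int k) mod int nb" unfolding pos_int[OF q] by (simp add: mod_diff_left_eq)
  finally have e: "int ((wnbr nb False ^^ k) (pos True q)) mod int nb = (- int q - int k) mod int nb" .
  have e2: "- int q - int k - 1 = - 1 - (int q + int k)" by simp
  have "whe b False ((wnbr nb False ^^ k) (pos True q)) = inf_word b (- 1 - (int q + int k))"
    using whe_mod[OF b_ne e, of False] by (simp only: if_False e2)
  then show ?thesis using True by (simp add: orient_def inf_word_inv[OF b_ne])
qed

lemma left_half_edge:
  assumes q: "q < nb"
  shows "whe b r (pos r q) = inf_word (orient r b) (int q - 1)"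
proof (cases r)
  case False then show ?thesis by (simp add: whe_def orient_def pos_def)
next
  case True
  have "int (pos True q) mod int nb = (- int q) mod int nb" using pos_int[OF q, of True] by simp
  from whe_mod[OF b_ne this, of True] True show ?thesis by (simp add: orient_def inf_word_inv[OF b_ne])
qed

lemma right_half_edge_c:
  assumes "p < nc"
  shows "whe c True ((wnbr nc True ^^ k) p) = letter_inv (inf_word c (int p + int k))"
proof -
  have "int ((wnbr nc True ^^ k) p) mod int nc = (int p + int k) mod int nc"
    using wnbr_pow[OF assms, of k True] by simp
  from whe_mod[OF c_ne this, of True] show ?thesis by simp
qed

lemma left_half_edge_c: "whe c False p = inf_word c (int p - 1)"
  by (simp add: whe_def)

lemma step_pow: "(step True ^^ k) (r, i, j) = (r, (wnbr nb (\<not> r) ^^ k) i, (wnbr nc True ^^ k) j)"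
  by (induction k) auto

lemma letter_inv_inject [simp]: "letter_inv x = letter_inv y \<longleftrightarrow> x = y"
  by (metis letter_inv_inv)

lemma con_pow:
  assumes "q < nb" "p < nc"
  shows "con True ((step True ^^ k) (r, pos r q, p)) \<longleftrightarrow>
    inf_word (orient r b) (int q + int k) = inf_word c (int p + int k)"
proof -
  have t: "(True \<noteq> r) = (\<not> r)" by simp
  show ?thesis
    unfolding step_pow con.simps t right_half_edge[OF assms(1)] right_half_edge_c[OF assms(2)] letter_inv_inject ..
qed

lemma good_pow:
  assumes "q < nb" "p < nc"
  shows "good True ((step True ^^ k) (r, pos r q, p)) \<longleftrightarrow>
    (\<exists>C. inf_word (orient r b) (int q + int k) = Inv C) \<and> (\<exists>A. inf_word c (int p + int k) = Dir A)"
proof -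
  have t: "(True \<noteq> r) = (\<not> r)" by simp
  have i: "letter_inv x = Dir a \<longleftrightarrow> x = Inv a" "letter_inv x = Inv a \<longleftrightarrow> x = Dir a" for x :: "'a letter" and a
    by (cases x; auto)+
  show ?thesis
    unfolding step_pow good.simps t right_half_edge[OF assms(1)] right_half_edge_c[OF assms(2)] i ..
qed

lemma good_left:
  assumes "q < nb"
  shows "good False (r, pos r q, p) \<longleftrightarrow>
    (\<exists>D. inf_word (orient r b) (int q - 1) = Dir D) \<and> (\<exists>B. inf_word c (int p - 1) = Inv B)"
proof -
  have t: "(False \<noteq> r) = r" by simp
  show ?thesis unfolding good.simps t left_half_edge[OF assms(1)] left_half_edge_c ..
qed

lemma overlap_iff:
  "overlap Q I c (orient r b) p q m A B C D \<longleftrightarrow> p < nc \<and> q < nb \<and>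
    inf_word c (int p - 1) = Inv B \<and> inf_word (orient r b) (int q - 1) = Dir D \<and>
    (\<forall>k<length m. inf_word c (int p + int k) = m ! k \<and> inf_word (orient r b) (int q + int k) = m ! k) \<and>
    inf_word c (int p + int (length m)) = Dir A \<and> inf_word (orient r b) (int q + int (length m)) = Inv C \<and>
    (m = [] \<longrightarrow> head Q A = tail Q C \<and> arrow_path Q [C, A] \<in> I \<and> head Q B = tail Q D \<and> arrow_path Q [D, B] \<in> I)"
  unfolding overlap_def subword_at_iff by auto

lemma cyc_orient: "cyc_word (orient r b)"
  using band_cyc_word[OF band_b] cyc_word_inv by (simp add: orient_def)

text \<open>
  If \<open>m\<close> is nonempty, neither \<open>D\<close> nor \<open>B\<close> is blocked by its first letter; as there are only two classes of
  half-edges at the vertex, they block each other.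
\<close>

lemma overlap_relation:
  assumes "overlap Q I c (orient r b) p q m A B C D"
  shows "arrow_path Q [D, B] \<in> I"
proof (cases m)
  case Nil then show ?thesis using assms by (simp add: overlap_iff)
next
  case (Cons l m')
  note o = assms[unfolded overlap_iff]
  have l: "inf_word c (int p) = l" "inf_word (orient r b) (int q) = l"
    using o Cons by (metis length_greater_0_conv list.distinct(1) nth_Cons_0 add_0_right of_nat_0)+
  have "str_ok (inf_word c (int p - 1)) (inf_word c (int p - 1 + 1))"
    using band_cyc_word[OF band_c] unfolding cyc_word_def by blast
  then have 1: "str_ok (Inv B) l" using o l by simp
  have "str_ok (inf_word (orient r b) (int q - 1)) (inf_word (orient r b) (int q - 1 + 1))"
    using cyc_orient unfolding cyc_word_def by blast
  then have 2: "str_ok (Dir D) l" using o l by simp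
  have "arrow_of (inf_word c (int p - 1)) \<in> arcs Q" "arrow_of (inf_word (orient r b) (int q - 1)) \<in> arcs Q" "arrow_of l \<in> arcs Q"
    using cyc_word_arc[OF band_cyc_word[OF band_c]] cyc_word_arc[OF cyc_orient] l by metis+
  then have "blk (Dir D) (Inv B) \<or> blk (Dir D) (letter_inv l)"
    using 1 2 o by (intro blk_dichotomy) (auto simp: str_ok_def)
  then show ?thesis using 2 by (simp add: str_ok_def)
qed

definition ovnode :: "bool \<times> nat \<times> nat \<times> 'a letter list \<Rightarrow> bool \<times> nat \<times> nat" where
  "ovnode = (\<lambda>(r, p, q, m). (r, pos r q, p))"

text \<open>
  The middle word \<open>m\<close> of an overlap spells the letters along a chain, and its bounding letters are the two good
  ends.
\<close>

lemma overlap_node_of: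
  assumes "overlap Q I c (orient r b) p q m A B C D"
  shows "overlap_node (r, pos r q, p)"
proof -
  note o = assms[unfolded overlap_iff]
  have pq: "p < nc" "q < nb" using o by auto
  have "node (r, pos r q, p)"
    using overlap_relation[OF assms] o pos_less[OF pq(2)] left_half_edge[OF pq(2), of r]
    by (simp add: left_half_edge_c)
  moreover have "good False (r, pos r q, p)" unfolding good_left[OF pq(2)] using o by blast
  moreover have "run_ends (step True) (con True) (good True) (r, pos r q, p)"
    unfolding run_ends_def con_pow[OF pq(2,1)] good_pow[OF pq(2,1)]
    using o by (intro exI[of _ "length m"]) auto
  ultimately show ?thesis by (simp add: overlap_node_def del: node.simps good.simps)
qed

lemma overlap_of_node:
  assumes "overlap_node (r, i, j)"
  shows "\<exists>m A B C D. overlap Q I c (orient r b) j (pos r i) m A B C D"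
proof -
  have ij: "i < nb" "j < nc" using assms by (auto simp: overlap_node_def)
  define q where "q = pos r i"
  have q: "q < nb" "pos r q = i" using ij by (simp_all add: q_def pos_less pos_pos)
  have n: "node (r, i, j)" using assms by (simp add: overlap_node_def)
  obtain D B where DB: "inf_word (orient r b) (int q - 1) = Dir D" "inf_word c (int j - 1) = Inv B"
    using assms good_left[OF q(1), of r j] unfolding overlap_node_def q(2) by blast
  obtain k where k: "\<forall>l<k. inf_word (orient r b) (int q + int l) = inf_word c (int j + int l)"
    "\<exists>C. inf_word (orient r b) (int q + int k) = Inv C" "\<exists>A. inf_word c (int j + int k) = Dir A"
    using assms con_pow[OF q(1) ij(2), of _ r] good_pow[OF q(1) ij(2), of _ r]
    unfolding overlap_node_def run_ends_def q(2) by auto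
  obtain C A where CA: "inf_word (orient r b) (int q + int k) = Inv C" "inf_word c (int j + int k) = Dir A"
    using k by blast
  define m where "m = map (\<lambda>l. inf_word c (int j + int l)) [0..<k]"
  have rDB: "arrow_path Q [D, B] \<in> I"
    using n DB left_half_edge[OF q(1), of r] by (simp add: left_half_edge_c q(2))
  have rCA: "arrow_path Q [C, A] \<in> I" if "k = 0"
  proof -
    have t: "(True \<noteq> r) = (\<not> r)" by simp
    have "blk (whe b (\<not> r) i) (whe c True j)" using node_side[OF n, of True] unfolding t .
    then show ?thesis
      using right_half_edge[OF q(1), of r 0] right_half_edge_c[OF ij(2), of 0] CA that by (simp add: q(2))
  qed
  have "overlap Q I c (orient r b) j q m A B C D"
    unfolding overlap_iff using ij q DB k(1) CA rDB rCA relation_arcs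
    by (auto simp: m_def)
  then show ?thesis unfolding q_def by blast
qed

text \<open>
  Conversely the chain recovers \<open>m\<close> and the positions of the decompositions, so overlaps are the chains with two
  good ends.
\<close>

lemma ovnode_bij: "bij_betw ovnode (overlap_data Q I c b) (Collect overlap_node)"
  unfolding bij_betw_def
proof
  show "inj_on ovnode (overlap_data Q I c b)"
  proof (rule inj_onI)
    fix x x' assume x: "x \<in> overlap_data Q I c b" "x' \<in> overlap_data Q I c b" "ovnode x = ovnode x'"
    obtain r p q m r' p' q' m' where e: "x = (r, p, q, m)" "x' = (r', p', q', m')" by (metis prod_cases4)
    obtain A B C D where o: "overlap Q I c (orient r b) p q m A B C D" using x e by (auto simp: overlap_data_def)
    obtain A' B' C' D' where o': "overlap Q I c (orient r' b) p' q' m' A' B' C' D'" using x e by (auto simp: overlap_data_def)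
    have rp: "r' = r" "p' = p" "pos r q = pos r q'" using x e by (auto simp: ovnode_def)
    have ql: "q < nb" "q' < nb" using o o' by (auto simp: overlap_iff)
    have "pos r (pos r q') = pos r (pos r q)" unfolding rp(3) ..
    then have q: "q' = q" unfolding pos_pos[OF ql(1)] pos_pos[OF ql(2)] .
    note o = o[unfolded overlap_iff] and o' = o'[unfolded overlap_iff rp q]
    have len: "length m = length m'"
    proof (rule linorder_cases[of "length m" "length m'"])
      assume "length m < length m'"
      then have "inf_word c (int p + int (length m)) = inf_word (orient r b) (int q + int (length m))" using o' by metis
      then show ?thesis using o by simp
    next
      assume "length m' < length m"
      then have "inf_word c (int p + int (length m')) = inf_word (orient r b) (int q + int (length m'))" using o by metis
      then show ?thesis using o' by simp
    qed
    have "m = m'" by (rule nth_equalityI[OF len]) (use o o' len in metis)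
    then show "x = x'" using e rp q by simp
  qed
  show "ovnode ` overlap_data Q I c b = Collect overlap_node"
  proof (intro equalityI subsetI)
    fix y assume "y \<in> ovnode ` overlap_data Q I c b"
    then show "y \<in> Collect overlap_node" by (auto simp: overlap_data_def ovnode_def overlap_node_of)
  next
    fix y assume y: "y \<in> Collect overlap_node"
    obtain r i j where e: "y = (r, i, j)" by (cases y) auto
    obtain m A B C D where o: "overlap Q I c (orient r b) j (pos r i) m A B C D"
      using overlap_of_node y e by blast
    have "i < nb" using y e by (simp add: overlap_node_def)
    then have "ovnode (r, j, pos r i, m) = y" by (simp add: ovnode_def pos_pos e)
    moreover have "(r, j, pos r i, m) \<in> overlap_data Q I c b" using o by (auto simp: overlap_data_def)
    ultimately show "y \<in> ovnode ` overlap_data Q I c b" by blast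
  qed
qed

lemma finite_overlap_data: "finite (overlap_data Q I c b)"
proof -
  have "Collect overlap_node \<subseteq> UNIV \<times> {..<nb} \<times> {..<nc}" by (auto simp: overlap_node_def)
  then have "finite (Collect overlap_node)" using finite_subset by fastforce
  then show ?thesis using bij_betw_finite[OF ovnode_bij] by blast
qed

text \<open>
  On a chain that never ends the two infinite words agree. By primitivity they have the same period, and the
  product of the ratios over one period compares \<open>\<lambda>\<close> with \<open>\<mu>\<^sup>\<plusminus>\<^sup>1\<close>. It is \<open>1\<close> only if the two band data are equal.
\<close>

lemma closed_chain:
  assumes neq: "\<not> band_data_eq b \<mu> c lam"
    and n: "node \<nu>" and forever: "\<And>k. con True ((step True ^^ k) \<nu>)"
  shows "(step True ^^ nc) \<nu> = \<nu> \<and> (\<Prod>k<nc. ratio ((step True ^^ k) \<nu>)) \<noteq> 1"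
proof -
  obtain r i p where e: "\<nu> = (r, i, p)" by (cases \<nu>) auto
  have ip: "i < nb" "p < nc" using n e by auto
  define q where "q = pos r i"
  have q: "q < nb" "pos r q = i" using ip by (simp_all add: q_def pos_less pos_pos)
  have u: "inf_word (orient r b) (int q + int k) = inf_word c (int p + int k)" for k
    using forever[of k] unfolding e q(2)[symmetric] con_pow[OF q(1) ip(2)] .
  have prim: "primitive (rotate q (orient r b))" "primitive (rotate p c)"
    using band_primitive[OF band_b] band_primitive[OF band_c]
    by (auto simp: orient_def intro!: primitive_rotate primitive_inv)
  (* words with the same infinite power commute, and commuting primitive words are equal *)
  have "rotate q (orient r b) = rotate p c"
    by (rule primitive_commute[OF prim equal_forever_commute[OF orient_ne c_ne u]])
  from arg_cong[OF this, of length] have len: "nb = nc" by simp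
  have uz: "inf_word (orient r b) (int q + z) = inf_word c (int p + z)" for z
  proof -
    have z: "(z mod int nc) = int (nat (z mod int nc))" using c_ne by simp
    have "inf_word (orient r b) (int q + z) = inf_word (orient r b) (int q + z mod int nc)"
      by (rule inf_word_mod) (simp add: len mod_add_right_eq)
    also have "\<dots> = inf_word c (int p + z mod int nc)" by (subst (1 2) z) (rule u)
    also have "\<dots> = inf_word c (int p + z)" by (rule inf_word_mod) (simp add: mod_add_right_eq)
    finally show ?thesis .
  qed
  have neq': "(if r then inverse \<mu> else \<mu>) \<noteq> lam"
  proof (cases r)
    case False
    have "inf_word b z = inf_word c (z + (int p - int q))" for z
      using uz[of "z - int q"] False by (simp add: orient_def algebra_simps)
    then have "inf_word_eq b c" unfolding inf_word_eq_def by blast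
    then show ?thesis using neq False by (auto simp: band_data_eq_def)
  next
    case True
    have "inf_word b z = inf_word (word_inv c) (z + (int q - int p))" for z
    proof -
      have "inf_word (word_inv b) (- 1 - z) = inf_word c (int p + (- 1 - z - int q))"
        using uz[of "- 1 - z - int q"] True by (simp add: orient_def)
      then show ?thesis unfolding inf_word_inv[OF b_ne] inf_word_inv[OF c_ne]
        by (simp add: algebra_simps) (metis letter_inv_inv)
    qed
    then have "inf_word_eq b (word_inv c)" unfolding inf_word_eq_def by blast
    then have "\<mu> \<noteq> inverse lam" using neq by (auto simp: band_data_eq_def)
    then show ?thesis using True by (metis inverse_inverse_eq)
  qed
  have jbl: "jb < nb" "\<exists>a. b ! jb = Dir a" and jcl: "jc < nc" "\<exists>a. c ! jc = Dir a"
    using direct_b direct_c by (auto simp: direct_at_def)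
  define i0 where "i0 = (if r then wnbr nb False i else i)"
  have i0: "i0 < nb" using ip B.nbr_less by (simp add: i0_def)
  define ik jk ek where "ik k = (wnbr nb (\<not> r) ^^ k) i" and "jk k = (wnbr nc True ^^ k) p"
    and "ek k = (wnbr nb (\<not> r) ^^ k) i0" for k
  have ek: "ek k = (if r then wnbr nb False (ik k) else ik k)" for k
    by (auto simp: ek_def ik_def i0_def funpow_swap1)
  have lt: "ik k < nb" "jk k < nc" for k by (simp_all add: ik_def jk_def wnbr_pow_less ip)
  have ratio_k: "ratio ((step True ^^ k) \<nu>) =
      (if jk k = jc then inverse lam else 1) * (if ek k = jb then (if r then inverse \<mu> else \<mu>) else 1)" for k
  proof -
    let ?v = "inf_word c (int p + int k)"
    have hc: "whe c True (jk k) = letter_inv ?v" unfolding jk_def by (rule right_half_edge_c[OF ip(2)])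
    have hb: "whe b (\<not> r) (ik k) = letter_inv ?v"
      unfolding ik_def q(2)[symmetric] right_half_edge[OF q(1)] u ..
    have wc: "wew nc jc lam True (jk k) = (if jk k = jc then lam else 1)" by (simp add: wew_def)
    have wb: "wew nb jb \<mu> (\<not> r) (ik k) = (if ek k = jb then \<mu> else 1)"
      by (simp add: wew_def ek wnbr_def)
    have jd: "\<exists>a. ?v = Dir a" if "jk k = jc"
    proof -
      have "letter_inv (c ! jc) = letter_inv ?v" using hc that jcl(1) by (simp add: whe_def inf_word_nth)
      then show ?thesis using jcl(2) by simp
    qed
    have ed: "\<exists>a. ?v = (if r then Inv a else Dir a)" if ej: "ek k = jb"
    proof (cases r)
      case False
      then have "letter_inv (b ! jb) = letter_inv ?v" using hb ej ek jbl(1) by (simp add: whe_def inf_word_nth)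
      then show ?thesis using jbl(2) False by simp
    next
      case True
      have "whe b True (ek k) = letter_inv (whe b False (ik k))"
        using B.he_nbr[OF lt(1)[of k], of False] True ek by simp
      then have "?v = letter_inv (b ! jb)" using hb ej jbl(1) True by (simp add: whe_def inf_word_nth)
      moreover obtain a where "b ! jb = Dir a" using jbl(2) by blast
      ultimately have "?v = Inv a" by simp
      then show ?thesis using True by simp
    qed
    have "ratio ((step True ^^ k) \<nu>) = (case letter_inv ?v of
        Dir _ \<Rightarrow> wew nc jc lam True (jk k) / wew nb jb \<mu> (\<not> r) (ik k)
      | Inv _ \<Rightarrow> wew nb jb \<mu> (\<not> r) (ik k) / wew nc jc lam True (jk k))"
      unfolding e step_pow ratio.simps ik_def[symmetric] jk_def[symmetric] hc ..
    then show ?thesis unfolding wc wb using jd ed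
      by (cases ?v; cases r; cases "jk k = jc"; cases "ek k = jb") (auto simp: field_simps)
  qed
  have "(\<Prod>k<nc. ratio ((step True ^^ k) \<nu>)) = inverse lam * (if r then inverse \<mu> else \<mu>)"
    unfolding ratio_k prod.distrib
    using prod_single_orbit[OF ip(2) jcl(1), of True "inverse lam"]
      prod_single_orbit[OF i0 jbl(1), of "\<not> r" "if r then inverse \<mu> else \<mu>"]
    by (simp add: jk_def ek_def len del: if_split)
  then have "(\<Prod>k<nc. ratio ((step True ^^ k) \<nu>)) \<noteq> 1"
    using neq' lam_nz by (auto simp: field_simps split: if_splits)
  moreover have "(step True ^^ nc) \<nu> = \<nu>"
    unfolding e step_pow using wnbr_pow_period[OF ip(1)] wnbr_pow_period[OF ip(2)] len by simp
  ultimately show ?thesis by blast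
qed

lemma overlap_ext_eq_X:
  assumes x: "x \<in> overlap_data Q I c b"
  shows "overlap_ext Q c jc lam b jb \<mu> x = X (glue_cocycle (ovnode x))"
proof -
  obtain r p q m where e: "x = (r, p, q, m)" by (metis prod_cases4)
  obtain A B C D where ov: "overlap Q I c (orient r b) p q m A B C D"
    using x e by (auto simp: overlap_data_def)
  note o = ov[unfolded overlap_iff]
  have pq: "p < nc" "q < nb" using o by auto
  define y where "y = pos r q"
  have y: "y < nb" using pos_less[OF pq(2)] by (simp add: y_def)
  have hD: "whe b r y = Dir D" and hB: "whe c False p = Inv B"
    using o left_half_edge[OF pq(2), of r] by (simp_all add: y_def left_half_edge_c)
  have D: "D \<in> arcs Q" using B.he_arc[OF y, of r] hD by simp
  have actD: "word_act b jb \<mu> D (\<lambda>i. if i = y then t else 0) i =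
      (if i = wnbr nb r y then wew nb jb \<mu> r y * t else 0)" for t i
  proof -
    have "(\<lambda>i. if i = y then t else 0) = (\<lambda>i. t * unit y i)" by (auto simp: unit_def)
    then show ?thesis using B.act_scale[OF D, of t "unit y"] B.act_unit[OF y hD] by (simp add: mult.commute)
  qed
  have "glue_act nb (word_act b jb \<mu>) (word_act c jc lam) p y D B a v i = ext_act (glue_cocycle (r, y, p)) a v i" for a v i
  proof (cases "i < nb")
    case True
    have "(if a = B then (if i = y then word_act c jc lam a (hi v) p else 0) else 0) =
        (if whe c False p = Inv a \<and> i = y then wew nc jc lam False p * hi v (wnbr nc False p) else 0)"
      using C.act_in[OF pq(1) hB] hB by auto
    then show ?thesis
      using True actD hD unfolding ext_act_def mat_glue_cocycle[OF y pq(1)]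
      by (auto simp: glue_act_def Let_def lo_def[symmetric] hi_def[symmetric])
  next
    case False
    then show ?thesis by (simp add: ext_act_def glue_act_def Let_def hi_def)
  qed
  then have "glue_act nb (word_act b jb \<mu>) (word_act c jc lam) p y D B = ext_act (glue_cocycle (r, y, p))"
    by (intro ext)
  moreover have "(if r then (nb - q) mod nb else q) = y" by (simp add: y_def pos_def)
  ultimately show ?thesis
    using o unfolding e overlap_ext_def X_def ovnode_def y_def[symmetric]
    by (simp add: y_def[symmetric] evx_def[abs_def] Let_def)
qed

text \<open>
  Chains with two good ends are the overlaps, and closed chains impose no condition on the extension because the
  band data differ.
\<close>

theorem overlap_extensions_basis:
  assumes neq: "\<not> band_data_eq b \<mu> c lam"
  shows "is_basis ExtV (overlap_data Q I c b) (\<lambda>x. ext_class L Mc Mb (overlap_ext Q c jc lam b jb \<mu> x))"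
proof -
  let ?J = "overlap_data Q I c b"
  have bas: "is_basis ExtV ?J (\<lambda>x. cl (glue_cocycle (ovnode x)))"
    by (rule glue_basis[OF finite_overlap_data ovnode_bij closed_chain[OF neq]])
  have eq: "ext_class L Mc Mb (overlap_ext Q c jc lam b jb \<mu> x) = cl (glue_cocycle (ovnode x))" if "x \<in> ?J" for x
    unfolding overlap_ext_eq_X[OF that] cl_def ..
  have cc: "cocycle (glue_cocycle (ovnode x))" if x: "x \<in> ?J" for x
  proof -
    have "overlap_node (ovnode x)" using ovnode_bij x by (auto simp: bij_betw_def)
    then show ?thesis using cocycle_glue by (cases "ovnode x") (auto simp: overlap_node_def)
  qed
  interpret V: abelian_monoid ExtV by (rule abelian_monoid_Ext)
  have "(\<Oplus>\<^bsub>ExtV\<^esub>x\<in>?J. \<kappa> x \<odot>\<^bsub>ExtV\<^esub> ext_class L Mc Mb (overlap_ext Q c jc lam b jb \<mu> x)) =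
      (\<Oplus>\<^bsub>ExtV\<^esub>x\<in>?J. \<kappa> x \<odot>\<^bsub>ExtV\<^esub> cl (glue_cocycle (ovnode x)))" for \<kappa>
    by (rule V.finsum_cong') (auto simp: eq cl_smult cc carrier_Ext cocycle_scale)
  then show ?thesis using bas eq unfolding is_basis_def by auto
qed

text \<open>
  The criterion for independence, applied to a single overlap.
\<close>

lemma overlap_extension_nonsplit:
  assumes x: "x \<in> overlap_data Q I c b"
  shows "overlap_ext Q c jc lam b jb \<mu> x \<in> extensions L Mc Mb" "\<not> ext_split L Mc (overlap_ext Q c jc lam b jb \<mu> x)"
proof -
  have n: "overlap_node (ovnode x)" using ovnode_bij x by (auto simp: bij_betw_def)
  then have cc: "cocycle (glue_cocycle (ovnode x))"
    using cocycle_glue by (cases "ovnode x") (auto simp: overlap_node_def)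
  let ?X = "X (glue_cocycle (ovnode x))"
  have ex: "?X \<in> extensions L Mc Mb" by (rule X_extension[OF cc])
  have "\<not> ext_split L Mc ?X"
  proof
    assume "ext_split L Mc ?X"
    then have "ext_equiv L Mb (X (\<lambda>_ _ _. 0)) ?X"
      using split_iff ex unfolding X_def by blast
    then have "ext_equiv L Mb ?X (X (\<lambda>_ _ _. 0))"
      using ext_equiv_sym[OF X_extension[OF cocycle_zero] ex] by blast
    then obtain h where "coboundary h (\<lambda>a i j. glue_cocycle (ovnode x) a i j - 0)"
      unfolding equiv_X_iff[OF cc cocycle_zero] by blast
    then have "coboundary h (\<lambda>a i j. \<Sum>y\<in>{ovnode x}. 1 * glue_cocycle y a i j)" by simp
    then have "(1 :: 'k) = 0" by (rule glue_independent[where g = "\<lambda>y. y" and \<kappa> = "\<lambda>_. 1", rotated 3]) (use n in auto)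
    then show False by simp
  qed
  then show "overlap_ext Q c jc lam b jb \<mu> x \<in> extensions L Mc Mb" "\<not> ext_split L Mc (overlap_ext Q c jc lam b jb \<mu> x)"
    unfolding overlap_ext_eq_X[OF x] using ex by auto
qed

end

text \<open>
  A square matrix whose columns span all unit vectors has a right inverse, which is then an inverse.
\<close>

lemma matrix_surj_bij:
  fixes P :: "nat \<Rightarrow> nat \<Rightarrow> 'k::field"
  assumes surj: "\<And>i. i < n \<Longrightarrow> \<exists>v. \<forall>l<n. (\<Sum>k<n. P l k * v k) = (if l = i then 1 else 0)"
  shows "bij_betw (\<lambda>v i. if i < n then \<Sum>k<n. P i k * v k else 0)
    {v. \<forall>i\<ge>n. v i = 0} {v. \<forall>i\<ge>n. v i = (0::'k)}"
proof -
  obtain V where V: "\<And>i l. i < n \<Longrightarrow> l < n \<Longrightarrow> (\<Sum>k<n. P l k * V i k) = (if l = i then 1 else 0)"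
    using surj by metis
  let ?A = "Matrix.mat n n (\<lambda>(l, k). P l k)" and ?B = "Matrix.mat n n (\<lambda>(k, i). V i k)"
  have AB: "?A * ?B = 1\<^sub>m n"
    by (rule eq_matI) (simp_all add: scalar_prod_def V lessThan_atLeast0[symmetric])
  have "?B * ?A = 1\<^sub>m n"
    by (rule mat_mult_left_right_inverse[OF _ _ AB]) simp_all
  then have BA: "(?B * ?A) $$ (i, l) = 1\<^sub>m n $$ (i, l)" for i l by simp
  have V': "(\<Sum>k<n. V k i * P k l) = (if i = l then 1 else 0)" if "i < n" "l < n" for i l
    using BA[of i l] that by (simp add: scalar_prod_def lessThan_atLeast0[symmetric])
  define f where "f v = (\<lambda>i. if i < n then \<Sum>k<n. P i k * v k else 0)" for v
  define g where "g v = (\<lambda>k. if k < n then \<Sum>i<n. V i k * v i else 0)" for v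
  have fg: "f (g v) = v" if v: "\<forall>i\<ge>n. v i = 0" for v
  proof
    fix i show "f (g v) i = v i"
    proof (cases "i < n")
      case True
      have "f (g v) i = (\<Sum>k<n. \<Sum>l<n. P i k * V l k * v l)"
        using True by (simp add: f_def g_def sum_distrib_left mult.assoc)
      also have "\<dots> = (\<Sum>l<n. (\<Sum>k<n. P i k * V l k) * v l)"
        by (subst sum.swap) (simp add: sum_distrib_right)
      also have "\<dots> = (\<Sum>l<n. if l = i then v l else 0)"
        by (rule sum.cong) (use True V in auto)
      finally show ?thesis using True by simp
    qed (use v in \<open>simp add: f_def\<close>)
  qed
  have gf: "g (f v) = v" if v: "\<forall>i\<ge>n. v i = 0" for v
  proof
    fix i show "g (f v) i = v i"
    proof (cases "i < n")
      case True
      have "g (f v) i = (\<Sum>k<n. \<Sum>l<n. V k i * P k l * v l)"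
        using True by (simp add: f_def g_def sum_distrib_left mult.assoc)
      also have "\<dots> = (\<Sum>l<n. (\<Sum>k<n. V k i * P k l) * v l)"
        by (subst sum.swap) (simp add: sum_distrib_right)
      also have "\<dots> = (\<Sum>l<n. if l = i then v l else 0)"
        by (rule sum.cong) (use True V' in auto)
      finally show ?thesis using True by simp
    qed (use v in \<open>simp add: g_def\<close>)
  qed
  have "bij_betw f {v. \<forall>i\<ge>n. v i = 0} {v. \<forall>i\<ge>n. v i = 0}"
    by (rule bij_betw_byWitness[where f' = g]) (auto simp: fg gf, auto simp: f_def g_def)
  then show ?thesis by (simp add: f_def[abs_def])
qed

lemma length_word_pow: "length (word_pow d t) = t * length d"
  by (induction t) (auto simp: word_pow_simps)

lemma word_pow_nth: "k < t * length d \<Longrightarrow> word_pow d t ! k = d ! (k mod length d)"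
proof (induction t arbitrary: k)
  case (Suc t)
  show ?case
  proof (cases "k < length d")
    case True then show ?thesis by (simp add: word_pow_simps nth_append)
  next
    case False
    then have "k - length d < t * length d" using Suc.prems by simp
    then show ?thesis using Suc.IH[of "k - length d"] False
      by (simp add: word_pow_simps nth_append le_mod_geq)
  qed
qed simp

lemma inf_word_pow: "t \<ge> 1 \<Longrightarrow> d \<noteq> [] \<Longrightarrow> inf_word (word_pow d t) i = inf_word d i"
proof -
  assume t: "t \<ge> 1" and d: "d \<noteq> []"
  let ?l = "int (length d)" and ?n = "int (t * length d)"
  have n: "0 < ?n" using t d by simp
  define k where "k = nat (i mod ?n)"
  have k: "int k = i mod ?n" using n by (simp add: k_def)
  then have kl: "k < t * length d" using n by (metis of_nat_less_iff pos_mod_bound)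
  have "inf_word (word_pow d t) i = word_pow d t ! k" by (simp add: inf_word_def length_word_pow k_def)
  also have "\<dots> = d ! (k mod length d)" by (rule word_pow_nth[OF kl])
  also have "int (k mod length d) = i mod ?l" by (simp add: of_nat_mod k mod_mod_cancel)
  then have "k mod length d = nat (i mod ?l)" by simp
  finally show ?thesis by (simp add: inf_word_def)
qed

text \<open>
  The band \<open>d\<close> of the middle term and its multiplicity \<open>t\<close> come from this.
\<close>

lemma primitive_root_exists: "w \<noteq> [] \<Longrightarrow> \<exists>d t. primitive d \<and> t \<ge> 1 \<and> w = word_pow d t"
proof (induction "length w" arbitrary: w rule: less_induct)
  case less
  show ?case
  proof (cases "primitive w")
    case True
    then show ?thesis by (intro exI[of _ w] exI[of _ 1]) (simp add: word_pow_def)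
  next
    case False
    then obtain z k where z: "w = word_pow z k" "k \<noteq> 1" using less.prems by (auto simp: primitive_def)
    have k0: "k \<noteq> 0" using z less.prems by (metis word_pow_simps(1))
    have len: "length w = k * length z" by (simp add: z(1) length_word_pow)
    then have z0: "z \<noteq> []" using less.prems by auto
    have "length z < length w" using len z(2) k0 z0 by (cases k) auto
    then obtain d t where d: "primitive d" "t \<ge> 1" "z = word_pow d t" using less.hyps z0 by blast
    have "word_pow (word_pow d t) k = word_pow d (k * t)" by (induction k) (auto simp: word_pow_simps word_pow_add)
    then show ?thesis using d z k0 by (intro exI[of _ d] exI[of _ "k * t"]) auto
  qed
qed

context bound_quiver
begin

lemma cyc_word_band: "cyc_word d \<Longrightarrow> primitive d \<Longrightarrow> band Q I d"
proof -
  assume d: "cyc_word d" and p: "primitive d"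
  have ne: "d \<noteq> []" and arcs: "arrow_of ` set d \<subseteq> arcs Q" and ok: "\<And>i. str_ok (inf_word d i) (inf_word d (i + 1))"
    using d by (auto simp: cyc_word_def)
  have "str_ok (d ! i) (d ! Suc i)" if "Suc i < length d" for i
    using ok[of "int i"] inf_word_nth[of i d] inf_word_nth[OF that] that by (simp add: add.commute)
  then have s: "is_string Q I d" using ne arcs by (simp add: is_string_iff)
  have "inf_word d (- 1) = inf_word d (int (length d - 1))"
  proof (rule inf_word_mod)
    have "int (length d - 1) = - 1 + int (length d)" using ne by (cases d) auto
    then show "- 1 mod int (length d) = int (length d - 1) mod int (length d)" by simp
  qed
  then have l: "inf_word d (- 1) = last d" using inf_word_nth[of "length d - 1" d] ne by (simp add: last_conv_nth)
  have h: "inf_word d (- 1 + 1) = hd d" using inf_word_nth[of 0 d] ne by (simp add: hd_conv_nth)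
  have lh: "str_ok (last d) (hd d)" using ok[of "- 1"] unfolding l h .
  then have s2: "is_string Q I [last d, hd d]" using arcs ne by (auto simp: is_string_iff)
  have "\<not> (\<exists>y r. r > 1 \<and> d = word_pow y r)" using p by (auto simp: primitive_def)
  then show ?thesis using s s2 lh by (auto simp: band_def str_ok_def)
qed

text \<open>
  A walk of vectors \<open>f k\<close> along a bi-infinite word \<open>U\<close>: the letter \<open>U k\<close> joins \<open>f (k + 1)\<close> to \<open>f k\<close>, and every
  arrow that is not one of the two letters adjacent to \<open>f k\<close> kills it.
\<close>

definition strip :: "('a \<Rightarrow> (nat \<Rightarrow> 'k) \<Rightarrow> nat \<Rightarrow> 'k) \<Rightarrow> (int \<Rightarrow> 'a letter) \<Rightarrow> (int \<Rightarrow> nat \<Rightarrow> 'k) \<Rightarrow> bool" where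
  "strip act U f \<longleftrightarrow> (\<forall>a\<in>arcs Q. \<forall>k. act a (f k) =
    (\<lambda>i. (if U (k - 1) = Dir a then f (k - 1) i else 0) + (if U k = Inv a then f (k + 1) i else 0)))"

lemma strip_shift: "strip act U f \<Longrightarrow> strip act (\<lambda>k. U (l + k)) (\<lambda>k. f (l + k))"
  unfolding strip_def by (auto simp: algebra_simps)

text \<open>
  Reading a strip backwards replaces every letter by its inverse.
\<close>

lemma strip_reverse: "strip act U f \<Longrightarrow> strip act (\<lambda>k. letter_inv (U (- 1 - k))) (\<lambda>k. f (- k))"
proof -
  assume s: "strip act U f"
  have e: "letter_inv x = Dir a \<longleftrightarrow> x = Inv a" "letter_inv x = Inv a \<longleftrightarrow> x = Dir a" for x :: "'a letter" and a
    by (cases x; auto)+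
  show ?thesis unfolding strip_def
  proof (intro ballI allI)
    fix a k assume a: "a \<in> arcs Q"
    have "act a (f (- k)) = (\<lambda>i. (if U (- k - 1) = Dir a then f (- k - 1) i else 0) + (if U (- k) = Inv a then f (- k + 1) i else 0))"
      using s a unfolding strip_def by blast
    moreover have "- 1 - (k - 1) = - k" "- 1 - k = - k - 1" "- (k - 1) = - k + 1" "- (k + 1) = - k - 1" by simp_all
    ultimately show "act a (f (- k)) = (\<lambda>i. (if letter_inv (U (- 1 - (k - 1))) = Dir a then f (- (k - 1)) i else 0) +
        (if letter_inv (U (- 1 - k)) = Inv a then f (- (k + 1)) i else 0))"
      unfolding e by (simp only: add.commute)
  qed
qed

end

lemma (in quiver_rep) strip_scale: "strip act U f \<Longrightarrow> strip act U (\<lambda>k i. \<kappa> * f k i)"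
  unfolding strip_def by (auto simp: act_scale algebra_simps)

text \<open>
  The rescaled basis of a band module in which the scalar is spread out over the bi-infinite word, so
  that every letter acts by \<open>1\<close>; one period of the word multiplies it by \<open>\<mu>\<^sup>-\<^sup>1\<close>.
\<close>

definition word_strip :: "'a letter list \<Rightarrow> nat \<Rightarrow> 'k::field \<Rightarrow> int \<Rightarrow> nat \<Rightarrow> 'k" where
  "word_strip w j \<mu> k = (\<lambda>i. \<mu> powi (- ((k + int (length w) - 1 - int j) div int (length w))) *
    unit (nat (k mod int (length w))) i)"

lemma word_strip_period:
  assumes "w \<noteq> []" and "\<mu> \<noteq> 0"
  shows "word_strip w j \<mu> (k + int (length w)) i = inverse \<mu> * word_strip w j \<mu> k i"
proof -
  let ?n = "int (length w)"
  let ?x = "k + ?n - 1 - int j"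
  have "(k + ?n + ?n - 1 - int j) div ?n = (?x + ?n) div ?n" by (simp add: algebra_simps)
  also have "\<dots> = ?x div ?n + 1" by (rule div_add_self2) (use assms in simp)
  finally have "(k + ?n + ?n - 1 - int j) div ?n = ?x div ?n + 1" .
  then have e: "- ((k + ?n + ?n - 1 - int j) div ?n) = - (?x div ?n) + - 1" by simp
  have "\<mu> powi (- ((k + ?n + ?n - 1 - int j) div ?n)) = \<mu> powi (- (?x div ?n)) * inverse \<mu>"
    unfolding e using assms(2) by (subst power_int_add) (auto simp: power_int_minus)
  then show ?thesis by (simp add: word_strip_def)
qed

lemma word_strip_unit:
  assumes "w \<noteq> []" and "\<mu> \<noteq> 0"
  shows "\<exists>t. t \<noteq> 0 \<and> word_strip w j \<mu> k = (\<lambda>i. t * unit (nat (k mod int (length w))) i)"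
  using assms(2) by (intro exI[of _ "\<mu> powi (- ((k + int (length w) - 1 - int j) div int (length w)))"])
    (simp add: word_strip_def)

lemma div_pred_int: "0 < (n::int) \<Longrightarrow> x div n = (x - 1) div n + (if x mod n = 0 then 1 else 0)"
proof -
  assume n: "0 < n"
  show ?thesis
  proof (cases "x mod n = 0")
    case True
    then obtain q where q: "x = n * q" by auto
    have "(n * q - 1) div n = (n * (q - 1) + (n - 1)) div n" by (simp add: algebra_simps)
    also have "\<dots> = q - 1" using n by (simp add: div_pos_pos_trivial)
    finally show ?thesis using n q by simp
  next
    case False
    have "0 < x mod n" using False n by (simp add: order.strict_iff_order)
    then have "(x mod n - 1) div n = 0" using n pos_mod_bound[OF n, of x] by (intro div_pos_pos_trivial) auto
    moreover have "x - 1 = n * (x div n) + (x mod n - 1)" by simp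
    then have "(x - 1) div n = x div n + (x mod n - 1) div n" using n by (metis div_mult_self4 add.commute less_irrefl)
    ultimately show ?thesis using False by simp
  qed
qed

context gentle_quiver
begin

text \<open>
  Moving past the letter that carries the scalar is compensated by the exponent in the definition, which jumps
  exactly there.
\<close>

lemma strip_word:
  assumes w: "cyc_word w" and \<mu>: "\<mu> \<noteq> 0" and dj: "direct_at w j"
  shows "strip (word_act w j \<mu>) (inf_word w) (word_strip w j \<mu>)"
  unfolding strip_def
proof (intro ballI allI)
  fix a k assume a: "a \<in> arcs Q"
  interpret W: cyc_rep Q I "length w" "word_vertex Q w" "whe w" "wnbr (length w)" "wew (length w) j \<mu>" "word_act w j \<mu>"
    by (rule cyc_rep_word[OF w \<mu> dj])
  have ne: "w \<noteq> []" using w by (simp add: cyc_word_def)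
  let ?n = "length w"
  have n: "0 < int ?n" "0 < ?n" using ne by simp_all
  define i0 where "i0 = nat (k mod int ?n)"
  have i0: "int i0 = k mod int ?n" using n by (simp add: i0_def)
  have il: "i0 < ?n" using i0 n by (metis of_nat_less_iff pos_mod_bound)
  define cf where "cf k = \<mu> powi (- ((k + int ?n - 1 - int j) div int ?n))" for k
  have cf0: "cf k \<noteq> 0" for k using \<mu> by (simp add: cf_def)
  have ws: "word_strip w j \<mu> k = (\<lambda>i. cf k * unit (nat (k mod int ?n)) i)" for k
    by (simp add: word_strip_def cf_def)
  have jl: "j < ?n" "\<exists>a. w ! j = Dir a" using dj by (auto simp: direct_at_def)
  have cf_step: "cf (k - 1) = cf k * (if (k - 1) mod int ?n = int j then \<mu> else 1)" for k
  proof -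
    let ?x = "k + int ?n - 1 - int j"
    have "(k - 1) mod int ?n = int j \<longleftrightarrow> (k - 1) mod int ?n = int j mod int ?n" using jl by simp
    also have "\<dots> \<longleftrightarrow> int ?n dvd (k - 1 - int j)" by (rule mod_eq_dvd_iff)
    also have "\<dots> \<longleftrightarrow> int ?n dvd (k - 1 - int j + int ?n)" by simp
    also have "k - 1 - int j + int ?n = ?x" by simp
    finally have c: "(k - 1) mod int ?n = int j \<longleftrightarrow> ?x mod int ?n = 0" by (simp add: dvd_eq_mod_eq_0)
    have "?x div int ?n = (?x - 1) div int ?n + (if ?x mod int ?n = 0 then 1 else 0)"
      by (rule div_pred_int[OF n(1)])
    moreover have "?x - 1 = k - 1 + int ?n - 1 - int j" by simp
    ultimately have e: "- ((k - 1 + int ?n - 1 - int j) div int ?n) =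
        - (?x div int ?n) + (if (k - 1) mod int ?n = int j then 1 else 0)" unfolding c by simp
    show ?thesis unfolding cf_def e using \<mu> power_int_add[of \<mu> "- (?x div int ?n)" 1] by auto
  qed
  have heF: "whe w False i0 = inf_word w (k - 1)" and heT: "whe w True i0 = letter_inv (inf_word w k)"
    using whe_mod[OF ne, of i0 k] i0 by simp_all
  have act: "word_act w j \<mu> a (word_strip w j \<mu> k) = (\<lambda>i. cf k * word_act w j \<mu> a (unit i0) i)"
    unfolding ws i0_def[symmetric] by (rule W.act_scale[OF a])
  have nbF: "wnbr ?n False i0 = nat ((k - 1) mod int ?n)" "wnbr ?n True i0 = nat ((k + 1) mod int ?n)"
    using wnbr_int[OF n(2), of False i0] wnbr_int[OF n(2), of True i0] i0
    by (simp_all add: mod_diff_left_eq mod_add_left_eq)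
  have both: "\<not> (inf_word w (k - 1) = Dir a \<and> inf_word w k = Inv a)"
    using W.he_blk[OF il, of True] heF heT by auto
  show "word_act w j \<mu> a (word_strip w j \<mu> k) = (\<lambda>i. (if inf_word w (k - 1) = Dir a then word_strip w j \<mu> (k - 1) i else 0) +
      (if inf_word w k = Inv a then word_strip w j \<mu> (k + 1) i else 0))"
  proof (cases "inf_word w (k - 1) = Dir a")
    case True
    have "(i0 + ?n - 1) mod ?n = nat ((k - 1) mod int ?n)" using nbF(1) by (simp add: wnbr_def)
    then have "wew ?n j \<mu> False i0 = (if nat ((k - 1) mod int ?n) = j then \<mu> else 1)" by (simp add: wew_def)
    moreover have "nat ((k - 1) mod int ?n) = j \<longleftrightarrow> (k - 1) mod int ?n = int j" using n by auto
    ultimately have "cf k * wew ?n j \<mu> False i0 = cf (k - 1)" by (simp add: cf_step[of k])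
    then show ?thesis
      using both True unfolding act unfolding W.act_unit[OF il heF[unfolded True]] ws nbF
      by (auto simp: unit_def)
  next
    case F: False
    show ?thesis
    proof (cases "inf_word w k = Inv a")
      case True
      have "w ! i0 = Inv a" using True i0 by (simp add: inf_word_def i0_def)
      then have nj: "i0 \<noteq> j" using jl by auto
      have "cf k = cf (k + 1)" using cf_step[of "k + 1"] nj i0 by auto
      moreover have "wew ?n j \<mu> True i0 = 1" using nj by (simp add: wew_def)
      moreover have d: "whe w True i0 = Dir a" using heT True by simp
      ultimately show ?thesis
        using F True unfolding act unfolding W.act_unit[OF il d] ws nbF by (auto simp: unit_def)
    next
      case False
      have "whe w s i0 \<noteq> Dir a" for s
        using F False heF heT by (cases s; cases "inf_word w k") auto
      then show ?thesis using F False unfolding act by (simp add: W.act_unit_none[OF il])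
    qed
  qed
qed

text \<open>The universal property of a band module: morphisms out of it are closed walks of vectors.\<close>

lemma hom_of_circuit:
  fixes f :: "nat \<Rightarrow> nat \<Rightarrow> 'k"
  assumes w: "cyc_word w" and s: "s \<noteq> 0" and dj: "direct_at w j"
    and E: "quiver_rep Q I n' vx' act'"
    and fc: "\<And>k. k < length w \<Longrightarrow> f k \<in> carrier (rep_module n' vx' act')"
    and fv: "\<And>k i. k < length w \<Longrightarrow> f k i \<noteq> 0 \<Longrightarrow> vx' i = word_vertex Q w k"
    and fa: "\<And>a k. a \<in> arcs Q \<Longrightarrow> k < length w \<Longrightarrow> act' a (f k) = (\<lambda>i.
      (if k = 0 then if last w = Dir a then s * f (length w - 1) i else 0
       else if w ! (k - 1) = Dir a then f (k - 1) i else 0) +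
      (if w ! k = Inv a then if Suc k = length w then inverse s * f 0 i else f (Suc k) i else 0))"
  shows "(\<lambda>v i. \<Sum>k<length w. f k i * ((if k \<le> j then 1 else s) * v k)) \<in>
    lmod_hom L (band_module Q w j s) (rep_module n' vx' act')"
proof -
  interpret W: cyc_rep Q I "length w" "word_vertex Q w" "whe w" "wnbr (length w)" "wew (length w) j s" "word_act w j s"
    by (rule cyc_rep_word[OF w s dj])
  interpret E: quiver_rep Q I n' vx' act' by (rule E)
  have ne: "w \<noteq> []" using w by (simp add: cyc_word_def)
  let ?n = "length w"
  have n: "0 < ?n" using ne by simp
  have jl: "j < ?n" "\<exists>a. w ! j = Dir a" using dj by (auto simp: direct_at_def)
  define cf where "cf k = (if k \<le> j then 1 else s)" for k
  define F where "F v = (\<lambda>i. \<Sum>k<?n. f k i * (cf k * v k))" for v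
  have F_add: "F (\<lambda>i. u i + v i) = (\<lambda>i. F u i + F v i)" for u v
    by (simp add: F_def algebra_simps sum.distrib)
  have F_scale: "F (\<lambda>i. \<kappa> * v i) = (\<lambda>i. \<kappa> * F v i)" for \<kappa> v
    by (simp add: F_def sum_distrib_left ac_simps)
  have F_unit: "F (\<lambda>i. t * unit k i) = (\<lambda>i. t * (cf k * f k i))" if "k < ?n" for k t
    using that by (simp add: F_def unit_def if_distrib[of "\<lambda>t. _ * t"] ac_simps cong: if_cong)
  have F_sum: "F (\<lambda>i. \<Sum>k\<in>J. g k i) = (\<lambda>i. \<Sum>k\<in>J. F (g k) i)" for g :: "nat \<Rightarrow> nat \<Rightarrow> 'k" and J
    by (induction J rule: infinite_finite_induct) (simp_all add: F_add, simp_all add: F_def)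
  (* linearity reduces the compatibility with an arrow to a basis vector and the two letters next to it *)
  have unit_step: "F (word_act w j s a (unit k)) = (\<lambda>i. cf k * act' a (f k) i)" if a: "a \<in> arcs Q" and k: "k < ?n" for a k
  proof -
    have heF: "whe w False k = (if k = 0 then last w else w ! (k - 1))"
    proof (cases k)
      case 0
      have "int (?n - 1) mod int ?n = - 1 mod int ?n"
      proof -
        have "int (?n - 1) = - 1 + int ?n" using ne by (cases w) auto
        then show ?thesis by (simp only: mod_add_self2)
      qed
      then have "inf_word w (- 1) = inf_word w (int (?n - 1))" by (intro inf_word_mod) simp
      then show ?thesis using 0 ne inf_word_nth[of "?n - 1" w] by (simp add: whe_def last_conv_nth)
    next
      case (Suc k')
      then show ?thesis using inf_word_nth[of k' w] k by (simp add: whe_def)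
    qed
    have heT: "whe w True k = letter_inv (w ! k)" by (simp add: whe_def inf_word_nth[OF k])
    have nbF: "wnbr ?n False k = (if k = 0 then ?n - 1 else k - 1)"
      using k by (cases k) (auto simp: wnbr_def)
    have nbT: "wnbr ?n True k = (if Suc k = ?n then 0 else Suc k)"
      using k by (auto simp: wnbr_def)
    have wtF: "wew ?n j s False k = (if (if k = 0 then ?n - 1 else k - 1) = j then s else 1)"
      using nbF by (simp add: wew_def wnbr_def)
    have both: "\<not> (whe w False k = Dir a \<and> w ! k = Inv a)"
      using W.he_blk[OF k, of True] heT by auto
    show ?thesis
    proof (cases "whe w False k = Dir a")
      case True
      have e: "word_act w j s a (unit k) = (\<lambda>i. wew ?n j s False k * unit (wnbr ?n False k) i)"
        unfolding W.act_unit[OF k True] by (auto simp: unit_def)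
      have "wnbr ?n False k < ?n" using n by (simp add: wnbr_def)
      then have "F (word_act w j s a (unit k)) = (\<lambda>i. wew ?n j s False k * (cf (wnbr ?n False k) * f (wnbr ?n False k) i))"
        unfolding e by (rule F_unit)
      then show ?thesis
        using both True jl k unfolding fa[OF a k] wtF nbF heF by (auto simp: cf_def)
    next
      case F: False
      have l0: "(if k = 0 then if last w = Dir a then s * f (length w - 1) i else 0
          else if w ! (k - 1) = Dir a then f (k - 1) i else 0) = 0" for i
        using F unfolding heF by (auto split: if_splits)
      show ?thesis
      proof (cases "w ! k = Inv a")
        case True
        have nj: "k \<noteq> j" using True jl by auto
        have d: "whe w True k = Dir a" using heT True by simp
        have e: "word_act w j s a (unit k) = (\<lambda>i. wew ?n j s True k * unit (wnbr ?n True k) i)"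
          unfolding W.act_unit[OF k d] by (auto simp: unit_def)
        have "wnbr ?n True k < ?n" using n by (simp add: wnbr_def)
        then have "F (word_act w j s a (unit k)) = (\<lambda>i. wew ?n j s True k * (cf (wnbr ?n True k) * f (wnbr ?n True k) i))"
          unfolding e by (rule F_unit)
        moreover have "wew ?n j s True k = 1" using nj by (simp add: wew_def)
        ultimately show ?thesis
          using True nj jl k s unfolding fa[OF a k] l0 nbT by (auto simp: cf_def)
      next
        case False
        have "whe w t k \<noteq> Dir a" for t
          using F False heT by (cases t; cases "w ! k") auto
        then have "word_act w j s a (unit k) = (\<lambda>_. 0)" by (rule W.act_unit_none[OF k])
        then show ?thesis using False F_scale[of 0 "\<lambda>_. 0"] unfolding fa[OF a k] l0 by simp
      qed
    qed
  qed
  have "F \<in> lmod_hom L (rep_module (length w) (word_vertex Q w) (word_act w j s)) (rep_module n' vx' act')"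
  proof (rule rep_hom[OF W.quiver_rep_axioms E])
    fix v assume v: "v \<in> carrier W.M"
    show "F v \<in> carrier E.M" using fc by (simp add: F_def E.carrier_M)
    show "F (\<lambda>i. if word_vertex Q w i = x then v i else 0) = (\<lambda>i. if vx' i = x then F v i else 0)" for x
    proof
      fix i
      have eq: "f k i * (cf k * (if word_vertex Q w k = x then v k else 0)) = (if vx' i = x then f k i * (cf k * v k) else 0)"
        if "k < ?n" for k
        using fv[OF that, of i] by (cases "f k i = 0") auto
      then show "F (\<lambda>i. if word_vertex Q w i = x then v i else 0) i = (if vx' i = x then F v i else 0)"
      proof -
        have "F (\<lambda>i. if word_vertex Q w i = x then v i else 0) i =
            (\<Sum>k<?n. if vx' i = x then f k i * (cf k * v k) else 0)"
          unfolding F_def by (intro sum.cong refl eq) simp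
        then show ?thesis by (simp add: F_def)
      qed
    qed
    show "F (word_act w j s a v) = act' a (F v)" if a: "a \<in> arcs Q" for a
    proof -
      have "v = (\<lambda>i. \<Sum>k<?n. v k * unit k i)"
        using v by (auto simp: unit_def W.carrier_M if_distrib[of "\<lambda>t. _ * t"] cong: if_cong)
      then have "word_act w j s a v = word_act w j s a (\<lambda>i. \<Sum>k<?n. v k * unit k i)" by (rule arg_cong)
      also have "\<dots> = (\<lambda>i. \<Sum>k<?n. v k * word_act w j s a (unit k) i)"
        by (simp only: W.act_sum[OF a] W.act_scale[OF a])
      finally have "F (word_act w j s a v) = (\<lambda>i. \<Sum>k<?n. v k * (cf k * act' a (f k) i))"
        by (simp add: F_sum F_scale unit_step[OF a])
      also have "\<dots> = act' a (F v)"
        unfolding F_def by (simp add: E.act_sum[OF a] mult.commute[of "f _ _"] E.act_scale[OF a] mult.assoc ac_simps)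
      finally show ?thesis .
    qed
  qed (simp_all add: F_add F_scale)
  then show ?thesis by (simp add: F_def[abs_def] cf_def band_module_def)
qed

end

section \<open>The middle term of an overlap extension\<close>

text \<open>
  The vectors of a closed walk through the middle term along \<open>b'c'\<close>. The minuend is the vector that follows
  \<open>c'b'\<close>, as long as this word agrees with \<open>b'c'\<close>, that is, up to the end of the overlap; if the overlap is longer
  than \<open>c'\<close>, the walk along \<open>c'b'\<close> has by then passed \<open>B\<close> and continues with a multiple of the walk itself.
  The case \<open>nc = 0\<close> only serves termination.
\<close>

fun spliced :: "nat \<Rightarrow> nat \<Rightarrow> 'k::field \<Rightarrow> (nat \<Rightarrow> nat \<Rightarrow> 'k) \<Rightarrow> (nat \<Rightarrow> nat \<Rightarrow> 'k) \<Rightarrow> nat \<Rightarrow> nat \<Rightarrow> 'k" where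
  "spliced nc M \<delta> Z X k = (\<lambda>i. - Z k i +
    (if k \<le> M then if k < nc \<or> nc = 0 then X k i else \<delta> * spliced nc M \<delta> Z X (k - nc) i else 0))"

declare spliced.simps [simp del]

text \<open>
  \<open>Y\<close> and \<open>X\<close> are the walks along one period of \<open>b'\<close> and \<open>c'\<close>, in the subspace and in the chosen complement;
  \<open>\<gamma>\<close> and \<open>\<delta>\<close> are the factors after one period, and \<open>M\<close> is the length of the overlap. The assumptions \<open>Yact\<close> and
  \<open>Xact\<close> describe the glued action: \<open>D\<close> sends \<open>X 0\<close> and \<open>Y 0\<close> to the same vector \<open>Ym\<close>, and where \<open>B\<close> ended at \<open>X 0\<close>
  it now ends at \<open>X 0 - Y 0\<close>.
\<close>

locale splice = quiver_rep Q I n vx act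
  for Q :: "('v, 'a) pre_digraph" and I :: "(('v, 'a) path \<Rightarrow> 'k::field) set" and n vx act +
  fixes b' c' :: "'a letter list" and Y X :: "nat \<Rightarrow> nat \<Rightarrow> 'k" and Ym :: "nat \<Rightarrow> 'k"
    and \<gamma> \<delta> :: 'k and M :: nat and A B C D :: 'a
  assumes ne: "b' \<noteq> []" "c' \<noteq> []" and \<gamma>: "\<gamma> \<noteq> 0"
    and bound: "M + 2 \<le> length b' + length c'"
    and agree: "\<And>k. k < M \<Longrightarrow> (b' @ c') ! k = (c' @ b' @ c') ! k"
    and differ: "(b' @ c') ! M = Inv C" "(c' @ b' @ c') ! M = Dir A"
    and last_b: "b' ! (length b' - 1) = Dir D" and last_c: "c' ! (length c' - 1) = Inv B"
    and Ym: "(\<lambda>i. \<gamma> * Ym i) = Y (length b' - 1)"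
    and Yact: "\<And>a k. a \<in> arcs Q \<Longrightarrow> k < length b' \<Longrightarrow> act a (Y k) = (\<lambda>i.
      (if k = 0 then if a = D then Ym i else 0 else if b' ! (k - 1) = Dir a then Y (k - 1) i else 0) +
      (if Suc k = length b' then 0 else if b' ! k = Inv a then Y (Suc k) i else 0))"
    and Xact: "\<And>a k. a \<in> arcs Q \<Longrightarrow> k < length c' \<Longrightarrow> act a (X k) = (\<lambda>i.
      (if k = 0 then if a = D then Ym i else 0 else if c' ! (k - 1) = Dir a then X (k - 1) i else 0) +
      (if Suc k = length c' then if a = B then \<delta> * (X 0 i - Y 0 i) else 0
       else if c' ! k = Inv a then X (Suc k) i else 0))"
begin

abbreviation "lb \<equiv> length b'"
abbreviation "lc \<equiv> length c'"
abbreviation "W \<equiv> b' @ c'"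
abbreviation "U \<equiv> c' @ b' @ c'"

text \<open>
  \<open>Z\<close> walks along \<open>b'c'\<close> and \<open>V\<close> along \<open>c'b'\<close>; the difference \<open>w\<close> is a closed walk.
\<close>

definition Z where "Z k = (if k < lb then Y k else (\<lambda>i. \<gamma> * X (k - lb) i))"
definition w where "w = spliced lc M \<delta> Z X"
definition V where "V k = (if k < lc then X k else (\<lambda>i. \<delta> * w (k - lc) i))"

lemma lpos: "0 < lb" "0 < lc" using ne by auto

lemma w_eq: "w k = (\<lambda>i. - Z k i + (if k \<le> M then V k i else 0))"
  unfolding w_def V_def using lpos by (subst spliced.simps) auto

lemma w_0: "w 0 = (\<lambda>i. X 0 i - Y 0 i)"
  using lpos by (simp add: w_eq Z_def V_def)

lemma W_last: "W ! (lb + lc - 1) = Inv B"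
proof -
  have "lb + lc - 1 = lb + (lc - 1)" using lpos(2) by linarith
  then show ?thesis using last_c by (simp only: nth_append_length_plus)
qed

text \<open>
  The walk \<open>Z\<close> crosses from \<open>b'\<close> to \<open>c'\<close> through \<open>D\<close> without a jump, but \<open>D\<close> also acts on its first vector, and it
  ends at a multiple of the first vector of \<open>w\<close>.
\<close>

lemma Zact:
  assumes a: "a \<in> arcs Q" and k: "k < lb + lc"
  shows "act a (Z k) = (\<lambda>i.
    (if k = 0 then if a = D then Ym i else 0 else if W ! (k - 1) = Dir a then Z (k - 1) i else 0) +
    (if Suc k = lb + lc then if a = B then \<gamma> * \<delta> * w 0 i else 0
     else if W ! k = Inv a then Z (Suc k) i else 0))"
proof (cases "k < lb")
  case True
  show ?thesis
  proof
    fix i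
    have 1: "(if Suc k = lb then 0 else if b' ! k = Inv a then Y (Suc k) i else 0) =
        (if Suc k = lb + lc then if a = B then \<gamma> * \<delta> * w 0 i else 0 else if W ! k = Inv a then Z (Suc k) i else 0)"
    proof (cases "Suc k = lb")
      case e: True
      then have "b' ! k = Dir D" using last_b by (metis diff_Suc_1)
      then show ?thesis using e lpos by (simp add: nth_append)
    next
      case False
      then show ?thesis using True lpos by (simp add: nth_append Z_def)
    qed
    have 2: "(if k = 0 then if a = D then Ym i else 0 else if b' ! (k - 1) = Dir a then Y (k - 1) i else 0) =
        (if k = 0 then if a = D then Ym i else 0 else if W ! (k - 1) = Dir a then Z (k - 1) i else 0)"
    proof (cases k)
      case (Suc h)
      have "W ! h = b' ! h" "Z h = Y h" using True Suc by (simp_all add: nth_append Z_def)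
      then show ?thesis using Suc by simp
    qed simp
    have "act a (Z k) i = (if k = 0 then if a = D then Ym i else 0 else if b' ! (k - 1) = Dir a then Y (k - 1) i else 0) +
        (if Suc k = lb then 0 else if b' ! k = Inv a then Y (Suc k) i else 0)"
      using True Yact[OF a True] by (simp add: Z_def)
    then show "act a (Z k) i = (if k = 0 then if a = D then Ym i else 0 else if W ! (k - 1) = Dir a then Z (k - 1) i else 0) +
        (if Suc k = lb + lc then if a = B then \<gamma> * \<delta> * w 0 i else 0 else if W ! k = Inv a then Z (Suc k) i else 0)"
      unfolding 1 2 .
  qed
next
  case False
  define l where "l = k - lb"
  have l: "k = lb + l" "l < lc" using False k by (simp_all add: l_def)
  have Zk: "Z k = (\<lambda>i. \<gamma> * X l i)" using l by (simp add: Z_def)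
  show ?thesis
  proof
    fix i
    have 1: "\<gamma> * (if Suc l = lc then if a = B then \<delta> * (X 0 i - Y 0 i) else 0 else if c' ! l = Inv a then X (Suc l) i else 0) =
        (if Suc k = lb + lc then if a = B then \<gamma> * \<delta> * w 0 i else 0 else if W ! k = Inv a then Z (Suc k) i else 0)"
      using l by (simp add: nth_append Z_def w_0)
    have 2: "\<gamma> * (if l = 0 then if a = D then Ym i else 0 else if c' ! (l - 1) = Dir a then X (l - 1) i else 0) =
        (if k = 0 then if a = D then Ym i else 0 else if W ! (k - 1) = Dir a then Z (k - 1) i else 0)"
    proof (cases "l = 0")
      case True
      have "W ! (k - 1) = Dir D" using l True last_b lpos by (simp add: nth_append)
      moreover have "Z (k - 1) i = \<gamma> * Ym i" using l True lpos fun_cong[OF Ym, of i] by (simp add: Z_def)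
      ultimately show ?thesis using l True lpos by simp
    next
      case False
      then have "W ! (k - 1) = c' ! (l - 1)" "Z (k - 1) i = \<gamma> * X (l - 1) i" using l by (auto simp: nth_append Z_def)
      then show ?thesis using l False by simp
    qed
    have "act a (Z k) i = \<gamma> * (if l = 0 then if a = D then Ym i else 0 else if c' ! (l - 1) = Dir a then X (l - 1) i else 0) +
        \<gamma> * (if Suc l = lc then if a = B then \<delta> * (X 0 i - Y 0 i) else 0 else if c' ! l = Inv a then X (Suc l) i else 0)"
      unfolding Zk act_scale[OF a] Xact[OF a l(2)] by (rule distrib_left)
    then show "act a (Z k) i = (if k = 0 then if a = D then Ym i else 0 else if W ! (k - 1) = Dir a then Z (k - 1) i else 0) +
        (if Suc k = lb + lc then if a = B then \<gamma> * \<delta> * w 0 i else 0 else if W ! k = Inv a then Z (Suc k) i else 0)"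
      unfolding 1 2 .
  qed
qed

text \<open>
  On the overlap \<open>V\<close> and \<open>Z\<close> move in parallel, and \<open>D\<close> kills the difference of their first vectors. After the overlap
  the next letter of \<open>c'b'\<close> is \<open>A\<close>, which points towards the last vector of \<open>V\<close> and does not act on it, while the next
  letter of \<open>b'c'\<close> is the inverse of \<open>C\<close>, so that \<open>V\<close> can be dropped from there on. The sign of \<open>Z\<close> in \<open>w\<close> produces
  the sign of the scalar of the middle term.
\<close>

lemma wact:
  assumes a: "a \<in> arcs Q" and k: "k < lb + lc"
  shows "act a (w k) = (\<lambda>i.
    (if k = 0 then 0 else if W ! (k - 1) = Dir a then w (k - 1) i else 0) +
    (if W ! k = Inv a then if Suc k = lb + lc then - (\<gamma> * \<delta> * w 0 i) else w (Suc k) i else 0))"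
  using k
proof (induction k rule: less_induct)
  case (less k)
  have Vact: "act a (V k) i =
      (if k = 0 then if a = D then Ym i else 0 else if U ! (k - 1) = Dir a then V (k - 1) i else 0) +
      (if U ! k = Inv a then V (Suc k) i else 0)" if kM: "k \<le> M" for i
  proof (cases "k < lc")
    case True
    have 1: "(if Suc k = lc then if a = B then \<delta> * (X 0 i - Y 0 i) else 0 else if c' ! k = Inv a then X (Suc k) i else 0) =
        (if U ! k = Inv a then V (Suc k) i else 0)"
    proof (cases "Suc k = lc")
      case e: True
      then have "c' ! k = Inv B" using last_c by (metis diff_Suc_1)
      then show ?thesis using e True by (simp add: nth_append V_def w_0)
    next
      case False then show ?thesis using True by (simp add: nth_append V_def)
    qed
    have 2: "(if k = 0 then if a = D then Ym i else 0 else if c' ! (k - 1) = Dir a then X (k - 1) i else 0) =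
        (if k = 0 then if a = D then Ym i else 0 else if U ! (k - 1) = Dir a then V (k - 1) i else 0)"
    proof (cases k)
      case (Suc h)
      have "U ! h = c' ! h" "V h = X h" using True Suc by (simp_all add: nth_append V_def)
      then show ?thesis using Suc by simp
    qed simp
    have "V k = X k" using True by (simp add: V_def)
    then show ?thesis by (simp only: Xact[OF a True] 1 2)
  next
    case False
    define l where "l = k - lc"
    have l: "k = lc + l" "l < k" "l < lb + lc" "Suc l \<noteq> lb + lc"
      using False lpos(2) kM bound less.prems unfolding l_def by linarith+
    have Uk: "U ! k = W ! l" using l by (simp add: nth_append)
    have 2: "\<delta> * (if l = 0 then 0 else if W ! (l - 1) = Dir a then w (l - 1) i else 0) =
        (if k = 0 then if a = D then Ym i else 0 else if U ! (k - 1) = Dir a then V (k - 1) i else 0)"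
    proof (cases "l = 0")
      case True
      then have "U ! (k - 1) = Inv B" using l last_c lpos by (simp add: nth_append)
      then show ?thesis using l True lpos by simp
    next
      case False
      then have "k - 1 = lc + (l - 1)" using l by simp
      then have "U ! (k - 1) = W ! (l - 1)" "V (k - 1) i = \<delta> * w (l - 1) i" by (simp_all add: V_def nth_append)
      then show ?thesis using l False by simp
    qed
    have "act a (V k) i = \<delta> * act a (w l) i" using l act_scale[OF a, of \<delta> "w l"] by (simp add: V_def)
    also have "\<dots> = \<delta> * (if l = 0 then 0 else if W ! (l - 1) = Dir a then w (l - 1) i else 0) +
        (if W ! l = Inv a then \<delta> * w (Suc l) i else 0)"
      unfolding less.IH[OF l(2,3)] using l(4) by (simp add: distrib_left)
    finally show ?thesis unfolding 2 Uk using l by (simp add: V_def Suc_diff_le)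
  qed
  have "act a (w k) = (\<lambda>i. - act a (Z k) i + (if k \<le> M then act a (V k) i else 0))"
  proof (cases "k \<le> M")
    case True
    have "act a (w k) = act a (\<lambda>i. V k i - Z k i)" using True by (simp add: w_eq)
    then show ?thesis using True by (simp add: act_diff[OF a])
  next
    case False
    have "act a (w k) = act a (\<lambda>i. - 1 * Z k i)" using False by (simp add: w_eq)
    then show ?thesis using False unfolding act_scale[OF a] by simp
  qed
  then have aw: "act a (w k) i = - act a (Z k) i + (if k \<le> M then act a (V k) i else 0)" for i by simp
  show ?case
  proof
    fix i
    consider (lt) "k < M" | (eq) "k = M" | (gt) "M < k" by linarith
    then show "act a (w k) i = (if k = 0 then 0 else if W ! (k - 1) = Dir a then w (k - 1) i else 0) +
        (if W ! k = Inv a then if Suc k = lb + lc then - (\<gamma> * \<delta> * w 0 i) else w (Suc k) i else 0)"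
    proof cases
      case lt
      have "W ! k = U ! k" "k \<noteq> 0 \<Longrightarrow> W ! (k - 1) = U ! (k - 1)" using agree lt by auto
      moreover have "Suc k \<noteq> lb + lc" using lt bound by simp
      ultimately show ?thesis unfolding aw Zact[OF a less.prems] using Vact[of i] lt by (auto simp: w_eq)
    next
      case eq
      have "W ! k = Inv C" "U ! k = Dir A" using differ eq by auto
      moreover have "k \<noteq> 0 \<Longrightarrow> W ! (k - 1) = U ! (k - 1)" using agree eq by auto
      moreover have "Suc k \<noteq> lb + lc" using eq bound by simp
      ultimately show ?thesis unfolding aw Zact[OF a less.prems] using Vact[of i] eq by (auto simp: w_eq)
    next
      case gt
      then have k0: "k \<noteq> 0" by simp
      have l: "(if W ! (k - 1) = Dir a then Z (k - 1) i else 0) = - (if W ! (k - 1) = Dir a then w (k - 1) i else 0)"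
      proof (cases "k - 1 = M")
        case True then show ?thesis using differ by simp
      next
        case False
        then have "\<not> k - 1 \<le> M" using gt by linarith
        then show ?thesis by (simp add: w_eq)
      qed
      have r: "(if Suc k = lb + lc then if a = B then \<gamma> * \<delta> * w 0 i else 0 else if W ! k = Inv a then Z (Suc k) i else 0) =
          - (if W ! k = Inv a then if Suc k = lb + lc then - (\<gamma> * \<delta> * w 0 i) else w (Suc k) i else 0)"
      proof (cases "Suc k = lb + lc")
        case True
        then have "k = lb + lc - 1" by simp
        then have "W ! k = Inv B" using W_last by simp
        then show ?thesis using True by auto
      next
        case False then show ?thesis using gt by (simp add: w_eq)
      qed
      show ?thesis unfolding aw Zact[OF a less.prems] r using l gt k0 by simp
    qed
  qed
qed

lemma wsupp:
  assumes "\<And>k i. k < lb \<Longrightarrow> Y k i \<noteq> 0 \<Longrightarrow> P i (W ! k)" and "\<And>k i. k < lc \<Longrightarrow> X k i \<noteq> 0 \<Longrightarrow> P i (c' ! k)"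
    and "\<And>k i. k \<le> M \<Longrightarrow> P i (U ! k) = P i (W ! k)"
  shows "k < lb + lc \<Longrightarrow> w k i \<noteq> 0 \<Longrightarrow> P i (W ! k)"
proof (induction k arbitrary: i rule: less_induct)
  case (less k)
  have Z: "P i (W ! k)" if "Z k i \<noteq> 0"
    using that assms(1)[of k i] assms(2)[of "k - lb" i] less.prems(1) by (auto simp: Z_def nth_append split: if_splits)
  have V: "P i (W ! k)" if "k \<le> M" "V k i \<noteq> 0"
  proof (cases "k < lc")
    case True
    then show ?thesis using that assms(2)[of k i] assms(3)[of k i] by (simp add: V_def nth_append)
  next
    case False
    then have "w (k - lc) i \<noteq> 0" using that by (simp add: V_def)
    moreover have "k - lc < k" "k - lc < lb + lc" using False lpos(2) less.prems(1) by linarith+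
    ultimately have "P i (W ! (k - lc))" using less.IH[of "k - lc" i] by blast
    then show ?thesis using False assms(3)[OF that(1), of i] by (simp add: nth_append)
  qed
  show ?case
  proof (cases "Z k i = 0")
    case True
    then have "k \<le> M" "V k i \<noteq> 0" using less.prems(2) by (simp_all add: w_eq split: if_splits)
    then show ?thesis by (rule V)
  qed (rule Z)
qed

text \<open>
  In the part \<open>c'\<close> of \<open>b'c'\<close>, the vector \<open>w\<close> differs from a multiple of \<open>X\<close> by at most a later \<open>X\<close> or a multiple of
  another \<open>w\<close>. So all \<open>X\<close> are recovered by descending induction, and then all \<open>Y\<close>.
\<close>

lemma wspan:
  assumes S: "\<And>k. k < lb + lc \<Longrightarrow> w k \<in> S"
    and add: "\<And>u v. u \<in> S \<Longrightarrow> v \<in> S \<Longrightarrow> (\<lambda>i. u i + v i) \<in> S" and scale: "\<And>\<kappa> u. u \<in> S \<Longrightarrow> (\<lambda>i. \<kappa> * u i) \<in> S"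
  shows "k < lc \<Longrightarrow> X k \<in> S" and "k < lb \<Longrightarrow> Y k \<in> S"
proof -
  have zero: "(\<lambda>_. 0) \<in> S" using scale[OF S[of 0], of 0] lpos by simp
  have V: "V k \<in> S" if "lc \<le> k" "k \<le> M" for k
    using that scale[OF S[of "k - lc"], of \<delta>] bound by (simp add: V_def)
  have ZS: "Z k \<in> S" if "k < lb + lc" "k \<le> M \<Longrightarrow> V k \<in> S" for k
  proof -
    have "Z k = (\<lambda>i. (- 1) * w k i + (if k \<le> M then V k i else 0))" by (simp add: w_eq)
    moreover have "(\<lambda>i. if k \<le> M then V k i else 0) \<in> S" using that(2) zero by (cases "k \<le> M") auto
    ultimately show ?thesis using add[OF scale[OF S[OF that(1)], of "- 1"]] by simp
  qed
  have X: "X k \<in> S" if "k < lc" for k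
    using that
  proof (induction "lc - k" arbitrary: k rule: less_induct)
    case less
    have "V (lb + k) \<in> S" if "lb + k \<le> M"
    proof (cases "lb + k < lc")
      case True
      moreover have "lc - (lb + k) < lc - k" using True lpos(1) by linarith
      ultimately have "X (lb + k) \<in> S" using less.hyps[of "lb + k"] by blast
      then show ?thesis using True by (simp add: V_def)
    next
      case False then show ?thesis using V that by simp
    qed
    then have "Z (lb + k) \<in> S" using ZS[of "lb + k"] less.prems by simp
    then have "(\<lambda>i. \<gamma> * X k i) \<in> S" by (simp add: Z_def)
    from scale[OF this, of "inverse \<gamma>"] show ?case using \<gamma> by (simp add: mult.assoc[symmetric])
  qed
  then show "k < lc \<Longrightarrow> X k \<in> S" by blast
  show "Y k \<in> S" if k: "k < lb"
  proof -
    have "V k \<in> S" if "k \<le> M" using V[OF _ that] X by (cases "k < lc") (auto simp: V_def[of k])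
    then have "Z k \<in> S" using ZS k by simp
    then show ?thesis using k by (simp add: Z_def)
  qed
qed

end

context gentle_quiver
begin

text \<open>
  The walk along a cyclic word in either direction, normalised to start at a given basis vector. Reversing the
  direction inverts the factor after one period, which is why \<open>opposite_scalar\<close> appears.
\<close>

lemma strip_from:
  assumes w: "cyc_word w" and \<mu>: "\<mu> \<noteq> 0" and dj: "direct_at w j"
    and i0: "i0 < length w" "int i0 = (if r then - int q else int q) mod int (length w)"
  shows "\<exists>y. strip (word_act w j \<mu>) (\<lambda>k. inf_word (if r then word_inv w else w) (int q + k)) y \<and>
    y 0 = unit i0 \<and> (\<forall>k i. y (k + int (length w)) i = (if r then \<mu> else inverse \<mu>) * y k i) \<and>
    (\<forall>k::nat. \<exists>t. t \<noteq> 0 \<and> y (int k) = (\<lambda>i. t * unit ((wnbr (length w) (\<not> r) ^^ k) i0) i))"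
proof -
  interpret W: cyc_rep Q I "length w" "word_vertex Q w" "whe w" "wnbr (length w)" "wew (length w) j \<mu>" "word_act w j \<mu>"
    by (rule cyc_rep_word[OF w \<mu> dj])
  have ne: "w \<noteq> []" using w by (simp add: cyc_word_def)
  let ?n = "int (length w)"
  have n: "0 < ?n" using ne by simp
  define e where "e k = (if r then - (int q + k) else int q + k)" for k
  let ?f = "\<lambda>k. word_strip w j \<mu> (e k)"
  have s0: "strip (word_act w j \<mu>) (\<lambda>k. inf_word (if r then word_inv w else w) (int q + k)) ?f"
  proof (cases r)
    case False
    then show ?thesis using strip_shift[OF strip_word[OF w \<mu> dj], of "int q"] by (simp add: e_def)
  next
    case True
    have "(\<lambda>k. letter_inv (inf_word w (- 1 - k))) = inf_word (word_inv w)"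
      by (rule ext) (rule inf_word_inv[OF ne, symmetric])
    then have "strip (word_act w j \<mu>) (inf_word (word_inv w)) (\<lambda>k. word_strip w j \<mu> (- k))"
      using strip_reverse[OF strip_word[OF w \<mu> dj]] by simp
    from strip_shift[OF this, of "int q"] show ?thesis using True by (simp only: e_def if_True)
  qed
  have posn: "nat (e (int k) mod ?n) = (wnbr (length w) (\<not> r) ^^ k) i0" for k
  proof -
    have "int ((wnbr (length w) (\<not> r) ^^ k) i0) = (if r then int i0 - int k else int i0 + int k) mod ?n"
      using wnbr_pow[OF i0(1), of k "\<not> r"] by simp
    also have "\<dots> = e (int k) mod ?n"
      by (cases r) (simp_all add: e_def i0(2) mod_diff_left_eq mod_add_left_eq)
    finally show ?thesis by simp
  qed
  have unit_f: "\<exists>t. t \<noteq> 0 \<and> ?f (int k) = (\<lambda>i. t * unit ((wnbr (length w) (\<not> r) ^^ k) i0) i)" for k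
    using word_strip_unit[OF ne \<mu>, of j "e (int k)"] unfolding posn .
  obtain t0 where t0: "t0 \<noteq> 0" "?f 0 = (\<lambda>i. t0 * unit i0 i)" using unit_f[of 0] by auto
  have per: "?f (k + ?n) i = (if r then \<mu> else inverse \<mu>) * ?f k i" for k i
  proof (cases r)
    case False
    have "e (k + ?n) = e k + ?n" using False by (simp add: e_def)
    then show ?thesis using False word_strip_period[OF ne \<mu>, of j "e k" i] by simp
  next
    case True
    have "e k = e (k + ?n) + ?n" using True by (simp add: e_def)
    then have "?f k i = inverse \<mu> * ?f (k + ?n) i" using word_strip_period[OF ne \<mu>, of j "e (k + ?n)" i] by simp
    then show ?thesis using True \<mu> by simp
  qed
  define y where "y k = (\<lambda>i. inverse t0 * ?f k i)" for k
  have "strip (word_act w j \<mu>) (\<lambda>k. inf_word (if r then word_inv w else w) (int q + k)) y"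
    unfolding y_def by (rule W.strip_scale[OF s0])
  moreover have "y 0 = unit i0" using t0 by (simp add: y_def mult.assoc[symmetric])
  moreover have "y (k + ?n) i = (if r then \<mu> else inverse \<mu>) * y k i" for k i
    unfolding y_def per by simp
  moreover have "\<exists>t. t \<noteq> 0 \<and> y (int k) = (\<lambda>i. t * unit ((wnbr (length w) (\<not> r) ^^ k) i0) i)" for k
  proof -
    obtain t where "t \<noteq> 0" "?f (int k) = (\<lambda>i. t * unit ((wnbr (length w) (\<not> r) ^^ k) i0) i)" using unit_f by blast
    then show ?thesis using t0(1) unfolding y_def by (intro exI[of _ "inverse t0 * t"]) (simp add: mult.assoc)
  qed
  ultimately show ?thesis by blast
qed

end

text \<open>
  Two bands together with a fixed overlap. The word of the middle term is \<open>b'c'\<close> with both periods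
  read from the left end of \<open>m\<close>.
\<close>

locale overlap_pair = band_pair Q I b c jb jc \<mu> lam
  for Q :: "('v, 'a) pre_digraph" and I :: "(('v, 'a) path \<Rightarrow> 'k::field) set" and b c jb jc \<mu> lam +
  fixes r :: bool and p q :: nat and m :: "'a letter list" and A B C D :: 'a
  assumes ov: "overlap Q I c (orient r b) p q m A B C D"
begin

abbreviation "rb \<equiv> rotate q (orient r b)"
abbreviation "rc \<equiv> rotate p c"
abbreviation "u k \<equiv> inf_word (orient r b) (int q + int k)"
abbreviation "v k \<equiv> inf_word c (int p + int k)"

lemma o: "p < nc" "q < nb" "inf_word c (int p - 1) = Inv B" "inf_word (orient r b) (int q - 1) = Dir D"
    "\<And>k. k < length m \<Longrightarrow> v k = m ! k" "\<And>k. k < length m \<Longrightarrow> u k = m ! k"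
    "v (length m) = Dir A" "u (length m) = Inv C"
    "m = [] \<Longrightarrow> head Q A = tail Q C" "m = [] \<Longrightarrow> arrow_path Q [C, A] \<in> I"
  using ov unfolding overlap_iff by auto

lemma uv: "k < length m \<Longrightarrow> u k = v k" using o(5,6) by simp

lemma pred_index: "0 < l \<Longrightarrow> length x = l \<Longrightarrow> inf_word x (int i + int (l - 1)) = inf_word x (int i - 1)"
proof -
  assume l: "0 < l" "length x = l"
  have "int i + int (l - 1) = (int i - 1) + int (length x)" using l by simp
  then show ?thesis by (simp only: inf_word_add)
qed

lemma last_rb: "rb ! (nb - 1) = Dir D"
  using rotate_nth_inf[of "nb - 1" "orient r b" q] b_ne pred_index[of nb "orient r b" q] o(4) by simp

lemma last_rc: "rc ! (nc - 1) = Inv B"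
  using rotate_nth_inf[of "nc - 1" c p] c_ne pred_index[of nc c p] o(3) by simp

lemma W_u: "k \<le> length m \<Longrightarrow> k < nb + nc \<Longrightarrow> (rb @ rc) ! k = u k"
  by (rule append_rotations_nth[OF orient_ne]) (auto simp: uv)

lemma V_v: "k \<le> length m \<Longrightarrow> k < nb + nc \<Longrightarrow> (rc @ rb) ! k = v k"
  by (rule append_rotations_nth[OF c_ne]) (auto simp: uv)

text \<open>
  The words \<open>b'c'\<close> and \<open>c'b'\<close> have the same letters with multiplicity but end in different letters, so they
  cannot agree on all the other positions. This bounds the length of the overlap.
\<close>

lemma overlap_bound: "length m + 2 \<le> nb + nc"
proof (rule ccontr)
  assume "\<not> ?thesis"
  then have big: "nb + nc - 1 \<le> length m" by simp
  have n: "0 < nb" "0 < nc" using b_ne c_ne by auto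
  let ?W = "rb @ rc" and ?V = "rc @ rb" and ?n = "nb + nc - 1"
  have "take ?n ?W = take ?n ?V"
  proof (rule nth_equalityI)
    fix k assume "k < length (take ?n ?W)"
    then have k: "k < ?n" by simp
    have "?W ! k = ?V ! k" using W_u[of k] V_v[of k] uv[of k] big k by simp
    then show "take ?n ?W ! k = take ?n ?V ! k" by (simp only: nth_take[OF k])
  qed simp
  moreover have "?W = take ?n ?W @ [Inv B]"
  proof -
    have "?n = nb + (nc - 1)" using n by linarith
    then have "?W ! ?n = Inv B" using last_rc nth_append_length_plus[of rb rc "nc - 1"] by simp
    moreover have "Suc ?n = length ?W" "?n < length ?W" using n by simp_all
    ultimately show ?thesis using take_Suc_conv_app_nth[of ?n ?W] by (metis take_all_iff order_refl)
  qed
  moreover have "?V = take ?n ?V @ [Dir D]"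
  proof -
    have "?n = nc + (nb - 1)" using n by linarith
    then have "?V ! ?n = Dir D" using last_rb nth_append_length_plus[of rc rb "nb - 1"] by simp
    moreover have "Suc ?n = length ?V" "?n < length ?V" using n unfolding length_append length_rotate length_orient by linarith+
    ultimately show ?thesis using take_Suc_conv_app_nth[of ?n ?V] by (metis take_all_iff order_refl)
  qed
  ultimately have "mset (take ?n ?V @ [Inv B]) = mset ?W" "mset (take ?n ?V @ [Dir D]) = mset ?V" by metis+
  then have "mset (take ?n ?V @ [Inv B]) = mset (take ?n ?V @ [Dir D])" by (simp add: union_commute)
  then show False by simp
qed

lemma U_v: "k \<le> length m \<Longrightarrow> (rc @ rb @ rc) ! k = v k"
proof (cases "k < nc")
  case True then show ?thesis by (simp add: nth_append rotate_nth_inf)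
next
  assume km: "k \<le> length m"
  case False
  have "(rc @ rb @ rc) ! k = (rb @ rc) ! (k - nc)" using False by (simp add: nth_append)
  also have "\<dots> = u (k - nc)" using km overlap_bound by (intro W_u) auto
  also have "\<dots> = v (k - nc)" using False km c_ne by (intro uv) (cases c; auto)
  also have "\<dots> = inf_word c (int p + int (k - nc) + int nc)" by (rule inf_word_add[symmetric])
  also have "int p + int (k - nc) + int nc = int p + int k" using False by simp
  finally show ?thesis .
qed

lemma rel_DB: "arrow_path Q [D, B] \<in> I" by (rule overlap_relation[OF ov])

lemma ok_b: "str_ok (inf_word (orient r b) k) (inf_word (orient r b) (k + 1))"
  using cyc_orient unfolding cyc_word_def by blast

lemma ok_c: "str_ok (inf_word c k) (inf_word c (k + 1))"
  using band_cyc_word[OF band_c] unfolding cyc_word_def by blast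

text \<open>
  At the two places where \<open>b'\<close> and \<open>c'\<close> meet, the first letter of either word has to follow the last letter of the
  other. If \<open>m\<close> is nonempty, the first letters coincide; otherwise \<open>CA \<in> I\<close> and \<open>DB \<in> I\<close> force \<open>DA\<close> and \<open>CB\<close> not to
  lie in \<open>I\<close>.
\<close>

lemma cyc_word_W: "cyc_word (rb @ rc)"
proof (rule cyc_wordI)
  have n: "0 < nb" "0 < nc" using b_ne c_ne by auto
  show "rb @ rc \<noteq> []" using c_ne by simp
  show "arrow_of ` set (rb @ rc) \<subseteq> arcs Q"
    using cyc_orient band_cyc_word[OF band_c] by (auto simp: cyc_word_def)
  have c0: "str_ok (Inv B) (v 0)" using ok_c[of "int p - 1"] o(3) by simp
  have b0: "str_ok (Dir D) (u 0)" using ok_b[of "int q - 1"] o(4) by simp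
  have cross: "str_ok (Dir D) (v 0) \<and> str_ok (Inv B) (u 0)"
  proof (cases "m = []")
    case False then show ?thesis using uv[of 0] b0 c0 by simp
  next
    case True
    have AC: "v 0 = Dir A" "u 0 = Inv C" using o(7,8) True by auto
    have nAB: "A \<noteq> B" and nCD: "C \<noteq> D" using b0 c0 AC by (auto simp: str_ok_def)
    have "arrow_path Q [D, A] \<notin> I" using gentle_unique(2)[OF rel_DB, of A] nAB by auto
    moreover have "arrow_path Q [C, B] \<notin> I" using gentle_unique(2)[OF o(10)[OF True], of B] nAB by auto
    ultimately show ?thesis using b0 c0 AC relation_arcs[OF rel_DB] o(9)[OF True] by (auto simp: str_ok_def)
  qed
  have rb0: "rb ! 0 = u 0" and rc0: "rc ! 0 = v 0" using n by (simp_all add: rotate_nth_inf)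
  have "last (rb @ rc) = rc ! (nc - 1)" using c_ne last_appendR[of rc rb] last_conv_nth[of rc] by simp
  moreover have "hd (rb @ rc) = rb ! 0" using orient_ne by (simp add: hd_append hd_conv_nth)
  ultimately show "str_ok (last (rb @ rc)) (hd (rb @ rc))" unfolding last_rc rb0 using cross by simp
  fix i assume i: "Suc i < length (rb @ rc)"
  consider "Suc i < nb" | "Suc i = nb" | "nb \<le> i" by linarith
  then show "str_ok ((rb @ rc) ! i) ((rb @ rc) ! Suc i)"
  proof cases
    case 1
    then show ?thesis using ok_b[of "int q + int i"] by (simp add: nth_append rotate_nth_inf ac_simps)
  next
    case 2
    then have "i = nb - 1" by simp
    then show ?thesis using 2 cross last_rb rc0 n by (simp add: nth_append)
  next
    case 3
    define l where "l = i - nb"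
    have l: "i = nb + l" "Suc l < nc" using 3 i by (simp_all add: l_def)
    then show ?thesis using ok_c[of "int p + int l"] by (simp add: nth_append rotate_nth_inf ac_simps)
  qed
qed

lemma primitive_root_W: "\<exists>d t. band Q I d \<and> t \<ge> 1 \<and> word_pow d t = rb @ rc"
proof -
  obtain d t where d: "primitive d" "t \<ge> 1" "rb @ rc = word_pow d t"
    using primitive_root_exists[of "rb @ rc"] c_ne by auto
  have ne: "d \<noteq> []" using d(1) by (simp add: primitive_def)
  have "cyc_word d"
    by (rule cyc_word_cong[OF ne _ cyc_word_W, of 0]) (simp add: d(3) inf_word_pow[OF d(2) ne])
  then have "band Q I d" using d(1) by (rule cyc_word_band)
  then show ?thesis using d by metis
qed

abbreviation "yb \<equiv> pos r q"
abbreviation "GT \<equiv> glue_cocycle (r, yb, p)"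

lemma GT_cocycle: "cocycle GT"
  using overlap_node_of[OF ov] cocycle_glue by (simp add: overlap_node_def)

lemma half_edges: "whe b r yb = Dir D" "whe c False p = Inv B" "yb < nb"
  using left_half_edge[OF o(2), of r] left_half_edge_c[of p] o pos_less[OF o(2)] by auto

lemma ext_act_lo:
  assumes a: "a \<in> arcs Q" and t: "t \<in> carrier Mb"
  shows "ext_act GT a t = word_act b jb \<mu> a t"
proof (rule vec_eqI)
  have c: "word_act b jb \<mu> a t \<in> carrier Mb" by (simp add: B.carrier_M B.act_bound[OF a])
  show "lo (ext_act GT a t) = lo (word_act b jb \<mu> a t)"
    by (simp add: lo_ext_act[OF a] lo_Mb[OF t] lo_Mb[OF c] hi_Mb[OF t] mat_zero)
  show "hi (ext_act GT a t) = hi (word_act b jb \<mu> a t)"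
    by (simp add: hi_ext_act hi_Mb[OF t] hi_Mb[OF c] C.act_zero[OF a])
qed

end

context gentle_quiver
begin

text \<open>
  A closed walk whose vectors span a space of the right dimension is an isomorphism from the module of its word.
\<close>

lemma circuit_iso:
  assumes w: "cyc_word w" and s: "s \<noteq> 0" and dj: "direct_at w j"
    and E: "quiver_rep Q I n vx' act'" and n: "length w = n"
    and f: "\<And>k i. k < n \<Longrightarrow> n \<le> i \<Longrightarrow> f k i = 0"
    and fv: "\<And>k i. k < n \<Longrightarrow> f k i \<noteq> 0 \<Longrightarrow> vx' i = lend Q (w ! k)"
    and fa: "\<And>a k. a \<in> arcs Q \<Longrightarrow> k < n \<Longrightarrow> act' a (f k) = (\<lambda>i.
      (if k = 0 then if last w = Dir a then s * f (n - 1) i else 0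
       else if w ! (k - 1) = Dir a then f (k - 1) i else 0) +
      (if w ! k = Inv a then if Suc k = n then inverse s * f 0 i else f (Suc k) i else 0))"
    and span: "\<And>i. i < n \<Longrightarrow> \<exists>v. unit i = (\<lambda>l. \<Sum>k<n. f k l * v k)"
  shows "lmod_iso L (band_module Q w j s) (rep_module n vx' act')"
proof -
  let ?c = "\<lambda>k. if k \<le> j then 1 else s"
  let ?F = "\<lambda>v i. \<Sum>k<n. f k i * (?c k * v k)"
  interpret E: quiver_rep Q I n vx' act' by (rule E)
  have hom: "?F \<in> lmod_hom L (band_module Q w j s) (rep_module n vx' act')"
  proof (rule hom_of_circuit[OF w s dj E, unfolded n])
    show "f k \<in> carrier (rep_module n vx' act')" if "k < n" for k using f that by (simp add: E.carrier_M)
    show "vx' i = word_vertex Q w k" if "k < n" "f k i \<noteq> 0" for k i using fv that by (simp add: word_vertex_def)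
  qed (rule fa)
  have "\<exists>v. \<forall>l<n. (\<Sum>k<n. f k l * ?c k * v k) = (if l = i then 1 else 0)" if "i < n" for i
  proof -
    obtain v where v: "unit i = (\<lambda>l. \<Sum>k<n. f k l * v k)" using span \<open>i < n\<close> by blast
    have "(\<Sum>k<n. f k l * ?c k * (inverse (?c k) * v k)) = (if l = i then 1 else 0)" for l
    proof -
      have "(\<Sum>k<n. f k l * ?c k * (inverse (?c k) * v k)) = (\<Sum>k<n. f k l * v k)"
        using s by (intro sum.cong) (auto simp: field_simps)
      also have "\<dots> = unit i l" unfolding v ..
      finally show ?thesis by (simp add: unit_def)
    qed
    then show ?thesis by (intro exI[of _ "\<lambda>k. inverse (?c k) * v k"]) blast
  qed
  from matrix_surj_bij[where P = "\<lambda>l k. f k l * ?c k", OF this]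
  have "bij_betw (\<lambda>v i. if i < n then \<Sum>k<n. f k i * ?c k * v k else 0) {v. \<forall>i\<ge>n. v i = 0} {v. \<forall>i\<ge>n. v i = 0}" .
  also have "(\<lambda>v i. if i < n then \<Sum>k<n. f k i * ?c k * v k else 0) = ?F"
    by (intro ext) (simp add: f mult.assoc)
  finally have "bij_betw ?F (carrier (band_module Q w j s)) (carrier (rep_module n vx' act'))"
    by (simp add: band_module_def rep_module_def n)
  then show ?thesis using hom unfolding lmod_iso_def by blast
qed

end

lemma int_pred: "0 < k \<Longrightarrow> int (k - 1) = - 1 + int k"
  by (cases k) auto

context overlap_pair
begin

text \<open>
  The two words agree on \<open>m\<close>, and \<open>A\<close> ends where \<open>C\<close> starts.
\<close>

lemma lend_agree: "k \<le> length m \<Longrightarrow> lend Q (u k) = lend Q (v k)"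
proof (cases "k = length m")
  case False then show "k \<le> length m \<Longrightarrow> lend Q (u k) = lend Q (v k)" using uv by simp
next
  case True
  show ?thesis
  proof (cases "m = []")
    case m: True then show ?thesis using o(7,8,9) True by simp
  next
    case False
    then obtain l where l: "length m = Suc l" by (cases m) auto
    have "str_ok (u l) (u (Suc l))" using ok_b[of "int q + int l"] by (simp add: ac_simps)
    moreover have "str_ok (v l) (v (Suc l))" using ok_c[of "int p + int l"] by (simp add: ac_simps)
    ultimately show ?thesis using uv[of l] True l by (auto simp: str_ok_def)
  qed
qed

lemma lstart_letter_inv: "lstart Q (letter_inv x) = lend Q x"
  by (cases x) auto

text \<open>
  The glued representation satisfies the abstract description of a splice: the correction by the gluing cocycle
  acts only on the two vectors adjacent to the left end of \<open>m\<close> in \<open>c'\<close>.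
\<close>

lemma middle_term_circuit:
  defines "\<gamma> \<equiv> opposite_scalar r \<mu>" and "\<delta> \<equiv> inverse lam"
  shows "\<exists>w. (\<forall>k<nb + nc. \<forall>i\<ge>nb + nc. w k i = 0) \<and>
    (\<forall>k<nb + nc. \<forall>i. w k i \<noteq> 0 \<longrightarrow> evx i = lend Q ((rb @ rc) ! k)) \<and>
    (\<forall>a\<in>arcs Q. \<forall>k<nb + nc. ext_act GT a (w k) = (\<lambda>i.
      (if k = 0 then 0 else if (rb @ rc) ! (k - 1) = Dir a then w (k - 1) i else 0) +
      (if (rb @ rc) ! k = Inv a then if Suc k = nb + nc then - (\<gamma> * \<delta> * w 0 i) else w (Suc k) i else 0))) \<and>
    (\<forall>i<nb + nc. \<exists>v. unit i = (\<lambda>l. \<Sum>k<nb + nc. w k l * v k))"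
proof -
  have n: "0 < nb" "0 < nc" using b_ne c_ne by auto
  have pq: "p < nc" "yb < nb" using o(1) half_edges(3) by auto
  have yb: "int yb = (if r then - int q else int q) mod int nb"
    using pos_int[OF o(2), of r] pq(2) by simp
  have p: "int p = (if False then - int p else int p) mod int nc" using pq(1) by simp
  obtain y where y: "strip (word_act b jb \<mu>) (\<lambda>k. inf_word (orient r b) (int q + k)) y"
      "y 0 = unit yb" "\<And>k i. y (k + int nb) i = \<gamma> * y k i"
      "\<And>k::nat. \<exists>t. t \<noteq> 0 \<and> y (int k) = (\<lambda>i. t * unit ((wnbr nb (\<not> r) ^^ k) yb) i)"
    using strip_from[OF band_cyc_word[OF band_b] \<mu>_nz direct_b pq(2) yb]
    unfolding \<gamma>_def opposite_scalar_def orient_def by blast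
  obtain x where x: "strip (word_act c jc lam) (\<lambda>k. inf_word c (int p + k)) x"
      "x 0 = unit p" "\<And>k i. x (k + int nc) i = \<delta> * x k i"
      "\<And>k::nat. \<exists>t. t \<noteq> 0 \<and> x (int k) = (\<lambda>i. t * unit ((wnbr nc True ^^ k) p) i)"
    using strip_from[OF band_cyc_word[OF band_c] lam_nz direct_c pq(1) p]
    unfolding \<delta>_def by (auto simp only: if_False not_False_eq_True)
  let ?X = "\<lambda>k. join (\<lambda>_. 0) (x (int k))"
  have ys: "word_act b jb \<mu> a (y k) = (\<lambda>i. (if inf_word (orient r b) (int q + (k - 1)) = Dir a then y (k - 1) i else 0) +
      (if inf_word (orient r b) (int q + k) = Inv a then y (k + 1) i else 0))" if "a \<in> arcs Q" for a k
    using y(1) that unfolding strip_def by blast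
  have xs: "word_act c jc lam a (x k) = (\<lambda>i. (if inf_word c (int p + (k - 1)) = Dir a then x (k - 1) i else 0) +
      (if inf_word c (int p + k) = Inv a then x (k + 1) i else 0))" if "a \<in> arcs Q" for a k
    using x(1) that unfolding strip_def by blast
  have um: "inf_word (orient r b) (int q + - 1) = Dir D" "inf_word c (int p + - 1) = Inv B" using o(3,4) by simp_all
  have ul: "u (nb - 1) = Dir D" "v (nc - 1) = Inv B"
  proof -
    have "rb ! (nb - 1) = u (nb - 1)" by (rule rotate_nth_inf) (use n in simp)
    then show "u (nb - 1) = Dir D" by (simp only: last_rb)
    have "rc ! (nc - 1) = v (nc - 1)" by (rule rotate_nth_inf) (use n in simp)
    then show "v (nc - 1) = Inv B" by (simp only: last_rc)
  qed
  have yM: "y (int k) \<in> carrier Mb" for k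
  proof -
    obtain t where "y (int k) = (\<lambda>i. t * unit ((wnbr nb (\<not> r) ^^ k) yb) i)" using y(4) by blast
    then show ?thesis using wnbr_pow_less[OF pq(2), of k "\<not> r"] by (auto simp: B.carrier_M unit_def)
  qed
  have x_p: "x (int k) p = (if k = 0 then 1 else 0)" if "k < nc" for k
  proof (cases "k = 0")
    case True then show ?thesis by (simp add: x(2) unit_def)
  next
    case False
    obtain t where t: "x (int k) = (\<lambda>i. t * unit ((wnbr nc True ^^ k) p) i)" using x(4) by blast
    have "inj_on (\<lambda>k. (wnbr nc True ^^ k) p) {..<nc}" using wnbr_pow_bij[OF pq(1)] by (rule bij_betw_imp_inj_on)
    then have "(wnbr nc True ^^ k) p \<noteq> (wnbr nc True ^^ 0) p"
      using False that n by (metis inj_on_eq_iff lessThan_iff)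
    then show ?thesis using False by (simp add: t unit_def)
  qed
  have DB: "D \<in> arcs Q" "B \<in> arcs Q" using relation_arcs[OF rel_DB] by auto
  have u0: "u 0 \<noteq> Inv D" using ok_b[of "int q - 1"] o(4) by (auto simp: str_ok_def)
  have v0: "v 0 \<noteq> Dir B" using ok_c[of "int p - 1"] o(3) by (auto simp: str_ok_def)
  have y_left: "y (- 1) = (\<lambda>i. if i = wnbr nb r yb then wew nb jb \<mu> r yb else 0)"
  proof -
    have "word_act b jb \<mu> D (y 0) = y (- 1)"
      using ys[OF DB(1), of 0] um(1) u0 by simp
    then show ?thesis unfolding y(2) B.act_unit[OF pq(2) half_edges(1)] by simp
  qed
  (* only the last vector of a period is sent by B to the basis vector at the left end of m *)
  have x_left: "word_act c jc lam B (x (int k)) p = (if Suc k = nc then \<delta> else 0)" if k: "k < nc" for k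
  proof -
    have 1: "(if inf_word c (int p + (int k - 1)) = Dir B then x (int k - 1) p else 0) = 0"
    proof (cases k)
      case 0 then show ?thesis using um(2) by simp
    next
      case (Suc h)
      then show ?thesis using x_p[of h] v0 k by (cases "h = 0") simp_all
    qed
    have 2: "(if v k = Inv B then x (int k + 1) p else 0) = (if Suc k = nc then \<delta> else 0)"
    proof (cases "Suc k = nc")
      case True
      then have kn: "k = nc - 1" "int k + 1 = 0 + int nc" by simp_all
      have "v k = Inv B" using ul(2) by (simp only: kn(1))
      moreover have "x (int k + 1) p = \<delta>" unfolding kn(2) x(3) using x(2) by (simp add: unit_def)
      ultimately show ?thesis using True by simp
    next
      case False
      then have "x (int (Suc k)) p = 0" using x_p[of "Suc k"] k by simp
      then have "x (int k + 1) p = 0" by (simp add: add.commute)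
      then show ?thesis using False by simp
    qed
    show ?thesis unfolding xs[OF DB(2)] 1 2 by simp
  qed
  have ext_X: "ext_act GT a (?X k) i = (if a = D \<and> k = 0 then y (- 1) i else 0) -
      (if a = B \<and> Suc k = nc then \<delta> * unit yb i else 0) + join (\<lambda>_. 0) (word_act c jc lam a (x (int k))) i"
    if a: "a \<in> arcs Q" and k: "k < nc" for a k i
  proof -
    have lo: "lo (?X k) = (\<lambda>_. 0)" and hi: "hi (?X k) = x (int k)" by (auto simp: lo_def hi_def join_def)
    have "mat GT a (x (int k)) i = (if a = D \<and> i = wnbr nb r yb then wew nb jb \<mu> r yb * x (int k) p else 0) -
        (if a = B \<and> i = yb then word_act c jc lam B (x (int k)) p else 0)"
      unfolding mat_glue_cocycle[OF pq(2,1)] half_edges(1,2)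
      using C.act_in[OF pq(1) half_edges(2), of "x (int k)"] by auto
    also have "\<dots> = (if a = D \<and> k = 0 then y (- 1) i else 0) - (if a = B \<and> Suc k = nc then \<delta> * unit yb i else 0)"
      unfolding x_p[OF k] x_left[OF k] y_left by (simp add: unit_def)
    finally have m: "mat GT a (x (int k)) i =
      (if a = D \<and> k = 0 then y (- 1) i else 0) - (if a = B \<and> Suc k = nc then \<delta> * unit yb i else 0)" .
    show ?thesis
    proof (cases "i < nb")
      case True
      have "ext_act GT a (?X k) i = mat GT a (x (int k)) i"
        using True by (simp add: ext_act_def lo hi B.act_zero[OF a])
      then show ?thesis using True unfolding m by (simp add: join_def)
    next
      case False
      then have "mat GT a (x (int k)) i = 0" by (simp add: mat_bound)
      then show ?thesis using False unfolding m[symmetric] by (simp add: ext_act_def hi) (simp add: join_def)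
    qed
  qed
  interpret S: splice Q I "nb + nc" evx "ext_act GT" rb rc "\<lambda>k. y (int k)" ?X "y (- 1)" \<gamma> \<delta> "length m" A B C D
  proof (intro splice.intro splice_axioms.intro ext_rep GT_cocycle)
    show "rb \<noteq> []" "rc \<noteq> []" using orient_ne c_ne by simp_all
    show "\<gamma> \<noteq> 0" using \<mu>_nz by (simp add: \<gamma>_def opposite_scalar_def)
    show "length m + 2 \<le> length rb + length rc" using overlap_bound by simp
    show "(rb @ rc) ! k = (rc @ rb @ rc) ! k" if "k < length m" for k
      using W_u[of k] U_v[of k] uv[OF that] that overlap_bound by simp
    show "(rb @ rc) ! length m = Inv C" using W_u[of "length m"] o(8) overlap_bound by simp
    show "(rc @ rb @ rc) ! length m = Dir A" using U_v[of "length m"] o(7) by simp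
    show "rb ! (length rb - 1) = Dir D" using last_rb by simp
    show "rc ! (length rc - 1) = Inv B" using last_rc by simp
    have "int (length rb - 1) = - 1 + int nb"
      unfolding length_rotate length_orient by (rule int_pred[OF n(1)])
    then show "(\<lambda>i. \<gamma> * y (- 1) i) = y (int (length rb - 1))" by (intro ext) (simp only: y(3))
  next
    fix a k assume a: "a \<in> arcs Q" and "k < length rb"
    then have k: "k < nb" by simp
    have 1: "(if inf_word (orient r b) (int q + (int k - 1)) = Dir a then y (int k - 1) i else 0) =
        (if k = 0 then if a = D then y (- 1) i else 0 else if rb ! (k - 1) = Dir a then y (int (k - 1)) i else 0)" for i
    proof (cases k)
      case 0 then show ?thesis using um by simp
    next
      case (Suc h) then show ?thesis using rotate_nth_inf[of h "orient r b" q] k by simp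
    qed
    have 2: "(if u k = Inv a then y (int k + 1) i else 0) =
        (if Suc k = length rb then 0 else if rb ! k = Inv a then y (int (Suc k)) i else 0)" for i
    proof (cases "Suc k = nb")
      case True
      then have "u k = Dir D" using ul(1) by (metis diff_Suc_1)
      then show ?thesis using True by simp
    next
      case False then show ?thesis using rotate_nth_inf[of k "orient r b" q] k by (simp add: add.commute)
    qed
    show "ext_act GT a (y (int k)) = (\<lambda>i.
      (if k = 0 then if a = D then y (- 1) i else 0 else if rb ! (k - 1) = Dir a then y (int (k - 1)) i else 0) +
      (if Suc k = length rb then 0 else if rb ! k = Inv a then y (int (Suc k)) i else 0))"
      unfolding ext_act_lo[OF a yM] ys[OF a] 1 2 ..
  next
    fix a k assume a: "a \<in> arcs Q" and "k < length rc"
    then have k: "k < nc" by simp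
    show "ext_act GT a (?X k) = (\<lambda>i.
      (if k = 0 then if a = D then y (- 1) i else 0 else if rc ! (k - 1) = Dir a then ?X (k - 1) i else 0) +
      (if Suc k = length rc then if a = B then \<delta> * (?X 0 i - y (int 0) i) else 0
       else if rc ! k = Inv a then ?X (Suc k) i else 0))"
    proof
      fix i
      have 1: "(if a = D \<and> k = 0 then y (- 1) i else 0) + join (\<lambda>_. 0) (\<lambda>i. if inf_word c (int p + (int k - 1)) = Dir a then x (int k - 1) i else 0) i =
        (if k = 0 then if a = D then y (- 1) i else 0 else if rc ! (k - 1) = Dir a then ?X (k - 1) i else 0)"
      proof (cases k)
        case 0 then show ?thesis using um by (simp add: join_def)
      next
        case (Suc h) then show ?thesis using rotate_nth_inf[of h c p] k by (simp add: join_def)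
      qed
      have 2: "join (\<lambda>_. 0) (\<lambda>i. if v k = Inv a then x (int k + 1) i else 0) i - (if a = B \<and> Suc k = nc then \<delta> * unit yb i else 0) =
        (if Suc k = length rc then if a = B then \<delta> * (?X 0 i - y (int 0) i) else 0
         else if rc ! k = Inv a then ?X (Suc k) i else 0)"
      proof (cases "Suc k = nc")
        case True
        then have kn: "k = nc - 1" "int k + 1 = 0 + int nc" by simp_all
        have "v k = Inv B" using ul(2) by (simp only: kn(1))
        moreover have "x (int k + 1) = (\<lambda>i. \<delta> * x 0 i)" unfolding kn(2) x(3) by (rule refl)
        ultimately show ?thesis using True y(2) by (auto simp: join_def algebra_simps)
      next
        case False then show ?thesis using rotate_nth_inf[of k c p] k by (simp add: join_def add.commute)
      qed
      have j: "join (\<lambda>_. 0) (\<lambda>i. g i + h i) i = join (\<lambda>_. 0) g i + join (\<lambda>_. 0) h i" for g h :: "nat \<Rightarrow> 'k"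
        by (simp add: join_def)
      show "ext_act GT a (?X k) i =
        (if k = 0 then if a = D then y (- 1) i else 0 else if rc ! (k - 1) = Dir a then ?X (k - 1) i else 0) +
        (if Suc k = length rc then if a = B then \<delta> * (?X 0 i - y (int 0) i) else 0
         else if rc ! k = Inv a then ?X (Suc k) i else 0)"
        unfolding ext_X[OF a k] xs[OF a] j 1[symmetric] 2[symmetric] by simp
    qed
  qed
  have Y_supp: "i = (wnbr nb (\<not> r) ^^ k) yb" if "y (int k) i \<noteq> 0" for k i
    using y(4)[of k] that by (auto simp: unit_def split: if_splits)
  have X_supp: "i = nb + (wnbr nc True ^^ k) p" if "?X k i \<noteq> 0" for k i
    using x(4)[of k] that by (auto simp: join_def unit_def split: if_splits)
  have bound: "w < nb + nc" if "w = (wnbr nb (\<not> r) ^^ k) yb \<or> w = nb + (wnbr nc True ^^ k) p" for w k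
    using that wnbr_pow_less[OF pq(2), of k "\<not> r"] wnbr_pow_less[OF pq(1), of k True] by auto
  have wb: "i < nb + nc" if "k < nb + nc" "S.w k i \<noteq> 0" for k i
    using S.wsupp[of "\<lambda>i _. i < nb + nc" k i] bound Y_supp X_supp that by fastforce
  have Yv: "evx i = lend Q ((rb @ rc) ! k)" if k: "k < nb" and nz: "y (int k) i \<noteq> 0" for k i
  proof -
    have i: "i = (wnbr nb (\<not> r) ^^ k) yb" by (rule Y_supp[OF nz])
    then have l: "i < nb" using wnbr_pow_less[OF pq(2)] by simp
    have "evx i = word_vertex Q b i" using l by (simp add: evx_def)
    also have "\<dots> = lstart Q (whe b (\<not> r) i)" by (rule B.he_start[OF l, symmetric])
    also have "\<dots> = lend Q (u k)" unfolding i right_half_edge[OF o(2)] lstart_letter_inv ..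
    also have "u k = (rb @ rc) ! k" using k by (simp add: nth_append rotate_nth_inf)
    finally show ?thesis .
  qed
  have Xv: "evx i = lend Q (rc ! k)" if k: "k < nc" and nz: "?X k i \<noteq> 0" for k i
  proof -
    define h where "h = (wnbr nc True ^^ k) p"
    have i: "i = nb + h" unfolding h_def by (rule X_supp[OF nz])
    have l: "h < nc" unfolding h_def by (rule wnbr_pow_less[OF pq(1)])
    have "evx i = word_vertex Q c h" using i by (simp add: evx_def)
    also have "\<dots> = lstart Q (whe c True h)" by (rule C.he_start[OF l, symmetric])
    also have "\<dots> = lend Q (v k)" unfolding h_def right_half_edge_c[OF pq(1)] lstart_letter_inv ..
    also have "v k = rc ! k" using k by (simp add: rotate_nth_inf)
    finally show ?thesis .
  qed
  have UW: "(evx i = lend Q ((rc @ rb @ rc) ! k)) = (evx i = lend Q ((rb @ rc) ! k))" if "k \<le> length m" for k i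
    using U_v[OF that] W_u[OF that] lend_agree[OF that] that overlap_bound by simp
  have wv: "evx i = lend Q ((rb @ rc) ! k)" if "k < nb + nc" "S.w k i \<noteq> 0" for k i
  proof (rule S.wsupp[of "\<lambda>i l. evx i = lend Q l" k i])
    show "k < length rb + length rc" "S.w k i \<noteq> 0" using that by simp_all
  qed (use Yv Xv UW in simp_all)
  have span: "\<exists>v. unit i = (\<lambda>l. \<Sum>k<nb + nc. S.w k l * v k)" if i: "i < nb + nc" for i
  proof -
    let ?S = "{z. \<exists>v. z = (\<lambda>l. \<Sum>k<nb + nc. S.w k l * v k)}"
    have add: "(\<lambda>i. z i + z' i) \<in> ?S" if zz: "z \<in> ?S" "z' \<in> ?S" for z z'
    proof -
      obtain v v' where "z = (\<lambda>l. \<Sum>k<nb + nc. S.w k l * v k)" "z' = (\<lambda>l. \<Sum>k<nb + nc. S.w k l * v' k)"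
        using zz by blast
      then have "(\<lambda>i. z i + z' i) = (\<lambda>l. \<Sum>k<nb + nc. S.w k l * (v k + v' k))"
        by (simp add: distrib_left sum.distrib)
      then show ?thesis unfolding mem_Collect_eq by (rule exI[of _ "\<lambda>k. v k + v' k"])
    qed
    have scale: "(\<lambda>i. \<kappa> * z i) \<in> ?S" if zS: "z \<in> ?S" for \<kappa> z
    proof -
      obtain v where "z = (\<lambda>l. \<Sum>k<nb + nc. S.w k l * v k)" using zS by blast
      then have "(\<lambda>i. \<kappa> * z i) = (\<lambda>l. \<Sum>k<nb + nc. S.w k l * (\<kappa> * v k))"
        by (simp add: sum_distrib_left ac_simps)
      then show ?thesis unfolding mem_Collect_eq by (rule exI[of _ "\<lambda>k. \<kappa> * v k"])
    qed
    have w: "S.w k \<in> ?S" if "k < length rb + length rc" for k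
    proof -
      have "S.w k = (\<lambda>l. \<Sum>k'<nb + nc. S.w k' l * (if k' = k then 1 else 0))"
        using that by (intro ext) (simp add: if_distrib[of "\<lambda>z. _ * z"] sum.delta cong: if_cong)
      then show ?thesis unfolding mem_Collect_eq by (rule exI[of _ "\<lambda>k'. if k' = k then 1 else 0"])
    qed
    note sp = S.wspan[of ?S, OF w add scale]
    have "unit i \<in> ?S"
    proof (cases "i < nb")
      case True
      then have "i \<in> (\<lambda>k. (wnbr nb (\<not> r) ^^ k) yb) ` {..<nb}"
        unfolding bij_betw_imp_surj_on[OF wnbr_pow_bij[OF pq(2), of "\<not> r"]] by simp
      then obtain k where k: "k < nb" "(wnbr nb (\<not> r) ^^ k) yb = i" by auto
      obtain t where t: "t \<noteq> 0" "y (int k) = (\<lambda>l. t * unit i l)" using y(4)[of k] k(2) by auto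
      have "y (int k) \<in> ?S" by (rule sp(2)) (use k in simp_all)
      from scale[OF this, of "inverse t"] show ?thesis using t by (simp add: mult.assoc[symmetric])
    next
      case False
      then have "i - nb \<in> (\<lambda>k. (wnbr nc True ^^ k) p) ` {..<nc}"
        unfolding bij_betw_imp_surj_on[OF wnbr_pow_bij[OF pq(1), of True]] using i by simp
      then obtain k where k: "k < nc" "(wnbr nc True ^^ k) p = i - nb" by auto
      obtain t where t: "t \<noteq> 0" "x (int k) = (\<lambda>l. t * unit (i - nb) l)" using x(4)[of k] k(2) by auto
      have "?X k = (\<lambda>l. t * unit i l)" using False by (intro ext) (simp add: join_def t unit_def eq_diff_iff)
      moreover have "?X k \<in> ?S" by (rule sp(1)) (use k in simp_all)
      ultimately have "(\<lambda>l. t * unit i l) \<in> ?S" by simp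
      from scale[OF this, of "inverse t"] show ?thesis using t by (simp add: mult.assoc[symmetric])
    qed
    then show ?thesis unfolding mem_Collect_eq .
  qed
  have act: "ext_act GT a (S.w k) = (\<lambda>i.
      (if k = 0 then 0 else if (rb @ rc) ! (k - 1) = Dir a then S.w (k - 1) i else 0) +
      (if (rb @ rc) ! k = Inv a then if Suc k = nb + nc then - (\<gamma> * \<delta> * S.w 0 i) else S.w (Suc k) i else 0))"
    if "a \<in> arcs Q" "k < nb + nc" for a k
  proof -
    have len: "length rb + length rc = nb + nc" by simp
    show ?thesis by (rule S.wact[OF that(1), of k, unfolded len, OF that(2)])
  qed
  show ?thesis
  proof (intro exI[of _ S.w] conjI allI ballI impI)
    fix k i assume "k < nb + nc" "nb + nc \<le> i"
    then show "S.w k i = 0" using wb[of k i] by (meson not_le)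
  qed (fact wv act span)+
qed

lemma middle_term_iso:
  assumes j: "direct_at (rb @ rc) j"
  shows "lmod_iso L (band_module Q (rb @ rc) j (- (lam * inverse (opposite_scalar r \<mu>)))) (E GT)"
proof -
  let ?\<gamma> = "opposite_scalar r \<mu>" and ?W = "rb @ rc"
  let ?s = "- (lam * inverse ?\<gamma>)"
  have \<gamma>: "?\<gamma> \<noteq> 0" using \<mu>_nz by (simp add: opposite_scalar_def)
  have s: "?s \<noteq> 0" "inverse ?s = - (?\<gamma> * inverse lam)" using \<gamma> lam_nz by (simp_all add: field_simps)
  obtain w where w: "\<And>k i. k < nb + nc \<Longrightarrow> nb + nc \<le> i \<Longrightarrow> w k i = 0"
    "\<And>k i. k < nb + nc \<Longrightarrow> w k i \<noteq> 0 \<Longrightarrow> evx i = lend Q (?W ! k)"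
    "\<And>a k. a \<in> arcs Q \<Longrightarrow> k < nb + nc \<Longrightarrow> ext_act GT a (w k) = (\<lambda>i.
      (if k = 0 then 0 else if ?W ! (k - 1) = Dir a then w (k - 1) i else 0) +
      (if ?W ! k = Inv a then if Suc k = nb + nc then - (?\<gamma> * inverse lam * w 0 i) else w (Suc k) i else 0))"
    "\<And>i. i < nb + nc \<Longrightarrow> \<exists>v. unit i = (\<lambda>l. \<Sum>k<nb + nc. w k l * v k)"
    using middle_term_circuit by blast
  have last: "last ?W = Inv B" using c_ne last_appendR[of rc rb] last_conv_nth[of rc] last_rc by simp
  show ?thesis
  proof (rule circuit_iso[OF cyc_word_W s(1) j ext_rep[OF GT_cocycle], where f = w])
    show "length ?W = nb + nc" by simp
    fix a k assume ak: "a \<in> arcs Q" "k < nb + nc"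
    show "ext_act GT a (w k) = (\<lambda>i.
      (if k = 0 then if last ?W = Dir a then ?s * w (nb + nc - 1) i else 0
       else if ?W ! (k - 1) = Dir a then w (k - 1) i else 0) +
      (if ?W ! k = Inv a then if Suc k = nb + nc then inverse ?s * w 0 i else w (Suc k) i else 0))"
      unfolding last s(2) w(3)[OF ak] by (intro ext) simp
  qed (fact w)+
qed

end


section \<open>The middle term as a direct sum\<close>

lemma dsum_simps:
  "carrier (lmod_dsum J N) = (\<Pi>\<^sub>E i\<in>J. carrier (N i))" "\<zero>\<^bsub>lmod_dsum J N\<^esub> = (\<lambda>i\<in>J. \<zero>\<^bsub>N i\<^esub>)"
  "x \<oplus>\<^bsub>lmod_dsum J N\<^esub> y = (\<lambda>i\<in>J. x i \<oplus>\<^bsub>N i\<^esub> y i)" "a \<odot>\<^bsub>lmod_dsum J N\<^esub> x = (\<lambda>i\<in>J. a \<odot>\<^bsub>N i\<^esub> x i)"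
  by (simp_all add: lmod_dsum_def)

lemma left_module_dsum:
  assumes R: "ring R" and N: "\<And>i. i \<in> J \<Longrightarrow> left_module R (N i)"
  shows "left_module R (lmod_dsum J N)"
proof (rule left_module.intro[OF R])
  let ?S = "lmod_dsum J N"
  have ab: "abelian_group (N i)" if "i \<in> J" for i using N[OF that] by (rule left_module.axioms(2))
  have am: "abelian_monoid (N i)" if "i \<in> J" for i using ab[OF that] by (simp add: abelian_group_def)
  have mem: "z i \<in> carrier (N i)" if "z \<in> carrier ?S" "i \<in> J" for z i
    using that unfolding dsum_simps by (rule PiE_mem)
  have memI: "(\<lambda>i\<in>J. z i) \<in> carrier ?S" if "\<And>i. i \<in> J \<Longrightarrow> z i \<in> carrier (N i)" for z
    unfolding dsum_simps using that by (rule restrict_PiE_iff[THEN iffD2, OF ballI])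
  have eta: "(\<lambda>i\<in>J. z i) = z" if "z \<in> carrier ?S" for z
    using that unfolding dsum_simps by (intro extensional_restrict) (simp add: PiE_iff)
  show "abelian_group ?S"
  proof (rule abelian_groupI)
    show "\<zero>\<^bsub>?S\<^esub> \<in> carrier ?S" unfolding dsum_simps(2) by (rule memI) (rule abelian_monoid.zero_closed[OF am])
    fix x assume x: "x \<in> carrier ?S"
    note xm = mem[OF x]
    show "\<exists>y\<in>carrier ?S. y \<oplus>\<^bsub>?S\<^esub> x = \<zero>\<^bsub>?S\<^esub>"
    proof (rule bexI)
      show "(\<lambda>i\<in>J. \<ominus>\<^bsub>N i\<^esub> x i) \<oplus>\<^bsub>?S\<^esub> x = \<zero>\<^bsub>?S\<^esub>"
        unfolding dsum_simps by (rule restrict_ext) (simp add: abelian_group.l_neg[OF ab] xm)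
      show "(\<lambda>i\<in>J. \<ominus>\<^bsub>N i\<^esub> x i) \<in> carrier ?S"
        by (rule memI) (rule abelian_group.a_inv_closed[OF ab xm])
    qed
    have "\<zero>\<^bsub>?S\<^esub> \<oplus>\<^bsub>?S\<^esub> x = (\<lambda>i\<in>J. x i)"
      unfolding dsum_simps by (rule restrict_ext) (simp add: abelian_monoid.l_zero[OF am] xm)
    then show "\<zero>\<^bsub>?S\<^esub> \<oplus>\<^bsub>?S\<^esub> x = x" unfolding eta[OF x] .
    fix y assume y: "y \<in> carrier ?S"
    note ym = mem[OF y]
    show "x \<oplus>\<^bsub>?S\<^esub> y \<in> carrier ?S"
      unfolding dsum_simps(3) by (rule memI) (rule abelian_monoid.a_closed[OF am xm ym])
    show "x \<oplus>\<^bsub>?S\<^esub> y = y \<oplus>\<^bsub>?S\<^esub> x"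
      unfolding dsum_simps(3) by (rule restrict_ext) (rule abelian_monoid.a_comm[OF am xm ym])
    fix z assume z: "z \<in> carrier ?S"
    show "(x \<oplus>\<^bsub>?S\<^esub> y) \<oplus>\<^bsub>?S\<^esub> z = x \<oplus>\<^bsub>?S\<^esub> (y \<oplus>\<^bsub>?S\<^esub> z)"
      unfolding dsum_simps(3)
      by (rule restrict_ext) (simp add: abelian_monoid.a_assoc[OF am] xm ym mem[OF z])
  qed
  show "left_module_axioms R ?S"
  proof
    fix a x assume a: "a \<in> carrier R" and x: "x \<in> carrier ?S"
    note xm = mem[OF x]
    show "a \<odot>\<^bsub>?S\<^esub> x \<in> carrier ?S"
      unfolding dsum_simps(4) by (rule memI) (rule left_module.smult_closed[OF N a xm])
    show "a \<odot>\<^bsub>?S\<^esub> (x \<oplus>\<^bsub>?S\<^esub> y) = a \<odot>\<^bsub>?S\<^esub> x \<oplus>\<^bsub>?S\<^esub> a \<odot>\<^bsub>?S\<^esub> y" if "y \<in> carrier ?S" for y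
      unfolding dsum_simps(3,4)
      by (rule restrict_ext) (simp add: left_module.smult_r_distr[OF N] a xm mem[OF that])
    fix a' assume a': "a' \<in> carrier R"
    show "(a \<oplus>\<^bsub>R\<^esub> a') \<odot>\<^bsub>?S\<^esub> x = a \<odot>\<^bsub>?S\<^esub> x \<oplus>\<^bsub>?S\<^esub> a' \<odot>\<^bsub>?S\<^esub> x"
      unfolding dsum_simps(3,4)
      by (rule restrict_ext) (simp add: left_module.smult_l_distr[OF N] a a' xm)
    show "(a \<otimes>\<^bsub>R\<^esub> a') \<odot>\<^bsub>?S\<^esub> x = a \<odot>\<^bsub>?S\<^esub> (a' \<odot>\<^bsub>?S\<^esub> x)"
      unfolding dsum_simps(4)
      by (rule restrict_ext) (simp add: left_module.smult_assoc1[OF N] a a' xm)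
  next
    fix x assume x: "x \<in> carrier ?S"
    have "\<one>\<^bsub>R\<^esub> \<odot>\<^bsub>?S\<^esub> x = (\<lambda>i\<in>J. x i)"
      unfolding dsum_simps(4) by (rule restrict_ext) (rule left_module.smult_one[OF N mem[OF x]])
    then show "\<one>\<^bsub>R\<^esub> \<odot>\<^bsub>?S\<^esub> x = x" unfolding eta[OF x] .
  qed
qed

lemma dsum_hom:
  assumes "\<And>i. i \<in> J \<Longrightarrow> g i \<in> lmod_hom R M (N i)"
  shows "(\<lambda>x. \<lambda>i\<in>J. g i x) \<in> lmod_hom R M (lmod_dsum J N)"
  using assms by (auto simp: lmod_hom_def dsum_simps Pi_iff PiE_iff intro!: restrict_ext)

text \<open>
  Newton interpolation: one node is added at a time.
\<close>

lemma interpolation_exists: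
  fixes a :: "'i \<Rightarrow> 'k::field"
  assumes "finite J" and "inj_on a J"
  shows "\<exists>p. (\<forall>l\<ge>card J. poly.coeff p l = 0) \<and> (\<forall>i\<in>J. poly p (a i) = z i)"
  using assms
proof (induction J rule: finite_induct)
  case empty
  then show ?case by (intro exI[of _ 0]) simp
next
  case (insert j J)
  then obtain p where p: "\<And>l. card J \<le> l \<Longrightarrow> poly.coeff p l = 0" "\<And>i. i \<in> J \<Longrightarrow> poly p (a i) = z i" by auto
  let ?q = "\<Prod>i\<in>J. [:- a i, 1:]"
  have deg: "degree ?q = card J"
    by (subst degree_prod_eq_sum_degree) auto
  have q0: "poly ?q (a i) = 0" if "i \<in> J" for i
    using that insert.hyps(1) by (auto simp: poly_prod)
  have qj: "poly ?q (a j) \<noteq> 0"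
    using insert.hyps insert.prems by (auto simp: poly_prod)
  let ?c = "(z j - poly p (a j)) / poly ?q (a j)"
  have "poly.coeff (p + Polynomial.smult ?c ?q) l = 0" if "card (insert j J) \<le> l" for l
    using that p(1)[of l] coeff_eq_0[of ?q l] deg insert.hyps by simp
  moreover have "poly (p + Polynomial.smult ?c ?q) (a i) = z i" if "i \<in> insert j J" for i
    using that qj q0 p(2) by auto
  ultimately show ?case by blast
qed

text \<open>
  Interpolation solves a square Vandermonde system with distinct nodes; counting roots shows that the solution is
  unique.
\<close>

lemma vandermonde_exists:
  fixes a :: "'i \<Rightarrow> 'k::field"
  assumes "finite J" and "inj_on a J" and "card J = t"
  shows "\<exists>u. \<forall>i\<in>J. (\<Sum>l<t. u l * a i ^ l) = z i"
proof -
  obtain p where p: "\<And>l. card J \<le> l \<Longrightarrow> poly.coeff p l = 0" "\<And>i. i \<in> J \<Longrightarrow> poly p (a i) = z i"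
    using interpolation_exists[OF assms(1,2)] by meson
  have "poly p x = (\<Sum>l<t. poly.coeff p l * x ^ l)" for x
  proof -
    have "poly p x = (\<Sum>l\<le>degree p + t. poly.coeff p l * x ^ l)"
      unfolding poly_altdef by (rule sum.mono_neutral_left) (auto simp: coeff_eq_0)
    also have "\<dots> = (\<Sum>l<t. poly.coeff p l * x ^ l)"
      by (rule sum.mono_neutral_right) (auto simp: p(1) assms(3))
    finally show ?thesis .
  qed
  then show ?thesis using p(2) by (intro exI[of _ "poly.coeff p"]) simp
qed

lemma vandermonde_unique:
  fixes a :: "'i \<Rightarrow> 'k::field"
  assumes J: "finite J" "inj_on a J" "card J = t"
    and eq: "\<And>i. i \<in> J \<Longrightarrow> (\<Sum>l<t. u l * a i ^ l) = (\<Sum>l<t. v l * a i ^ l)" and l: "l < t"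
  shows "u l = v l"
proof -
  let ?p = "\<Sum>l<t. Polynomial.monom (u l - v l) l"
  have c: "poly.coeff ?p k = (if k < t then u k - v k else 0)" for k
    by (simp add: coeff_sum sum.delta' if_distrib cong: if_cong)
  have root: "poly ?p (a i) = 0" if "i \<in> J" for i
    using eq[OF that] by (simp add: poly_sum poly_monom left_diff_distrib sum_subtractf)
  have "?p = 0"
  proof (rule ccontr)
    assume nz: "?p \<noteq> 0"
    have "degree ?p < t"
    proof (rule ccontr)
      assume "\<not> degree ?p < t"
      then have "poly.coeff ?p (degree ?p) = 0" using c by simp
      then show False using nz by simp
    qed
    moreover have "t \<le> card {x. poly ?p x = 0}"
      using card_mono[OF poly_roots_finite[OF nz], of "a ` J"] root J card_image[OF J(2)] by (auto simp: image_subset_iff)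
    moreover have "card {x. poly ?p x = 0} \<le> degree ?p" by (rule card_poly_roots_bound[OF nz])
    ultimately show False by simp
  qed
  then show ?thesis using c[of l] l by simp
qed

lemma primitive_root_multiples_inj:
  fixes \<omega> \<rho> :: "'k::field"
  assumes w: "primitive_unity_root t \<omega>" and t: "t \<ge> 1" and \<rho>: "\<rho> \<noteq> 0"
  shows "inj_on (\<lambda>i. inverse (\<omega> ^ i * \<rho>)) {1..t}"
proof -
  have nz: "\<omega> \<noteq> 0" using w t by (auto simp: primitive_unity_root_def power_0_left)
  have "i = j" if *: "i \<in> {1..t}" "j \<in> {1..t}" "i \<le> j" "\<omega> ^ i = \<omega> ^ j" for i j
  proof (rule ccontr)
    assume "i \<noteq> j"
    then have "0 < j - i" "j - i < t" using * by auto
    moreover have "\<omega> ^ i * \<omega> ^ (j - i) = \<omega> ^ i * 1" using *(3) *(4) power_add[of \<omega> i "j - i"] by simp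
    then have "\<omega> ^ (j - i) = 1" using nz by simp
    ultimately show False using w by (auto simp: primitive_unity_root_def)
  qed
  then show ?thesis using \<rho> by (intro inj_onI) (metis inverse_inverse_eq mult_right_cancel nle_le)
qed

lemma sum_lessThan_mult:
  "(\<Sum>k<t * n. h k) = (\<Sum>l<t. \<Sum>x<n. h (x + l * n))" for h :: "nat \<Rightarrow> 'b::comm_monoid_add"
proof -
  have "(\<Sum>k<t * n. h k) = (\<Sum>l<t. sum h {l * n..<l * n + n})" by (rule sum.nat_group[symmetric])
  moreover have "sum h {l * n..<l * n + n} = (\<Sum>x<n. h (x + l * n))" for l
    using sum.shift_bounds_nat_ivl[of h 0 "l * n" n] by (simp add: lessThan_atLeast0 add.commute)
  ultimately show ?thesis by simp
qed

context gentle_quiver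
begin

lemma direct_at_word_pow: "t \<ge> 1 \<Longrightarrow> direct_at d j \<Longrightarrow> direct_at (word_pow d t) j"
proof -
  assume t: "t \<ge> 1" and j: "direct_at d j"
  have l: "j < length d" using j by (simp add: direct_at_def)
  also have "1 * length d \<le> t * length d" using t by (rule mult_le_mono1)
  finally have "j < t * length d" by simp
  then show ?thesis using j l word_pow_nth[of j t d] by (simp add: direct_at_def length_word_pow)
qed

lemma left_module_band_module:
  assumes "cyc_word w" and "s \<noteq> 0" and "direct_at w j"
  shows "left_module L (band_module Q w j s)"
proof -
  interpret cyc_rep Q I "length w" "word_vertex Q w" "whe w" "wnbr (length w)" "wew (length w) j s" "word_act w j s"
    by (rule cyc_rep_word[OF assms])
  show ?thesis using left_module_M by (simp add: band_module_def)
qed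

text \<open>
  The module of \<open>d\<^sup>t\<close> is a cyclic cover of the modules of \<open>d\<close>. For every \<open>t\<close>-th root \<open>\<sigma>\<close> of the scalar it projects
  onto the band module of \<open>d\<close> with scalar \<open>\<sigma>\<close>, by sending the copies of a basis vector in the consecutive
  periods to multiples with factors \<open>1, \<sigma>\<^sup>-\<^sup>1, \<sigma>\<^sup>-\<^sup>2, \<dots>\<close>. Taken together, the projections for all \<open>t\<close> roots are
  invertible because on each basis vector of \<open>d\<close> they form a Vandermonde matrix with distinct nodes.
\<close>

lemma cyclic_cover_iso:
  fixes \<omega> \<rho> :: 'k
  assumes d: "cyc_word d" and t: "t \<ge> 1" and w: "primitive_unity_root t \<omega>" and \<rho>: "\<rho> ^ t = s" "s \<noteq> 0"
    and j: "direct_at d j"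
  shows "lmod_iso L (band_module Q (word_pow d t) j s)
    (lmod_dsum {1..t} (\<lambda>i. band_module Q d j (\<omega> ^ i * \<rho>)))"
proof -
  let ?W = "word_pow d t" and ?J = "{1..t}"
  define n where "n = length d"
  have ne: "d \<noteq> []" using d by (simp add: cyc_word_def)
  then have n: "0 < n" by (simp add: n_def)
  have Wne: "?W \<noteq> []" and lW: "length ?W = t * n" using ne t by (simp_all add: length_word_pow n_def) (auto simp: word_pow_def)
  have cW: "cyc_word ?W"
    by (rule cyc_word_cong[OF Wne _ d, of 0]) (simp add: inf_word_pow[OF t ne])
  have nth: "?W ! k = d ! (k mod n)" if "k < t * n" for k using word_pow_nth that by (simp add: n_def)
  have jW: "direct_at ?W j" by (rule direct_at_word_pow[OF t j])
  have \<rho>0: "\<rho> \<noteq> 0" using \<rho> t by (auto simp: power_0_left)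
  have \<omega>0: "\<omega> \<noteq> 0" using w t by (auto simp: primitive_unity_root_def power_0_left)
  define \<sigma> where "\<sigma> i = \<omega> ^ i * \<rho>" for i :: nat
  have \<sigma>0: "\<sigma> i \<noteq> 0" for i using \<rho>0 \<omega>0 by (simp add: \<sigma>_def)
  have \<sigma>t: "\<sigma> i ^ t = s" for i
  proof -
    have "(\<omega> ^ i) ^ t = (\<omega> ^ t) ^ i" by (simp only: power_mult[symmetric] mult.commute)
    then have "(\<omega> ^ i) ^ t = 1" using w by (simp add: primitive_unity_root_def)
    then show ?thesis using \<rho>(1) by (simp add: \<sigma>_def power_mult_distrib)
  qed
  define f where "f i k = word_strip d j (\<sigma> i) (int k)" for i k
  have per: "f i (k + l * n) x = inverse (\<sigma> i) ^ l * f i k x" for i k l x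
  proof (induction l)
    case (Suc l)
    have "int (k + Suc l * n) = int (k + l * n) + int (length d)" by (simp add: n_def algebra_simps)
    then have "f i (k + Suc l * n) x = inverse (\<sigma> i) * f i (k + l * n) x"
      unfolding f_def by (simp only: word_strip_period[OF ne \<sigma>0])
    then show ?case using Suc.IH by simp
  qed simp
  have unit_f: "\<exists>g. g \<noteq> 0 \<and> f i k = (\<lambda>x. g * unit (k mod n) x)" for i k
    using word_strip_unit[OF ne \<sigma>0, of j i "int k"]
    by (simp add: f_def n_def nat_mod_distrib flip: of_nat_mod)
  have diag: "f i k x = (if x = k then f i k k else 0)" if "k < n" for i k x
    using unit_f[of i k] that by (auto simp: unit_def)
  have diag0: "f i k k \<noteq> 0" if "k < n" for i k
    using unit_f[of i k] that by (auto simp: unit_def)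
  define c where "c k = (if k \<le> j then 1 else s)" for k
  have c0: "c k \<noteq> 0" for k using \<rho>(2) by (simp add: c_def)
  define F where "F i v = (\<lambda>x. \<Sum>k<t * n. f i k x * (c k * v k))" for i v
  (* sorting the positions by their residue turns each coordinate into a polynomial in the inverse of the root *)
  have F: "F i v x = (if x < n then f i x x * (\<Sum>l<t. (c (x + l * n) * v (x + l * n)) * inverse (\<sigma> i) ^ l) else 0)" for i v x
  proof -
    have "F i v x = (\<Sum>l<t. \<Sum>k<n. (if x = k then f i k k * ((c (k + l * n) * v (k + l * n)) * inverse (\<sigma> i) ^ l) else 0))"
      unfolding F_def sum_lessThan_mult per by (intro sum.cong refl) (subst diag; auto)
    also have "\<dots> = (\<Sum>l<t. if x < n then f i x x * ((c (x + l * n) * v (x + l * n)) * inverse (\<sigma> i) ^ l) else 0)"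
      by (simp add: sum.delta)
    finally show ?thesis by (simp add: sum_distrib_left)
  qed
  have hom: "F i \<in> lmod_hom L (band_module Q ?W j s) (band_module Q d j (\<sigma> i))" for i
  proof -
    interpret d: cyc_rep Q I "length d" "word_vertex Q d" "whe d" "wnbr (length d)" "wew (length d) j (\<sigma> i)" "word_act d j (\<sigma> i)"
      by (rule cyc_rep_word[OF d \<sigma>0 j])
    have "(\<lambda>v x. \<Sum>k<length ?W. f i k x * ((if k \<le> j then 1 else s) * v k)) \<in>
      lmod_hom L (band_module Q ?W j s) (rep_module (length d) (word_vertex Q d) (word_act d j (\<sigma> i)))"
    proof (rule hom_of_circuit[OF cW \<rho>(2) jW d.quiver_rep_axioms])
      fix k assume k: "k < length ?W"
      obtain g where g: "f i k = (\<lambda>x. g * unit (k mod n) x)" using unit_f by blast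
      show "f i k \<in> carrier (rep_module (length d) (word_vertex Q d) (word_act d j (\<sigma> i)))"
        unfolding d.carrier_M g using mod_less_divisor[OF n, of k] by (auto simp: unit_def n_def)
      show "word_vertex Q d x = word_vertex Q ?W k" if "f i k x \<noteq> 0" for x
        using that k nth[of k] unfolding g lW by (auto simp: unit_def word_vertex_def split: if_splits)
      fix a assume a: "a \<in> arcs Q"
      have iW: "inf_word d (int l) = ?W ! l" if "l < t * n" for l
        using nth[OF that] by (simp add: inf_word_def n_def nat_mod_distrib flip: of_nat_mod)
      have tn: "0 < t * n" using t n by simp
      have shift: "word_strip d j (\<sigma> i) (x + int (t * n)) y = inverse s * word_strip d j (\<sigma> i) x y" for x y
      proof -
        have "word_strip d j (\<sigma> i) (x + int (l * n)) y = inverse (\<sigma> i) ^ l * word_strip d j (\<sigma> i) x y" for l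
        proof (induction l)
          case (Suc l)
          have "x + int (Suc l * n) = (x + int (l * n)) + int (length d)" by (simp add: n_def algebra_simps)
          then show ?case using Suc.IH by (simp only: word_strip_period[OF ne \<sigma>0]) simp
        qed simp
        then show ?thesis using \<sigma>t[of i] by (simp add: power_inverse)
      qed
      have l: "(if inf_word d (int k - 1) = Dir a then word_strip d j (\<sigma> i) (int k - 1) x else 0) =
          (if k = 0 then if last ?W = Dir a then s * f i (length ?W - 1) x else 0
           else if ?W ! (k - 1) = Dir a then f i (k - 1) x else 0)" for x
      proof (cases k)
        case 0
        have e: "int (t * n - 1) = - 1 + int (t * n)" by (rule int_pred[OF tn])
        have "inf_word d (- 1) = inf_word d (int (t * n - 1))"
          using inf_word_add[of ?W "- 1"] unfolding e inf_word_pow[OF t ne, symmetric] lW by simp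
        also have "\<dots> = last ?W" using iW[of "t * n - 1"] tn last_conv_nth[OF Wne] lW by simp
        finally have 1: "inf_word d (- 1) = last ?W" .
        have "f i (t * n - 1) x = inverse s * word_strip d j (\<sigma> i) (- 1) x" unfolding f_def e shift ..
        then have "s * f i (t * n - 1) x = word_strip d j (\<sigma> i) (- 1) x" using \<rho>(2) by simp
        then show ?thesis using 0 1 lW by simp
      next
        case (Suc h) then show ?thesis using iW[of h] k lW by (simp add: f_def)
      qed
      have r: "(if inf_word d (int k) = Inv a then word_strip d j (\<sigma> i) (int k + 1) x else 0) =
          (if ?W ! k = Inv a then if Suc k = length ?W then inverse s * f i 0 x else f i (Suc k) x else 0)" for x
      proof (cases "Suc k = t * n")
        case True
        have "int k + 1 = 0 + int (t * n)" unfolding True[symmetric] by simp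
        then have "word_strip d j (\<sigma> i) (int k + 1) x = inverse s * f i 0 x"
          unfolding f_def by (simp only: shift of_nat_0)
        then show ?thesis using True iW[of k] k lW by simp
      next
        case False then show ?thesis using iW[of k] k lW by (simp add: f_def add.commute)
      qed
      have "word_act d j (\<sigma> i) a (f i k) = (\<lambda>x. (if inf_word d (int k - 1) = Dir a then word_strip d j (\<sigma> i) (int k - 1) x else 0) +
        (if inf_word d (int k) = Inv a then word_strip d j (\<sigma> i) (int k + 1) x else 0))"
        using strip_word[OF d \<sigma>0 j, of i] a unfolding strip_def f_def by blast
      then show "word_act d j (\<sigma> i) a (f i k) = (\<lambda>x.
        (if k = 0 then if last ?W = Dir a then s * f i (length ?W - 1) x else 0
         else if ?W ! (k - 1) = Dir a then f i (k - 1) x else 0) +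
        (if ?W ! k = Inv a then if Suc k = length ?W then inverse s * f i 0 x else f i (Suc k) x else 0))"
        unfolding l r .
    qed
    then show ?thesis unfolding F_def c_def lW band_module_def .
  qed
  let ?\<Phi> = "\<lambda>v. \<lambda>i\<in>?J. F i v"
  have "?\<Phi> \<in> lmod_hom L (band_module Q ?W j s) (lmod_dsum ?J (\<lambda>i. band_module Q d j (\<sigma> i)))"
    by (rule dsum_hom) (rule hom)
  moreover have "bij_betw ?\<Phi> (carrier (band_module Q ?W j s)) (carrier (lmod_dsum ?J (\<lambda>i. band_module Q d j (\<sigma> i))))"
  proof -
    have C: "carrier (band_module Q ?W j s) = {v. \<forall>x\<ge>t * n. v x = (0::'k)}"
      "carrier (lmod_dsum ?J (\<lambda>i. band_module Q d j (\<sigma> i))) = (\<Pi>\<^sub>E i\<in>?J. {v. \<forall>x\<ge>n. v x = (0::'k)})"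
      by (simp_all add: band_module_def rep_module_def dsum_simps lW n_def)
    have cJ: "card ?J = t" by simp
    note J = finite_atLeastAtMost[of 1 t] primitive_root_multiples_inj[OF w t \<rho>0, folded \<sigma>_def] cJ
    have split: "\<exists>x l. k = x + l * n \<and> x < n \<and> l < t" if "k < t * n" for k
      using that n by (intro exI[of _ "k mod n"] exI[of _ "k div n"]) (simp add: div_less_iff_less_mult)
    show ?thesis unfolding C
    proof (rule bij_betwI')
      fix u v assume u: "u \<in> {v. \<forall>x\<ge>t * n. v x = (0::'k)}" and v: "v \<in> {v. \<forall>x\<ge>t * n. v x = (0::'k)}"
      show "(?\<Phi> u = ?\<Phi> v) = (u = v)"
      proof
        assume e: "?\<Phi> u = ?\<Phi> v"
        show "u = v"
        proof
          fix k
          show "u k = v k"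
          proof (cases "k < t * n")
            case True
            then obtain x l where xl: "k = x + l * n" "x < n" "l < t" using split by blast
            have "(\<Sum>l<t. (c (x + l * n) * u (x + l * n)) * inverse (\<sigma> i) ^ l) =
                (\<Sum>l<t. (c (x + l * n) * v (x + l * n)) * inverse (\<sigma> i) ^ l)" if "i \<in> ?J" for i
            proof -
              have "F i u x = F i v x" using fun_cong[OF e, of i] that by simp
              then show ?thesis using diag0[OF xl(2), of i] xl(2) by (simp add: F)
            qed
            from vandermonde_unique[OF J, where u = "\<lambda>l. c (x + l * n) * u (x + l * n)" and v = "\<lambda>l. c (x + l * n) * v (x + l * n)", OF this xl(3)]
            have "c (x + l * n) * u (x + l * n) = c (x + l * n) * v (x + l * n)" .
            then show ?thesis using c0 xl(1) by simp
          next
            case False then show ?thesis using u v by simp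
          qed
        qed
      qed simp
    next
      fix v assume "v \<in> {v. \<forall>x\<ge>t * n. v x = (0::'k)}"
      show "?\<Phi> v \<in> (\<Pi>\<^sub>E i\<in>?J. {v. \<forall>x\<ge>n. v x = (0::'k)})" by (auto simp: F)
    next
      fix z assume z: "z \<in> (\<Pi>\<^sub>E i\<in>?J. {v. \<forall>x\<ge>n. v x = (0::'k)})"
      have "\<exists>U. \<forall>i\<in>?J. (\<Sum>l<t. U l * inverse (\<sigma> i) ^ l) = z i x / f i x x" for x
        by (rule vandermonde_exists[OF J])
      then obtain U where U: "\<And>x i. i \<in> ?J \<Longrightarrow> (\<Sum>l<t. U x l * inverse (\<sigma> i) ^ l) = z i x / f i x x" by metis
      define v where "v k = (if k < t * n then inverse (c k) * U (k mod n) (k div n) else 0)" for k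
      have vU: "c (x + l * n) * v (x + l * n) = U x l" if "x < n" "l < t" for x l
      proof -
        have "x + l * n < Suc l * n" using that by simp
        also have "\<dots> \<le> t * n" using that by (intro mult_le_mono1) simp
        finally show ?thesis using that c0[of "x + l * n"] by (simp add: v_def)
      qed
      have "?\<Phi> v = z"
      proof
        fix i show "?\<Phi> v i = z i"
        proof (cases "i \<in> ?J")
          case True
          have "F i v x = z i x" for x
          proof (cases "x < n")
            case x: True
            have "F i v x = f i x x * (\<Sum>l<t. U x l * inverse (\<sigma> i) ^ l)" using x by (simp add: F vU)
            then show ?thesis using U[OF True, of x] diag0[OF x, of i] by simp
          next
            case False then show ?thesis using PiE_mem[OF z True] by (simp add: F)
          qed
          then show ?thesis using True by auto
        next
          case False then show ?thesis using PiE_arb[OF z False] by (simp only: restrict_apply False if_False)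
        qed
      qed
      moreover have "v \<in> {v. \<forall>x\<ge>t * n. v x = (0::'k)}" by (simp add: v_def)
      ultimately show "\<exists>v\<in>{v. \<forall>x\<ge>t * n. v x = (0::'k)}. z = ?\<Phi> v" by metis
    qed
  qed
  ultimately show ?thesis unfolding lmod_iso_def \<sigma>_def by blast
qed

end

text \<open>
  Division with remainder of the length of \<open>m\<close> by the period.
\<close>

lemma prefix_of_power:
  assumes "x \<noteq> []" and "\<And>k. k < length m \<Longrightarrow> m ! k = x ! (k mod length x)"
  shows "(\<exists>v. v \<noteq> [] \<and> x = m @ v) \<or> (\<exists>x1 x2 k. k \<ge> 1 \<and> x = x2 @ x1 \<and> m = word_pow x k @ x2)"
proof (cases "length m < length x")
  case True
  have "m = take (length m) x" using True assms(2) by (intro nth_equalityI) auto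
  then have "x = m @ drop (length m) x" by (metis append_take_drop_id)
  moreover have "drop (length m) x \<noteq> []" using True by simp
  ultimately show ?thesis by blast
next
  case False
  let ?n = "length x" and ?k = "length m div length x"
  let ?h = "length m mod length x"
  have n: "0 < ?n" using assms(1) by simp
  have km: "?k * ?n + ?h = length m" by simp
  have h: "?h < ?n" using n by simp
  have "m = word_pow x ?k @ take ?h x"
  proof (rule nth_equalityI)
    show l: "length m = length (word_pow x ?k @ take ?h x)" using km h by (simp add: length_word_pow)
    fix k assume k: "k < length m"
    show "m ! k = (word_pow x ?k @ take ?h x) ! k"
    proof (cases "k < ?k * ?n")
      case True
      then show ?thesis using assms(2)[OF k] by (simp add: nth_append length_word_pow word_pow_nth)
    next
      case False
      define l where "l = k - ?k * ?n"
      have kl: "k = l + ?k * ?n" "l < ?h" using False k km unfolding l_def by linarith+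
      have "k mod ?n = l" unfolding kl(1) using kl(2) h by simp
      then have "m ! k = x ! l" using assms(2)[OF k] by simp
      then show ?thesis using False kl(2) by (simp add: nth_append length_word_pow l_def)
    qed
  qed
  moreover have "?k \<ge> 1" using False n by (simp add: Suc_le_eq div_greater_zero_iff)
  ultimately show ?thesis by (metis append_take_drop_id)
qed


text \<open>
  The glued module is the module of \<open>b'c' = d\<^sup>t\<close>, and the latter is a direct sum of band modules; the maps of the extension
  are carried along this isomorphism.
\<close>

lemma (in overlap_pair) middle_term_direct_sum:
  assumes d: "cyc_word d" and t: "t \<ge> 1" and W: "word_pow d t = rb @ rc"
    and w: "primitive_unity_root t \<omega>" and \<rho>: "\<rho> ^ t = - (lam * inverse (opposite_scalar r \<mu>))"
    and j: "direct_at d j"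
  shows "\<exists>f g. let F = (lmod_dsum {1..t} (\<lambda>i. band_module Q d j (\<omega> ^ i * \<rho>)), f, g) in
    F \<in> extensions L Mc Mb \<and> \<not> ext_split L Mc F \<and> ext_equiv L Mb (X GT) F"
proof -
  let ?s = "- (lam * inverse (opposite_scalar r \<mu>))"
  let ?D = "lmod_dsum {1..t} (\<lambda>i. band_module Q d j (\<omega> ^ i * \<rho>))"
  have s: "?s \<noteq> 0" using \<mu>_nz lam_nz by (simp add: opposite_scalar_def)
  have jW: "direct_at (rb @ rc) j" using direct_at_word_pow[OF t j] W by simp
  have "lmod_iso L (E GT) (band_module Q (rb @ rc) j ?s)"
    by (rule lmod_iso_sym[OF left_module_band_module[OF cyc_word_W s jW] middle_term_iso[OF jW]])
  moreover have "lmod_iso L (band_module Q (rb @ rc) j ?s) ?D"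
    using cyclic_cover_iso[OF d t w \<rho> s j] unfolding W .
  ultimately have "lmod_iso L (E GT) ?D" by (rule lmod_iso_trans)
  then obtain g where g: "g \<in> lmod_hom L (E GT) ?D" "bij_betw g (carrier (E GT)) (carrier ?D)"
    unfolding lmod_iso_def by blast
  have nz: "\<omega> ^ i * \<rho> \<noteq> 0" for i
    using w \<rho> s t by (auto simp: primitive_unity_root_def power_0_left)
  have D: "left_module L ?D"
    by (rule left_module_dsum[OF ring_L left_module_band_module[OF d nz j]])
  have x: "(r, p, q, m) \<in> overlap_data Q I c b" using ov unfolding overlap_data_def by blast
  have e: "overlap_ext Q c jc lam b jb \<mu> (r, p, q, m) = X GT" using overlap_ext_eq_X[OF x] by (simp add: ovnode_def)
  note ns = overlap_extension_nonsplit[OF x, unfolded e X_def]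
  show ?thesis
    unfolding X_def Let_def
    by (intro exI conjI)
      (rule extension_along_iso(1)[OF ns(1) D g], rule extension_along_iso(3)[OF ns(1) D g ns(2)],
        rule extension_along_iso(2)[OF ns(1) D g])
qed

text \<open>
  A subword of a periodic word is either shorter than the period or it covers at least one full period.
\<close>

lemma overlap_word_shape:
  assumes "x \<noteq> []" and "\<And>k. k < length m \<Longrightarrow> inf_word x (int i + int k) = m ! k"
  shows "(\<exists>v. v \<noteq> [] \<and> rotate i x = m @ v) \<or>
    (\<exists>x1 x2 k. k \<ge> 1 \<and> rotate i x = x2 @ x1 \<and> m = word_pow (rotate i x) k @ x2)"
proof (rule prefix_of_power)
  show "rotate i x \<noteq> []" using assms(1) by simp
  fix k assume k: "k < length m"
  have "k mod length x < length x" using assms(1) by simp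
  then have "rotate i x ! (k mod length x) = inf_word x (int i + int (k mod length x))" by (rule rotate_nth_inf)
  also have "\<dots> = inf_word x (int i + int k)" unfolding inf_word_def by (simp add: of_nat_mod mod_add_right_eq)
  finally show "m ! k = rotate i x ! (k mod length (rotate i x))" using assms(2)[OF k] by simp
qed

theorem theorem4:
  fixes Q :: "('v, 'a) pre_digraph"
    and I :: "(('v, 'a) path \<Rightarrow> 'k::alg_closed_field) set"
    and b c m :: "'a letter list"
    and \<mu> lam :: 'k
    and jb jc p q :: nat
    and r :: bool
    and A B C D :: 'a
  defines "\<Lambda> \<equiv> bound_algebra Q I"
    and "Mb \<equiv> band_module Q b jb \<mu>"
    and "Mc \<equiv> band_module Q c jc lam"
    and "b' \<equiv> rotate q (orient r b)"
    and "c' \<equiv> rotate p c"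
    and "\<xi> \<equiv> overlap_ext Q c jc lam b jb \<mu>"
  assumes "gentle Q I"
    and "band Q I b" and "band Q I c"
    and "\<mu> \<noteq> 0" and "lam \<noteq> 0"
    and "direct_at b jb" and "direct_at c jc"
    and "\<not> band_data_eq b \<mu> c lam"
    and "overlap Q I c (orient r b) p q m A B C D"
  shows
    "((\<exists>v. v \<noteq> [] \<and> b' = m @ v) \<or>
      (\<exists>b1 b2 k. k \<ge> 1 \<and> b' = b2 @ b1 \<and> m = word_pow b' k @ b2)) \<and>
     ((\<exists>w. w \<noteq> [] \<and> c' = m @ w) \<or>
      (\<exists>c1 c2 l. l \<ge> 1 \<and> c' = c2 @ c1 \<and> m = word_pow c' l @ c2)) \<and>
     (\<exists>d t. band Q I d \<and> t \<ge> 1 \<and>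
       (\<forall>v w. b' = m @ v \<and> c' = m @ w \<longrightarrow> word_pow d t = m @ v @ m @ w) \<and>
       (\<forall>v c1 c2 l. b' = m @ v \<and> l \<ge> 1 \<and> c' = c2 @ c1 \<and> m = word_pow c' l @ c2 \<longrightarrow>
          word_pow d t = m @ v @ c2 @ c1) \<and>
       (\<forall>b1 b2 k w. k \<ge> 1 \<and> b' = b2 @ b1 \<and> m = word_pow b' k @ b2 \<and> c' = m @ w \<longrightarrow>
          word_pow d t = b2 @ b1 @ m @ w) \<and>
       (\<forall>b1 b2 k c1 c2 l. k \<ge> 1 \<and> b' = b2 @ b1 \<and> m = word_pow b' k @ b2 \<and>
          l \<ge> 1 \<and> c' = c2 @ c1 \<and> m = word_pow c' l @ c2 \<longrightarrow>
          word_pow d t = b2 @ b1 @ c2 @ c1) \<and>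
       (\<exists>\<epsilon>\<in>{1, -1}.
          (\<forall>j. direct_at (word_pow d t) j \<longrightarrow>
             lmod_iso \<Lambda> (fst (\<xi> (r, p, q, m)))
               (band_module Q (word_pow d t) j (\<epsilon> * lam * inverse (opposite_scalar r \<mu>)))) \<and>
          (\<forall>\<omega> \<rho> j. primitive_unity_root t \<omega> \<and>
             \<rho> ^ t = \<epsilon> * lam * inverse (opposite_scalar r \<mu>) \<and> direct_at d j \<longrightarrow>
             (\<exists>f g. let E = (lmod_dsum {1..t} (\<lambda>i. band_module Q d j (\<omega> ^ i * \<rho>)), f, g) in
                E \<in> extensions \<Lambda> Mc Mb \<and> \<not> ext_split \<Lambda> Mc E \<and>
                ext_equiv \<Lambda> Mb (\<xi> (r, p, q, m)) E)))) \<and>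
     is_basis (Ext1 \<Lambda> (scalar_elem Q I) Mc Mb) (overlap_data Q I c b)
       (\<lambda>x. ext_class \<Lambda> Mc Mb (\<xi> x))"
proof -
  interpret O: overlap_pair Q I b c jb jc \<mu> lam r p q m A B C D
    by (intro overlap_pair.intro band_pair.intro band_pair_axioms.intro overlap_pair_axioms.intro gentle_quiver.intro)
      (fact assms)+
  have x: "(r, p, q, m) \<in> overlap_data Q I c b" using O.ov unfolding overlap_data_def by blast
  have e: "\<xi> (r, p, q, m) = O.X O.GT" unfolding \<xi>_def using O.overlap_ext_eq_X[OF x] by (simp add: O.ovnode_def)
  obtain d t where d: "band Q I d" "t \<ge> 1" "word_pow d t = b' @ c'"
    using O.primitive_root_W unfolding b'_def c'_def by blast
  have cd: "O.cyc_word d" by (rule O.band_cyc_word[OF d(1)])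
  let ?s = "- 1 * lam * inverse (opposite_scalar r \<mu>)"
  have s: "?s = - (lam * inverse (opposite_scalar r \<mu>))" "?s \<noteq> 0"
    using O.\<mu>_nz O.lam_nz by (simp_all add: opposite_scalar_def)
  have W: "word_pow d t = rotate q (orient r b) @ rotate p c" using d(3) by (simp only: b'_def c'_def)
  have iso: "lmod_iso \<Lambda> (fst (\<xi> (r, p, q, m))) (band_module Q (word_pow d t) j ?s)"
    if "direct_at (word_pow d t) j" for j
  proof -
    have j: "direct_at (rotate q (orient r b) @ rotate p c) j" using that unfolding W .
    have "lmod_iso \<Lambda> (O.E O.GT) (band_module Q (rotate q (orient r b) @ rotate p c) j ?s)"
      unfolding \<Lambda>_def
      by (rule lmod_iso_sym[OF O.left_module_band_module[OF O.cyc_word_W s(2) j]])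
        (use O.middle_term_iso[OF j] in \<open>simp only: s(1)\<close>)
    then show ?thesis unfolding e W O.X_def by simp
  qed
  have dsum: "\<exists>f g. let E = (lmod_dsum {1..t} (\<lambda>i. band_module Q d j (\<omega> ^ i * \<rho>)), f, g) in
      E \<in> extensions \<Lambda> Mc Mb \<and> \<not> ext_split \<Lambda> Mc E \<and> ext_equiv \<Lambda> Mb (\<xi> (r, p, q, m)) E"
    if "primitive_unity_root t \<omega>" "\<rho> ^ t = ?s" "direct_at d j" for \<omega> \<rho> j
    using O.middle_term_direct_sum[OF cd d(2) W that(1) that(2)[unfolded s(1)] that(3)]
    unfolding \<Lambda>_def Mc_def Mb_def e band_module_def .
  have parts: "\<And>v w. b' = m @ v \<Longrightarrow> c' = m @ w \<Longrightarrow> word_pow d t = m @ v @ m @ w"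
    "\<And>v c1 c2. b' = m @ v \<Longrightarrow> c' = c2 @ c1 \<Longrightarrow> word_pow d t = m @ v @ c2 @ c1"
    "\<And>b1 b2 w. b' = b2 @ b1 \<Longrightarrow> c' = m @ w \<Longrightarrow> word_pow d t = b2 @ b1 @ m @ w"
    "\<And>b1 b2 c1 c2. b' = b2 @ b1 \<Longrightarrow> c' = c2 @ c1 \<Longrightarrow> word_pow d t = b2 @ b1 @ c2 @ c1"
    unfolding d(3) by simp_all
  have shape_b: "(\<exists>v. v \<noteq> [] \<and> b' = m @ v) \<or> (\<exists>b1 b2 k. k \<ge> 1 \<and> b' = b2 @ b1 \<and> m = word_pow b' k @ b2)"
    unfolding b'_def by (rule overlap_word_shape[OF O.orient_ne O.o(6)])
  have shape_c: "(\<exists>w. w \<noteq> [] \<and> c' = m @ w) \<or> (\<exists>c1 c2 l. l \<ge> 1 \<and> c' = c2 @ c1 \<and> m = word_pow c' l @ c2)"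
    unfolding c'_def by (rule overlap_word_shape[OF O.c_ne O.o(5)])
  have basis: "is_basis (Ext1 \<Lambda> (scalar_elem Q I) Mc Mb) (overlap_data Q I c b) (\<lambda>x. ext_class \<Lambda> Mc Mb (\<xi> x))"
    using O.overlap_extensions_basis assms unfolding \<Lambda>_def Mc_def Mb_def \<xi>_def band_module_def by blast
  show ?thesis
  proof (intro conjI exI[of _ d] exI[of _ t] bexI[of _ "- 1"] allI impI)
    show "word_pow d t = m @ v @ m @ w" if "b' = m @ v \<and> c' = m @ w" for v w
      using parts(1) that by blast
    show "word_pow d t = m @ v @ c2 @ c1"
      if "b' = m @ v \<and> 1 \<le> l \<and> c' = c2 @ c1 \<and> m = word_pow c' l @ c2" for v c1 c2 l
      using parts(2) that by blast
    show "word_pow d t = b2 @ b1 @ m @ w"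
      if "1 \<le> k \<and> b' = b2 @ b1 \<and> m = word_pow b' k @ b2 \<and> c' = m @ w" for b1 b2 k w
      using parts(3) that by blast
    show "word_pow d t = b2 @ b1 @ c2 @ c1"
      if "1 \<le> k \<and> b' = b2 @ b1 \<and> m = word_pow b' k @ b2 \<and> 1 \<le> l \<and> c' = c2 @ c1 \<and> m = word_pow c' l @ c2"
      for b1 b2 k c1 c2 l
      using parts(4) that by blast
    show "\<exists>f g. let E = (lmod_dsum {1..t} (\<lambda>i. band_module Q d j (\<omega> ^ i * \<rho>)), f, g) in
        E \<in> extensions \<Lambda> Mc Mb \<and> \<not> ext_split \<Lambda> Mc E \<and> ext_equiv \<Lambda> Mb (\<xi> (r, p, q, m)) E"
      if "primitive_unity_root t \<omega> \<and> \<rho> ^ t = ?s \<and> direct_at d j" for \<omega> \<rho> j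
      using dsum that by blast
    show "- 1 \<in> {1, - 1 :: 'k}" by simp
  qed (fact shape_b shape_c d(1,2) iso basis | erule iso)+
qed

end
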